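(* Let $n$ be a positive integer and $p$ a prime with $p\ge 2n+3$. Then there exists a Siegel modular form $h\in M_{\frac{p-1}{2}}(\Gamma_0^n(p),\chi_p)$ with $p$-integral Fourier coefficients such that $h\equiv 1\pmod p$ and $$\nu_p(h\mid_{\frac{p-1}{2}}\omega_j)\ge-\frac{j^2}{2}+1\qquad(1\le j\le n).$$
   Context: $\Gamma_0^n(p)=\{\binom{A\ B}{C\ D}\in Sp(n,\mathbb{Z}) : C\equiv0\bmod p\}$; $M_k(\Gamma_0^n(p),\chi_p)$ is the space of Siegel modular forms of degree $n$, weight $k$ and character $M\mapsto\chi_p(\det D)$, where $\chi_p(\ast)=\left(\frac{(-1)^{(p-1)/2}p}{\ast}\right)$. The slash operator is $(f\mid_k M)(Z)=\det(CZ+D)^{-k}f((AZ+B)(CZ+D)^{-1})$ for $M=\binom{A\ B}{C\ D}$. For $0\le j\le n$, $$\omega_j=\begin{pmatrix}0_j&0&-1_j&0\\0&1_{n-j}&0&0_{n-j}\\1_j&0&0_j&0\\0&0_{n-j}&0&1_{n-j}\end{pmatrix}.$$ For a Fourier series $f=\sum_T a(T;f)e^{2\pi i\,\mathrm{tr}(TZ)}$ whose coefficients lie in a number field and have bounded denominators, $\nu_p(f)=\min_T\nu_p(a(T;f))$, with $\nu_p$ the normalized $p$-adic valuation ($\nu_p(p)=1$), extended to the field generated by the coefficients. $h\equiv1\pmod p$ means $\nu_p(h-1)\ge 1$. *)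

theory Defs
  imports "HOL-Analysis.Analysis" "HOL-Number_Theory.Number_Theory"
begin

text \<open>
  The degree n is the cardinality of the finite index type \<open>'n\<close>. Matrices of size 2n are indexed by
  \<open>'n + 'n\<close>, so that their four n-by-n blocks correspond to the two injections.
\<close>

section \<open>Block matrices and the symplectic group\<close>

definition block_mat ::
  "'a^'n^'n \<Rightarrow> 'a^'n^'n \<Rightarrow> 'a^'n^'n \<Rightarrow> 'a^'n^'n \<Rightarrow> 'a^('n + 'n)^('n::finite + 'n)" where
  "block_mat A B C D = (\<chi> r s. case (r, s) of
      (Inl i, Inl k) \<Rightarrow> A $ i $ k | (Inl i, Inr k) \<Rightarrow> B $ i $ k
    | (Inr i, Inl k) \<Rightarrow> C $ i $ k | (Inr i, Inr k) \<Rightarrow> D $ i $ k)"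

definition block_A :: "'a^('n + 'n)^('n::finite + 'n) \<Rightarrow> 'a^'n^'n" where
  "block_A M = (\<chi> i k. M $ Inl i $ Inl k)"

definition block_B :: "'a^('n + 'n)^('n::finite + 'n) \<Rightarrow> 'a^'n^'n" where
  "block_B M = (\<chi> i k. M $ Inl i $ Inr k)"

definition block_C :: "'a^('n + 'n)^('n::finite + 'n) \<Rightarrow> 'a^'n^'n" where
  "block_C M = (\<chi> i k. M $ Inr i $ Inl k)"

definition block_D :: "'a^('n + 'n)^('n::finite + 'n) \<Rightarrow> 'a^'n^'n" where
  "block_D M = (\<chi> i k. M $ Inr i $ Inr k)"

definition Sp_int :: "(int^('n + 'n)^('n::finite + 'n)) set" where
  "Sp_int = {M. let J = block_mat 0 (mat 1) (- mat 1) 0 in transpose M ** J ** M = J}"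

definition Gamma0 :: "nat \<Rightarrow> (int^('n + 'n)^('n::finite + 'n)) set" where
  "Gamma0 p = {M \<in> Sp_int. \<forall>i k. int p dvd block_C M $ i $ k}"

definition diag_mat :: "('n \<Rightarrow> 'a::zero) \<Rightarrow> 'a^'n^'n::finite" where
  "diag_mat d = (\<chi> i k. if i = k then d i else 0)"

text \<open>The linear order on the index type is used only here, to single out the first j indices.\<close>

definition omega :: "nat \<Rightarrow> int^('n + 'n)^('n::{finite,linorder} + 'n)" where
  "omega j = (let first = (\<lambda>i. card {k. k < i} < j) in
     block_mat (diag_mat (\<lambda>i. if first i then 0 else 1)) (diag_mat (\<lambda>i. if first i then - 1 else 0))
               (diag_mat (\<lambda>i. if first i then 1 else 0)) (diag_mat (\<lambda>i. if first i then 0 else 1)))"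


section \<open>The quadratic character\<close>

definition kronecker_prime :: "int \<Rightarrow> nat \<Rightarrow> int" where
  "kronecker_prime a q =
     (if q = 2 then (if even a then 0 else if a mod 8 = 1 \<or> a mod 8 = 7 then 1 else - 1)
      else Legendre a (int q))"

definition kronecker :: "int \<Rightarrow> int \<Rightarrow> int" where
  "kronecker a m =
     (if m = 0 then (if \<bar>a\<bar> = 1 then 1 else 0)
      else (if m < 0 \<and> a < 0 then - 1 else 1) *
        (\<Prod>q\<in>#prime_factorization (nat \<bar>m\<bar>). kronecker_prime a q))"

definition chi :: "nat \<Rightarrow> int \<Rightarrow> int" where
  "chi p m = kronecker ((- 1) ^ ((p - 1) div 2) * int p) m"


section \<open>Siegel modular forms\<close>

definition siegel_upper :: "(complex^'n^'n::finite) set" where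
  "siegel_upper = {Z. transpose Z = Z \<and>
     (\<forall>x::real^'n. x \<noteq> 0 \<longrightarrow> x \<bullet> ((\<chi> i k. Im (Z $ i $ k)) *v x) > 0)}"

text \<open>
  The half-space is open in the symmetric matrices only, so the derivative is taken within it; complex
  differentiability means that some Frechet derivative is complex linear.
\<close>

definition siegel_holomorphic :: "(complex^'n^'n::finite \<Rightarrow> complex) \<Rightarrow> bool" where
  "siegel_holomorphic f \<longleftrightarrow> (\<forall>Z\<in>siegel_upper. \<exists>f'.
     (f has_derivative f') (at Z within siegel_upper) \<and> (\<forall>c W. f' (mat c ** W) = c * f' W))"

definition int_to_cmat :: "int^'n^'n::finite \<Rightarrow> complex^'n^'n" where
  "int_to_cmat A = (\<chi> i k. of_int (A $ i $ k))"

definition slash :: "int \<Rightarrow> int^('n + 'n)^('n::finite + 'n) \<Rightarrow>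
    (complex^'n^'n \<Rightarrow> complex) \<Rightarrow> complex^'n^'n \<Rightarrow> complex" where
  "slash k M f Z =
     (let A = int_to_cmat (block_A M); B = int_to_cmat (block_B M);
          C = int_to_cmat (block_C M); D = int_to_cmat (block_D M)
      in det (C ** Z + D) powi (- k) * f ((A ** Z + B) ** matrix_inv (C ** Z + D)))"

definition half_integral :: "(real^'n^'n::finite) set" where
  "half_integral = {T. transpose T = T \<and> (\<forall>i. T $ i $ i \<in> \<int>) \<and> (\<forall>i k. 2 * T $ i $ k \<in> \<int>)}"

text \<open>
  Forms of higher level, such as the expansions at other cusps, are indexed by half-integral matrices
  divided by some positive integer N. The coefficients are extended by zero to all real matrices.
\<close>

definition has_fourier_expansion ::
  "(complex^'n^'n::finite \<Rightarrow> complex) \<Rightarrow> (real^'n^'n \<Rightarrow> complex) \<Rightarrow> bool" where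
  "has_fourier_expansion f a \<longleftrightarrow>
     (\<exists>N::nat. N > 0 \<and> (\<forall>T. a T \<noteq> 0 \<longrightarrow> real N *\<^sub>R T \<in> half_integral)) \<and>
     (\<forall>Z\<in>siegel_upper.
        ((\<lambda>T. a T * exp (2 * of_real pi * \<i> * trace ((\<chi> i k. of_real (T $ i $ k)) ** Z)))
           has_sum f Z) UNIV)"

text \<open>
  Holomorphy at the cusps is imposed in degree one only; in degree at least two it is automatic by the
  Koecher principle. Values of forms outside the half-space are irrelevant.
\<close>

definition siegel_forms ::
  "int \<Rightarrow> (int^('n + 'n)^('n::finite + 'n)) set \<Rightarrow> (int \<Rightarrow> int) \<Rightarrow> (complex^'n^'n \<Rightarrow> complex) set" where
  "siegel_forms k G \<psi> = {f. siegel_holomorphic f \<and>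
     (\<forall>M\<in>G. \<forall>Z\<in>siegel_upper. slash k M f Z = of_int (\<psi> (det (block_D M))) * f Z) \<and>
     (CARD('n) = 1 \<longrightarrow> (\<forall>M\<in>Sp_int. \<exists>a. has_fourier_expansion (slash k M f) a \<and>
        (\<forall>T. a T \<noteq> 0 \<longrightarrow> (\<forall>x::real^'n. x \<bullet> (T *v x) \<ge> 0))))}"


section \<open>Coefficients and their p-adic valuation\<close>

definition fourier_coeff :: "(complex^'n^'n::finite \<Rightarrow> complex) \<Rightarrow> real^'n^'n \<Rightarrow> complex" where
  "fourier_coeff f = (THE a. has_fourier_expansion f a)"

definition is_subfield :: "complex set \<Rightarrow> bool" where
  "is_subfield K \<longleftrightarrow> 0 \<in> K \<and> 1 \<in> K \<and>
     (\<forall>x\<in>K. \<forall>y\<in>K. x - y \<in> K \<and> x * y \<in> K) \<and> (\<forall>x\<in>K. inverse x \<in> K)"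

definition number_field :: "complex set \<Rightarrow> bool" where
  "number_field K \<longleftrightarrow> is_subfield K \<and>
     (\<exists>B. finite B \<and> (\<forall>x\<in>K. \<exists>q :: complex \<Rightarrow> rat. x = (\<Sum>b\<in>B. of_rat (q b) * b)))"

definition coeff_field :: "(complex^'n^'n::finite \<Rightarrow> complex) \<Rightarrow> complex set" where
  "coeff_field f = \<Inter>{K. is_subfield K \<and> range (fourier_coeff f) \<subseteq> K}"

definition bounded_denominators :: "(complex^'n^'n::finite \<Rightarrow> complex) \<Rightarrow> bool" where
  "bounded_denominators f \<longleftrightarrow> (\<exists>a. has_fourier_expansion f a) \<and>
     (\<exists>K. number_field K \<and> range (fourier_coeff f) \<subseteq> K) \<and>
     (\<exists>N::int. N \<noteq> 0 \<and> (\<forall>T. algebraic_int (of_int N * fourier_coeff f T)))"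

text \<open>
  Additive valuations on a subfield K that extend the p-adic valuation of the rationals, with
  v p = 1. Several of them may exist for one K; values outside K are irrelevant.
\<close>

definition extends_padic :: "nat \<Rightarrow> complex set \<Rightarrow> (complex \<Rightarrow> ereal) \<Rightarrow> bool" where
  "extends_padic p K v \<longleftrightarrow> v 0 = \<infinity> \<and> (\<forall>x\<in>K. x \<noteq> 0 \<longrightarrow> \<bar>v x\<bar> \<noteq> \<infinity>) \<and>
     (\<forall>x\<in>K. \<forall>y\<in>K. v (x * y) = v x + v y \<and> v (x + y) \<ge> min (v x) (v y)) \<and>
     (\<forall>m::int. m \<noteq> 0 \<longrightarrow> v (of_int m) = ereal (real (multiplicity (int p) m)))"

text \<open>The infimum is a minimum when the denominators are bounded, the valuation then being discrete.\<close>

definition nu :: "(complex \<Rightarrow> ereal) \<Rightarrow> (complex^'n^'n::finite \<Rightarrow> complex) \<Rightarrow> ereal" where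
  "nu v f = (INF T. v (fourier_coeff f T))"

end

theory Submission
  imports Defs "HOL-Probability.Characteristic_Functions" "HOL-Complex_Analysis.Complex_Analysis"
    "HOL-Computational_Algebra.Computational_Algebra"
begin

no_notation fps_nth (infixl "$" 75)

text \<open>
  Let \<open>\<delta>\<close> be the difference operator on p-periodic integer sequences. The lattices \<open>L\<^sub>a = \<delta>\<^sup>a(\<int>\<^sup>p)\<close> with
  \<open>1 \<le> a \<le> n + 1\<close> are even of rank p - 1, level p and covolume \<open>p\<^bsup>a - 1/2\<^esup>\<close>, and the cyclic shift acts on them without
  nonzero fixed points. Their theta series \<open>\<theta>\<^sub>a\<close> of degree n lie in the required space, and by the shift all
  nonconstant coefficients, also at the cusps \<open>\<omega>\<^sub>j\<close>, are divisible by p up to the transformation factor. At the cusp of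
  \<open>\<omega>\<^sub>j\<close> the series \<open>\<theta>\<^sub>a\<close> picks up a factor of absolute value \<open>p\<^bsup>- j(a - 1/2)\<^esup>\<close>, so that the combination
  \<open>\<Sum>\<^sub>r c\<^sub>r \<theta>\<^bsub>r+1\<^esub>\<close> with \<open>\<Sum>\<^sub>r c\<^sub>r x\<^sup>r = (1 - p x) \<cdots> (1 - p\<^sup>n x)\<close> has no constant term there, while
  \<open>p\<^bsup>r(r+1)/2\<^esup>\<close> divides \<open>c\<^sub>r\<close> and \<open>c\<^sub>0 = 1\<close>.
  The automorphy of \<open>\<theta>\<^sub>a\<close> is reduced to Jacobi theta functions of one variable, because \<open>\<Gamma>\<^sub>0(p)\<close> is generated by
  translations, unimodular substitutions and embedded copies of the elliptic group. The character comes from a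
  Gauss sum G of odd modulus d: its absolute value is known, \<open>G\<^sup>2\<close> is real because - 1 is a sum of two squares
  modulo d, and \<open>G \<equiv> 1\<close> modulo p by the shift.
\<close>

section \<open>Fourier uniqueness on the circle\<close>

text \<open>Periodic sequences form the group ring of the cyclic group of order p, and for a >= 1
  the lattice with index a is the ideal (1 - \<zeta>)^a of the p-th cyclotomic field. Total
  ramification, which makes p a multiple of (1 - X)^(p-1) on sequences of sum zero, yields the level
  as long as 2 a <= p - 1; with a up to n + 1 this is the bound p >= 2 n + 3. A single theta series
  fails only through its constant terms. At j = 1 that of \<theta>_1 is p^(-1/2) up to a unit, while
  1/2 is demanded; cancelling it with p \<theta>_2 spoils the constant term at j = 2, whose
  valuation drops to - 2, and so on up to j = n. This is why all n factors 1 - p^i x occur. At the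
  cusp j the theta series in the combination share the phase and the factor p^(-j/2) and differ by
  p^(-rj), so the constant term is the polynomial at x = p^(-j), killed by the factor i = j. The
  remaining coefficients have valuation at least r(r+1)/2 - rj - j/2 + 1 >= -j^2/2 + 1, where the 1
  comes from the free action of the shift.\<close>

definition ee :: "complex \<Rightarrow> complex" where "ee x = exp (2 * of_real pi * \<i> * x)"

lemma ee_add: "ee (x + y) = ee x * ee y"
  by (simp add: ee_def distrib_left exp_add)

lemma ee_0 [simp]: "ee 0 = 1"
  by (simp add: ee_def)

lemma ee_nonzero [simp]: "ee x \<noteq> 0"
  by (simp add: ee_def)

lemma ee_minus: "ee (- x) = inverse (ee x)"
  by (simp add: ee_def exp_minus)

lemma ee_diff: "ee (x - y) = ee x / ee y"
  by (simp add: ee_def right_diff_distrib exp_diff)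

lemma ee_Ints [simp]: "x \<in> \<int> \<Longrightarrow> ee x = 1"
  unfolding ee_def by (auto elim!: Ints_cases simp: exp_eq_1)

lemma ee_eq_1_iff: "ee x = 1 \<longleftrightarrow> x \<in> \<int>"
proof
  assume "ee x = 1"
  then obtain n :: int where n: "Re (2 * of_real pi * \<i> * x) = 0" "Im (2 * of_real pi * \<i> * x) = of_int (2 * n) * pi"
    unfolding ee_def exp_eq_1 by blast
  then have "Im x = 0" "Re x = of_int n" by auto
  then have "x = of_int n" by (simp add: complex_eq_iff)
  then show "x \<in> \<int>" by simp
qed simp

lemma norm_ee: "norm (ee x) = exp (- 2 * pi * Im x)"
  by (simp add: ee_def)

lemma cnj_ee: "cnj (ee x) = ee (- cnj x)"
  by (simp add: ee_def exp_cnj)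

lemma ee_of_nat_mult: "ee (of_nat n * x) = ee x ^ n"
  by (simp add: ee_def exp_of_nat_mult[symmetric] mult_ac)

lemma continuous_on_ee [continuous_intros]: "continuous_on S f \<Longrightarrow> continuous_on S (\<lambda>x. ee (f x))"
  unfolding ee_def by (intro continuous_intros)

text \<open>The finite linear combinations of characters. In the inductive form, orthogonality to
  all characters passes to the whole class by induction.\<close>

inductive trig_poly :: "(real \<Rightarrow> complex) \<Rightarrow> bool" where
  mono: "trig_poly (\<lambda>x. c * ee (of_int m * of_real x))"
| add: "trig_poly f \<Longrightarrow> trig_poly g \<Longrightarrow> trig_poly (\<lambda>x. f x + g x)"

lemma trig_poly_mult: "trig_poly f \<Longrightarrow> trig_poly g \<Longrightarrow> trig_poly (\<lambda>x. f x * g x)"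
proof (induction arbitrary: g rule: trig_poly.induct)
  case (mono c m)
  from mono show ?case
  proof (induction rule: trig_poly.induct)
    case (mono c' m')
    have "(\<lambda>x. c * ee (of_int m * complex_of_real x) * (c' * ee (of_int m' * complex_of_real x)))
       = (\<lambda>x. (c * c') * ee (of_int (m + m') * complex_of_real x))"
      by (simp add: fun_eq_iff ee_add distrib_right)
    then show ?case by (metis trig_poly.mono)
  next
    case (add f g)
    then show ?case by (simp add: distrib_left trig_poly.add)
  qed
next
  case (add f1 f2)
  then show ?case by (simp add: distrib_right trig_poly.add)
qed

lemma trig_poly_const: "trig_poly (\<lambda>x. c)"
  using trig_poly.mono[of c 0] by simp

text \<open>On the circle the conjugate of z is its inverse, so a real linear form in z is a
  combination of the characters with m = 1 and m = - 1. Sums and products stay in the class.\<close>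

lemma trig_poly_real_polynomial:
  assumes "real_polynomial_function (P :: complex \<Rightarrow> real)"
  shows "trig_poly (\<lambda>x. of_real (P (ee (of_real x))))"
  using assms
proof (induction rule: real_polynomial_function.induct)
  case (linear f)
  interpret bounded_linear f by fact
  have f: "f z = Re z * f 1 + Im z * f \<i>" for z
  proof -
    have "f z = f (Re z *\<^sub>R 1 + Im z *\<^sub>R \<i>)"
      by (intro arg_cong[of _ _ f]) (simp add: complex_eq_iff)
    then show ?thesis by (simp only: add scaleR) simp
  qed
  define h k :: complex where "h = 1 / 2" and "k = 1 / (2 * \<i>)"
  have "complex_of_real (f (ee (of_real x))) =
      (of_real (f 1) * h + of_real (f \<i>) * k) * ee (of_int 1 * of_real x)
      + (of_real (f 1) * h - of_real (f \<i>) * k) * ee (of_int (- 1) * of_real x)" for x :: real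
  proof -
    define z where "z = ee (of_real x)"
    have z: "complex_of_real (Re z) = (z + cnj z) * h" "complex_of_real (Im z) = (z - cnj z) * k"
      by (simp_all add: h_def k_def complex_add_cnj complex_diff_cnj)
    have "cnj z = ee (of_int (- 1) * of_real x)" by (simp add: cnj_ee z_def)
    moreover have "complex_of_real (f z) = (z + cnj z) * h * of_real (f 1) + (z - cnj z) * k * of_real (f \<i>)"
      unfolding z[symmetric] by (subst f) simp
    ultimately show ?thesis by (simp add: z_def algebra_simps)
  qed
  then show ?case by (simp only: trig_poly.mono trig_poly.add)
next
  case (const c)
  show ?case by (rule trig_poly_const)
next
  case (add f g)
  then show ?case by (simp add: trig_poly.add)
next
  case (mult f g)
  then show ?case by (simp add: trig_poly_mult)
qed

lemma ee_circle_eq: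
  assumes "x \<in> {0..1}" "y \<in> {0..1}" "ee (of_real x) = ee (of_real y)"
  shows "x = y \<or> {x, y} = {0, 1}"
proof -
  have "ee (of_real (x - y)) = 1" using assms(3) by (simp add: ee_diff)
  then have "complex_of_real (x - y) \<in> \<int>" by (simp only: ee_eq_1_iff)
  then obtain n :: int where n: "complex_of_real (x - y) = of_int n" by (auto elim: Ints_cases)
  then have "of_real (x - y) = (of_real (of_int n) :: complex)" by simp
  then have n: "x - y = of_int n" by (simp only: of_real_eq_iff)
  moreover have "- 1 \<le> x - y" "x - y \<le> 1" using assms by auto
  ultimately have "- 1 \<le> n" "n \<le> 1" by linarith+
  then have "n = - 1 \<or> n = 0 \<or> n = 1" by linarith
  then show ?thesis using n assms by auto
qed

text \<open>By the Stone-Weierstrass theorem on the circle, a continuous periodic function that is orthogonal to all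
  characters is orthogonal to itself.\<close>

lemma fourier_uniqueness:
  fixes f :: "real \<Rightarrow> complex"
  assumes cont: "continuous_on {0..1} f" and per: "f 0 = f 1"
    and zero: "\<And>m::int. integral {0..1} (\<lambda>x. f x * ee (of_int m * of_real x)) = 0"
    and x: "x \<in> {0..1}"
  shows "f x = 0"
proof -
  define C where "C = (\<lambda>x. ee (complex_of_real x)) ` {0..1}"
  have contC: "continuous_on {0..1} (\<lambda>x. ee (complex_of_real x))"
    by (intro continuous_intros)
  have compC: "compact C" unfolding C_def by (intro compact_continuous_image contC) auto
  \<comment> \<open>\<open>f\<close> agrees at 0 and 1, the only two points of the interval with the
    same image, so it descends to the circle, where Stone-Weierstrass applies.\<close>
  define \<phi> where "\<phi> w = f (SOME x. x \<in> {0..1} \<and> ee (complex_of_real x) = w)" for w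
  have \<phi>: "\<phi> (ee (complex_of_real x)) = f x" if "x \<in> {0..1}" for x
  proof -
    let ?y = "SOME y. y \<in> {0..1} \<and> ee (complex_of_real y) = ee (complex_of_real x)"
    have "?y \<in> {0..1} \<and> ee (complex_of_real ?y) = ee (complex_of_real x)"
      by (rule someI[of _ x]) (use that in simp)
    then have "?y = x \<or> {?y, x} = {0, 1}" using ee_circle_eq[of ?y x] that by auto
    then have "f ?y = f x" using per by (auto simp: doubleton_eq_iff)
    then show ?thesis by (simp add: \<phi>_def)
  qed
  \<comment> \<open>The exponential map of the compact interval is closed, hence a quotient map:
    preimages of closed sets under \<open>\<phi>\<close> are images of compact sets.\<close>
  have cont\<phi>: "continuous_on C \<phi>"
  proof (rule continuous_on_closed_vimage[THEN iffD2])
    show "closed C" using compC by (rule compact_imp_closed)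
    show "\<forall>B. closed B \<longrightarrow> closed (\<phi> -` B \<inter> C)"
    proof (intro allI impI)
      fix B :: "complex set" assume B: "closed B"
      have "closed (f -` B \<inter> {0..1})"
        using continuous_on_closed_vimage[of "{0..1::real}" f] cont B by auto
      then have "compact (f -` B \<inter> {0..1})"
        by (metis compact_Icc compact_Int_closed inf_commute inf.left_idem)
      then have "compact ((\<lambda>x. ee (complex_of_real x)) ` (f -` B \<inter> {0..1}))"
        by (intro compact_continuous_image) (auto intro!: continuous_intros)
      moreover have "(\<lambda>x. ee (complex_of_real x)) ` (f -` B \<inter> {0..1}) = \<phi> -` B \<inter> C"
        unfolding C_def using \<phi> by force
      ultimately show "closed (\<phi> -` B \<inter> C)" by (metis compact_imp_closed)
    qed
  qed
  have orth: "integral {0..1} (\<lambda>x. f x * g x) = 0 \<and> continuous_on {0..1} g" if "trig_poly g" for g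
    using that
  proof (induction rule: trig_poly.induct)
    case (mono c m)
    have "integral {0..1} (\<lambda>x. f x * (c * ee (of_int m * complex_of_real x)))
       = integral {0..1} (\<lambda>x. c * (f x * ee (of_int m * complex_of_real x)))"
      by (simp add: mult_ac)
    also have "\<dots> = 0" using zero by simp
    finally show ?case by (auto intro!: continuous_intros)
  next
    case (add g h)
    then have "(\<lambda>x. f x * g x) integrable_on {0..1}" "(\<lambda>x. f x * h x) integrable_on {0..1}"
      by (auto intro!: integrable_continuous_real continuous_intros cont)
    with add show ?case by (auto simp: distrib_left Henstock_Kurzweil_Integration.integral_add intro!: continuous_intros)
  qed
  define A where "A = integral {0..1} (\<lambda>x. norm (f x))"
  define S where "S = integral {0..1} (\<lambda>x. (norm (f x))\<^sup>2)"
  \<comment> \<open>\<open>S\<close> integrates f against its conjugate. A trigonometric polynomial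
    within e of the conjugate may be subtracted from it, as f is orthogonal to it.\<close>
  have S_le: "S \<le> A * e" if e: "e > 0" for e
  proof -
    obtain P where P: "polynomial_function P" "\<And>w. w \<in> C \<Longrightarrow> norm (\<phi> w - P w) < e"
      using Stone_Weierstrass_polynomial_function[OF compC cont\<phi> e] by auto
    define g where "g x = cnj (P (ee (of_real x)))" for x :: real
    have RP: "real_polynomial_function (\<lambda>z. Re (P z))" "real_polynomial_function (\<lambda>z. Im (P z))"
      using P(1) unfolding polynomial_function_def
      by (auto simp: o_def bounded_linear_Re bounded_linear_Im)
    have "trig_poly (\<lambda>x. of_real (Re (P (ee (of_real x)))) + (- \<i>) * of_real (Im (P (ee (of_real x)))))"
      by (intro trig_poly.add trig_poly_mult[OF trig_poly_const] trig_poly_real_polynomial RP)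
    moreover have "of_real (Re z) + (- \<i>) * of_real (Im z) = cnj z" for z
      by (simp add: complex_eq_iff)
    ultimately have "trig_poly g" by (simp add: g_def[abs_def])
    note g = orth[OF this]
    have "complex_of_real S = integral {0..1} (\<lambda>x. complex_of_real ((norm (f x))\<^sup>2))"
      unfolding S_def
      using integral_linear[OF integrable_continuous_real bounded_linear_of_real[where ?'a=complex], of 0 1 "\<lambda>x. (norm (f x))\<^sup>2"]
      by (simp add: o_def continuous_intros cont)
    also have "\<dots> = integral {0..1} (\<lambda>x. f x * (cnj (f x) - g x) + f x * g x)"
      by (intro Henstock_Kurzweil_Integration.integral_cong) (simp only: complex_norm_square, simp add: algebra_simps)
    also have "\<dots> = integral {0..1} (\<lambda>x. f x * (cnj (f x) - g x)) + integral {0..1} (\<lambda>x. f x * g x)"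
      using g by (intro Henstock_Kurzweil_Integration.integral_add integrable_continuous_real continuous_intros cont) auto
    finally have "complex_of_real S = integral {0..1} (\<lambda>x. f x * (cnj (f x) - g x))" using g by simp
    then have "norm (complex_of_real S) \<le> integral {0..1} (\<lambda>x. norm (f x) * e)"
    proof (simp only:, intro integral_norm_bound_integral)
      show "(\<lambda>x. f x * (cnj (f x) - g x)) integrable_on {0..1}"
        using g by (intro integrable_continuous_real continuous_intros cont) auto
      show "(\<lambda>x. norm (f x) * e) integrable_on {0..1}"
        by (intro integrable_continuous_real continuous_intros cont)
      fix x :: real assume x: "x \<in> {0..1}"
      have "cnj (f x) - g x = cnj (\<phi> (ee (of_real x)) - P (ee (of_real x)))"
        using \<phi>[OF x] by (simp add: g_def)
      then have "norm (cnj (f x) - g x) < e"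
        using P(2)[of "ee (of_real x)"] x by (auto simp: C_def complex_mod_cnj simp del: complex_cnj_diff)
      then show "norm (f x * (cnj (f x) - g x)) \<le> norm (f x) * e"
        by (simp add: norm_mult mult_left_mono)
    qed
    moreover have "S \<le> norm (complex_of_real S)" by simp
    ultimately show ?thesis by (simp add: A_def)
  qed
  have "S \<le> 0"
  proof (rule field_le_epsilon)
    fix e :: real assume e: "e > 0"
    have A: "A \<ge> 0" unfolding A_def by (intro Henstock_Kurzweil_Integration.integral_nonneg integrable_continuous_real continuous_intros cont) auto
    have "S \<le> A * (e / (A + 1))" by (rule S_le) (use e A in auto)
    also have "\<dots> \<le> e" using A e by (simp add: field_simps)
    finally show "S \<le> 0 + e" by simp
  qed
  moreover have "S \<ge> 0" unfolding S_def by (intro Henstock_Kurzweil_Integration.integral_nonneg integrable_continuous_real continuous_intros cont) auto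
  ultimately have "integral {0..1} (\<lambda>x. (norm (f x))\<^sup>2) = 0" by (simp add: S_def)
  then have "\<forall>x\<in>{0..1}. (norm (f x))\<^sup>2 = 0"
    by (subst (asm) integral_eq_0_iff) (auto intro!: continuous_intros cont)
  with x show ?thesis by simp
qed

section \<open>Poisson summation in one variable\<close>

lemma summable_on_exp_abs_int:
  assumes "c > 0"
  shows "(\<lambda>n::int. exp (- c * \<bar>of_int n\<bar> :: real)) summable_on UNIV"
proof -
  have UN: "(UNIV :: int set) = range int \<union> range (\<lambda>n. - int n)"
  proof (intro equalityI subsetI UnCI)
    fix z :: int assume "z \<notin> range (\<lambda>n. - int n)"
    then show "z \<in> range int" by (cases z rule: int_cases2) auto
  qed auto
  have "summable (\<lambda>n. exp (- c) ^ n)" using assms by (intro summable_geometric) simp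
  then have nat: "(\<lambda>n::nat. exp (- c * n)) summable_on UNIV"
    by (intro norm_summable_imp_summable_on) (simp add: exp_of_nat_mult[symmetric] mult_ac)
  show ?thesis unfolding UN
    by (intro summable_on_union; subst summable_on_reindex) (use nat in \<open>auto simp: inj_on_def o_def\<close>)
qed

text \<open>Completing the square absorbs the linear term, for any real b, at the cost of a constant
  and leaves a geometric series.\<close>

lemma summable_on_gauss_int:
  assumes "c > 0"
  shows "(\<lambda>n::int. exp (b * \<bar>of_int n\<bar> - c * (of_int n)\<^sup>2 :: real)) summable_on UNIV"
proof (rule summable_on_comparison_test)
  show "(\<lambda>n::int. exp ((b + 1)\<^sup>2 / (4 * c)) * exp (- 1 * \<bar>of_int n\<bar> :: real)) summable_on UNIV"
    by (intro summable_on_cmult_right summable_on_exp_abs_int) simp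
  fix n :: int
  define y where "y = (\<bar>of_int n\<bar> :: real)"
  have "(b + 1) * y - c * y\<^sup>2 \<le> (b + 1)\<^sup>2 / (4 * c)"
  proof -
    have "0 \<le> (2 * c * y - (b + 1))\<^sup>2" by simp
    then show ?thesis using assms by (simp add: field_simps power2_eq_square)
  qed
  moreover have "(of_int n)\<^sup>2 = y\<^sup>2" by (simp add: y_def)
  ultimately show "exp (b * \<bar>of_int n\<bar> - c * (of_int n)\<^sup>2 :: real) \<le> exp ((b + 1)\<^sup>2 / (4 * c)) * exp (- 1 * \<bar>of_int n\<bar>)"
    unfolding exp_add[symmetric] y_def[symmetric] by (simp add: algebra_simps)
qed simp

text \<open>The Weierstrass test makes the convergence uniform, so that summation and integration
  may be interchanged.\<close>

lemma has_sum_integral_unit_interval: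
  fixes f :: "'a \<Rightarrow> real \<Rightarrow> complex"
  assumes bound: "\<And>n x. x \<in> {0..1} \<Longrightarrow> norm (f n x) \<le> M n" and M: "M summable_on UNIV"
    and cont: "\<And>n. continuous_on {0..1} (f n)"
  shows "((\<lambda>n. integral {0..1} (f n)) has_sum integral {0..1} (\<lambda>x. \<Sum>\<^sub>\<infinity>n. f n x)) UNIV"
    and "continuous_on {0..1} (\<lambda>x. \<Sum>\<^sub>\<infinity>n. f n x)"
proof -
  let ?F = "finite_subsets_at_top (UNIV :: 'a set)"
  have lim: "uniform_limit {0..1} (\<lambda>X x. \<Sum>n\<in>X. f n x) (\<lambda>x. \<Sum>\<^sub>\<infinity>n. f n x) ?F"
    by (rule Weierstrass_m_test_general) (use bound M in auto)
  have c: "continuous_on {0..1} (\<lambda>x. \<Sum>n\<in>X. f n x)" for X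
    by (intro continuous_on_sum cont)
  obtain I J where IJ: "\<And>X. ((\<lambda>x. \<Sum>n\<in>X. f n x) has_integral I X) {0..1}"
    "((\<lambda>x. \<Sum>\<^sub>\<infinity>n. f n x) has_integral J) {0..1}" "(I \<longlongrightarrow> J) ?F"
    by (rule uniform_limit_integral[OF lim c]) auto
  have "I X = (\<Sum>n\<in>X. integral {0..1} (f n))" if "finite X" for X
    using IJ(1)[of X, THEN integral_unique]
      Henstock_Kurzweil_Integration.integral_sum[OF that, of f "{0..1}"] integrable_continuous_real[OF cont] by simp
  then have "\<forall>\<^sub>F X in ?F. I X = (\<Sum>n\<in>X. integral {0..1} (f n))"
    by (intro eventually_finite_subsets_at_top_weakI) auto
  then have "((\<lambda>X. \<Sum>n\<in>X. integral {0..1} (f n)) \<longlongrightarrow> J) ?F"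
    using IJ(3) by (simp add: tendsto_cong)
  then show "((\<lambda>n. integral {0..1} (f n)) has_sum integral {0..1} (\<lambda>x. \<Sum>\<^sub>\<infinity>n. f n x)) UNIV"
    using IJ(2) by (simp add: has_sum_def integral_unique)
  show "continuous_on {0..1} (\<lambda>x. \<Sum>\<^sub>\<infinity>n. f n x)"
    by (rule uniform_limit_theorem[OF _ lim]) (auto intro!: always_eventually c)
qed

lemma gauss_fourier_transform:
  assumes t: "t > 0"
  shows "integrable lborel (\<lambda>x::real. complex_of_real (exp (- pi * t * x\<^sup>2)) * ee (of_int m * of_real x))"
    and "(CLBINT x. complex_of_real (exp (- pi * t * x\<^sup>2)) * ee (of_int m * of_real x))
      = of_real (exp (- pi * (of_int m)\<^sup>2 / t) / sqrt t)"
proof -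
  \<comment> \<open>The substitution y = c x turns the Gaussian into the standard normal density and
    its Fourier transform into the characteristic function at s.\<close>
  define c s where "c = sqrt (2 * pi * t)" and "s = 2 * pi * of_int m / c"
  have c: "c > 0" "c\<^sup>2 = 2 * pi * t" using t by (auto simp: c_def)
  let ?f = "\<lambda>y. std_normal_density y *\<^sub>R iexp (s * y)"
  have f_eq: "?f (0 + c * x) = (1 / sqrt (2 * pi)) *\<^sub>R (complex_of_real (exp (- pi * t * x\<^sup>2)) * ee (of_int m * of_real x))" for x
  proof -
    have 1: "(c * x)\<^sup>2 / 2 = pi * t * x\<^sup>2" by (simp add: power_mult_distrib c)
    have 2: "s * (c * x) = 2 * pi * of_int m * x" using c by (simp add: s_def)
    have "iexp (s * (c * x)) = ee (of_int m * of_real x)" unfolding 2 by (simp add: ee_def mult_ac)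
    moreover have "std_normal_density (c * x) = 1 / sqrt (2 * pi) * exp (- pi * t * x\<^sup>2)"
      using 1 by (simp add: std_normal_density_def)
    ultimately show ?thesis by (simp add: scaleR_conv_of_real)
  qed
  have int0: "integrable lborel std_normal_density" by simp
  have "integrable lborel ?f"
    by (rule Bochner_Integration.integrable_bound[OF int0]) (auto simp: normal_density_nonneg)
  from lborel_integrable_real_affine[OF this, of c 0] c
  have "integrable lborel (\<lambda>x. (1 / sqrt (2 * pi)) *\<^sub>R (complex_of_real (exp (- pi * t * x\<^sup>2)) * ee (of_int m * of_real x)))"
    by (simp add: f_eq[simplified])
  then have "integrable lborel (\<lambda>x. sqrt (2 * pi) *\<^sub>R (1 / sqrt (2 * pi)) *\<^sub>R (complex_of_real (exp (- pi * t * x\<^sup>2)) * ee (of_int m * of_real x)))"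
    by (rule integrable_scaleR_right)
  moreover have "sqrt (2 * pi) * (1 / sqrt (2 * pi)) = 1" by simp
  ultimately show "integrable lborel (\<lambda>x::real. complex_of_real (exp (- pi * t * x\<^sup>2)) * ee (of_int m * of_real x))"
    by (simp only: scaleR_scaleR scaleR_one)
  have "char std_normal_distribution s = (CLBINT y. ?f y)"
    unfolding char_def by (subst integral_density) (auto simp: normal_density_nonneg)
  also have "\<dots> = c *\<^sub>R (CLBINT x. ?f (0 + c * x))"
    using c by (subst lborel_integral_real_affine[where c = c and t = 0]) auto
  also have "\<dots> = (c / sqrt (2 * pi)) *\<^sub>R (CLBINT x. complex_of_real (exp (- pi * t * x\<^sup>2)) * ee (of_int m * of_real x))"
    unfolding f_eq by (subst integral_scaleR_right) simp
  also have "c / sqrt (2 * pi) = sqrt t" by (simp add: c_def real_sqrt_mult)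
  finally have "char std_normal_distribution s =
     sqrt t *\<^sub>R (CLBINT x. complex_of_real (exp (- pi * t * x\<^sup>2)) * ee (of_int m * of_real x))" .
  moreover have "char std_normal_distribution s = of_real (exp (- pi * (of_int m)\<^sup>2 / t))"
  proof -
    have "s\<^sup>2 / 2 = pi * (of_int m)\<^sup>2 / t"
      unfolding s_def power_divide c(2) using t by (simp add: field_simps power2_eq_square)
    then show ?thesis by (simp add: char_std_normal_distribution)
  qed
  ultimately show "(CLBINT x. complex_of_real (exp (- pi * t * x\<^sup>2)) * ee (of_int m * of_real x))
      = of_real (exp (- pi * (of_int m)\<^sup>2 / t) / sqrt t)"
    using t by (simp add: scaleR_conv_of_real field_simps)
qed

lemma filterlim_symmetric_int_intervals:
  "filterlim (\<lambda>N. {- int N..<int N}) (finite_subsets_at_top UNIV) sequentially"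
  unfolding filterlim_finite_subsets_at_top
proof (intro allI impI)
  fix X :: "int set" assume "finite X \<and> X \<subseteq> UNIV"
  then have X: "finite X" by simp
  define B where "B = (\<Sum>x\<in>X. nat \<bar>x\<bar>) + 1"
  have "\<bar>x\<bar> < int N" if "x \<in> X" "N \<ge> B" for x N
  proof -
    have "nat \<bar>x\<bar> \<le> (\<Sum>x\<in>X. nat \<bar>x\<bar>)" using X that(1) by (intro member_le_sum) auto
    then show ?thesis using that(2) by (simp add: B_def)
  qed
  then show "\<forall>\<^sub>F N in sequentially. finite {- int N..<int N} \<and> X \<subseteq> {- int N..<int N} \<and> {- int N..<int N} \<subseteq> UNIV"
    by (intro eventually_sequentiallyI[of B]) force
qed

text \<open>Unfolding: the translates of the unit interval tile the line. Symmetric partial sums are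
  integrals over {- N..N}, which converge by dominated convergence.\<close>

lemma has_sum_unit_integrals:
  fixes g :: "real \<Rightarrow> complex"
  assumes g: "integrable lborel g" and cont: "continuous_on UNIV g"
    and S: "((\<lambda>n::int. integral {0..1} (\<lambda>x. g (x + of_int n))) has_sum S) UNIV"
  shows "S = (CLBINT x. g x)"
proof -
  have int: "g integrable_on {a..b}" for a b
    by (intro integrable_continuous_real continuous_on_subset[OF cont]) auto
  have shift: "integral {0..1} (\<lambda>x. g (x + of_int n)) = integral {of_int n..of_int n + 1} g" for n :: int
    using integral_shift_real_ivl[of "of_int n" "of_int n" "of_int n + 1" g] by simp
  have part: "(\<Sum>n\<in>{- int N..<int N}. integral {0..1} (\<lambda>x. g (x + of_int n))) = integral {- real N..real N} g" for N
  proof (induction N)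
    case (Suc N)
    have "{- int (Suc N)..<int (Suc N)} = insert (- int N - 1) (insert (int N) {- int N..<int N})" by auto
    then have "(\<Sum>n\<in>{- int (Suc N)..<int (Suc N)}. integral {0..1} (\<lambda>x. g (x + of_int n)))
        = integral {- real N - 1..- real N} g + (integral {real N..real N + 1} g + integral {- real N..real N} g)"
      using Suc.IH shift[of "- int N - 1"] shift[of "int N"] by simp
    also have "\<dots> = integral {- real N - 1..- real N} g + integral {- real N..real N + 1} g"
      using Henstock_Kurzweil_Integration.integral_combine[of "- real N" "real N" "real N + 1" g, OF _ _ int]
      by (simp add: add.commute)
    also have "\<dots> = integral {- real N - 1..real N + 1} g"
      by (intro Henstock_Kurzweil_Integration.integral_combine) (auto intro: int)
    also have "- real N - 1 = - real (Suc N)" by simp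
    also have "real N + 1 = real (Suc N)" by simp
    finally show ?case .
  qed simp
  have "((\<lambda>N. integral {- real N..real N} g) \<longlongrightarrow> S) sequentially"
    unfolding part[symmetric] using S filterlim_symmetric_int_intervals unfolding has_sum_def
    by (rule filterlim_compose)
  moreover have "((\<lambda>N. integral {- real N..real N} g) \<longlongrightarrow> (CLBINT x. g x)) sequentially"
  proof -
    have eq: "integral {- real N..real N} g = (CLBINT x. indicator {- real N..real N} x *\<^sub>R g x)" for N
      using set_borel_integral_eq_integral(2)[of "{- real N..real N}" g] borel_integrable_atLeastAtMost'[of "- real N" "real N" g]
        continuous_on_subset[OF cont] by (simp add: set_lebesgue_integral_def)
    show ?thesis unfolding eq
    proof (rule integral_dominated_convergence[where w = "\<lambda>x. norm (g x)"])
      show "AE x in lborel. (\<lambda>N. indicator {- real N..real N} x *\<^sub>R g x) \<longlonglongrightarrow> g x"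
      proof (rule AE_I2)
        fix x :: real
        obtain N where N: "\<bar>x\<bar> \<le> real N" using real_arch_simple by blast
        have "\<forall>\<^sub>F n in sequentially. indicator {- real n..real n} x *\<^sub>R g x = g x"
          by (rule eventually_sequentiallyI[of N]) (use N in \<open>auto simp: indicator_def\<close>)
        then show "(\<lambda>N. indicator {- real N..real N} x *\<^sub>R g x) \<longlonglongrightarrow> g x" by (rule tendsto_eventually)
      qed
    qed (use g in \<open>auto simp: indicator_def\<close>)
  qed
  ultimately show ?thesis by (rule LIMSEQ_unique)
qed

text \<open>Both sides are continuous and 1-periodic in x and have the same Fourier coefficients: on
  the left they unfold to the transform of the Gaussian, on the right they are read off by
  orthogonality.\<close>

lemma poisson_real:
  assumes t: "t > 0"
  shows "(\<Sum>\<^sub>\<infinity>n::int. complex_of_real (exp (- pi * t * (x + of_int n)\<^sup>2)))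
    = of_real (1 / sqrt t) * (\<Sum>\<^sub>\<infinity>m::int. of_real (exp (- pi * (of_int m)\<^sup>2 / t)) * ee (of_int m * of_real x))"
    (is "?L x = ?R x")
proof -
  let ?g = "\<lambda>x. complex_of_real (exp (- pi * t * x\<^sup>2))"
  let ?h = "\<lambda>(m::int) x. complex_of_real (exp (- pi * (of_int m)\<^sup>2 / t)) * ee (of_int m * complex_of_real x)"
  define M where "M n = exp (2 * pi * t * \<bar>of_int n\<bar> - pi * t * (of_int n)\<^sup>2)" for n :: int
  have M: "M summable_on UNIV"
    unfolding M_def using summable_on_gauss_int[of "pi * t" "2 * pi * t"] t by simp
  have gM: "norm (?g (x + of_int n) * ee (of_int m * of_real x)) \<le> M n" if "x \<in> {0..1}" for x n and m :: int
  proof -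
    have "x * (- \<bar>of_int n\<bar>) \<le> x * of_int n" using that by (intro mult_left_mono) auto
    moreover have "x * \<bar>of_int n\<bar> \<le> 1 * \<bar>of_int n\<bar>" using that by (intro mult_right_mono) auto
    ultimately have "- \<bar>of_int n\<bar> \<le> x * of_int n" by linarith
    then have "(of_int n)\<^sup>2 - 2 * \<bar>of_int n\<bar> \<le> (x + of_int n)\<^sup>2"
      using zero_le_power2[of x] by (simp only: power2_sum)
    then have "pi * t * ((of_int n)\<^sup>2 - 2 * \<bar>of_int n\<bar>) \<le> pi * t * (x + of_int n)\<^sup>2"
      using t by (intro mult_left_mono) auto
    then show ?thesis by (simp add: norm_mult norm_ee M_def algebra_simps)
  qed
  define M' where "M' m = exp (- pi * (of_int m)\<^sup>2 / t)" for m :: int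
  have M': "M' summable_on UNIV"
    unfolding M'_def using summable_on_gauss_int[of "pi / t" 0] t by simp
  have hM: "norm (?h m x * ee (of_int k * of_real x)) \<le> M' m" for m k x
    by (simp add: norm_mult norm_ee M'_def)
  have gc: "continuous_on S (\<lambda>x. ?g (x + of_int n) * ee (of_int m * of_real x))" for S n and m :: int
    by (intro continuous_intros)
  have hc: "continuous_on S (\<lambda>x. ?h m x * ee (of_int k * of_real x))" for S m and k :: int
    by (intro continuous_intros)
  have LS: "((\<lambda>n. integral {0..1} (\<lambda>x. ?g (x + of_int n) * ee (of_int m * of_real x))) has_sum
        integral {0..1} (\<lambda>x. \<Sum>\<^sub>\<infinity>n. ?g (x + of_int n) * ee (of_int m * of_real x))) UNIV"
    "continuous_on {0..1} (\<lambda>x. \<Sum>\<^sub>\<infinity>n. ?g (x + of_int n) * ee (of_int m * of_real x))" for m :: int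
    using has_sum_integral_unit_interval[OF gM M gc] by auto
  have RS: "((\<lambda>m. integral {0..1} (\<lambda>x. ?h m x * ee (of_int k * of_real x))) has_sum
        integral {0..1} (\<lambda>x. \<Sum>\<^sub>\<infinity>m. ?h m x * ee (of_int k * of_real x))) UNIV"
    "continuous_on {0..1} (\<lambda>x. \<Sum>\<^sub>\<infinity>m. ?h m x * ee (of_int k * of_real x))" for k :: int
    using has_sum_integral_unit_interval[OF hM M' hc] by auto
  have Lsum: "(\<lambda>n. ?g (x + of_int n)) summable_on UNIV" if "x \<in> {0..1}" for x
    by (rule abs_summable_summable, rule summable_on_comparison_test[OF M])
       (use gM[of x _ 0] that in auto)
  have Rsum: "(\<lambda>m. ?h m x) summable_on UNIV" for x
    by (rule abs_summable_summable, rule summable_on_comparison_test[OF M']) (use hM[where k = 0 and x = x] in auto)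
  have L1: "?L (x + 1) = ?L x" for x
    by (rule infsum_reindex_bij_witness[of _ "\<lambda>n. n - 1" "\<lambda>n. n + 1"]) (auto simp: algebra_simps)
  have R1: "?R (x + 1) = ?R x" for x
    by (simp add: distrib_left ee_add)
  have "?L x - ?R x = 0" if "x \<in> {0..1}" for x
  proof (rule fourier_uniqueness[OF _ _ _ that])
    have "continuous_on {0..1} ?L" using LS(2)[of 0] by simp
    moreover have "continuous_on {0..1} ?R" using RS(2)[of 0] by (intro continuous_intros) simp
    ultimately show "continuous_on {0..1} (\<lambda>x. ?L x - ?R x)" by (rule continuous_on_diff)
    show "?L 0 - ?R 0 = ?L 1 - ?R 1" using L1[of 0] R1[of 0] by simp
    fix k :: int
    have Leq: "integral {0..1} (\<lambda>x. \<Sum>\<^sub>\<infinity>n. ?g (x + of_int n) * ee (of_int k * of_real x))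
        = of_real (exp (- pi * (of_int k)\<^sup>2 / t) / sqrt t)"
    proof -
      have "((\<lambda>n. integral {0..1} (\<lambda>x. ?g (x + of_int n) * ee (of_int k * of_real (x + of_int n)))) has_sum
         integral {0..1} (\<lambda>x. \<Sum>\<^sub>\<infinity>n. ?g (x + of_int n) * ee (of_int k * of_real x))) UNIV"
        using LS(1)[of k] by (simp add: distrib_left ee_add flip: of_int_mult)
      moreover have "continuous_on UNIV (\<lambda>x. ?g x * ee (of_int k * of_real x))"
        by (intro continuous_intros)
      ultimately have "integral {0..1} (\<lambda>x. \<Sum>\<^sub>\<infinity>n. ?g (x + of_int n) * ee (of_int k * of_real x))
          = (CLBINT x. ?g x * ee (of_int k * of_real x))"
        by (intro has_sum_unit_integrals gauss_fourier_transform(1)[OF t])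
      then show ?thesis unfolding gauss_fourier_transform(2)[OF t] .
    qed
    have orth: "integral {0..1} (\<lambda>x. ee (of_int j * of_real x)) = (if j = 0 then 1 else 0)" for j :: int
    proof (cases "j = 0")
      case False
      define c where "c = 2 * of_real pi * \<i> * of_int j"
      have c: "c \<noteq> 0" using False by (simp add: c_def)
      have "((\<lambda>x. ee (of_int j * of_real x)) has_integral (ee (of_int j * of_real 1) / c - ee (of_int j * of_real 0) / c)) {0..1}"
      proof (rule fundamental_theorem_of_calculus)
        fix x :: real
        have "((\<lambda>z. exp (c * z) / c) has_field_derivative exp (c * of_real x)) (at (of_real x))"
          using c by (auto intro!: derivative_eq_intros)
        then have "((\<lambda>x. exp (c * of_real x) / c) has_vector_derivative exp (c * of_real x)) (at x within {0..1})"
          by (rule has_vector_derivative_real_field)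
        then show "((\<lambda>x. ee (of_int j * of_real x) / c) has_vector_derivative ee (of_int j * of_real x)) (at x within {0..1})"
          by (simp add: ee_def c_def mult_ac)
      qed auto
      with False show ?thesis by (simp add: integral_unique)
    qed simp
    \<comment> \<open>Coefficients are taken against ee (k x) rather than its conjugate, so the term
      m = - k survives; the Gaussian is even in m.\<close>
    have Req: "integral {0..1} (\<lambda>x. \<Sum>\<^sub>\<infinity>m. ?h m x * ee (of_int k * of_real x)) = of_real (exp (- pi * (of_int k)\<^sup>2 / t))"
    proof -
      have "integral {0..1} (\<lambda>x. ?h m x * ee (of_int k * of_real x))
          = (if m = - k then of_real (exp (- pi * (of_int k)\<^sup>2 / t)) else 0)" for m
      proof -
        have "(\<lambda>x. ?h m x * ee (of_int k * of_real x)) = (\<lambda>x. of_real (exp (- pi * (of_int m)\<^sup>2 / t)) * ee (of_int (m + k) * of_real x))"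
          by (simp add: fun_eq_iff ee_add distrib_right)
        then have "integral {0..1} (\<lambda>x. ?h m x * ee (of_int k * of_real x))
            = of_real (exp (- pi * (of_int m)\<^sup>2 / t)) * (if m + k = 0 then 1 else 0)"
          by (simp only: integral_mult_right orth)
        moreover have "m + k = 0 \<longleftrightarrow> m = - k" by auto
        ultimately show ?thesis by (simp only:) simp
      qed
      then have "((\<lambda>m. if m = - k then complex_of_real (exp (- pi * (of_int k)\<^sup>2 / t)) else 0) has_sum
         integral {0..1} (\<lambda>x. \<Sum>\<^sub>\<infinity>m. ?h m x * ee (of_int k * of_real x))) UNIV"
        using RS(1)[of k] by simp
      moreover have "((\<lambda>m. if m = - k then complex_of_real (exp (- pi * (of_int k)\<^sup>2 / t)) else 0) has_sum
          of_real (exp (- pi * (of_int k)\<^sup>2 / t))) UNIV"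
        by (rule has_sum_finite_neutralI[of "{- k}"]) auto
      ultimately show ?thesis by (rule has_sum_unique)
    qed
    have "integral {0..1} (\<lambda>x. (?L x - ?R x) * ee (of_int k * of_real x))
      = integral {0..1} (\<lambda>x. (\<Sum>\<^sub>\<infinity>n. ?g (x + of_int n) * ee (of_int k * of_real x))
           - of_real (1 / sqrt t) * (\<Sum>\<^sub>\<infinity>m. ?h m x * ee (of_int k * of_real x)))"
      by (intro Henstock_Kurzweil_Integration.integral_cong) (simp only: left_diff_distrib infsum_cmult_left' mult.assoc[of "of_real (1 / sqrt t)"])
    also have "\<dots> = integral {0..1} (\<lambda>x. \<Sum>\<^sub>\<infinity>n. ?g (x + of_int n) * ee (of_int k * of_real x))
           - of_real (1 / sqrt t) * integral {0..1} (\<lambda>x. \<Sum>\<^sub>\<infinity>m. ?h m x * ee (of_int k * of_real x))"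
      by (simp only: integral_mult_right Henstock_Kurzweil_Integration.integral_diff[OF
            integrable_continuous_real[OF LS(2)] integrable_continuous_real[OF continuous_on_mult_left[OF RS(2)]]])
    also have "\<dots> = 0" unfolding Leq Req by simp
    finally show "integral {0..1} (\<lambda>x. (?L x - ?R x) * ee (of_int k * of_real x)) = 0" .
  qed
  then have base: "?L x = ?R x" if "x \<in> {0..1}" for x using that by simp
  have L: "?L (y + of_int m) = ?L y" for y and m :: int
    by (rule infsum_reindex_bij_witness[of _ "\<lambda>n. n - m" "\<lambda>n. n + m"]) (auto simp: algebra_simps)
  have R: "?R (y + of_int m) = ?R y" for y and m :: int
    by (simp add: distrib_left ee_add flip: of_int_mult)
  have x: "x = frac x + of_int \<lfloor>x\<rfloor>" by (simp add: frac_def)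
  have "?L (frac x) = ?R (frac x)" by (rule base) (simp add: frac_lt_1 less_imp_le)
  then show ?thesis by (subst (1 2) x) (simp only: L R)
qed

section \<open>Differentiation of exponential series\<close>

text \<open>Termwise differentiation with the second-order bound of the exponential series. The
  factor exp (e * w x) in \<open>summ\<close> is the reserve that pays for it: one half for the
  growth within distance e / 2 of z, the other half for the square of \<open>w x\<close>. General
  index sets and spaces serve both the one-variable theta function and the theta series of degree
  n.\<close>

lemma has_derivative_exp_series:
  fixes l :: "'x \<Rightarrow> 'v::real_normed_vector \<Rightarrow> complex"
  assumes lin: "\<And>x. x \<in> X \<Longrightarrow> bounded_linear (l x)"
    and bnd: "\<And>x v. x \<in> X \<Longrightarrow> norm (l x v) \<le> w x * norm v"
    and w0: "\<And>x. x \<in> X \<Longrightarrow> w x \<ge> 0" and e: "e > 0"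
    and summ: "(\<lambda>x. norm (c x * exp (l x z)) * exp (e * w x)) summable_on X"
  shows "((\<lambda>v. \<Sum>\<^sub>\<infinity>x\<in>X. c x * exp (l x v)) has_derivative
      (\<lambda>h. \<Sum>\<^sub>\<infinity>x\<in>X. c x * exp (l x z) * l x h)) (at z within S)"
proof -
  define A where "A x = norm (c x * exp (l x z))" for x
  define T where "T = (\<Sum>\<^sub>\<infinity>x\<in>X. A x * exp (e * w x))"
  have A0: "A x \<ge> 0" for x by (simp add: A_def)
  have summA: "(\<lambda>x. A x * exp (e * w x)) summable_on X" using summ by (simp add: A_def)
  have w1: "w x \<le> (1 / e) * exp (e * w x)" if "x \<in> X" for x
  proof -
    have "e * w x \<le> exp (e * w x)" using exp_ge_add_one_self[of "e * w x"] by linarith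
    then show ?thesis using e by (simp add: field_simps)
  qed
  \<comment> \<open>A quarter of the exponent bounds \<open>w x\<close> linearly; its square uses up
    the second half of the reserve.\<close>
  have w2: "(w x)\<^sup>2 * exp (e / 2 * w x) \<le> (16 / e\<^sup>2) * exp (e * w x)" if "x \<in> X" for x
  proof -
    define u where "u = exp (e / 4 * w x)"
    have "e / 4 * w x \<le> u" using exp_ge_add_one_self[of "e / 4 * w x"] unfolding u_def by linarith
    then have "(e / 4 * w x)\<^sup>2 \<le> u\<^sup>2" using e w0[OF that] by (intro power_mono) auto
    then have "(w x)\<^sup>2 \<le> (16 / e\<^sup>2) * u\<^sup>2" using e by (simp add: field_simps power_mult_distrib power_divide)
    moreover have "exp (e / 2 * w x) = u\<^sup>2" "exp (e * w x) = u\<^sup>2 * u\<^sup>2"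
      by (simp_all add: u_def power2_eq_square flip: exp_add) (simp add: field_simps)?
    ultimately show ?thesis using mult_right_mono[of "(w x)\<^sup>2" "(16 / e\<^sup>2) * u\<^sup>2" "u\<^sup>2"] by (simp only: mult.assoc zero_le_power2)
  qed
  have s1: "(\<lambda>x. norm (c x * exp (l x z) * l x h)) summable_on X" for h
  proof (rule summable_on_comparison_test)
    show "(\<lambda>x. (norm h / e) * (A x * exp (e * w x))) summable_on X" by (intro summable_on_cmult_right summA)
    fix x assume x: "x \<in> X"
    have "norm (l x h) \<le> w x * norm h" by (rule bnd[OF x])
    also have "\<dots> \<le> (1 / e) * exp (e * w x) * norm h" by (intro mult_right_mono w1 x) simp
    finally have "A x * norm (l x h) \<le> A x * ((1 / e) * exp (e * w x) * norm h)" by (intro mult_left_mono A0)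
    then show "norm (c x * exp (l x z) * l x h) \<le> (norm h / e) * (A x * exp (e * w x))"
      by (simp add: A_def norm_mult mult_ac)
  qed simp
  have s2: "(\<lambda>x. norm (c x * exp (l x y))) summable_on X" if y: "norm (y - z) \<le> e" for y
  proof (rule summable_on_comparison_test[OF summA])
    fix x assume x: "x \<in> X"
    interpret bounded_linear "l x" by (rule lin[OF x])
    have "norm (l x (y - z)) \<le> w x * norm (y - z)" by (rule bnd[OF x])
    also have "\<dots> \<le> w x * e" by (intro mult_left_mono y w0 x)
    finally have "norm (exp (l x (y - z))) \<le> exp (e * w x)"
      using norm_exp[of "l x (y - z)"] by (smt (verit) exp_le_cancel_iff mult.commute)
    moreover have "exp (l x y) = exp (l x z) * exp (l x (y - z))" by (simp add: diff flip: exp_add)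
    ultimately show "norm (c x * exp (l x y)) \<le> A x * exp (e * w x)"
      using A0[of x] by (simp add: A_def norm_mult mult_left_mono flip: mult.assoc)
  qed simp
  have lin': "bounded_linear (\<lambda>h. \<Sum>\<^sub>\<infinity>x\<in>X. c x * exp (l x z) * l x h)"
  proof (rule bounded_linear_intro)
    note s1' = abs_summable_summable[OF s1]
    fix h k :: 'v and r :: real
    show "(\<Sum>\<^sub>\<infinity>x\<in>X. c x * exp (l x z) * l x (h + k))
        = (\<Sum>\<^sub>\<infinity>x\<in>X. c x * exp (l x z) * l x h) + (\<Sum>\<^sub>\<infinity>x\<in>X. c x * exp (l x z) * l x k)"
      by (subst infsum_add[symmetric, OF s1' s1'])
         (auto intro!: infsum_cong simp: bounded_linear.linear[OF lin, THEN linear_add] distrib_left)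
    show "(\<Sum>\<^sub>\<infinity>x\<in>X. c x * exp (l x z) * l x (r *\<^sub>R h)) = r *\<^sub>R (\<Sum>\<^sub>\<infinity>x\<in>X. c x * exp (l x z) * l x h)"
      by (subst infsum_scaleR_right[symmetric])
         (auto intro!: infsum_cong simp: bounded_linear.linear[OF lin, THEN linear_scale])
    have "norm (\<Sum>\<^sub>\<infinity>x\<in>X. c x * exp (l x z) * l x h) \<le> (\<Sum>\<^sub>\<infinity>x\<in>X. (norm h / e) * (A x * exp (e * w x)))"
    proof (rule norm_infsum_le)
      show "((\<lambda>x. c x * exp (l x z) * l x h) has_sum (\<Sum>\<^sub>\<infinity>x\<in>X. c x * exp (l x z) * l x h)) X"
        using s1' by (rule has_sum_infsum)
      show "((\<lambda>x. norm h / e * (A x * exp (e * w x))) has_sum (\<Sum>\<^sub>\<infinity>x\<in>X. norm h / e * (A x * exp (e * w x)))) X"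
        by (intro has_sum_infsum summable_on_cmult_right summA)
      fix x assume x: "x \<in> X"
      have "norm (l x h) \<le> (1 / e) * exp (e * w x) * norm h"
        by (rule order_trans[OF bnd[OF x]], intro mult_right_mono w1 x) simp
      then have "A x * norm (l x h) \<le> A x * ((1 / e) * exp (e * w x) * norm h)" by (intro mult_left_mono A0)
      then show "norm (c x * exp (l x z) * l x h) \<le> norm h / e * (A x * exp (e * w x))"
        by (simp add: A_def norm_mult mult_ac)
    qed
    also have "\<dots> = norm h * (T / e)" unfolding T_def infsum_cmult_right' using e by simp
    finally show "norm (\<Sum>\<^sub>\<infinity>x\<in>X. c x * exp (l x z) * l x h) \<le> norm h * (T / e)" .
  qed
  show ?thesis
  proof (rule has_derivativeI_sandwich[where e = "e / 2" and H = "\<lambda>y. (16 / e\<^sup>2 * T) * norm (y - z)"])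
    show "((\<lambda>y. (16 / e\<^sup>2 * T) * norm (y - z)) \<longlongrightarrow> 0) (at z within S)"
    proof -
      have "((\<lambda>y. (16 / e\<^sup>2 * T) * norm (y - z)) \<longlongrightarrow> (16 / e\<^sup>2 * T) * norm (z - z)) (at z within S)"
        by (intro tendsto_intros)
      then show ?thesis by simp
    qed
    fix y assume "y \<noteq> z" and "dist y z < e / 2"
    then have y: "norm (y - z) \<le> e / 2" "norm (y - z) > 0" by (auto simp: dist_norm)
    let ?h = "y - z"
    let ?t = "\<lambda>x. c x * exp (l x y) - c x * exp (l x z) - c x * exp (l x z) * l x ?h"
    have sy: "(\<lambda>x. c x * exp (l x y)) summable_on X" by (rule abs_summable_summable, rule s2) (use y e in linarith)
    have sz: "(\<lambda>x. c x * exp (l x z)) summable_on X" by (rule abs_summable_summable, rule s2) (use e in simp)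
    have sh: "(\<lambda>x. c x * exp (l x z) * l x ?h) summable_on X" by (rule abs_summable_summable[OF s1])
    have "((\<lambda>x. c x * exp (l x y) + - (c x * exp (l x z)) + - (c x * exp (l x z) * l x ?h)) has_sum
       ((\<Sum>\<^sub>\<infinity>x\<in>X. c x * exp (l x y)) + - (\<Sum>\<^sub>\<infinity>x\<in>X. c x * exp (l x z)) + - (\<Sum>\<^sub>\<infinity>x\<in>X. c x * exp (l x z) * l x ?h))) X"
      by (rule has_sum_add[OF has_sum_add[OF has_sum_infsum[OF sy] has_sum_uminusI[OF has_sum_infsum[OF sz]]]
            has_sum_uminusI[OF has_sum_infsum[OF sh]]])
    then have "(?t has_sum ((\<Sum>\<^sub>\<infinity>x\<in>X. c x * exp (l x y)) - (\<Sum>\<^sub>\<infinity>x\<in>X. c x * exp (l x z)) - (\<Sum>\<^sub>\<infinity>x\<in>X. c x * exp (l x z) * l x ?h))) X"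
      by simp
    moreover have "((\<lambda>x. (16 / e\<^sup>2 * (norm ?h)\<^sup>2) * (A x * exp (e * w x))) has_sum (16 / e\<^sup>2 * (norm ?h)\<^sup>2) * T) X"
      unfolding T_def by (intro has_sum_cmult_right has_sum_infsum summA)
    ultimately have "norm ((\<Sum>\<^sub>\<infinity>x\<in>X. c x * exp (l x y)) - (\<Sum>\<^sub>\<infinity>x\<in>X. c x * exp (l x z)) - (\<Sum>\<^sub>\<infinity>x\<in>X. c x * exp (l x z) * l x ?h))
       \<le> (16 / e\<^sup>2 * (norm ?h)\<^sup>2) * T"
    proof (rule norm_infsum_le)
      fix x assume x: "x \<in> X"
      interpret bounded_linear "l x" by (rule lin[OF x])
      define u where "u = l x ?h"
      have u: "norm u \<le> w x * norm ?h" unfolding u_def by (rule bnd[OF x])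
      have u2: "norm u \<le> e / 2 * w x"
        using mult_left_mono[OF y(1) w0[OF x]] u by (simp add: mult.commute)
      have "exp (l x y) = exp (l x z) * exp u" by (simp add: u_def diff flip: exp_add)
      then have "?t x = c x * exp (l x z) * (exp u - (\<Sum>k\<le>1. u ^ k / fact k))"
        by (simp add: u_def[symmetric] algebra_simps)
      then have t: "norm (?t x) = A x * norm (exp u - (\<Sum>k\<le>1. u ^ k / fact k))" by (simp only: norm_mult A_def)
      have "norm (exp u - (\<Sum>k\<le>1. u ^ k / fact k)) \<le> exp \<bar>Re u\<bar> * (norm u ^ Suc 1) / fact 1"
        by (rule Taylor_exp)
      also have "exp \<bar>Re u\<bar> * (norm u ^ Suc 1) / fact 1 = exp \<bar>Re u\<bar> * (norm u)\<^sup>2"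
        by (simp add: power2_eq_square)
      also have "\<dots> \<le> exp (e / 2 * w x) * (w x * norm ?h)\<^sup>2"
      proof (rule mult_mono)
        show "exp \<bar>Re u\<bar> \<le> exp (e / 2 * w x)" using u2 abs_Re_le_cmod[of u] by simp
        show "(norm u)\<^sup>2 \<le> (w x * norm ?h)\<^sup>2" by (rule power_mono[OF u]) simp
      qed auto
      also have "\<dots> = ((w x)\<^sup>2 * exp (e / 2 * w x)) * (norm ?h)\<^sup>2" by (simp add: power_mult_distrib)
      also have "\<dots> \<le> ((16 / e\<^sup>2) * exp (e * w x)) * (norm ?h)\<^sup>2" by (intro mult_right_mono w2 x) simp
      finally have "A x * norm (exp u - (\<Sum>k\<le>1. u ^ k / fact k)) \<le> A x * (((16 / e\<^sup>2) * exp (e * w x)) * (norm ?h)\<^sup>2)"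
        by (rule mult_left_mono[OF _ A0])
      then show "norm (?t x) \<le> (16 / e\<^sup>2 * (norm ?h)\<^sup>2) * (A x * exp (e * w x))"
        unfolding t by (simp only: mult_ac)
    qed
    then have "norm ((\<Sum>\<^sub>\<infinity>x\<in>X. c x * exp (l x y)) - (\<Sum>\<^sub>\<infinity>x\<in>X. c x * exp (l x z)) - (\<Sum>\<^sub>\<infinity>x\<in>X. c x * exp (l x z) * l x ?h)) / norm ?h
      \<le> (16 / e\<^sup>2 * (norm ?h)\<^sup>2) * T / norm ?h" by (intro divide_right_mono) auto
    also have "\<dots> = (16 / e\<^sup>2 * T) * norm ?h" using y by (simp add: power2_eq_square)
    finally show "norm ((\<Sum>\<^sub>\<infinity>x\<in>X. c x * exp (l x y)) - (\<Sum>\<^sub>\<infinity>x\<in>X. c x * exp (l x z)) - (\<Sum>\<^sub>\<infinity>x\<in>X. c x * exp (l x z) * l x ?h)) / norm ?h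
      \<le> (16 / e\<^sup>2 * T) * norm ?h" .
  qed (use e lin' in auto)
qed

section \<open>The Jacobi theta function of one variable and its inversion formula\<close>

definition theta1 :: "complex \<Rightarrow> complex \<Rightarrow> complex" where
  "theta1 \<tau> z = (\<Sum>\<^sub>\<infinity>n::int. ee (\<tau> * (of_int n)\<^sup>2 / 2 + of_int n * z))"

lemma theta1_summable:
  assumes "Im \<tau> > 0"
  shows "(\<lambda>n::int. norm (ee (\<tau> * (of_int n)\<^sup>2 / 2 + of_int n * z))) summable_on UNIV"
proof (rule summable_on_comparison_test)
  show "(\<lambda>n::int. exp (2 * pi * \<bar>Im z\<bar> * \<bar>of_int n\<bar> - pi * Im \<tau> * (of_int n)\<^sup>2)) summable_on UNIV"
    using assms by (intro summable_on_gauss_int) simp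
  fix n :: int
  have "Im (\<tau> * (of_int n)\<^sup>2) = Im \<tau> * (of_int n)\<^sup>2"
    by (simp add: power2_eq_square)
  moreover have "- (Im z * of_int n) \<le> \<bar>Im z\<bar> * \<bar>of_int n\<bar>"
    using abs_ge_minus_self[of "Im z * of_int n"] by (simp only: abs_mult)
  then have "2 * pi * (- (Im z * of_int n)) \<le> 2 * pi * (\<bar>Im z\<bar> * \<bar>of_int n\<bar>)"
    by (rule mult_left_mono) simp
  ultimately show "norm (ee (\<tau> * (of_int n)\<^sup>2 / 2 + of_int n * z)) \<le> exp (2 * pi * \<bar>Im z\<bar> * \<bar>of_int n\<bar> - pi * Im \<tau> * (of_int n)\<^sup>2)"
    by (simp add: norm_ee algebra_simps)
qed simp

text \<open>Holomorphy is stated along a holomorphic curve in the two variables, the form in which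
  the analytic continuation in \<open>poisson_theta1\<close> uses it.\<close>

lemma theta1_holomorphic:
  assumes f: "f holomorphic_on S" and g: "g holomorphic_on S" and S: "open S"
    and im: "\<And>s. s \<in> S \<Longrightarrow> Im (f s) > 0"
  shows "(\<lambda>s. theta1 (f s) (g s)) holomorphic_on S"
proof -
  define l where "l n v = 2 * of_real pi * \<i> * (fst v * (of_int n)\<^sup>2 / 2 + of_int n * snd v)" for n :: int and v :: "complex \<times> complex"
  define w where "w n = 4 * pi * (of_int n)\<^sup>2" for n :: int
  have bl: "bounded_linear (l n)" for n
    unfolding l_def by (intro bounded_linear_const_mult bounded_linear_add
        bounded_linear_compose[OF bounded_linear_divide] bounded_linear_mult_const bounded_linear_fst bounded_linear_snd)
  have bnd: "norm (l n v) \<le> w n * norm v" for n v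
  proof -
    have "norm (l n v) \<le> 2 * pi * (norm (fst v) * (of_int n)\<^sup>2 / 2 + \<bar>of_int n\<bar> * norm (snd v))"
      unfolding l_def using norm_triangle_ineq[of "fst v * (of_int n)\<^sup>2 / 2" "of_int n * snd v"]
      by (simp add: norm_mult norm_power norm_divide)
    also have "\<bar>of_int n :: real\<bar> \<le> (of_int n)\<^sup>2"
    proof (cases "n = 0")
      case False
      then have "1 \<le> \<bar>n\<bar>" by linarith
      then have "1 \<le> \<bar>of_int n :: real\<bar>" by linarith
      from mult_right_mono[OF this abs_ge_zero[of "of_int n :: real"]] show ?thesis
        by (simp add: power2_eq_square flip: abs_mult)
    qed simp
    also have "2 * pi * (norm (fst v) * (of_int n)\<^sup>2 / 2 + (of_int n)\<^sup>2 * norm (snd v))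
       \<le> 2 * pi * (norm v * (of_int n)\<^sup>2 / 2 + (of_int n)\<^sup>2 * norm v)"
      using norm_fst_le[of "fst v" "snd v"] norm_snd_le[of "snd v" "fst v"]
      by (intro mult_left_mono add_mono divide_right_mono mult_right_mono mult_left_mono) 
         (auto simp: norm_Pair)
    also have "\<dots> \<le> w n * norm v" by (simp add: w_def algebra_simps)
    finally show ?thesis by (simp add: mult_left_mono mult_right_mono)
  qed
  have th: "theta1 (fst v) (snd v) = (\<Sum>\<^sub>\<infinity>n. 1 * exp (l n v))" for v
    by (simp add: theta1_def l_def ee_def)
  show ?thesis
    unfolding holomorphic_on_def
  proof
    fix s assume s: "s \<in> S"
    define z where "z = (f s, g s)"
    \<comment> \<open>The weight exp (e * w n) amounts to lowering the imaginary part of the modulus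
      by 4 e; with this e it is merely halved.\<close>
    define e where "e = Im (f s) / 8"
    have e: "e > 0" using im[OF s] by (simp add: e_def)
    have "(\<lambda>n. norm (1 * exp (l n z)) * exp (e * w n)) summable_on UNIV"
    proof (rule summable_on_cong[THEN iffD1])
      show "(\<lambda>n. norm (ee ((f s - 4 * \<i> * of_real e) * (of_int n)\<^sup>2 / 2 + of_int n * g s))) summable_on UNIV"
        by (rule theta1_summable) (use im[OF s] in \<open>simp add: e_def\<close>)
      fix n :: int
      have "- 2 * pi * Im ((f s - 4 * \<i> * of_real e) * (of_int n)\<^sup>2 / 2 + of_int n * g s)
        = - 2 * pi * Im (f s * (of_int n)\<^sup>2 / 2 + of_int n * g s) + e * w n"
        by (simp add: w_def power2_eq_square algebra_simps add_divide_distrib diff_divide_distrib)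
      moreover have "norm (1 * exp (l n z)) = norm (ee (f s * (of_int n)\<^sup>2 / 2 + of_int n * g s))"
        by (simp add: l_def z_def ee_def)
      ultimately show "norm (ee ((f s - 4 * \<i> * of_real e) * (of_int n)\<^sup>2 / 2 + of_int n * g s)) = norm (1 * exp (l n z)) * exp (e * w n)"
        by (simp only: norm_ee exp_add)
    qed
    then have D: "((\<lambda>v. \<Sum>\<^sub>\<infinity>n. 1 * exp (l n v)) has_derivative
      (\<lambda>h. \<Sum>\<^sub>\<infinity>n. 1 * exp (l n z) * l n h)) (at z)"
      by (intro has_derivative_exp_series[where w = w and e = e] bl bnd e) (auto simp: w_def)
    obtain f' g' where fg: "(f has_field_derivative f') (at s)" "(g has_field_derivative g') (at s)"
      using f g s S by (metis holomorphic_derivI)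
    have "((\<lambda>s. (f s, g s)) has_derivative (\<lambda>h. (f' * h, g' * h))) (at s)"
      using fg unfolding has_field_derivative_def by (rule has_derivative_Pair)
    from has_derivative_compose[OF this, of "\<lambda>v. \<Sum>\<^sub>\<infinity>n. 1 * exp (l n v)"] D
    have "((\<lambda>s. theta1 (f s) (g s)) has_derivative (\<lambda>h. \<Sum>\<^sub>\<infinity>n. 1 * exp (l n z) * l n (f' * h, g' * h))) (at s)"
      using th[of "(f s, g s)" for s] by (simp add: z_def)
    moreover have "(\<lambda>h. \<Sum>\<^sub>\<infinity>n. 1 * exp (l n z) * l n (f' * h, g' * h)) = (*) (\<Sum>\<^sub>\<infinity>n. 1 * exp (l n z) * l n (f', g'))"
    proof
      fix h
      have "l n (f' * h, g' * h) = l n (f', g') * h" for n by (simp add: l_def algebra_simps)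
      then show "(\<Sum>\<^sub>\<infinity>n. 1 * exp (l n z) * l n (f' * h, g' * h)) = (\<Sum>\<^sub>\<infinity>n. 1 * exp (l n z) * l n (f', g')) * h"
        by (simp add: infsum_cmult_left' flip: mult.assoc)
    qed
    ultimately have "((\<lambda>s. theta1 (f s) (g s)) has_field_derivative (\<Sum>\<^sub>\<infinity>n. 1 * exp (l n z) * l n (f', g'))) (at s)"
      by (simp only: has_field_derivative_def)
    then show "(\<lambda>s. theta1 (f s) (g s)) field_differentiable at s within S"
      unfolding field_differentiable_def by (blast intro: has_field_derivative_at_within)
  qed
qed

text \<open>For imaginary \<tau> and real z this is \<open>poisson_real\<close>. The general case
  follows by the identity theorem on one complex curve, so no continuation in two variables is
  needed.\<close>

lemma poisson_theta1:
  assumes "Im \<tau> > 0"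
  shows "theta1 \<tau> z = csqrt (\<i> / \<tau>) * (\<Sum>\<^sub>\<infinity>m::int. ee (- ((of_int m + z)\<^sup>2 / (2 * \<tau>))))"
proof -
  have conv: "(\<Sum>\<^sub>\<infinity>m::int. ee (- ((of_int m + z)\<^sup>2 / (2 * \<tau>)))) = ee (- (z\<^sup>2 / (2 * \<tau>))) * theta1 (- 1 / \<tau>) (- z / \<tau>)" for z \<tau> :: complex
    unfolding theta1_def infsum_cmult_right'[symmetric]
    by (intro infsum_cong) (simp add: ee_add[symmetric], intro arg_cong[of _ _ ee], simp add: power2_sum add_divide_distrib algebra_simps)
  have real_case: "theta1 (\<i> * of_real t) (of_real x) = csqrt (\<i> / (\<i> * of_real t)) * (\<Sum>\<^sub>\<infinity>m::int. ee (- ((of_int m + of_real x)\<^sup>2 / (2 * (\<i> * of_real t)))))"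
    if t: "t > 0" for t x :: real
  proof -
    have "theta1 (\<i> * of_real t) (of_real x) = (\<Sum>\<^sub>\<infinity>m::int. of_real (exp (- pi * (of_int m)\<^sup>2 / (1 / t))) * ee (of_int m * of_real x))"
      unfolding theta1_def ee_add
    proof (intro infsum_cong)
      fix n :: int
      have "2 * of_real pi * \<i> * (\<i> * of_real t * (of_real (of_int n))\<^sup>2 / 2) = complex_of_real (- pi * (of_int n)\<^sup>2 / (1 / t))"
        by simp
      then show "ee (\<i> * of_real t * (of_int n)\<^sup>2 / 2) * ee (of_int n * of_real x) = complex_of_real (exp (- pi * (of_int n)\<^sup>2 / (1 / t))) * ee (of_int n * of_real x)"
        unfolding ee_def[of "\<i> * of_real t * (of_int n)\<^sup>2 / 2"] exp_of_real[symmetric] by (simp add: mult_ac)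
    qed
    also have "\<dots> = of_real (1 / sqrt t) * (\<Sum>\<^sub>\<infinity>n::int. complex_of_real (exp (- pi * (1 / t) * (x + of_int n)\<^sup>2)))"
      using poisson_real[of "1 / t" x] t by (simp add: real_sqrt_divide)
    also have "(\<Sum>\<^sub>\<infinity>n::int. complex_of_real (exp (- pi * (1 / t) * (x + of_int n)\<^sup>2))) = (\<Sum>\<^sub>\<infinity>m::int. ee (- ((of_int m + of_real x)\<^sup>2 / (2 * (\<i> * of_real t)))))"
    proof (intro infsum_cong)
      fix n :: int
      define w where "w = x + of_int n"
      have "2 * of_real pi * \<i> * (- ((of_real w)\<^sup>2 / (2 * (\<i> * of_real t)))) = complex_of_real (- pi * (1 / t) * w\<^sup>2)"
        by simp
      then show "complex_of_real (exp (- pi * (1 / t) * (x + of_int n)\<^sup>2)) = ee (- ((of_int n + of_real x)\<^sup>2 / (2 * (\<i> * of_real t))))"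
        unfolding w_def[symmetric] ee_def exp_of_real[symmetric] by (simp add: w_def add.commute)
    qed
    also have "of_real (1 / sqrt t) = csqrt (\<i> / (\<i> * of_real t))"
      using t by (simp add: csqrt_of_real_nonneg real_sqrt_divide flip: of_real_divide)
    finally show ?thesis .
  qed
  define a b x y where "a = Re \<tau>" and "b = Im \<tau>" and "x = Re z" and "y = Im z"
  have b: "b > 0" using assms by (simp add: b_def)
  \<comment> \<open>At s = 1 the curve passes through (\<tau>, z). At imaginary s the modulus is
    purely imaginary and the elliptic variable is real; these s accumulate at 0.\<close>
  define T where "T s = \<i> * of_real b + s * of_real a" for s
  define W where "W s = of_real x + \<i> * s * of_real y" for s
  define S where "S = {s. Im (T s) > 0}"
  define F where "F s = theta1 (T s) (W s) - csqrt (\<i> / T s) * (ee (- ((W s)\<^sup>2 / (2 * T s))) * theta1 (- 1 / T s) (- W s / T s))" for s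
  have S_eq: "S = {s. a * Im s > - b}" by (auto simp: S_def T_def algebra_simps)
  have openS: "open S" unfolding S_def T_def by (intro open_Collect_less continuous_intros)
  have convS: "convex S"
  proof (rule convexI)
    fix s t :: complex and u v :: real assume st: "s \<in> S" "t \<in> S" and uv: "0 \<le> u" "0 \<le> v" "u + v = 1"
    have "u * (a * Im s + b) + v * (a * Im t + b) > 0"
      using st uv unfolding S_eq by (smt (verit) mem_Collect_eq mult_nonneg_nonneg mult_pos_pos)
    moreover have "u * b + v * b = b" using uv by (simp flip: distrib_right)
    ultimately show "u *\<^sub>R s + v *\<^sub>R t \<in> S" unfolding S_eq by (simp add: algebra_simps)
  qed
  have T: "T s \<noteq> 0" "Im (T s) > 0" "Im (- 1 / T s) > 0" if "s \<in> S" for s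
  proof -
    show im: "Im (T s) > 0" using that by (simp add: S_def)
    then show nz: "T s \<noteq> 0" by auto
    have "Im (- 1 / T s) = Im (T s) / ((Re (T s))\<^sup>2 + (Im (T s))\<^sup>2)" by (simp add: Im_divide)
    moreover have "(Re (T s))\<^sup>2 + (Im (T s))\<^sup>2 > 0" using im by (simp add: add_nonneg_pos)
    ultimately show "Im (- 1 / T s) > 0" using im by simp
  qed
  have holT: "T holomorphic_on S" and holW: "W holomorphic_on S"
    unfolding T_def W_def by (intro holomorphic_intros)+
  \<comment> \<open>The real part of i / T s is the imaginary part of - 1 / T s, hence positive, so
    the principal root is holomorphic along the whole curve.\<close>
  have sq: "(\<lambda>s. csqrt (\<i> / T s)) holomorphic_on S"
  proof (rule holomorphic_on_compose_gen[unfolded o_def, where g = csqrt and t = "- \<real>\<^sub>\<le>\<^sub>0"])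
    show "(\<lambda>s. \<i> / T s) holomorphic_on S" using T by (intro holomorphic_intros holT) auto
    show "csqrt holomorphic_on - \<real>\<^sub>\<le>\<^sub>0" by (intro holomorphic_intros) auto
    show "(\<lambda>s. \<i> / T s) ` S \<subseteq> - \<real>\<^sub>\<le>\<^sub>0"
    proof clarify
      fix s assume s: "s \<in> S" "\<i> / T s \<in> \<real>\<^sub>\<le>\<^sub>0"
      have "Re (\<i> / T s) = Im (- 1 / T s)" by (simp add: Re_divide Im_divide)
      with T(3)[OF s(1)] s(2) show False by (auto simp: complex_nonpos_Reals_iff)
    qed
  qed
  have "F holomorphic_on S"
    unfolding F_def ee_def
    by (intro holomorphic_on_diff holomorphic_on_mult sq theta1_holomorphic openS holomorphic_intros holT holW) (use T in auto)
  moreover have "F (\<i> * of_real \<sigma>) = 0" if "\<i> * of_real \<sigma> \<in> S" for \<sigma>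
  proof -
    have "b + \<sigma> * a > 0" using that unfolding S_eq by (simp add: algebra_simps)
    moreover have "T (\<i> * of_real \<sigma>) = \<i> * of_real (b + \<sigma> * a)" "W (\<i> * of_real \<sigma>) = of_real (x - \<sigma> * y)"
      by (auto simp: T_def W_def algebra_simps complex_eq_iff)
    ultimately show ?thesis
      using real_case[of "b + \<sigma> * a" "x - \<sigma> * y"] unfolding F_def conv[symmetric] by simp
  qed
  moreover have "0 islimpt {s \<in> S. \<exists>\<sigma>. s = \<i> * of_real \<sigma>}"
  proof (rule islimptI)
    fix U :: "complex set" assume "0 \<in> U" "open U"
    moreover have "0 \<in> S" using b by (simp add: S_eq)
    ultimately obtain r where r: "r > 0" "ball 0 r \<subseteq> U \<inter> S" using openS by (metis IntI open_Int open_contains_ball)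
    have "\<i> * of_real (r / 2) \<in> ball 0 r" using r by (simp add: norm_mult)
    then show "\<exists>y\<in>{s \<in> S. \<exists>\<sigma>. s = \<i> * of_real \<sigma>}. y \<in> U \<and> y \<noteq> 0"
      using r by (intro bexI[of _ "\<i> * of_real (r / 2)"]) (auto intro!: exI[of _ "r / 2"])
  qed
  moreover have "0 \<in> S" "1 \<in> S" using b by (auto simp: S_eq)
  ultimately have "F 1 = 0"
    using analytic_continuation[of F S "{s \<in> S. \<exists>\<sigma>. s = \<i> * of_real \<sigma>}" 0 1] openS convex_connected[OF convS] by auto
  moreover have "T 1 = \<tau>" "W 1 = z" by (auto simp: T_def W_def a_def b_def x_def y_def complex_eq_iff)
  ultimately show ?thesis unfolding F_def conv[symmetric] by simp
qed

section \<open>Lattices of periodic sequences\<close>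

text \<open>An integer polynomial acts on sequences by evaluating it at the shift operator.\<close>

definition poly_act :: "int poly \<Rightarrow> (nat \<Rightarrow> complex) \<Rightarrow> nat \<Rightarrow> complex" where
  "poly_act P f i = (\<Sum>j\<le>Polynomial.degree P. of_int (Polynomial.coeff P j) * f (i + j))"

lemma poly_act_bound:
  assumes "Polynomial.degree P \<le> n"
  shows "poly_act P f i = (\<Sum>j\<le>n. of_int (Polynomial.coeff P j) * f (i + j))"
  unfolding poly_act_def
  by (rule sum.mono_neutral_left) (use assms in \<open>auto simp: coeff_eq_0\<close>)

lemma poly_act_0 [simp]: "poly_act 0 f = (\<lambda>i. 0)"
  by (simp add: poly_act_def fun_eq_iff)

lemma poly_act_pCons: "poly_act (pCons a P) f i = of_int a * f i + poly_act P f (i + 1)"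
proof -
  have "poly_act (pCons a P) f i = (\<Sum>j\<le>Suc (Polynomial.degree P). of_int (Polynomial.coeff (pCons a P) j) * f (i + j))"
    by (rule poly_act_bound) (rule degree_pCons_le)
  also have "\<dots> = of_int a * f i + (\<Sum>j\<le>Polynomial.degree P. of_int (Polynomial.coeff P j) * f (i + 1 + j))"
    by (subst sum.atMost_Suc_shift) simp
  finally show ?thesis by (simp add: poly_act_def)
qed

lemma poly_act_add: "poly_act (P + Q) f i = poly_act P f i + poly_act Q f i"
proof -
  define n where "n = max (Polynomial.degree P) (Polynomial.degree Q)"
  have "Polynomial.degree (P + Q) \<le> n" "Polynomial.degree P \<le> n" "Polynomial.degree Q \<le> n" by (auto simp: n_def degree_add_le_max)
  then show ?thesis by (simp add: poly_act_bound distrib_right sum.distrib)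
qed

lemma poly_act_smult: "poly_act (Polynomial.smult c P) f i = of_int c * poly_act P f i"
  by (simp add: poly_act_bound[OF degree_smult_le] poly_act_def sum_distrib_left mult.assoc)

lemma poly_act_mult: "poly_act (P * Q) f i = poly_act P (poly_act Q f) i"
proof (induction P arbitrary: i rule: pCons_induct)
  case (pCons a P)
  then show ?case by (simp add: mult_pCons_left poly_act_add poly_act_smult poly_act_pCons)
qed simp

lemma poly_act_mult': "poly_act (P * Q) f = poly_act P (poly_act Q f)"
  by (simp add: fun_eq_iff poly_act_mult)

lemma poly_act_const: "poly_act [:c:] f i = of_int c * f i"
  by (simp add: poly_act_pCons)

definition delta :: "(nat \<Rightarrow> complex) \<Rightarrow> nat \<Rightarrow> complex" where
  "delta f i = f i - f (i + 1)"

lemma poly_act_delta: "poly_act [:1, - 1:] f = delta f"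
  by (simp add: poly_act_pCons delta_def fun_eq_iff)

lemma poly_act_delta_pow: "poly_act ([:1, - 1:] ^ a) f = (delta ^^ a) f"
proof (induction a arbitrary: f)
  case 0
  then show ?case by (simp add: poly_act_const fun_eq_iff one_pCons)
next
  case (Suc a)
  have "poly_act ([:1, - 1:] ^ Suc a) f = poly_act [:1, - 1:] (poly_act ([:1, - 1:] ^ a) f)"
    by (simp add: poly_act_mult fun_eq_iff del: mult_pCons_left)
  then show ?case by (simp add: Suc poly_act_delta)
qed

lemma poly_act_comm: "poly_act P (poly_act Q f) = poly_act Q (poly_act P f)"
  by (simp add: fun_eq_iff mult.commute flip: poly_act_mult)

lemma poly_act_linear: "poly_act P (\<lambda>i. c * f i + d * g i) i = c * poly_act P f i + d * poly_act P g i"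
  by (simp add: poly_act_def sum.distrib sum_distrib_left algebra_simps)

lemma delta_pow_linear: "(delta ^^ a) (\<lambda>i. c * f i + d * g i) i = c * (delta ^^ a) f i + d * (delta ^^ a) g i"
  by (simp add: poly_act_linear flip: poly_act_delta_pow)

lemma poly_act_Ints: "(\<And>i. f i \<in> \<int>) \<Longrightarrow> poly_act P f i \<in> \<int>"
  unfolding poly_act_def by (intro Ints_sum Ints_mult) auto

lemma smult_sum: "(\<Sum>k\<in>A. Polynomial.smult c (g k)) = Polynomial.smult c (\<Sum>k\<in>A. g k)"
  by (induction A rule: infinite_finite_induct) (auto simp: smult_add_right)

text \<open>Modulo the norm polynomial, p equals a unit times the (p - 1)-st power of 1 - X: this is the
  total ramification of p in the p-th cyclotomic field.\<close>

lemma prime_ramified: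
  assumes p: "prime p" and odd: "odd p"
  shows "\<exists>H K :: int poly. [:int p:] = [:1, - 1:] ^ (p - 1) * H + (\<Sum>i<p. Polynomial.monom 1 i) * K"
proof -
  define X N u :: "int poly" where "X = [:0, 1:]" and "N = (\<Sum>i<p. X ^ i)" and "u = [:1, - 1:]"
  have u: "u = 1 - X" by (simp add: u_def X_def one_pCons)
  have N: "N = (\<Sum>i<p. Polynomial.monom 1 i)" by (simp add: N_def X_def monom_altdef)
  have p2: "p \<ge> 2" using p prime_ge_2_nat by blast
  have uN: "u * N = 1 - X ^ p" unfolding u N_def by (simp add: one_diff_power_eq)
  \<comment> \<open>The inner binomial coefficients are divisible by p, and (- X)^p = - X^p because
    p is odd.\<close>
  have "\<exists>F. u ^ p = 1 - X ^ p + Polynomial.smult (int p) F"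
  proof -
    have "u ^ p = (- X + 1) ^ p" by (simp add: u)
    also have "\<dots> = (\<Sum>k\<le>p. of_nat (p choose k) * (- X) ^ k * 1 ^ (p - k))" by (rule binomial_ring)
    also have "\<dots> = (\<Sum>k\<in>insert 0 (insert p {1..<p}). of_nat (p choose k) * (- X) ^ k)"
      using p2 by (intro sum.cong) auto
    also have "\<dots> = 1 + ((- X) ^ p + (\<Sum>k\<in>{1..<p}. of_nat (p choose k) * (- X) ^ k))"
      using p2 by (subst sum.insert) auto
    also have "(- X) ^ p = - (X ^ p)" using odd by simp
    also have "(\<Sum>k\<in>{1..<p}. of_nat (p choose k) * (- X) ^ k) = (\<Sum>k\<in>{1..<p}. Polynomial.smult (int p) (of_nat ((p choose k) div p) * (- X) ^ k))"
    proof (intro sum.cong refl)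
      fix k assume "k \<in> {1..<p}"
      then have "p dvd (p choose k)" using p by (intro dvd_choose_prime) auto
      then have "p choose k = p * ((p choose k) div p)" by simp
      then have "(of_nat (p choose k) :: int poly) = of_nat p * of_nat ((p choose k) div p)" by (metis of_nat_mult)
      then show "of_nat (p choose k) * (- X) ^ k = Polynomial.smult (int p) (of_nat ((p choose k) div p) * (- X) ^ k)"
        by (simp add: of_nat_poly mult.commute)
    qed
    also have "\<dots> = Polynomial.smult (int p) (\<Sum>k\<in>{1..<p}. of_nat ((p choose k) div p) * (- X) ^ k)"
      by (rule smult_sum)
    finally show ?thesis by (intro exI) (simp add: algebra_simps)
  qed
  then obtain F where F: "u ^ p = 1 - X ^ p + Polynomial.smult (int p) F" by blast
  \<comment> \<open>Both u and 1 - X^p vanish at 1, so F does too and is a multiple of u.\<close>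
  have "poly F 1 = 0"
    using arg_cong[OF F, of "\<lambda>q. poly q 1"] p2 by (simp add: u_def X_def power_0_left)
  then obtain E where E: "F = u * E"
    by (metis poly_eq_0_iff_dvd dvdE u_def dvd_minus_iff minus_pCons minus_minus minus_zero neg_equal_0_iff_equal mult_minus_left minus_mult_commute add.inverse_inverse)
  have u0: "u \<noteq> 0" by (simp add: u_def)
  have "u * u ^ (p - 1) = u * (N + Polynomial.smult (int p) E)"
    using F p2 by (simp add: uN E distrib_left flip: power_Suc)
  then have E1: "u ^ (p - 1) = N + Polynomial.smult (int p) E" using u0 by simp
  \<comment> \<open>N takes the value p at 1, so E takes the value - 1 there. Hence E + 1 is again a
    multiple of u, which expresses p through N, u^(p-1) and p u.\<close>
  have "int p * (1 + poly E 1) = 0"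
    using arg_cong[OF E1, of "\<lambda>q. poly q 1"] p2 by (simp add: u_def N poly_sum poly_monom distrib_left power_0_left)
  then have "poly (E + 1) 1 = 0" using p2 by simp
  then obtain F' where F': "E + 1 = u * F'"
    by (metis poly_eq_0_iff_dvd dvdE u_def dvd_minus_iff minus_pCons minus_minus minus_zero neg_equal_0_iff_equal mult_minus_left minus_mult_commute add.inverse_inverse)
  have pE: "[:int p:] = N - u ^ (p - 1) + [:int p:] * u * F'"
  proof -
    have eq: "[:int p:] * u * F' = Polynomial.smult (int p) E + [:int p:]"
      by (simp add: mult.assoc smult_add_right flip: F')
    show ?thesis unfolding eq E1 by simp
  qed
  \<comment> \<open>Substituting \<open>pE\<close> into itself trades the remaining factor p for one
    more power of u until the exponent p - 1 is reached.\<close>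
  have "\<exists>H K. [:int p:] = u ^ j * H + N * K" if "j \<le> p - 1" for j
    using that
  proof (induction j)
    case 0
    then show ?case by (intro exI[of _ "[:int p:]"] exI[of _ 0]) simp
  next
    case (Suc j)
    then obtain H K where HK: "[:int p:] = u ^ j * H + N * K" by auto
    have "p - 1 = Suc j + (p - 1 - Suc j)" using Suc.prems by simp
    then have "u ^ (p - 1) = u ^ Suc j * u ^ (p - 1 - Suc j)" by (metis power_add)
    then have "[:int p:] = N - u ^ Suc j * u ^ (p - 1 - Suc j) + (u ^ j * H + N * K) * u * F'"
      using pE HK by metis
    also have "\<dots> = u ^ Suc j * (H * F' - u ^ (p - 1 - Suc j)) + N * (1 + K * u * F')"
      by (simp add: algebra_simps)
    finally show ?case by blast
  qed
  from this[of "p - 1"] show ?thesis by (simp add: N u_def)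
qed

text \<open>Indices run over all natural numbers and periodicity is a separate condition, so that
  the cyclic shift is l + 1 without wrapping. Values are complex because the elliptic variable of
  the theta functions lives in the same space.\<close>

type_synonym cvec = "nat \<Rightarrow> complex"

text \<open>Bilinear and not hermitian, since the theta functions have to be holomorphic in the
  elliptic variable.\<close>

definition ip :: "nat \<Rightarrow> cvec \<Rightarrow> cvec \<Rightarrow> complex" where
  "ip p x y = (\<Sum>l<p. x l * y l)"

definition scale :: "complex \<Rightarrow> cvec \<Rightarrow> cvec" where
  "scale c x = (\<lambda>l. c * x l)"

definition vadd :: "cvec \<Rightarrow> cvec \<Rightarrow> cvec" where
  "vadd x y = (\<lambda>l. x l + y l)"

lemma ip_commute: "ip p x y = ip p y x"
  by (simp add: ip_def mult.commute)

lemma ip_vadd_left [simp]: "ip p (vadd x y) z = ip p x z + ip p y z"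
  by (simp add: ip_def vadd_def distrib_right sum.distrib)

lemma ip_vadd_right [simp]: "ip p z (vadd x y) = ip p z x + ip p z y"
  by (simp add: ip_def vadd_def distrib_left sum.distrib)

lemma ip_scale_left [simp]: "ip p (scale c x) z = c * ip p x z"
  by (simp add: ip_def scale_def sum_distrib_left mult.assoc)

lemma ip_scale_right [simp]: "ip p z (scale c x) = c * ip p z x"
  by (simp add: ip_def scale_def sum_distrib_left mult_ac)

lemma ip_zero [simp]: "ip p (\<lambda>l. 0) z = 0" "ip p z (\<lambda>l. 0) = 0"
  by (simp_all add: ip_def)

definition periodic :: "nat \<Rightarrow> cvec \<Rightarrow> bool" where
  "periodic p f \<longleftrightarrow> (\<forall>i. f (i + p) = f i)"

lemma periodic_add_mult:
  assumes "periodic p f"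
  shows "f (i + k * p) = f i"
proof (induction k)
  case (Suc k)
  have "f (i + Suc k * p) = f ((i + k * p) + p)" by (simp add: ac_simps)
  also have "\<dots> = f (i + k * p)" using assms by (simp only: periodic_def)
  finally show ?case using Suc by simp
qed simp

lemma periodic_mod: "periodic p f \<Longrightarrow> f (i mod p) = f i"
  using periodic_add_mult[of p f "i mod p" "i div p"] by simp

lemma sum_shift_periodic:
  assumes "periodic p f" "p > 0"
  shows "(\<Sum>l<p. f (l + j)) = (\<Sum>l<p. f l)"
proof (induction j)
  case (Suc j)
  have "(\<Sum>l<p. f (Suc l + j)) = (\<Sum>l<p. f (l + j)) - f j + f (p + j)"
    using sum.lessThan_Suc_shift[of "\<lambda>l. f (l + j)" p] sum.lessThan_Suc[of "\<lambda>l. f (l + j)" p] by (simp add: algebra_simps)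
  also have "f (p + j) = f j" using assms by (simp add: periodic_def add.commute)
  finally show ?case using Suc by simp
qed simp

lemma periodic_vadd: "periodic p f \<Longrightarrow> periodic p g \<Longrightarrow> periodic p (vadd f g)"
  by (simp add: periodic_def vadd_def)

lemma periodic_scale: "periodic p f \<Longrightarrow> periodic p (scale c f)"
  by (simp add: periodic_def scale_def)

lemma periodic_poly_act: "periodic p f \<Longrightarrow> periodic p (poly_act P f)"
  by (simp add: periodic_def poly_act_def add.assoc add.commute[of p]) (simp add: add.assoc[symmetric])?

lemma sum_poly_act:
  assumes "periodic p f" "p > 0"
  shows "(\<Sum>l<p. poly_act P f l) = of_int (poly P 1) * (\<Sum>l<p. f l)"
proof -
  have "(\<Sum>l<p. poly_act P f l) = (\<Sum>j\<le>Polynomial.degree P. of_int (Polynomial.coeff P j) * (\<Sum>l<p. f (l + j)))"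
    unfolding poly_act_def by (subst sum.swap) (simp add: sum_distrib_left)
  then show ?thesis
    by (simp add: sum_shift_periodic[OF assms] sum_distrib_right poly_altdef)
qed

definition hyperplane :: "nat \<Rightarrow> cvec set" where
  "hyperplane p = {f. periodic p f \<and> (\<Sum>l<p. f l) = 0}"

definition int_vecs :: "nat \<Rightarrow> cvec set" where
  "int_vecs p = {f. periodic p f \<and> (\<forall>i. f i \<in> \<int>)}"

definition lat :: "nat \<Rightarrow> nat \<Rightarrow> cvec set" where
  "lat p a = (delta ^^ a) ` int_vecs p"

text \<open>The adjoint of \<open>delta\<close> is \<open>delta\<close> up to sign and shift, so
  integrality of \<open>ip\<close> on \<open>lat p a\<close> becomes integrality of the a-th
  difference. That this is the dual lattice is shown by \<open>ip_lat_dual\<close> and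
  \<open>dual_latI\<close>.\<close>

definition dual_lat :: "nat \<Rightarrow> nat \<Rightarrow> cvec set" where
  "dual_lat p a = {y \<in> hyperplane p. (delta ^^ a) y \<in> int_vecs p}"


lemma delta_pow_shift: "(delta ^^ a) (\<lambda>i. f (i + c)) i = (delta ^^ a) f (i + c)"
  by (simp add: poly_act_def ac_simps flip: poly_act_delta_pow)

lemma periodic_shift: "periodic p f \<Longrightarrow> periodic p (\<lambda>i. f (i + c))"
  by (simp add: periodic_def) (metis add.assoc add.commute)

text \<open>Summation by parts. The backward shift is written as l + (p - 1), as indices are natural
  numbers.\<close>

lemma ip_delta_left:
  assumes "periodic p f" "periodic p y" "p > 0"
  shows "ip p (delta f) y = - ip p f (\<lambda>l. delta y (l + (p - 1)))"
proof -
  have p: "l + (p - 1) + 1 = l + p" for l using assms(3) by simp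
  have "(\<Sum>l<p. f (l + 1) * y l) = (\<Sum>l<p. f l * y (l + (p - 1)))"
    using sum_shift_periodic[of p "\<lambda>l. f l * y (l + (p - 1))" 1] assms periodic_shift[OF assms(2), of "p - 1"]
    by (simp add: periodic_def)
  then show ?thesis
    using assms(2) unfolding ip_def delta_def p
    by (simp add: periodic_def left_diff_distrib right_diff_distrib sum_subtractf)
qed

lemma periodic_delta_pow: "periodic p f \<Longrightarrow> periodic p ((delta ^^ a) f)"
  by (simp add: periodic_poly_act flip: poly_act_delta_pow)

lemma ip_delta_pow_left:
  assumes "periodic p f" "periodic p y" "p > 0"
  shows "ip p ((delta ^^ a) f) y = (- 1) ^ a * ip p f (\<lambda>l. (delta ^^ a) y (l + a * (p - 1)))"
  using assms(2)
proof (induction a arbitrary: y)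
  case (Suc a)
  let ?Ty = "\<lambda>l. delta y (l + (p - 1))"
  have per: "periodic p ?Ty"
    using periodic_delta_pow[OF Suc.prems, of 1] periodic_shift by simp
  have "ip p ((delta ^^ Suc a) f) y = - ip p ((delta ^^ a) f) ?Ty"
    using ip_delta_left[OF periodic_delta_pow[OF assms(1)] Suc.prems assms(3)] by simp
  also have "\<dots> = (- 1) ^ Suc a * ip p f (\<lambda>l. (delta ^^ a) ?Ty (l + a * (p - 1)))"
    using Suc.IH[OF per] by simp
  also have "(\<lambda>l. (delta ^^ a) ?Ty (l + a * (p - 1))) = (\<lambda>l. (delta ^^ Suc a) y (l + Suc a * (p - 1)))"
  proof
    fix l
    have "(delta ^^ a) ?Ty (l + a * (p - 1)) = (delta ^^ a) (delta y) (l + a * (p - 1) + (p - 1))"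
      by (rule delta_pow_shift)
    also have "(delta ^^ a) (delta y) = (delta ^^ Suc a) y" by (simp add: funpow_swap1)
    also have "l + a * (p - 1) + (p - 1) = l + Suc a * (p - 1)" by simp
    finally show "(delta ^^ a) ?Ty (l + a * (p - 1)) = (delta ^^ Suc a) y (l + Suc a * (p - 1))" .
  qed
  finally show ?case .
qed simp

lemma ip_Ints: "(\<And>l. x l \<in> \<int>) \<Longrightarrow> (\<And>l. y l \<in> \<int>) \<Longrightarrow> ip p x y \<in> \<int>"
  unfolding ip_def by (intro Ints_sum Ints_mult) auto

lemma poly_act_sum_monom: "poly_act (\<Sum>i<n. Polynomial.monom 1 i) f i = (\<Sum>j<n. f (i + j))"
proof (induction n)
  case (Suc n)
  have "poly_act (Polynomial.monom 1 n) f i = (\<Sum>j\<le>n. of_int (Polynomial.coeff (Polynomial.monom 1 n) j) * f (i + j))"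
    by (rule poly_act_bound) (rule degree_monom_le)
  also have "\<dots> = (\<Sum>j\<in>{n}. f (i + j))"
    by (rule sum.mono_neutral_cong_right) auto
  finally show ?case using Suc by (simp add: poly_act_add)
qed simp

lemma hyperplane_vadd: "x \<in> hyperplane p \<Longrightarrow> y \<in> hyperplane p \<Longrightarrow> vadd x y \<in> hyperplane p"
  by (simp add: hyperplane_def periodic_vadd) (simp add: vadd_def sum.distrib)

lemma hyperplane_scale: "x \<in> hyperplane p \<Longrightarrow> scale c x \<in> hyperplane p"
  by (simp add: hyperplane_def periodic_scale) (simp add: scale_def flip: sum_distrib_left)

lemma int_vecs_vadd: "x \<in> int_vecs p \<Longrightarrow> y \<in> int_vecs p \<Longrightarrow> vadd x y \<in> int_vecs p"
  by (simp add: int_vecs_def periodic_vadd) (simp add: vadd_def)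

lemma int_vecs_scale: "x \<in> int_vecs p \<Longrightarrow> c \<in> \<int> \<Longrightarrow> scale c x \<in> int_vecs p"
  by (simp add: int_vecs_def periodic_scale) (simp add: scale_def)

lemma delta_pow_vadd: "(delta ^^ a) (vadd x y) = vadd ((delta ^^ a) x) ((delta ^^ a) y)"
  using delta_pow_linear[of a 1 x 1 y] by (simp add: vadd_def fun_eq_iff)

lemma delta_pow_scale: "(delta ^^ a) (scale c x) = scale c ((delta ^^ a) x)"
  using delta_pow_linear[of a c x 0 x] by (simp add: scale_def fun_eq_iff)

lemma int_vecs_poly_act: "f \<in> int_vecs p \<Longrightarrow> poly_act P f \<in> int_vecs p"
  by (simp add: int_vecs_def periodic_poly_act poly_act_Ints)

lemma int_vecs_delta_pow: "f \<in> int_vecs p \<Longrightarrow> (delta ^^ a) f \<in> int_vecs p"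
  by (simp add: int_vecs_poly_act flip: poly_act_delta_pow)

lemma lat_vadd: "x \<in> lat p a \<Longrightarrow> y \<in> lat p a \<Longrightarrow> vadd x y \<in> lat p a"
  unfolding lat_def by (auto simp: delta_pow_vadd[symmetric] int_vecs_vadd)

lemma lat_scale: "x \<in> lat p a \<Longrightarrow> c \<in> \<int> \<Longrightarrow> scale c x \<in> lat p a"
  unfolding lat_def by (auto simp: delta_pow_scale[symmetric] int_vecs_scale)

lemma lat_zero: "(\<lambda>l. 0) \<in> lat p a"
proof -
  have "scale 0 (\<lambda>l. 0) \<in> int_vecs p" by (simp add: int_vecs_def periodic_def scale_def)
  then have "(delta ^^ a) (scale 0 (\<lambda>l. 0)) \<in> lat p a" by (simp add: lat_def)
  then show ?thesis by (simp add: delta_pow_scale) (simp add: scale_def)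
qed

lemma lat_shift: "g \<in> lat p a \<Longrightarrow> (\<lambda>i. g (i + c)) \<in> lat p a"
proof -
  assume "g \<in> lat p a"
  then obtain f where f: "f \<in> int_vecs p" "g = (delta ^^ a) f" by (auto simp: lat_def)
  have "(\<lambda>i. g (i + c)) = (delta ^^ a) (\<lambda>i. f (i + c))" by (simp add: f delta_pow_shift fun_eq_iff)
  moreover have "(\<lambda>i. f (i + c)) \<in> int_vecs p" using f by (simp add: int_vecs_def periodic_shift)
  ultimately show ?thesis by (auto simp: lat_def)
qed

lemma dual_lat_shift:
  assumes "y \<in> dual_lat p a" and "p > 0"
  shows "(\<lambda>i. y (i + c)) \<in> dual_lat p a"
proof -
  have "(delta ^^ a) (\<lambda>i. y (i + c)) = (\<lambda>i. (delta ^^ a) y (i + c))" by (simp add: delta_pow_shift fun_eq_iff)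
  then show ?thesis using assms
    by (simp add: dual_lat_def hyperplane_def int_vecs_def periodic_shift sum_shift_periodic)
qed

lemma ip_shift:
  assumes "periodic p x" "periodic p y" "p > 0"
  shows "ip p (\<lambda>i. x (i + c)) (\<lambda>i. y (i + c)) = ip p x y"
  unfolding ip_def using sum_shift_periodic[of p "\<lambda>l. x l * y l" c] assms by (simp add: periodic_def)

lemma lat_subset_int_vecs: "lat p a \<subseteq> int_vecs p"
  by (auto simp: lat_def int_vecs_delta_pow)

lemma delta_pow_hyperplane:
  assumes "periodic p f" "p > 0" "a \<ge> 1"
  shows "(delta ^^ a) f \<in> hyperplane p"
  using sum_poly_act[OF assms(1,2), of "[:1, - 1:] ^ a"] assms
  by (simp add: hyperplane_def periodic_delta_pow poly_act_delta_pow)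

lemma delta_pow_hyperplane': "f \<in> hyperplane p \<Longrightarrow> p > 0 \<Longrightarrow> poly_act P f \<in> hyperplane p"
  using sum_poly_act[of p f P] by (simp add: hyperplane_def periodic_poly_act)

lemma lat_subset_hyperplane: "p > 0 \<Longrightarrow> a \<ge> 1 \<Longrightarrow> lat p a \<subseteq> hyperplane p"
  by (auto simp: lat_def int_vecs_def intro: delta_pow_hyperplane)

lemma lat_subset_dual: "p > 0 \<Longrightarrow> a \<ge> 1 \<Longrightarrow> lat p a \<subseteq> dual_lat p a"
  using lat_subset_hyperplane[of p a] lat_subset_int_vecs[of p a] by (auto simp: dual_lat_def int_vecs_delta_pow)

lemma ip_lat_dual:
  assumes "g \<in> lat p a" "y \<in> dual_lat p a" "p > 0"
  shows "ip p g y \<in> \<int>"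
proof -
  obtain f where f: "f \<in> int_vecs p" "g = (delta ^^ a) f" using assms by (auto simp: lat_def)
  have "ip p f (\<lambda>l. (delta ^^ a) y (l + a * (p - 1))) \<in> \<int>"
    using f assms(2) by (intro ip_Ints) (auto simp: int_vecs_def dual_lat_def)
  then show ?thesis
    using ip_delta_pow_left[of p f y a] f assms by (auto simp: int_vecs_def dual_lat_def hyperplane_def)
qed

definition unit_vec :: "nat \<Rightarrow> nat \<Rightarrow> cvec" where
  "unit_vec p j = (\<lambda>i. if i mod p = j then 1 else 0)"

lemma unit_vec_int: "unit_vec p j \<in> int_vecs p"
  by (simp add: unit_vec_def int_vecs_def periodic_def)

lemma ip_unit_vec: "j < p \<Longrightarrow> ip p (unit_vec p j) y = y j"
proof -
  assume j: "j < p"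
  have "ip p (unit_vec p j) y = (\<Sum>l<p. if l = j then y l else 0)"
    unfolding ip_def unit_vec_def by (intro sum.cong) auto
  then show ?thesis using j by simp
qed

lemma dual_latI:
  assumes y: "y \<in> hyperplane p" and int: "\<And>g. g \<in> lat p a \<Longrightarrow> ip p g y \<in> \<int>" and p: "p > 0"
  shows "y \<in> dual_lat p a"
proof -
  have per: "periodic p ((delta ^^ a) y)" using y by (simp add: hyperplane_def periodic_delta_pow)
  have "(delta ^^ a) y i \<in> \<int>" for i
  proof -
    \<comment> \<open>The a-fold adjoint shifts by a (p - 1), which is - a modulo p; testing with
      the unit vector at i + a therefore isolates the value at i.\<close>
    define j where "j = (i + a) mod p"
    have j: "j < p" using p by (simp add: j_def)
    have "(delta ^^ a) (unit_vec p j) \<in> lat p a" by (simp add: lat_def unit_vec_int)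
    from int[OF this] have "(- 1) ^ a * (delta ^^ a) y (j + a * (p - 1)) \<in> \<int>"
      using ip_delta_pow_left[of p "unit_vec p j" y a] y p unit_vec_int[of p j]
      by (simp add: hyperplane_def int_vecs_def ip_unit_vec[OF j])
    then have "(delta ^^ a) y (j + a * (p - 1)) \<in> \<int>"
      by (cases "even a") (auto simp: minus_in_Ints_iff)
    moreover have "(j + a * (p - 1)) mod p = i mod p"
    proof -
      have "(j + a * (p - 1)) mod p = (i + a + a * (p - 1)) mod p" by (simp add: j_def mod_simps)
      also have "i + a + a * (p - 1) = i + a * p" using p by (cases p) (simp_all add: algebra_simps)
      finally show ?thesis by simp
    qed
    ultimately show ?thesis using periodic_mod[OF per] by metis
  qed
  then show ?thesis using y per by (simp add: dual_lat_def int_vecs_def)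
qed

text \<open>A square has the parity of its root, and the coordinates of g sum to zero.\<close>

lemma lat_even:
  assumes "g \<in> lat p a" "p > 0" "a \<ge> 1"
  shows "ip p g g / 2 \<in> \<int>"
proof -
  have g: "\<And>l. g l \<in> \<int>" "(\<Sum>l<p. g l) = 0"
    using assms lat_subset_int_vecs[of p a] lat_subset_hyperplane[of p a] by (auto simp: int_vecs_def hyperplane_def)
  define n where "n l = \<lfloor>Re (g l)\<rfloor>" for l
  have n: "g l = of_int (n l)" for l
    using g(1)[of l] by (auto simp: n_def elim: Ints_cases)
  have "even (\<Sum>l<p. n l * n l)"
  proof -
    have "(\<Sum>l<p. n l) = 0" using g(2) unfolding n by (simp flip: of_int_sum)
    moreover have "even ((\<Sum>l<p. n l * n l) - (\<Sum>l<p. n l))"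
      unfolding sum_subtractf[symmetric] by (intro dvd_sum) auto
    ultimately show ?thesis by simp
  qed
  then obtain k where "(\<Sum>l<p. n l * n l) = 2 * k" by (auto elim: dvdE)
  moreover have "ip p g g = of_int (\<Sum>l<p. n l * n l)" by (simp add: ip_def n)
  ultimately show ?thesis by simp
qed

lemma hyperplane_fixed:
  assumes "f \<in> hyperplane p" "(\<lambda>i. f (i + 1)) = f" "p > 0"
  shows "f = (\<lambda>l. 0)"
proof -
  have c: "f i = f 0" for i
  proof (induction i)
    case (Suc i)
    then show ?case using fun_cong[OF assms(2), of i] by simp
  qed simp
  have "(\<Sum>l<p. f l) = (\<Sum>l<p. f 0)" by (intro sum.cong refl c)
  then have "f 0 = 0" using assms by (simp add: hyperplane_def)
  then show ?thesis using c by (auto simp: fun_eq_iff)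
qed

section \<open>Level and reduction modulo d from total ramification\<close>

locale odd_prime =
  fixes p :: nat
  assumes prime: "prime p" and odd: "odd p"
begin

lemma p_pos: "p > 0"
  using prime prime_gt_0_nat by blast

text \<open>The norm polynomial acts as the sum over a full period, which is zero on the
  hyperplane.\<close>

lemma ramified:
  obtains H where "\<And>f i. f \<in> hyperplane p \<Longrightarrow> of_nat p * f i = poly_act ([:1, - 1:] ^ (p - 1) * H) f i"
proof -
  obtain H K :: "int poly" where HK: "[:int p:] = [:1, - 1:] ^ (p - 1) * H + (\<Sum>i<p. Polynomial.monom 1 i) * K"
    using prime_ramified[OF prime odd] by blast
  have "of_nat p * f i = poly_act ([:1, - 1:] ^ (p - 1) * H) f i" if f: "f \<in> hyperplane p" for f i
  proof -
    have "of_nat p * f i = poly_act [:int p:] f i" by (simp add: poly_act_const)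
    also have "\<dots> = poly_act ([:1, - 1:] ^ (p - 1) * H) f i + poly_act (\<Sum>i<p. Polynomial.monom 1 i) (poly_act K f) i"
      unfolding HK poly_act_add poly_act_mult ..
    also have "poly_act (\<Sum>i<p. Polynomial.monom 1 i) (poly_act K f) i = 0"
      using delta_pow_hyperplane'[OF f p_pos, of K] sum_shift_periodic[of p "poly_act K f" i] p_pos
      by (simp add: poly_act_sum_monom hyperplane_def add.commute)
    finally show ?thesis by simp
  qed
  then show ?thesis by (rule that)
qed

text \<open>On the hyperplane p is a multiple of (1 - X)^(2a): one factor (1 - X)^a makes y
  integral, the other one places the result in the lattice. The condition on a leaves room for
  both.\<close>

lemma dual_lat_scale_prime:
  assumes y: "y \<in> dual_lat p a" and a: "2 * a \<le> p - 1"
  shows "scale (of_nat p) y \<in> lat p a"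
proof -
  obtain H where H: "\<And>f i. f \<in> hyperplane p \<Longrightarrow> of_nat p * f i = poly_act ([:1, - 1:] ^ (p - 1) * H) f i"
    using ramified by blast
  have "p - 1 = a + (p - 1 - 2 * a) + a" using a by simp
  then have "([:1, - 1:] :: int poly) ^ (p - 1) = [:1, - 1:] ^ a * [:1, - 1:] ^ (p - 1 - 2 * a) * [:1, - 1:] ^ a"
    by (metis power_add)
  then have "scale (of_nat p) y = poly_act ([:1, - 1:] ^ a * (([:1, - 1:] ^ (p - 1 - 2 * a) * H) * [:1, - 1:] ^ a)) y"
    using H[of y] y by (simp add: scale_def dual_lat_def fun_eq_iff mult_ac)
  also have "\<dots> = (delta ^^ a) (poly_act ([:1, - 1:] ^ (p - 1 - 2 * a) * H) ((delta ^^ a) y))"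
    by (simp only: poly_act_mult' poly_act_delta_pow)
  also have "\<dots> \<in> lat p a" using y by (simp add: lat_def dual_lat_def int_vecs_poly_act)
  finally show ?thesis .
qed

text \<open>Evenness of the lattice vector p y shows that p times the integer p ip(y, y) is even; as
  p is odd, that integer is even.\<close>

lemma dual_lat_level:
  assumes y: "y \<in> dual_lat p a" and a: "a \<ge> 1" "2 * a \<le> p - 1"
  shows "of_nat p * ip p y y / 2 \<in> \<int>"
proof -
  note py = dual_lat_scale_prime[OF y a(2)]
  have "of_nat p * ip p y y \<in> \<int>" using ip_lat_dual[OF py y p_pos] by simp
  then obtain m :: int where m: "of_nat p * ip p y y = of_int m" by (auto elim: Ints_cases)
  have "of_nat p * (of_nat p * ip p y y) / 2 \<in> \<int>" using lat_even[OF py p_pos a(1)] by simp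
  then obtain k where "of_nat p * of_int m / 2 = (of_int k :: complex)" unfolding m by (auto elim: Ints_cases)
  then have "complex_of_int (int p * m) = of_int (2 * k)" by (simp add: field_simps)
  then have "int p * m = 2 * k" by (simp only: of_int_eq_iff)
  then have "even m" using odd by (metis even_mult_iff dvd_triv_left even_of_nat)
  then show ?thesis unfolding m by (auto elim!: evenE)
qed

lemma coprime_divides_lat:
  assumes r: "r \<in> lat p a" and w: "w \<in> lat p a" and eq: "scale (of_nat p) r = scale (of_int d) w" and d: "coprime d (int p)"
  shows "\<exists>t\<in>lat p a. r = scale (of_int d) t"
proof -
  obtain x y where xy: "x * d + y * int p = 1" using d by (metis bezout_int coprime_imp_gcd_eq_1)
  have "r = scale (of_int d) (vadd (scale (of_int y) w) (scale (of_int x) r))"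
  proof
    fix l
    have "r l = of_int (x * d + y * int p) * r l" unfolding xy by simp
    also have "\<dots> = of_int d * (of_int x * r l) + of_int y * (of_nat p * r l)" by (simp add: algebra_simps)
    also have "of_nat p * r l = of_int d * w l" using fun_cong[OF eq, of l] by (simp add: scale_def)
    finally show "r l = scale (of_int d) (vadd (scale (of_int y) w) (scale (of_int x) r)) l"
      by (simp add: scale_def vadd_def algebra_simps)
  qed
  moreover have "vadd (scale (of_int y) w) (scale (of_int x) r) \<in> lat p a"
    by (intro lat_vadd lat_scale r w) auto
  ultimately show ?thesis by blast
qed

text \<open>A class of L / d L fixed by the shift is zero: (1 - X) r lies in d L, and 1 - X divides
  p on the hyperplane, so p r lies in d L, where p is invertible modulo d.\<close>

lemma shift_fixed_mod:
  assumes r: "r \<in> lat p a" and s: "s \<in> lat p a" and eq: "\<And>i. r (i + 1) - r i = of_int d * s i"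
    and d: "coprime d (int p)" and a: "a \<ge> 1"
  shows "\<exists>t\<in>lat p a. r = scale (of_int d) t"
proof -
  obtain H where H: "\<And>f i. f \<in> hyperplane p \<Longrightarrow> of_nat p * f i = poly_act ([:1, - 1:] ^ (p - 1) * H) f i"
    using ramified by blast
  define Q where "Q = [:1, - 1:] ^ (p - 2) * H"
  have "p - 1 = Suc (p - 2)" using prime prime_ge_2_nat[of p] by simp
  then have Q: "[:1, - 1:] ^ (p - 1) * H = Q * [:1, - 1:]" by (simp add: Q_def mult_ac del: mult_pCons_left mult_pCons_right)
  have rh: "r \<in> hyperplane p" using r lat_subset_hyperplane[OF p_pos a] by auto
  have "delta r = scale (- of_int d) s"
    using eq by (simp add: fun_eq_iff delta_def scale_def) (metis minus_diff_eq)
  then have "of_nat p * r i = poly_act Q (scale (- of_int d) s) i" for i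
    using H[OF rh, of i] unfolding Q poly_act_mult poly_act_delta by simp
  also have "poly_act Q (scale (- of_int d) s) i = of_int d * (- poly_act Q s i)" for i
    using poly_act_linear[of Q "- of_int d" s 0 s i] by (simp add: scale_def)
  finally have "scale (of_nat p) r = scale (of_int d) (scale (- 1) (poly_act Q s))"
    by (simp add: scale_def fun_eq_iff)
  moreover have "poly_act Q s \<in> lat p a"
  proof -
    obtain x where x: "x \<in> int_vecs p" "s = (delta ^^ a) x" using s by (auto simp: lat_def)
    have "poly_act Q s = (delta ^^ a) (poly_act Q x)"
      using poly_act_comm[of Q "[:1, - 1:] ^ a" x] by (simp only: x poly_act_delta_pow)
    then show ?thesis using x by (simp add: lat_def int_vecs_poly_act)
  qed
  ultimately show ?thesis using r d by (intro coprime_divides_lat[OF r lat_scale]) auto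
qed

text \<open>The hypothesis puts t / d into the dual lattice, so p t / d lies in the lattice, and p
  can be removed because it is prime to d.\<close>

lemma pairing_nondegenerate_mod:
  assumes t: "t \<in> lat p a" and int: "\<And>s. s \<in> lat p a \<Longrightarrow> ip p s t / of_int d \<in> \<int>"
    and d: "coprime d (int p)" and a: "a \<ge> 1" "2 * a \<le> p - 1" and d0: "d \<noteq> 0"
  shows "\<exists>t'\<in>lat p a. t = scale (of_int d) t'"
proof -
  define y where "y = scale (1 / of_int d) t"
  have "y \<in> dual_lat p a"
    by (rule dual_latI) (use t int lat_subset_hyperplane[OF p_pos a(1)] p_pos in \<open>auto simp: y_def hyperplane_scale\<close>)
  from dual_lat_scale_prime[OF this a(2)] have "scale (of_nat p) y \<in> lat p a" .
  moreover have "scale (of_nat p) t = scale (of_int d) (scale (of_nat p) y)"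
    using d0 by (simp add: y_def scale_def fun_eq_iff)
  ultimately show ?thesis using coprime_divides_lat t d by blast
qed

end

section \<open>Squares, free actions and integral combinations\<close>

text \<open>Pigeonhole: the values x^2 and - 1 - x^2 with 0 <= x <= (q - 1) / 2 form two sets of (q
  + 1) / 2 residues each, which must meet.\<close>

lemma two_squares_mod_prime:
  fixes q :: int
  assumes q: "prime q" "odd q"
  shows "\<exists>u v. q dvd u\<^sup>2 + v\<^sup>2 + 1"
proof -
  define h where "h = (q - 1) div 2"
  have q2: "q = 2 * h + 1" using q(2) by (simp add: h_def)
  have h0: "h > 0" using prime_gt_1_int[OF q(1)] q2 by simp
  have inj: "inj_on (\<lambda>x. (x\<^sup>2) mod q) {0..h}"
  proof (rule inj_onI)
    fix x y assume xy: "x \<in> {0..h}" "y \<in> {0..h}" "x\<^sup>2 mod q = y\<^sup>2 mod q"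
    then have "q dvd x\<^sup>2 - y\<^sup>2" by (simp add: mod_eq_dvd_iff)
    also have "x\<^sup>2 - y\<^sup>2 = (x - y) * (x + y)" by (simp add: power2_eq_square algebra_simps)
    finally have "q dvd x - y \<or> q dvd x + y" using q(1) prime_dvd_mult_iff by blast
    then show "x = y"
    proof
      assume "q dvd x - y"
      moreover have "\<bar>x - y\<bar> < q" using xy q2 by auto
      ultimately show ?thesis using zdvd_not_zless[of "\<bar>x - y\<bar>" q] by fastforce
    next
      assume "q dvd x + y"
      moreover have "0 \<le> x + y" "x + y < q" using xy q2 by auto
      ultimately have "x + y = 0" using zdvd_not_zless[of "x + y" q] by fastforce
      then show ?thesis using xy by auto
    qed
  qed
  define A B where "A = (\<lambda>x. x\<^sup>2 mod q) ` {0..h}" and "B = (\<lambda>x. (- 1 - x\<^sup>2) mod q) ` {0..h}"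
  have "inj_on (\<lambda>x. (- 1 - x\<^sup>2) mod q) {0..h}"
  proof (rule inj_onI)
    fix x y assume xy: "x \<in> {0..h}" "y \<in> {0..h}" "(- 1 - x\<^sup>2) mod q = (- 1 - y\<^sup>2) mod q"
    then have "q dvd y\<^sup>2 - x\<^sup>2" by (simp add: mod_eq_dvd_iff)
    then have "y\<^sup>2 mod q = x\<^sup>2 mod q" by (simp add: mod_eq_dvd_iff)
    then show "x = y" using inj xy by (auto dest: inj_onD)
  qed
  then have "card A = nat (h + 1)" "card B = nat (h + 1)"
    using inj h0 by (simp_all add: A_def B_def card_image)
  moreover have "A \<union> B \<subseteq> {0..<q}"
    using prime_gt_0_int[OF q(1)] by (auto simp: A_def B_def)
  then have "card (A \<union> B) \<le> nat q" using card_mono[of "{0..<q}" "A \<union> B"] by simp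
  moreover have "finite A" "finite B" by (auto simp: A_def B_def)
  ultimately have "A \<inter> B \<noteq> {}" using card_Un_disjoint[of A B] q2 h0 by (auto simp: nat_le_iff)
  then obtain u v where "u\<^sup>2 mod q = (- 1 - v\<^sup>2) mod q" by (auto simp: A_def B_def)
  then have "q dvd u\<^sup>2 - (- 1 - v\<^sup>2)" by (simp add: mod_eq_dvd_iff)
  then show ?thesis by (intro exI[of _ u] exI[of _ v]) (simp add: algebra_simps)
qed

text \<open>Hensel lifting in whichever of u and v is prime to q; both cannot be divisible by q,
  since u^2 + v^2 is - 1 modulo q.\<close>

lemma two_squares_mod_prime_power:
  fixes q :: int
  assumes q: "prime q" "odd q"
  shows "\<exists>u v. q ^ k dvd u\<^sup>2 + v\<^sup>2 + 1"
proof (induction k)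
  case (Suc k)
  have lift: "\<exists>u v. q ^ Suc k dvd u\<^sup>2 + v\<^sup>2 + 1"
    if N: "q ^ k dvd u\<^sup>2 + v\<^sup>2 + 1" and u: "\<not> q dvd u" and k: "k > 0" for u v
  proof -
    obtain m where m: "u\<^sup>2 + v\<^sup>2 + 1 = q ^ k * m" using N by blast
    have "\<not> q dvd 2"
    proof
      assume "q dvd 2"
      then have "q = 2" using zdvd_imp_le[of q 2] prime_gt_1_int[OF q(1)] by simp
      then show False using q(2) by simp
    qed
    then have "\<not> q dvd 2 * u" using u q(1) by (simp add: prime_dvd_mult_iff)
    then have "coprime (2 * u) q" using q(1) by (metis coprime_commute prime_imp_coprime)
    then obtain s where s: "[2 * u * s = - m] (mod q)"
      using cong_solve_coprime_int[of "2 * u" q] by (metis cong_scalar_right mult.assoc mult.left_neutral mult_1 cong_def mult.commute)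
    have "(u + q ^ k * s)\<^sup>2 + v\<^sup>2 + 1 = q ^ k * (m + 2 * u * s) + q ^ k * q ^ k * s\<^sup>2"
      using m by (simp add: power2_eq_square algebra_simps)
    moreover have "q dvd m + 2 * u * s" using s by (simp add: cong_iff_dvd_diff add.commute)
    then have "q ^ Suc k dvd q ^ k * (m + 2 * u * s)" by (simp add: mult.commute mult_dvd_mono)
    moreover have "q dvd q ^ k" using k by (simp add: dvd_power)
    then have "q ^ Suc k dvd q ^ k * q ^ k * s\<^sup>2" by (simp add: mult_dvd_mono dvd_mult2)
    ultimately have "q ^ Suc k dvd (u + q ^ k * s)\<^sup>2 + v\<^sup>2 + 1" by (simp only: dvd_add)
    then show ?thesis by blast
  qed
  obtain u v where uv: "q ^ k dvd u\<^sup>2 + v\<^sup>2 + 1" using Suc by blast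
  show ?case
  proof (cases "k = 0")
    case True
    then show ?thesis using two_squares_mod_prime[OF q] by simp
  next
    case False
    have "\<not> (q dvd u \<and> q dvd v)"
    proof
      assume "q dvd u \<and> q dvd v"
      then have "q dvd u\<^sup>2 + v\<^sup>2" by (simp add: power2_eq_square)
      moreover have "q dvd u\<^sup>2 + v\<^sup>2 + 1" using uv False by (meson dvd_power dvd_trans gr0I)
      ultimately have "q dvd 1" by (simp add: dvd_add_right_iff)
      then show False using q(1) not_prime_unit by blast
    qed
    then show ?thesis using lift[of u v] lift[of v u] uv False by (auto simp: add.commute)
  qed
qed simp

lemma two_squares_mod_odd:
  fixes d :: nat
  assumes "odd d"
  shows "\<exists>u v. int d dvd u\<^sup>2 + v\<^sup>2 + 1"
  using assms
proof (induction d rule: less_induct)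
  case (less d)
  show ?case
  proof (cases "d = 1")
    case False
    then obtain q where q: "prime q" "q dvd d" using prime_factor_nat by blast
    have d0: "d \<noteq> 0" using less.prems by (metis even_zero)
    obtain m where m: "d = q ^ multiplicity q d * m" "\<not> q dvd m"
      using multiplicity_decompose'[of d q] d0 q by (metis not_prime_unit)
    define k where "k = multiplicity q d"
    have "d > 0" using d0 by simp
    then have k: "k > 0" using q by (simp add: k_def prime_multiplicity_gt_zero_iff prime_imp_prime_elem)
    have oddq: "odd q" and oddm: "odd m" using less.prems m k q by (metis dvd_trans, metis even_mult_iff)
    have "m < d"
    proof -
      have "m > 0" using m(2) by (cases m) auto
      moreover have "1 < q ^ k" by (rule one_less_power[OF prime_gt_1_nat[OF q(1)] k])
      ultimately have "m * 1 < m * q ^ k" by (intro mult_strict_left_mono)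
      then show ?thesis using m(1) unfolding k_def[symmetric] by (simp add: mult.commute)
    qed
    then obtain u2 v2 where 2: "int m dvd u2\<^sup>2 + v2\<^sup>2 + 1" using less.IH oddm by blast
    obtain u1 v1 where 1: "int q ^ k dvd u1\<^sup>2 + v1\<^sup>2 + 1"
      using two_squares_mod_prime_power[of "int q" k] q oddq by auto
    have cop: "coprime (int q ^ k) (int m)"
      using m(2) q(1) by (simp add: prime_imp_coprime flip: of_nat_power)
    obtain u where u: "[u = u1] (mod int q ^ k)" "[u = u2] (mod int m)"
      using binary_chinese_remainder_int[OF cop] by blast
    obtain v where v: "[v = v1] (mod int q ^ k)" "[v = v2] (mod int m)"
      using binary_chinese_remainder_int[OF cop] by blast
    have "[u\<^sup>2 + v\<^sup>2 + 1 = u1\<^sup>2 + v1\<^sup>2 + 1] (mod int q ^ k)" "[u\<^sup>2 + v\<^sup>2 + 1 = u2\<^sup>2 + v2\<^sup>2 + 1] (mod int m)"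
      by (intro cong_add cong_pow cong_refl u v)+
    then have "int q ^ k dvd u\<^sup>2 + v\<^sup>2 + 1" "int m dvd u\<^sup>2 + v\<^sup>2 + 1"
      using 1 2 by (auto simp: cong_dvd_iff)
    then have "int q ^ k * int m dvd u\<^sup>2 + v\<^sup>2 + 1" using cop by (rule divides_mult)
    then show ?thesis using m(1) by (metis k_def of_nat_mult of_nat_power)
  qed simp
qed

text \<open>The orbits partition X, and without fixed points each of them has exactly p
  elements.\<close>

lemma prime_dvd_card_free_action:
  assumes fin: "finite X" and p: "prime p" and X: "\<And>x. x \<in> X \<Longrightarrow> f x \<in> X"
    and per: "\<And>x. x \<in> X \<Longrightarrow> (f ^^ p) x = x" and free: "\<And>x. x \<in> X \<Longrightarrow> f x \<noteq> x"
  shows "p dvd card X"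
proof -
  define orb where "orb x = (\<lambda>i. (f ^^ i) x) ` {..<p}" for x
  have p0: "p > 0" using p prime_gt_0_nat by blast
  have fX: "(f ^^ i) x \<in> X" if "x \<in> X" for i x by (induction i) (use that X in auto)
  have orbI: "(f ^^ i) x \<in> orb x" if "x \<in> X" for i x
    using funpow_mod_eq[OF per[OF that], of i] p0 by (auto simp: orb_def intro!: image_eqI[of _ _ "i mod p"])
  have card_orb: "card (orb x) = p" if x: "x \<in> X" for x
  proof -
    have False if ij: "i < j" "j < p" "(f ^^ i) x = (f ^^ j) x" for i j
    proof -
      \<comment> \<open>Two equal iterates give an exponent 0 < e < p whose iterate fixes x;
        inverting e modulo p shows that f itself fixes x.\<close>
      define e where "e = p - j + i"
      have "(f ^^ e) x = (f ^^ (p - j)) ((f ^^ i) x)" by (simp add: e_def funpow_add)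
      also have "\<dots> = (f ^^ (p - j + j)) x" unfolding ij(3) by (simp add: funpow_add)
      finally have e: "(f ^^ e) x = x" using ij per[OF x] by simp
      have "0 < e" "e < p" using ij by (auto simp: e_def)
      then have "\<not> p dvd e" by (auto dest: dvd_imp_le)
      then have "coprime e p" using prime_imp_coprime[OF p, of e] by (simp add: coprime_commute)
      then obtain a where a: "[e * a = 1] (mod p)" using cong_solve_coprime_nat[of e p] by auto
      have "(f ^^ (e * n)) x = x" for n
      proof (induction n)
        case (Suc n)
        have "(f ^^ (e * Suc n)) x = (f ^^ e) ((f ^^ (e * n)) x)" by (simp only: mult_Suc_right funpow_add o_apply)
        then show ?case by (simp only: Suc e)
      qed simp
      moreover have "(f ^^ (e * a)) x = (f ^^ (e * a mod p)) x" using funpow_mod_eq[OF per[OF x]] by simp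
      moreover have "e * a mod p = 1" using a prime_gt_1_nat[OF p] by (simp add: cong_def)
      ultimately show False using free[OF x] by simp
    qed
    then have "inj_on (\<lambda>i. (f ^^ i) x) {..<p}"
      by (intro inj_onI) (metis lessThan_iff linorder_neqE_nat)
    then show ?thesis by (simp add: orb_def card_image)
  qed
  have UN: "\<Union>(orb ` X) = X"
  proof
    show "\<Union>(orb ` X) \<subseteq> X" using fX by (auto simp: orb_def)
    show "X \<subseteq> \<Union>(orb ` X)" using orbI[of _ 0] by auto
  qed
  have "p dvd card (\<Union>(orb ` X))"
  proof (rule dvd_partition)
    show "finite (\<Union>(orb ` X))" using fin UN by simp
    show "\<forall>c\<in>orb ` X. p dvd card c" using card_orb by auto
    have sub: "orb y \<subseteq> orb x" if x: "x \<in> X" and y: "y \<in> orb x" for x y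
    proof
      fix z assume "z \<in> orb y"
      then obtain i j where "z = (f ^^ j) y" "y = (f ^^ i) x" using y by (auto simp: orb_def)
      then have "z = (f ^^ (j + i)) x" by (simp add: funpow_add)
      then show "z \<in> orb x" using orbI[OF x] by simp
    qed
    have eq: "orb y = orb x" if x: "x \<in> X" and y: "y \<in> orb x" for x y
    proof
      show "orb y \<subseteq> orb x" by (rule sub[OF x y])
      obtain i where i: "i < p" "y = (f ^^ i) x" using y by (auto simp: orb_def)
      then have "(f ^^ (p - i)) y = (f ^^ (p - i + i)) x" by (simp only: funpow_add o_apply)
      then have "x = (f ^^ (p - i)) y" using i per[OF x] by simp
      moreover have "y \<in> X" using i fX x by simp
      ultimately have "x \<in> orb y" using orbI by metis
      then show "orb x \<subseteq> orb y" using sub \<open>y \<in> X\<close> by blast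
    qed
    show "\<forall>c1\<in>orb ` X. \<forall>c2\<in>orb ` X. c1 \<noteq> c2 \<longrightarrow> c1 \<inter> c2 = {}"
    proof (intro ballI impI)
      fix c1 c2 assume "c1 \<in> orb ` X" "c2 \<in> orb ` X" and ne: "c1 \<noteq> c2"
      then obtain x y where xy: "x \<in> X" "c1 = orb x" "y \<in> X" "c2 = orb y" by auto
      show "c1 \<inter> c2 = {}"
      proof (rule ccontr)
        assume "c1 \<inter> c2 \<noteq> {}"
        then obtain z where "z \<in> orb x" "z \<in> orb y" using xy by auto
        then show False using eq xy ne by metis
      qed
    qed
  qed
  then show ?thesis by (simp add: UN)
qed

text \<open>Nakayama's lemma over the integers localised at p, by elimination of the last variable.\<close>

lemma nakayama_complex:
  fixes d :: nat and w :: "nat \<Rightarrow> complex" and U :: "nat \<Rightarrow> int" and A :: "nat \<Rightarrow> nat \<Rightarrow> int"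
  assumes p: "prime p"
    and "\<And>i. i < d \<Longrightarrow> \<not> int p dvd U i"
    and "\<And>i. i < d \<Longrightarrow> of_int (U i) * w i = of_nat p * (\<Sum>j<d. of_int (A i j) * w j)"
    and "i < d"
  shows "w i = 0"
  using assms(2-4)
proof (induction d arbitrary: U A i)
  case (Suc d)
  \<comment> \<open>The last relation is solved for its diagonal term; its coefficient is congruent
    to \<open>U d\<close> and so stays prime to p.\<close>
  define u where "u = U d - int p * A d d"
  have u: "\<not> int p dvd u" using Suc.prems(1)[of d] by (simp add: u_def dvd_diff_left_iff)
  have ud: "of_int u * w d = of_nat p * (\<Sum>j<d. of_int (A d j) * w j)"
    using Suc.prems(2)[of d] by (simp add: u_def algebra_simps)
  have 0: "w i = 0" if i: "i < d" for i
  proof (rule Suc.IH[where U = "\<lambda>i. u * U i" and A = "\<lambda>i j. u * A i j + int p * A i d * A d j"])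
    fix i assume i: "i < d"
    have "prime (int p)" using p by simp
    then show "\<not> int p dvd u * U i" using u Suc.prems(1)[of i] i by (simp add: prime_dvd_mult_iff)
    have "of_int (U i) * w i = of_nat p * (\<Sum>j<d. of_int (A i j) * w j) + of_nat p * of_int (A i d) * w d"
      using Suc.prems(2)[of i] i by (simp add: algebra_simps)
    then have "of_int u * (of_int (U i) * w i) = of_nat p * (of_int u * (\<Sum>j<d. of_int (A i j) * w j)) + of_nat p * of_int (A i d) * (of_int u * w d)"
      by (simp add: algebra_simps)
    then show "of_int (u * U i) * w i = of_nat p * (\<Sum>j<d. of_int (u * A i j + int p * A i d * A d j) * w j)"
      unfolding ud by (simp add: sum_distrib_left sum.distrib algebra_simps)
  qed (rule i)
  show ?case
  proof (cases "i < d")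
    case False
    then have "i = d" using Suc.prems(3) by simp
    moreover have "of_int u * w d = 0" unfolding ud using 0 by simp
    moreover have "u \<noteq> 0" using u by auto
    ultimately show ?thesis by simp
  qed (rule 0)
qed simp

text \<open>The ring Z[z]. For a root of unity z it is spanned by finitely many powers, which
  supplies the finite system required by \<open>nakayama_complex\<close>.\<close>

inductive_set int_span :: "complex \<Rightarrow> complex set" for z where
  power: "of_int c * z ^ k \<in> int_span z"
| add: "x \<in> int_span z \<Longrightarrow> y \<in> int_span z \<Longrightarrow> x + y \<in> int_span z"

lemma int_span_mult: "x \<in> int_span z \<Longrightarrow> y \<in> int_span z \<Longrightarrow> x * y \<in> int_span z"
proof (induction arbitrary: y rule: int_span.induct)
  case (power c k)
  from power show ?case
  proof (induction rule: int_span.induct)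
    case (power c' k')
    have "of_int c * z ^ k * (of_int c' * z ^ k') = of_int (c * c') * z ^ (k + k')"
      by (simp add: power_add)
    then show ?case by (metis int_span.power)
  qed (simp add: distrib_left int_span.add)
qed (simp add: distrib_right int_span.add)

lemma int_span_int: "of_int c \<in> int_span z"
  using int_span.power[of c z 0] by simp

lemma int_span_sum: "(\<And>i. i \<in> A \<Longrightarrow> f i \<in> int_span z) \<Longrightarrow> (\<Sum>i\<in>A. f i) \<in> int_span z"
  using int_span_int[of 0 z] by (induction A rule: infinite_finite_induct) (auto intro: int_span.add)

lemma int_span_reduce:
  assumes "x \<in> int_span z" and z: "z ^ d = 1" and d: "d > 0"
  shows "\<exists>a :: nat \<Rightarrow> int. x = (\<Sum>j<d. of_int (a j) * z ^ j)"
  using assms(1)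
proof induction
  case (power c k)
  have "z ^ k = z ^ (d * (k div d) + k mod d)" by simp
  also have "\<dots> = z ^ (k mod d)" by (simp only: power_add power_mult z power_one mult_1_left)
  finally have "of_int c * z ^ k = (\<Sum>j\<in>{k mod d}. of_int c * z ^ j)" by simp
  also have "\<dots> = (\<Sum>j<d. of_int (if j = k mod d then c else 0) * z ^ j)"
    using d by (intro sum.mono_neutral_cong_left) auto
  finally show ?case by (rule exI[of _ "\<lambda>j. if j = k mod d then c else 0"])
next
  case (add x y)
  then obtain a b where "x = (\<Sum>j<d. of_int (a j) * z ^ j)" "y = (\<Sum>j<d. of_int (b j) * z ^ j)" by blast
  then have "x + y = (\<Sum>j<d. of_int (a j + b j) * z ^ j)" by (simp add: distrib_right sum.distrib)
  then show ?case by (rule exI[of _ "\<lambda>j. a j + b j"])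
qed

text \<open>An integer in p Z[z] is divisible by p: otherwise multiplication by y expresses n z^i
  through p times the powers of z, and Nakayama's lemma would make all powers vanish, including z^0
  = 1.\<close>

lemma int_span_divisible:
  assumes p: "prime p" and y: "y \<in> int_span z" and z: "z ^ d = 1" and d: "d > 0" and n: "of_int n = of_nat p * y"
  shows "int p dvd n"
proof (rule ccontr)
  assume nd: "\<not> int p dvd n"
  have "\<exists>a :: nat \<Rightarrow> int. y * z ^ i = (\<Sum>j<d. of_int (a j) * z ^ j)" for i
    using int_span.power[of 1 z i] by (intro int_span_reduce[OF int_span_mult[OF y] z d]) simp
  then obtain A :: "nat \<Rightarrow> nat \<Rightarrow> int" where A: "\<And>i. y * z ^ i = (\<Sum>j<d. of_int (A i j) * z ^ j)" by metis
  have "z ^ 0 = 0"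
    by (rule nakayama_complex[OF p, of d "\<lambda>_. n" "\<lambda>i. z ^ i" A]) (use nd n d A in \<open>auto simp flip: A mult.assoc\<close>)
  then show False by simp
qed

text \<open>Gauss's lemma for the multiplier 2: with h = (p - 1) / 2, exactly h - h div 2 of the
  numbers 2, 4, ..., p - 1 exceed h, and the parity of this count depends on p modulo 8.\<close>

lemma Legendre_two:
  assumes p: "prime p" "odd (p :: nat)"
  shows "Legendre 2 (int p) = (if p mod 8 = 1 \<or> p mod 8 = 7 then 1 else - 1)"
proof -
  have p2: "2 < p" using p by (metis even_numeral less_one linorder_neqE_nat not_less_iff_gr_or_eq prime_ge_2_nat le_neq_implies_less)
  interpret GAUSS p 2
  proof
    show "[2 \<noteq> 0] (mod int p)" using p2 by (simp add: cong_0_iff) (metis dvd_imp_le int_dvd_int_iff not_less of_nat_numeral zero_less_numeral)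
  qed (use p p2 in auto)
  define h where "h = (int p - 1) div 2"
  have h: "int p = 2 * h + 1" "h > 0" using p(2) p2 by (auto simp: h_def)
  have "E = (\<lambda>x. x * 2) ` {h div 2<..h}"
  proof -
    have "C = (\<lambda>x. x * 2) ` {0<..h}"
      unfolding C_def B_def A_def h_def[symmetric] image_image using h by (intro image_cong) auto
    then show ?thesis unfolding E_def h_def[symmetric] by auto
  qed
  then have "card E = nat (h - h div 2)"
    by (simp add: card_image inj_on_def)
  then have L: "Legendre 2 (int p) = (- 1) ^ nat (h - h div 2)" using gauss_lemma by simp
  have "p mod 8 = 1 \<or> p mod 8 = 3 \<or> p mod 8 = 5 \<or> p mod 8 = 7" using p(2) by presburger
  moreover have "int p = 8 * int (p div 8) + int (p mod 8)" by presburger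
  ultimately have "(p mod 8 = 1 \<and> h = 4 * int (p div 8)) \<or> (p mod 8 = 3 \<and> h = 4 * int (p div 8) + 1)
      \<or> (p mod 8 = 5 \<and> h = 4 * int (p div 8) + 2) \<or> (p mod 8 = 7 \<and> h = 4 * int (p div 8) + 3)"
    using h by auto
  then have "even (h - h div 2) \<longleftrightarrow> (p mod 8 = 1 \<or> p mod 8 = 7)"
    by (elim disjE conjE) presburger+
  moreover have "even (nat (h - h div 2)) \<longleftrightarrow> even (h - h div 2)" using h by (simp add: even_nat_iff)
  ultimately show ?thesis unfolding L by simp
qed

section \<open>The quadratic character\<close>

text \<open>Euler's criterion determines the symbol modulo q, and the three possible values are
  distinct modulo q because q > 2.\<close>

lemma Legendre_eqI:
  assumes "prime q" "2 < (q :: nat)" "[L = a ^ ((q - 1) div 2)] (mod int q)" "L \<in> {- 1, 0, 1}"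
  shows "Legendre a (int q) = L"
proof -
  have "[Legendre a (int q) = L] (mod int q)"
    using euler_criterion[OF assms(1,2), of a] assms(3) by (metis cong_sym cong_trans)
  then have "int q dvd Legendre a (int q) - L" by (simp add: cong_iff_dvd_diff)
  moreover have "Legendre a (int q) \<in> {- 1, 0, 1}" by (auto simp: Legendre_def)
  then have "\<bar>Legendre a (int q) - L\<bar> < int q" using assms(2,4) by auto
  ultimately show ?thesis using zdvd_not_zless[of "\<bar>Legendre a (int q) - L\<bar>" "int q"] by fastforce
qed

lemma Legendre_range: "Legendre a q \<in> {- 1, 0, 1}"
  by (auto simp: Legendre_def)

lemma Legendre_mult:
  assumes "prime q" "2 < (q :: nat)"
  shows "Legendre (a * b) (int q) = Legendre a (int q) * Legendre b (int q)"
proof (rule Legendre_eqI[OF assms])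
  show "[Legendre a (int q) * Legendre b (int q) = (a * b) ^ ((q - 1) div 2)] (mod int q)"
    unfolding power_mult_distrib by (intro cong_mult euler_criterion assms)
  show "Legendre a (int q) * Legendre b (int q) \<in> {- 1, 0, 1}"
    using Legendre_range[of a "int q"] Legendre_range[of b "int q"] by auto
qed

lemma Legendre_minus_1:
  assumes "prime q" "2 < (q :: nat)"
  shows "Legendre (- 1) (int q) = (- 1) ^ ((q - 1) div 2)"
  by (rule Legendre_eqI[OF assms]) (auto simp: minus_one_power_iff)

lemma Legendre_1:
  assumes "prime q" "2 < (q :: nat)"
  shows "Legendre 1 (int q) = 1"
  by (rule Legendre_eqI[OF assms]) auto

lemma Legendre_cong: "[a = b] (mod q) \<Longrightarrow> Legendre a q = Legendre b q"
  by (auto simp: Legendre_def QuadRes_def cong_def)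

lemma Legendre_nonzero: "\<not> q dvd a \<Longrightarrow> Legendre a q = 1 \<or> Legendre a q = - 1"
  by (auto simp: Legendre_def cong_0_iff)

text \<open>Quadratic reciprocity for the prime discriminant: the sign (-1)^((p-1)/2) absorbs the
  reciprocity sign, and for q = 2 it does not affect membership in the classes 1 and 7 modulo
  8.\<close>

lemma kronecker_prime_dual:
  assumes p: "prime p" "odd p" and q: "prime q" "q \<noteq> p"
  shows "kronecker_prime ((- 1) ^ ((p - 1) div 2) * int p) q = Legendre (int q) (int p)"
proof -
  define h where "h = (p - 1) div 2"
  have p2: "2 < p" using p prime_ge_2_nat[of p] by (cases "p = 2") auto
  show ?thesis
  proof (cases "q = 2")
    case True
    have "\<not> even ((- 1) ^ h * int p)" using p by simp
    moreover define r where "r = p mod 8"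
    have r: "r = 1 \<or> r = 3 \<or> r = 5 \<or> r = 7" using p(2) unfolding r_def by presburger
    have r1: "int p mod 8 = int r" by (simp add: r_def zmod_int)
    then have r2: "(- int p) mod 8 = (- int r) mod 8" by (metis mod_minus_eq)
    have "(int p mod 8 = 1 \<or> int p mod 8 = 7) \<longleftrightarrow> (p mod 8 = 1 \<or> p mod 8 = 7)"
      unfolding r1 r_def[symmetric] using r by (elim disjE) simp_all
    moreover have "((- int p) mod 8 = 1 \<or> (- int p) mod 8 = 7) \<longleftrightarrow> (p mod 8 = 1 \<or> p mod 8 = 7)"
      unfolding r2 r_def[symmetric] using r by (elim disjE) simp_all
    ultimately have "\<not> even ((- 1) ^ h * int p)"
      "(((- 1) ^ h * int p) mod 8 = 1 \<or> ((- 1) ^ h * int p) mod 8 = 7) \<longleftrightarrow> (p mod 8 = 1 \<or> p mod 8 = 7)"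
      by (cases "even h"; simp)+
    then show ?thesis using Legendre_two[OF p] unfolding kronecker_prime_def h_def[symmetric] True by simp
  next
    case False
    then have q2: "2 < q" using prime_ge_2_nat[OF q(1)] by simp
    have "Legendre ((- 1) ^ h) (int q) = (- 1) ^ (h * ((q - 1) div 2))"
      by (cases "even h") (simp_all add: Legendre_1 Legendre_minus_1 q q2 minus_one_power_iff)
    then have "Legendre ((- 1) ^ h * int p) (int q) = (Legendre (int p) (int q) * Legendre (int q) (int p)) * Legendre (int p) (int q)"
      unfolding Legendre_mult[OF q(1) q2] using Quadratic_Reciprocity[of p q] p p2 q q2 by (simp add: h_def)
    also have "\<dots> = Legendre (int q) (int p) * (Legendre (int p) (int q))\<^sup>2" by (simp add: power2_eq_square)
    also have "\<not> int q dvd int p" using primes_dvd_imp_eq[OF q(1) p(1)] q(2) by auto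
    then have "(Legendre (int p) (int q))\<^sup>2 = 1" using Legendre_nonzero[of "int q" "int p"] by auto
    finally show ?thesis using False by (simp add: kronecker_prime_def h_def)
  qed
qed

lemma Legendre_prod_mset:
  assumes "prime q" "2 < (q :: nat)"
  shows "Legendre (int (\<Prod>\<^sub># A)) (int q) = (\<Prod>x\<in>#A. Legendre (int x) (int q))"
  by (induction A) (simp_all add: Legendre_1 Legendre_mult assms)

text \<open>Positive m are handled prime by prime. For negative m the Kronecker symbol contributes -
  1 exactly when the discriminant is negative, that is for odd (p - 1) / 2, and this is the Legendre
  symbol of - 1.\<close>

theorem chi_eq_Legendre:
  assumes p: "prime p" "odd p" and m: "\<not> int p dvd m"
  shows "chi p m = Legendre m (int p)"
proof -
  define h where "h = (p - 1) div 2"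
  have p2: "2 < p" using p prime_ge_2_nat[of p] by (cases "p = 2") auto
  have m0: "m \<noteq> 0" using m by auto
  define n where "n = nat \<bar>m\<bar>"
  have n0: "n \<noteq> 0" using m0 by (simp add: n_def)
  have "(\<Prod>q\<in>#prime_factorization n. kronecker_prime ((- 1) ^ h * int p) q) = (\<Prod>q\<in>#prime_factorization n. Legendre (int q) (int p))"
  proof (intro arg_cong[of _ _ prod_mset] image_mset_cong)
    fix q assume "q \<in># prime_factorization n"
    then have q: "prime q" "q dvd n" by (auto simp: in_prime_factors_iff)
    then have "int q dvd m" by (simp add: n_def)
    then have "q \<noteq> p" using m by auto
    then show "kronecker_prime ((- 1) ^ h * int p) q = Legendre (int q) (int p)"
      unfolding h_def using p q by (intro kronecker_prime_dual) auto
  qed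
  also have "\<dots> = Legendre (int n) (int p)"
    using Legendre_prod_mset[OF p(1) p2, of "prime_factorization n"] n0 by (simp add: prod_mset_prime_factorization_nat)
  finally have L: "(\<Prod>q\<in>#prime_factorization n. kronecker_prime ((- 1) ^ h * int p) q) = Legendre (int n) (int p)" .
  have sgn: "(- 1) ^ h * int p < 0 \<longleftrightarrow> odd h" using p2 by (cases "even h") auto
  show ?thesis
  proof (cases "m < 0")
    case True
    then have "m = - 1 * int n" by (simp add: n_def)
    then have "Legendre m (int p) = (- 1) ^ h * Legendre (int n) (int p)"
      by (simp only: Legendre_mult[OF p(1) p2] Legendre_minus_1[OF p(1) p2] h_def)
    then show ?thesis
      unfolding chi_def kronecker_def h_def[symmetric] n_def[symmetric] L
      using m0 sgn True by (simp add: minus_one_power_iff)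
  next
    case False
    then have "m = int n" by (simp add: n_def)
    then show ?thesis
      unfolding chi_def kronecker_def h_def[symmetric] n_def[symmetric] L
      using m0 False by simp
  qed
qed

section \<open>The symplectic action\<close>

lemma sum_UNIV_Plus:
  fixes f :: "'n::finite + 'm::finite \<Rightarrow> 'a::comm_monoid_add"
  shows "sum f UNIV = (\<Sum>i\<in>UNIV. f (Inl i)) + (\<Sum>i\<in>UNIV. f (Inr i))"
  using sum.Plus[of "UNIV :: 'n set" "UNIV :: 'm set" f] by (simp add: UNIV_Plus_UNIV o_def)

lemma block_mat_simps [simp]:
  "block_A (block_mat A B C D) = A" "block_B (block_mat A B C D) = B"
  "block_C (block_mat A B C D) = C" "block_D (block_mat A B C D) = D"
  by (simp_all add: block_A_def block_B_def block_C_def block_D_def block_mat_def vec_eq_iff)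

lemma block_mat_eqI:
  "block_A M = block_A N \<Longrightarrow> block_B M = block_B N \<Longrightarrow> block_C M = block_C N \<Longrightarrow> block_D M = block_D N \<Longrightarrow> M = N"
  unfolding block_A_def block_B_def block_C_def block_D_def vec_eq_iff
  by (auto intro: sum.induct) (metis (no_types, lifting) sum.exhaust vec_lambda_beta)

lemma block_mult:
  fixes M N :: "'a::semiring_1^('n + 'n)^('n::finite + 'n)"
  shows "block_A (M ** N) = block_A M ** block_A N + block_B M ** block_C N"
    "block_B (M ** N) = block_A M ** block_B N + block_B M ** block_D N"
    "block_C (M ** N) = block_C M ** block_A N + block_D M ** block_C N"
    "block_D (M ** N) = block_C M ** block_B N + block_D M ** block_D N"
  by (simp_all add: block_A_def block_B_def block_C_def block_D_def matrix_matrix_mult_def vec_eq_iff sum_UNIV_Plus)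

lemma block_transpose:
  "block_A (transpose M) = transpose (block_A M)" "block_B (transpose M) = transpose (block_C M)"
  "block_C (transpose M) = transpose (block_B M)" "block_D (transpose M) = transpose (block_D M)"
  by (simp_all add: block_A_def block_B_def block_C_def block_D_def transpose_def vec_eq_iff)

lemma mat_minus_mult: "(- A) ** B = - (A ** (B :: 'a::comm_ring_1^'n^'m::finite))" for A :: "'a::comm_ring_1^'m^'k"
  by (simp add: matrix_matrix_mult_def vec_eq_iff sum_negf)

lemma mat_mult_minus: "A ** (- B) = - (A ** (B :: 'a::comm_ring_1^'n^'m::finite))" for A :: "'a::comm_ring_1^'m^'k"
  by (simp add: matrix_matrix_mult_def vec_eq_iff sum_negf)

lemma mat_add_rdistrib: "(A + B) ** C = A ** C + B ** (C :: 'a::semiring_1^'n^'m::finite)" for A B :: "'a::semiring_1^'m^'k"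
  by (simp add: matrix_matrix_mult_def vec_eq_iff distrib_right sum.distrib)

lemma matrix_inv_both:
  assumes "invertible A"
  shows "A ** matrix_inv A = mat 1" "matrix_inv A ** A = mat 1"
  using someI_ex[OF assms[unfolded invertible_def]] by (auto simp: matrix_inv_def)

lemma Sp_int_iff:
  fixes M :: "int^('n + 'n)^('n::finite + 'n)"
  shows "M \<in> Sp_int \<longleftrightarrow> transpose (block_A M) ** block_C M = transpose (block_C M) ** block_A M \<and>
    transpose (block_A M) ** block_D M = mat 1 + transpose (block_C M) ** block_B M \<and>
    transpose (block_B M) ** block_D M = transpose (block_D M) ** block_B M"
    (is "_ \<longleftrightarrow> ?A \<and> ?B \<and> ?D")
proof -
  define J :: "int^('n + 'n)^('n + 'n)" where "J = block_mat 0 (mat 1) (- mat 1) 0"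
  let ?L = "transpose M ** J ** M"
  have L: "block_A ?L = transpose (block_A M) ** block_C M - transpose (block_C M) ** block_A M"
    "block_B ?L = transpose (block_A M) ** block_D M - transpose (block_C M) ** block_B M"
    "block_C ?L = transpose (block_B M) ** block_C M - transpose (block_D M) ** block_A M"
    "block_D ?L = transpose (block_B M) ** block_D M - transpose (block_D M) ** block_B M"
    by (simp_all add: block_mult block_transpose J_def mat_mult_minus mat_minus_mult)
  \<comment> \<open>The matrix ?L is alternating, so its lower left block carries the same
    information as the upper right one and three relations remain.\<close>
  have T: "block_C ?L = - transpose (block_B ?L)"
    unfolding L by (simp add: matrix_transpose_mul transpose_def vec_eq_iff matrix_matrix_mult_def mult.commute)
  have "M \<in> Sp_int \<longleftrightarrow> ?L = J" by (simp add: Sp_int_def J_def Let_def)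
  also have "\<dots> \<longleftrightarrow> block_A ?L = 0 \<and> block_B ?L = mat 1 \<and> block_C ?L = - mat 1 \<and> block_D ?L = 0"
    unfolding J_def by (auto intro: block_mat_eqI)
  also have "\<dots> \<longleftrightarrow> block_A ?L = 0 \<and> block_B ?L = mat 1 \<and> block_D ?L = 0"
    using T by (auto simp: transpose_mat)
  also have "\<dots> \<longleftrightarrow> ?A \<and> ?B \<and> ?D" unfolding L by (auto simp: algebra_simps)
  finally show ?thesis .
qed

lemma Sp_int_mult:
  assumes "M \<in> Sp_int" "N \<in> Sp_int"
  shows "M ** N \<in> (Sp_int :: (int^('n + 'n)^('n::finite + 'n)) set)"
proof -
  define J :: "int^('n + 'n)^('n + 'n)" where "J = block_mat 0 (mat 1) (- mat 1) 0"
  have "transpose (M ** N) ** J ** (M ** N) = transpose N ** (transpose M ** J ** M) ** N"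
    by (simp add: matrix_transpose_mul matrix_mul_assoc)
  then show ?thesis using assms by (simp add: Sp_int_def J_def Let_def)
qed

lemma int_to_cmat_mult: "int_to_cmat (A ** B) = int_to_cmat A ** int_to_cmat B"
  by (simp add: int_to_cmat_def matrix_matrix_mult_def vec_eq_iff)

lemma int_to_cmat_add: "int_to_cmat (A + B) = int_to_cmat A + int_to_cmat B"
  by (simp add: int_to_cmat_def vec_eq_iff)

lemma int_to_cmat_transpose: "int_to_cmat (transpose A) = transpose (int_to_cmat A)"
  by (simp add: int_to_cmat_def transpose_def vec_eq_iff)

lemma int_to_cmat_mat: "int_to_cmat (mat c) = mat (of_int c)"
  by (simp add: int_to_cmat_def mat_def vec_eq_iff)

definition cnj_mat :: "complex^'n^'n::finite \<Rightarrow> complex^'n^'n" where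
  "cnj_mat A = (\<chi> i k. cnj (A $ i $ k))"

lemma cnj_mat_mult: "cnj_mat (A ** B) = cnj_mat A ** cnj_mat B"
  by (simp add: cnj_mat_def matrix_matrix_mult_def vec_eq_iff)

lemma cnj_mat_add: "cnj_mat (A + B) = cnj_mat A + cnj_mat B"
  by (simp add: cnj_mat_def vec_eq_iff)

lemma cnj_mat_int: "cnj_mat (int_to_cmat A) = int_to_cmat A"
  by (simp add: cnj_mat_def int_to_cmat_def vec_eq_iff)

definition herm :: "complex^'n::finite \<Rightarrow> complex^'n \<Rightarrow> complex" where
  "herm x y = (\<Sum>i\<in>UNIV. cnj (x $ i) * y $ i)"

lemma herm_matrix: "herm (A *v x) y = herm x (transpose (cnj_mat A) *v y)"
proof -
  have "herm (A *v x) y = (\<Sum>i\<in>UNIV. \<Sum>j\<in>UNIV. cnj (A $ i $ j) * cnj (x $ j) * y $ i)"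
    by (simp add: herm_def matrix_vector_mult_def sum_distrib_right)
  also have "\<dots> = (\<Sum>j\<in>UNIV. \<Sum>i\<in>UNIV. cnj (A $ i $ j) * cnj (x $ j) * y $ i)" by (rule sum.swap)
  also have "\<dots> = herm x (transpose (cnj_mat A) *v y)"
    by (simp add: herm_def matrix_vector_mult_def transpose_def cnj_mat_def sum_distrib_left mult_ac)
  finally show ?thesis .
qed

lemma cnj_herm: "cnj (herm x y) = herm y x"
  by (simp add: herm_def mult.commute)

definition im_mat :: "complex^'n^'n::finite \<Rightarrow> real^'n^'n" where
  "im_mat Z = (\<chi> i k. Im (Z $ i $ k))"

lemma siegel_upperI:
  "transpose Z = Z \<Longrightarrow> (\<And>x. x \<noteq> 0 \<Longrightarrow> x \<bullet> (im_mat Z *v x) > 0) \<Longrightarrow> Z \<in> siegel_upper"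
  by (simp add: siegel_upper_def im_mat_def)

lemma siegel_upperD:
  fixes Z :: "complex^'n^'n::finite"
  assumes "Z \<in> siegel_upper"
  shows "transpose Z = Z" "Z $ i $ k = Z $ k $ i" "x \<noteq> 0 \<Longrightarrow> x \<bullet> (im_mat Z *v x) > 0"
  using assms by (auto simp: siegel_upper_def im_mat_def transpose_def vec_eq_iff)

lemma im_mat_nonneg: "Z \<in> siegel_upper \<Longrightarrow> x \<bullet> (im_mat Z *v x) \<ge> 0"
  using siegel_upperD(3)[of Z x] by (cases "x = 0") auto

lemma herm_diff_cnj:
  assumes "Z \<in> siegel_upper"
  shows "herm x ((Z - cnj_mat Z) *v x) = 2 * \<i> * of_real ((\<chi> i. Re (x $ i)) \<bullet> (im_mat Z *v (\<chi> i. Re (x $ i)))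
    + (\<chi> i. Im (x $ i)) \<bullet> (im_mat Z *v (\<chi> i. Im (x $ i))))"
proof -
  define Y where "Y i k = Im (Z $ i $ k)" for i k
  have Y: "Y i k = Y k i" for i k using siegel_upperD(2)[OF assms] by (simp add: Y_def)
  have "(Z - cnj_mat Z) $ i $ k = 2 * \<i> * of_real (Y i k)" for i k
    by (simp add: cnj_mat_def Y_def complex_diff_cnj)
  then have "herm x ((Z - cnj_mat Z) *v x) = 2 * \<i> * (\<Sum>i\<in>UNIV. \<Sum>k\<in>UNIV. cnj (x $ i) * x $ k * of_real (Y i k))"
    by (simp add: herm_def matrix_vector_mult_def sum_distrib_left mult_ac del: vector_minus_component)
  also have "(\<Sum>i\<in>UNIV. \<Sum>k\<in>UNIV. cnj (x $ i) * x $ k * of_real (Y i k)) =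
     of_real (\<Sum>i\<in>UNIV. \<Sum>k\<in>UNIV. (Re (x $ i) * Re (x $ k) + Im (x $ i) * Im (x $ k)) * Y i k)
     + \<i> * of_real (\<Sum>i\<in>UNIV. \<Sum>k\<in>UNIV. (Re (x $ i) * Im (x $ k) - Im (x $ i) * Re (x $ k)) * Y i k)"
    by (simp add: complex_eq_iff)
  also have "(\<Sum>i\<in>UNIV. \<Sum>k\<in>UNIV. (Re (x $ i) * Im (x $ k) - Im (x $ i) * Re (x $ k)) * Y i k) = 0"
  proof -
    have "(\<Sum>i\<in>UNIV. \<Sum>k\<in>UNIV. Re (x $ i) * Im (x $ k) * Y i k) = (\<Sum>i\<in>UNIV. \<Sum>k\<in>UNIV. Im (x $ i) * Re (x $ k) * Y i k)"
      by (subst sum.swap) (simp add: mult.commute Y[of _ ])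
    then show ?thesis by (simp add: left_diff_distrib sum_subtractf)
  qed
  also have "(\<Sum>i\<in>UNIV. \<Sum>k\<in>UNIV. (Re (x $ i) * Re (x $ k) + Im (x $ i) * Im (x $ k)) * Y i k)
     = (\<chi> i. Re (x $ i)) \<bullet> (im_mat Z *v (\<chi> i. Re (x $ i))) + (\<chi> i. Im (x $ i)) \<bullet> (im_mat Z *v (\<chi> i. Im (x $ i)))"
    by (simp add: inner_vec_def matrix_vector_mult_def im_mat_def Y_def sum_distrib_left distrib_left distrib_right sum.distrib mult_ac)
  finally show ?thesis by simp
qed

definition num_mat :: "int^('n + 'n)^('n::finite + 'n) \<Rightarrow> complex^'n^'n \<Rightarrow> complex^'n^'n" where
  "num_mat M Z = int_to_cmat (block_A M) ** Z + int_to_cmat (block_B M)"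

definition den_mat :: "int^('n + 'n)^('n::finite + 'n) \<Rightarrow> complex^'n^'n \<Rightarrow> complex^'n^'n" where
  "den_mat M Z = int_to_cmat (block_C M) ** Z + int_to_cmat (block_D M)"

definition act_mat :: "int^('n + 'n)^('n::finite + 'n) \<Rightarrow> complex^'n^'n \<Rightarrow> complex^'n^'n" where
  "act_mat M Z = num_mat M Z ** matrix_inv (den_mat M Z)"

lemma slash_alt: "slash k M f Z = det (den_mat M Z) powi (- k) * f (act_mat M Z)"
  by (simp add: slash_def num_mat_def den_mat_def act_mat_def Let_def)

lemma transpose_add: "transpose (A + B) = transpose A + transpose B"
  by (simp add: transpose_def vec_eq_iff)

text \<open>Independent Z and Z' cover two uses: Z' = Z gives the symmetry of the image, and Z' the
  conjugate of Z gives the positivity of its imaginary part.\<close>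

lemma symplectic_relation:
  assumes M: "M \<in> Sp_int" and Z: "transpose Z = Z" and Z': "transpose Z' = Z'"
  shows "transpose (den_mat M Z') ** num_mat M Z - transpose (num_mat M Z') ** den_mat M Z = Z - Z'"
proof -
  define A B C D where "A = int_to_cmat (block_A M)" and "B = int_to_cmat (block_B M)"
    and "C = int_to_cmat (block_C M)" and "D = int_to_cmat (block_D M)"
  have 1: "transpose A ** C = transpose C ** A" "transpose A ** D = mat 1 + transpose C ** B"
    "transpose B ** D = transpose D ** B"
    using M unfolding Sp_int_iff A_def B_def C_def D_def
    by (simp_all flip: int_to_cmat_transpose int_to_cmat_mult) (simp add: int_to_cmat_add int_to_cmat_mat)
  have 2: "transpose D ** A = mat 1 + transpose B ** C"
    using arg_cong[OF 1(2), of transpose] by (simp add: matrix_transpose_mul transpose_add transpose_mat)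
  have "transpose (C ** Z' + D) ** (A ** Z + B) - transpose (A ** Z' + B) ** (C ** Z + D)
      = Z' ** (transpose C ** A) ** Z + Z' ** (transpose C ** B) + (transpose D ** A) ** Z + transpose D ** B
        - (Z' ** (transpose A ** C) ** Z + Z' ** (transpose A ** D) + (transpose B ** C) ** Z + transpose B ** D)"
    by (simp add: transpose_add matrix_transpose_mul Z' matrix_add_ldistrib mat_add_rdistrib matrix_mul_assoc)
  also have "\<dots> = Z - Z'"
    unfolding 1 2 by (simp add: matrix_add_ldistrib mat_add_rdistrib)
  finally show ?thesis by (simp add: den_mat_def num_mat_def A_def B_def C_def D_def)
qed

lemma cnj_den_num:
  "cnj_mat (den_mat M Z) = den_mat M (cnj_mat Z)" "cnj_mat (num_mat M Z) = num_mat M (cnj_mat Z)"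
  by (simp_all add: den_mat_def num_mat_def cnj_mat_add cnj_mat_mult cnj_mat_int)

lemma herm_den_num:
  assumes M: "M \<in> Sp_int" and Z: "Z \<in> siegel_upper"
  shows "herm (den_mat M Z *v x) (num_mat M Z *v x) - herm (num_mat M Z *v x) (den_mat M Z *v x) = herm x ((Z - cnj_mat Z) *v x)"
proof -
  have t: "transpose Z = Z" by (rule siegel_upperD(1)[OF Z])
  then have t': "transpose (cnj_mat Z) = cnj_mat Z"
    by (simp add: cnj_mat_def transpose_def vec_eq_iff)
  have h: "herm x u - herm x v = herm x (u - v)" for u v by (simp add: herm_def sum_subtractf right_diff_distrib)
  show ?thesis
    unfolding herm_matrix cnj_den_num h symplectic_relation[OF M t t', symmetric]
    by (simp add: matrix_vector_mul_assoc matrix_vector_mult_diff_rdistrib)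
qed

lemma im_part_pos:
  assumes Z: "Z \<in> siegel_upper" and x: "(x :: complex^'n::finite) \<noteq> 0"
  shows "(\<chi> i. Re (x $ i)) \<bullet> (im_mat Z *v (\<chi> i. Re (x $ i))) + (\<chi> i. Im (x $ i)) \<bullet> (im_mat Z *v (\<chi> i. Im (x $ i))) > 0"
proof -
  have "(\<chi> i. Re (x $ i)) \<noteq> 0 \<or> (\<chi> i. Im (x $ i)) \<noteq> 0"
    using x by (auto simp: vec_eq_iff complex_eq_iff)
  then show ?thesis
    using siegel_upperD(3)[OF Z] im_mat_nonneg[OF Z] by (meson add_nonneg_pos add_pos_nonneg)
qed

text \<open>A vector x in the kernel of C Z + D would annihilate the hermitian form of Z minus its
  conjugate, which is definite.\<close>

lemma det_den_mat_nonzero: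
  assumes M: "M \<in> Sp_int" and Z: "Z \<in> siegel_upper"
  shows "det (den_mat M Z) \<noteq> 0"
proof -
  have "x = 0" if "den_mat M Z *v x = 0" for x
  proof (rule ccontr)
    assume x: "x \<noteq> 0"
    have "herm x ((Z - cnj_mat Z) *v x) = 0"
      using herm_den_num[OF M Z, of x] that by (simp add: herm_def)
    then show False using im_part_pos[OF Z x]
      unfolding herm_diff_cnj[OF Z] by (simp only: mult_eq_0_iff of_real_eq_0_iff) auto
  qed
  then show ?thesis
    using matrix_left_invertible_ker[of "den_mat M Z"] by (auto simp: invertible_det_nz[symmetric] invertible_left_inverse)
qed

lemma matrix_inv_eqI:
  fixes Q :: "complex^'n^'n::finite"
  assumes "det Q \<noteq> 0" "W ** Q = P"
  shows "P ** matrix_inv Q = W"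
proof -
  have "P ** matrix_inv Q = W ** (Q ** matrix_inv Q)" by (simp add: assms(2)[symmetric] matrix_mul_assoc)
  also have "Q ** matrix_inv Q = mat 1" using assms(1) by (intro matrix_inv_both(1)) (simp add: invertible_det_nz)
  finally show ?thesis by simp
qed

lemma act_mat_den:
  assumes M: "M \<in> Sp_int" and Z: "Z \<in> siegel_upper"
  shows "act_mat M Z ** den_mat M Z = num_mat M Z"
proof -
  have "matrix_inv (den_mat M Z) ** den_mat M Z = mat 1"
    using det_den_mat_nonzero[OF M Z] by (intro matrix_inv_both(2)) (simp add: invertible_det_nz)
  then show ?thesis by (simp add: act_mat_def matrix_mul_assoc[symmetric])
qed

lemma act_mat_siegel_upper:
  assumes M: "M \<in> Sp_int" and Z: "Z \<in> siegel_upper"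
  shows "act_mat M Z \<in> siegel_upper"
proof (rule siegel_upperI)
  define P Q W where "P = num_mat M Z" and "Q = den_mat M Z" and "W = act_mat M Z"
  have WQ: "W ** Q = P" using act_mat_den[OF M Z] by (simp add: P_def Q_def W_def)
  have Q: "invertible Q" using det_den_mat_nonzero[OF M Z] by (simp add: Q_def invertible_det_nz)
  define R where "R = matrix_inv Q"
  have QR: "Q ** R = mat 1" "R ** Q = mat 1" using Q by (simp_all add: R_def matrix_inv_both(2) matrix_inv_both(1))
  have WR: "W = P ** R" by (simp add: W_def act_mat_def P_def Q_def R_def)
  have "transpose Q ** P = transpose P ** Q"
    using symplectic_relation[OF M siegel_upperD(1)[OF Z] siegel_upperD(1)[OF Z]] by (simp add: P_def Q_def)
  then have "transpose R ** (transpose Q ** P) ** R = transpose R ** (transpose P ** Q) ** R" by simp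
  moreover have "transpose R ** (transpose Q ** P) ** R = W"
    by (simp add: matrix_mul_assoc WR flip: matrix_transpose_mul) (simp add: QR transpose_mat)
  moreover have "transpose R ** (transpose P ** Q) ** R = transpose R ** transpose P ** (Q ** R)"
    by (simp only: matrix_mul_assoc)
  then have "transpose R ** (transpose P ** Q) ** R = transpose W"
    by (simp add: QR WR matrix_transpose_mul)
  ultimately show "transpose (act_mat M Z) = act_mat M Z" by (simp add: W_def)
  fix v :: "real^'a" assume v: "v \<noteq> 0"
  define u :: "complex^'a" where "u = (\<chi> i. of_real (v $ i))"
  \<comment> \<open>Choosing x as the preimage of the real vector u under C Z + D turns the left
    side of \<open>herm_den_num\<close> into the imaginary part of W evaluated at v.\<close>
  define x where "x = R *v u"
  have Qx: "Q *v x = u" by (simp add: x_def matrix_vector_mul_assoc QR)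
  have x0: "x \<noteq> 0"
  proof
    assume "x = 0"
    then have "u = 0" using Qx by simp
    then show False using v by (simp add: u_def vec_eq_iff)
  qed
  have Px: "P *v x = W *v u" by (simp add: x_def matrix_vector_mul_assoc WR)
  have "herm u (W *v u) - cnj (herm u (W *v u)) = herm x ((Z - cnj_mat Z) *v x)"
    using herm_den_num[OF M Z, of x] by (simp add: P_def[symmetric] Q_def[symmetric] Qx Px cnj_herm)
  then have "Im (herm u (W *v u)) = (\<chi> i. Re (x $ i)) \<bullet> (im_mat Z *v (\<chi> i. Re (x $ i))) + (\<chi> i. Im (x $ i)) \<bullet> (im_mat Z *v (\<chi> i. Im (x $ i)))"
    unfolding herm_diff_cnj[OF Z] complex_diff_cnj by (simp add: complex_eq_iff)
  moreover have "Im (herm u (W *v u)) = v \<bullet> (im_mat W *v v)"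
    by (simp add: herm_def u_def matrix_vector_mult_def inner_vec_def im_mat_def)
  ultimately show "v \<bullet> (im_mat (act_mat M Z) *v v) > 0" using im_part_pos[OF Z x0] by (simp add: W_def)
qed

lemma den_num_mult:
  assumes N: "N \<in> Sp_int" and Z: "Z \<in> siegel_upper"
  shows "den_mat (M ** N) Z = den_mat M (act_mat N Z) ** den_mat N Z"
    and "num_mat (M ** N) Z = num_mat M (act_mat N Z) ** den_mat N Z"
proof -
  have 1: "X ** act_mat N Z ** den_mat N Z = X ** num_mat N Z" for X
    by (simp add: act_mat_den[OF N Z] flip: matrix_mul_assoc)
  have "den_mat M (act_mat N Z) ** den_mat N Z = int_to_cmat (block_C M) ** num_mat N Z + int_to_cmat (block_D M) ** den_mat N Z"
    unfolding den_mat_def[of M] mat_add_rdistrib 1 ..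
  then show "den_mat (M ** N) Z = den_mat M (act_mat N Z) ** den_mat N Z"
    by (simp add: den_mat_def num_mat_def block_mult int_to_cmat_add int_to_cmat_mult matrix_add_ldistrib mat_add_rdistrib matrix_mul_assoc add_ac)
  have "num_mat M (act_mat N Z) ** den_mat N Z = int_to_cmat (block_A M) ** num_mat N Z + int_to_cmat (block_B M) ** den_mat N Z"
    unfolding num_mat_def[of M] mat_add_rdistrib 1 ..
  then show "num_mat (M ** N) Z = num_mat M (act_mat N Z) ** den_mat N Z"
    by (simp add: den_mat_def num_mat_def block_mult int_to_cmat_add int_to_cmat_mult matrix_add_ldistrib mat_add_rdistrib matrix_mul_assoc add_ac)
qed

lemma act_mat_mult:
  assumes M: "M \<in> Sp_int" and N: "N \<in> Sp_int" and Z: "Z \<in> siegel_upper"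
  shows "act_mat (M ** N) Z = act_mat M (act_mat N Z)"
  unfolding act_mat_def[of "M ** N"]
proof (rule matrix_inv_eqI)
  show "det (den_mat (M ** N) Z) \<noteq> 0" by (intro det_den_mat_nonzero Sp_int_mult assms)
  show "act_mat M (act_mat N Z) ** den_mat (M ** N) Z = num_mat (M ** N) Z"
    by (simp add: den_num_mult[OF N Z] matrix_mul_assoc act_mat_den[OF M act_mat_siegel_upper[OF N Z]])
qed

lemma slash_mult:
  assumes M: "M \<in> Sp_int" and N: "N \<in> Sp_int" and Z: "Z \<in> siegel_upper"
  shows "slash k (M ** N) f Z = det (den_mat N Z) powi (- k) * slash k M f (act_mat N Z)"
  by (simp add: slash_alt den_num_mult[OF N Z] act_mat_mult[OF assms] det_mul power_int_mult_distrib)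

section \<open>Generators of the congruence subgroup\<close>

text \<open>The elementary matrix 1 + m E_kl above and its inverse transpose below. On the left it
  adds m times the upper row l to the upper row k and subtracts m times the lower row k from the
  lower row l.\<close>

definition levi_mat :: "'n::finite \<Rightarrow> 'n \<Rightarrow> int \<Rightarrow> int^('n + 'n)^('n + 'n)" where
  "levi_mat k l m = block_mat (\<chi> i j. (if i = j then 1 else 0) + (if i = k then if j = l then m else 0 else 0)) 0 0
     (\<chi> i j. (if i = j then 1 else 0) - (if i = l then if j = k then m else 0 else 0))"

text \<open>The group SL_2 acting in the k-th symplectic coordinate plane.\<close>

definition emb_mat :: "'n::finite \<Rightarrow> int \<Rightarrow> int \<Rightarrow> int \<Rightarrow> int \<Rightarrow> int^('n + 'n)^('n + 'n)" where
  "emb_mat k a b c d = block_mat (diag_mat (\<lambda>i. if i = k then a else 1)) (diag_mat (\<lambda>i. if i = k then b else 0))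
     (diag_mat (\<lambda>i. if i = k then c else 0)) (diag_mat (\<lambda>i. if i = k then d else 1))"

definition trans_mat :: "int^'n^'n::finite \<Rightarrow> int^('n + 'n)^('n + 'n)" where
  "trans_mat B = block_mat (mat 1) B 0 (mat 1)"

lemma block_mat_row:
  "(block_mat A B C D ** N) $ Inl i $ t = (\<Sum>j\<in>UNIV. A $ i $ j * N $ Inl j $ t) + (\<Sum>j\<in>UNIV. B $ i $ j * N $ Inr j $ t)"
  "(block_mat A B C D ** N) $ Inr i $ t = (\<Sum>j\<in>UNIV. C $ i $ j * N $ Inl j $ t) + (\<Sum>j\<in>UNIV. D $ i $ j * N $ Inr j $ t)"
  by (simp_all add: matrix_matrix_mult_def sum_UNIV_Plus block_mat_def)

lemma levi_row:
  "(levi_mat k l m ** N) $ Inl i $ t = N $ Inl i $ t + (if i = k then m * N $ Inl l $ t else 0)"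
  "(levi_mat k l m ** N) $ Inr i $ t = N $ Inr i $ t - (if i = l then m * N $ Inr k $ t else 0)"
  unfolding levi_mat_def block_mat_row
  by (cases "i = k"; simp add: distrib_right sum.distrib if_distrib[where f = "\<lambda>x. x * _"] cong: if_cong)
     (cases "i = l"; simp add: left_diff_distrib sum_subtractf if_distrib[where f = "\<lambda>x. x * _"] cong: if_cong)

lemma emb_row:
  "(emb_mat k a b c d ** N) $ Inl i $ t = (if i = k then a * N $ Inl k $ t + b * N $ Inr k $ t else N $ Inl i $ t)"
  "(emb_mat k a b c d ** N) $ Inr i $ t = (if i = k then c * N $ Inl k $ t + d * N $ Inr k $ t else N $ Inr i $ t)"
  unfolding emb_mat_def block_mat_row diag_mat_def
  by (simp_all add: if_distrib[where f = "\<lambda>x. x * _"] cong: if_cong)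

lemma mat_rows_eqI: "(\<And>i t. M $ Inl i $ t = N $ Inl i $ t) \<Longrightarrow> (\<And>i t. M $ Inr i $ t = N $ Inr i $ t) \<Longrightarrow> M = N"
  unfolding vec_eq_iff by (metis sum.exhaust)

lemma levi_inverse: "k \<noteq> l \<Longrightarrow> levi_mat k l (- m) ** (levi_mat k l m ** N) = N"
  by (rule mat_rows_eqI) (simp_all add: levi_row)

lemma emb_inverse:
  assumes "a * d - b * c = 1"
  shows "emb_mat k d (- b) (- c) a ** (emb_mat k a b c d ** N) = N"
proof (rule mat_rows_eqI)
  fix i t
  have "d * (a * x + b * y) + - b * (c * x + d * y) = (a * d - b * c) * x" for x y :: int by (simp add: algebra_simps)
  moreover have "- c * (a * x + b * y) + a * (c * x + d * y) = (a * d - b * c) * y" for x y :: int by (simp add: algebra_simps)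
  ultimately show "(emb_mat k d (- b) (- c) a ** (emb_mat k a b c d ** N)) $ Inl i $ t = N $ Inl i $ t"
    "(emb_mat k d (- b) (- c) a ** (emb_mat k a b c d ** N)) $ Inr i $ t = N $ Inr i $ t"
    using assms by (simp_all add: emb_row)
qed

lemma diag_mat_mult: "diag_mat f ** diag_mat g = diag_mat (\<lambda>i. f i * (g i :: 'a::comm_ring_1))"
  by (simp add: diag_mat_def matrix_matrix_mult_def vec_eq_iff if_distrib[where f = "\<lambda>x. x * _"] cong: if_cong)

lemma transpose_diag_mat: "transpose (diag_mat f) = diag_mat f"
  by (auto simp: diag_mat_def transpose_def vec_eq_iff)

lemma emb_Sp:
  assumes "a * d - b * c = 1"
  shows "emb_mat k a b c d \<in> Sp_int"
proof -
  have "mat 1 + diag_mat (\<lambda>i. (if i = k then c else 0) * (if i = k then b else 0)) = diag_mat (\<lambda>i. (if i = k then a else 1) * (if i = k then d else 1))"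
    using assms by (auto simp: diag_mat_def mat_def vec_eq_iff algebra_simps)
  then show ?thesis
    unfolding Sp_int_iff emb_mat_def block_mat_simps transpose_diag_mat diag_mat_mult by (simp add: mult.commute cong: if_cong)
qed

lemma transpose_zero: "transpose 0 = (0 :: 'a::zero^'n^'m)"
  by (simp add: transpose_def vec_eq_iff)

lemma zero_mat_mult: "0 ** A = (0 :: 'a::semiring_1^'n^'k)" "B ** 0 = (0 :: 'a::semiring_1^'n^'k)"
  for A :: "'a::semiring_1^'n^'m::finite" and B :: "'a^'m^'k"
  by (simp_all add: matrix_matrix_mult_def vec_eq_iff)

lemma levi_Sp:
  assumes "k \<noteq> l"
  shows "levi_mat k l m \<in> Sp_int"
proof -
  define A D where "A = (\<chi> i j. (if i = j then 1 else 0) + (if i = k then if j = l then m else 0 else 0))"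
    and "D = (\<chi> i j. (if i = j then 1 else 0) - (if i = l then if j = k then m else 0 else 0))"
  have "(transpose A ** D) $ i $ j = (mat 1 :: int^'a^'a) $ i $ j" for i j
  proof -
    have "(transpose A ** D) $ i $ j = (\<Sum>x\<in>UNIV. ((if x = i then 1 else 0) + (if x = k then if i = l then m else 0 else 0)) * D $ x $ j)"
      by (simp add: matrix_matrix_mult_def transpose_def A_def)
    also have "\<dots> = D $ i $ j + (if i = l then m else 0) * D $ k $ j"
      by (simp add: distrib_right sum.distrib if_distrib[where f = "\<lambda>x. x * _"] cong: if_cong)
    also have "\<dots> = mat 1 $ i $ j"
      using assms by (auto simp: D_def mat_def)
    finally show ?thesis .
  qed
  then have "transpose A ** D = mat 1" by (simp add: vec_eq_iff)
  then show ?thesis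
    unfolding Sp_int_iff levi_mat_def block_mat_simps A_def[symmetric] D_def[symmetric] by (simp add: transpose_zero zero_mat_mult)
qed

lemma trans_Sp: "transpose B = B \<Longrightarrow> trans_mat B \<in> Sp_int"
  by (simp add: Sp_int_iff trans_mat_def transpose_mat transpose_zero zero_mat_mult)

text \<open>Left multiplications by generators that leave the normalised columns in F intact. For
  \<open>levi_mat\<close> it suffices that l lies outside F: on those columns the upper row l and
  all lower rows vanish.\<close>

inductive_set reach :: "nat \<Rightarrow> 'n::finite set \<Rightarrow> int^('n + 'n)^('n + 'n) \<Rightarrow> (int^('n + 'n)^('n + 'n)) set" for p F M where
  base: "M \<in> reach p F M"
| levi: "N \<in> reach p F M \<Longrightarrow> l \<notin> F \<Longrightarrow> k \<noteq> l \<Longrightarrow> levi_mat k l m ** N \<in> reach p F M"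
| emb: "N \<in> reach p F M \<Longrightarrow> k \<notin> F \<Longrightarrow> a * d - b * c = 1 \<Longrightarrow> int p dvd c \<Longrightarrow> emb_mat k a b c d ** N \<in> reach p F M"

definition fixed_cols :: "'n::finite set \<Rightarrow> int^('n + 'n)^('n + 'n) \<Rightarrow> bool" where
  "fixed_cols F M \<longleftrightarrow> (\<forall>i\<in>F. \<forall>k. M $ Inl k $ Inl i = (if k = i then 1 else 0) \<and> M $ Inr k $ Inl i = 0)"

lemma Gamma0_alt: "M \<in> Gamma0 p \<longleftrightarrow> M \<in> Sp_int \<and> (\<forall>i k. int p dvd M $ Inr i $ Inl k)"
  by (simp add: Gamma0_def block_C_def)

text \<open>The set S stands for any property that is multiplicative and holds for the generators;
  later it is the set of matrices under which a theta series transforms correctly. Closure under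
  products is enough because inverses of generators are again generators.\<close>

locale generators =
  fixes p :: nat and S :: "(int^('n + 'n)^('n::finite + 'n)) set"
  assumes prime: "prime p"
    and trans: "\<And>B. transpose B = B \<Longrightarrow> trans_mat B \<in> S"
    and levi: "\<And>k l m. k \<noteq> l \<Longrightarrow> levi_mat k l m \<in> S"
    and emb: "\<And>k a b c d. a * d - b * c = 1 \<Longrightarrow> int p dvd c \<Longrightarrow> emb_mat k a b c d \<in> S"
    and mult: "\<And>M N. M \<in> S \<Longrightarrow> N \<in> S \<Longrightarrow> M ** N \<in> S"
begin

lemma prime_int: "prime (int p)"
  using prime by simp

lemma reach_props:
  assumes "N \<in> reach p F M" "M \<in> Gamma0 p" "fixed_cols F M"
  shows "N \<in> Gamma0 p \<and> fixed_cols F N \<and> (N \<in> S \<longrightarrow> M \<in> S)"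
  using assms
proof (induction rule: reach.induct)
  case base
  then show ?case by simp
next
  case (levi N l k m)
  then have N: "N \<in> Gamma0 p" "fixed_cols F N" "N \<in> S \<Longrightarrow> M \<in> S" by auto
  have "levi_mat k l m ** N \<in> Gamma0 p"
    using N(1) levi_Sp[OF levi.hyps(3)] by (auto simp: Gamma0_alt Sp_int_mult levi_row)
  moreover have "fixed_cols F (levi_mat k l m ** N)"
    using N(2) levi.hyps(2) by (auto simp: fixed_cols_def levi_row)
  moreover have "M \<in> S" if "levi_mat k l m ** N \<in> S"
    using N(3) mult[OF generators.levi[OF generators_axioms levi.hyps(3), of "- m"] that] by (simp add: levi_inverse[OF levi.hyps(3)])
  ultimately show ?case by blast
next
  case (emb N k a d b c)
  then have N: "N \<in> Gamma0 p" "fixed_cols F N" "N \<in> S \<Longrightarrow> M \<in> S" by auto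
  have "emb_mat k a b c d ** N \<in> Gamma0 p"
    using N(1) emb_Sp[OF emb.hyps(3), of k] emb.hyps(4) by (auto simp: Gamma0_alt Sp_int_mult emb_row)
  moreover have "fixed_cols F (emb_mat k a b c d ** N)"
    using N(2) emb.hyps(2) by (auto simp: fixed_cols_def emb_row)
  moreover have "emb_mat k d (- b) (- c) a \<in> S"
    by (rule generators.emb[OF generators_axioms]) (use emb.hyps in \<open>auto simp: mult.commute\<close>)
  then have "M \<in> S" if "emb_mat k a b c d ** N \<in> S"
    using N(3) mult[OF _ that] by (metis emb_inverse[OF emb.hyps(3)])
  ultimately show ?case by blast
qed

text \<open>The column i is a unit vector, so its symplectic pairing with any other column reads off
  the lower entry i of that column.\<close>

lemma fixed_col_zero:
  assumes N: "N \<in> Sp_int" and F: "fixed_cols F N" and i: "i \<in> F"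
  shows "N $ Inr i $ Inl r = 0" "i \<noteq> r \<Longrightarrow> N $ Inr i $ Inr r = 0"
proof -
  have f: "N $ Inl k $ Inl i = (if k = i then 1 else 0)" "N $ Inr k $ Inl i = 0" for k
    using F i by (auto simp: fixed_cols_def)
  have "(transpose (block_A N) ** block_C N) $ i $ r = (transpose (block_C N) ** block_A N) $ i $ r"
    using N unfolding Sp_int_iff by simp
  then show "N $ Inr i $ Inl r = 0"
    by (simp add: matrix_matrix_mult_def transpose_def block_A_def block_C_def f if_distrib[where f = "\<lambda>x. x * _"] cong: if_cong)
  have "(transpose (block_A N) ** block_D N) $ i $ r = (mat 1 + transpose (block_C N) ** block_B N) $ i $ r"
    using N unfolding Sp_int_iff by simp
  then show "i \<noteq> r \<Longrightarrow> N $ Inr i $ Inr r = 0"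
    by (simp add: matrix_matrix_mult_def transpose_def block_A_def block_C_def block_D_def mat_def f if_distrib[where f = "\<lambda>x. x * _"] cong: if_cong)
qed

text \<open>The columns Inl r and Inr r have symplectic pairing 1. By \<open>fixed_col_zero\<close>
  the rows in F contribute nothing, so a common divisor of the other rows divides 1.\<close>

lemma col_primitive:
  assumes N: "N \<in> Sp_int" and F: "fixed_cols F N" and r: "r \<notin> F"
    and g: "\<And>k. k \<notin> F \<Longrightarrow> g dvd N $ Inl k $ Inl r \<and> g dvd N $ Inr k $ Inl r"
  shows "g dvd 1"
proof -
  have "(transpose (block_A N) ** block_D N) $ r $ r = (mat 1 + transpose (block_C N) ** block_B N) $ r $ r"
    using N unfolding Sp_int_iff by simp
  then have eq: "1 = (\<Sum>k\<in>UNIV. N $ Inl k $ Inl r * N $ Inr k $ Inr r) - (\<Sum>k\<in>UNIV. N $ Inr k $ Inl r * N $ Inl k $ Inr r)"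
    by (simp add: matrix_matrix_mult_def transpose_def block_A_def block_B_def block_C_def block_D_def mat_def)
  have a: "g dvd (\<Sum>k\<in>UNIV. N $ Inl k $ Inl r * N $ Inr k $ Inr r)"
  proof (rule dvd_sum)
    fix k show "g dvd N $ Inl k $ Inl r * N $ Inr k $ Inr r"
      using g[of k] fixed_col_zero(2)[OF N F, of k r] r by (cases "k \<in> F"; cases "k = r") auto
  qed
  have b: "g dvd (\<Sum>k\<in>UNIV. N $ Inr k $ Inl r * N $ Inl k $ Inr r)"
  proof (rule dvd_sum)
    fix k show "g dvd N $ Inr k $ Inl r * N $ Inl k $ Inr r"
      using g[of k] fixed_col_zero(1)[OF N F, of k r] by (cases "k \<in> F") auto
  qed
  show ?thesis by (subst eq) (rule dvd_diff[OF a b])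
qed

text \<open>Euclid's algorithm as a minimality argument: a reachable upper entry prime to p of least
  absolute value divides the relevant column and hence is a unit. Entries prime to p are singled out
  because the step that mixes an upper with a lower row must stay in the congruence
  subgroup.\<close>

lemma reach_unit_entry:
  fixes M :: "int^('n + 'n)^('n + 'n)"
  assumes M: "M \<in> Gamma0 p" and F: "fixed_cols F M" and r: "r \<notin> F"
  shows "\<exists>N\<in>reach p F M. \<exists>k. k \<notin> F \<and> \<bar>N $ Inl k $ Inl r\<bar> = 1"
proof -
  define P where "P m \<longleftrightarrow> (\<exists>N\<in>reach p F M. \<exists>k. k \<notin> F \<and> \<not> int p dvd N $ Inl k $ Inl r \<and> nat \<bar>N $ Inl k $ Inl r\<bar> = m)" for m
  note props = reach_props[OF _ M F]
  have "\<exists>k. k \<notin> F \<and> \<not> int p dvd M $ Inl k $ Inl r"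
  proof (rule ccontr)
    assume neg: "\<nexists>k. k \<notin> F \<and> \<not> int p dvd M $ Inl k $ Inl r"
    have Sp: "M \<in> Sp_int" using M by (simp add: Gamma0_def)
    have "int p dvd 1"
      by (rule col_primitive[OF Sp F r]) (use M neg in \<open>auto simp: Gamma0_alt\<close>)
    then show False using prime_int not_prime_unit by blast
  qed
  then have "\<exists>m. P m" unfolding P_def using reach.base by blast
  then have "P (LEAST m. P m)" by (rule LeastI_ex)
  then obtain N k where N: "N \<in> reach p F M" and k: "k \<notin> F" "\<not> int p dvd N $ Inl k $ Inl r"
    and least: "nat \<bar>N $ Inl k $ Inl r\<bar> = (LEAST m. P m)" unfolding P_def by blast
  define \<alpha> where "\<alpha> = N $ Inl k $ Inl r"
  have \<alpha>: "\<not> int p dvd \<alpha>" "\<alpha> \<noteq> 0" using k by (auto simp: \<alpha>_def)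
  have min: "\<bar>\<alpha>\<bar> \<le> \<bar>N' $ Inl k' $ Inl r\<bar>" if "N' \<in> reach p F M" "k' \<notin> F" "\<not> int p dvd N' $ Inl k' $ Inl r" for N' k'
  proof -
    have "P (nat \<bar>N' $ Inl k' $ Inl r\<bar>)" using that unfolding P_def by blast
    then have "nat \<bar>\<alpha>\<bar> \<le> nat \<bar>N' $ Inl k' $ Inl r\<bar>" using Least_le[of P] least by (simp add: \<alpha>_def)
    then show ?thesis by simp
  qed
  have i: "\<alpha> dvd N $ Inl l $ Inl r" if l: "l \<notin> F" for l
  proof (cases "l = k")
    case False
    define \<rho> where "\<rho> = N $ Inl l $ Inl r mod \<alpha>"
    define N1 where "N1 = levi_mat l k (- (N $ Inl l $ Inl r div \<alpha>)) ** N"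
    have N1: "N1 \<in> reach p F M" unfolding N1_def by (intro reach.levi N k False)
    have e1: "N1 $ Inl l $ Inl r = \<rho>" "N1 $ Inl k $ Inl r = \<alpha>"
      using False by (simp_all add: N1_def levi_row \<rho>_def \<alpha>_def minus_div_mult_eq_mod[symmetric])
    have "\<rho> = 0"
    proof (rule ccontr)
      assume \<rho>0: "\<rho> \<noteq> 0"
      have lt: "\<bar>\<rho>\<bar> < \<bar>\<alpha>\<bar>" unfolding \<rho>_def using \<alpha>(2) by (rule abs_mod_less)
      \<comment> \<open>A remainder prime to p contradicts minimality at once. One divisible by p
        leaves \<open>\<alpha>\<close> mod \<open>\<rho>\<close> prime to p and smaller still, so a
        second division finishes the argument.\<close>
      have p\<rho>: "int p dvd \<rho>" using min[OF N1 l] e1 lt by fastforce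
      define N2 where "N2 = levi_mat k l (- (\<alpha> div \<rho>)) ** N1"
      have N2: "N2 \<in> reach p F M" unfolding N2_def using False by (intro reach.levi N1 l) auto
      have e2: "N2 $ Inl k $ Inl r = \<alpha> mod \<rho>"
        by (simp add: N2_def levi_row e1 minus_div_mult_eq_mod[symmetric])
      have "\<not> int p dvd \<alpha> mod \<rho>" using \<alpha>(1) p\<rho> by (simp add: dvd_mod_iff)
      then have "\<bar>\<alpha>\<bar> \<le> \<bar>\<alpha> mod \<rho>\<bar>" using min[OF N2 k(1)] e2 by simp
      moreover have "\<bar>\<alpha> mod \<rho>\<bar> < \<bar>\<rho>\<bar>" using \<rho>0 by (rule abs_mod_less)
      ultimately show False using lt by simp
    qed
    then show ?thesis by (simp add: \<rho>_def dvd_eq_mod_eq_0)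
  qed (simp add: \<alpha>_def)
  \<comment> \<open>The matrix with the Bezout coefficients in its first row sends the pair
    (\<alpha>, \<gamma>) to (g, 0). It is admissible: p divides \<gamma> but not g, so it divides
    \<gamma> / g.\<close>
  have ii: "\<alpha> dvd N' $ Inr k $ Inl r" if N': "N' \<in> reach p F M" "N' $ Inl k $ Inl r = \<alpha>" for N'
  proof -
    define \<gamma> where "\<gamma> = N' $ Inr k $ Inl r"
    define g where "g = gcd \<alpha> \<gamma>"
    have g0: "g > 0" using \<alpha>(2) by (simp add: g_def)
    obtain x y where xy: "x * \<alpha> + y * \<gamma> = g" unfolding g_def using bezout_int by blast
    obtain \<alpha>' \<gamma>' where \<alpha>': "\<alpha> = g * \<alpha>'" and \<gamma>': "\<gamma> = g * \<gamma>'" unfolding g_def by (meson dvdE gcd_dvd1 gcd_dvd2)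
    have pg: "\<not> int p dvd g" using \<alpha>(1) \<alpha>' by auto
    have "int p dvd \<gamma>" using props[OF N'(1)] by (auto simp: Gamma0_alt \<gamma>_def)
    then have p\<gamma>: "int p dvd \<gamma>'" using pg prime_int unfolding \<gamma>' by (simp add: prime_dvd_mult_iff)
    have "g * (x * \<alpha>' - y * (- \<gamma>')) = g * 1" using xy unfolding \<alpha>' \<gamma>' by (simp add: algebra_simps)
    then have det: "x * \<alpha>' - y * (- \<gamma>') = 1" using g0 by simp
    have N'': "emb_mat k x y (- \<gamma>') \<alpha>' ** N' \<in> reach p F M" by (intro reach.emb N' k det) (simp add: p\<gamma>)
    have "(emb_mat k x y (- \<gamma>') \<alpha>' ** N') $ Inl k $ Inl r = g"
      using xy by (simp add: emb_row N'(2) \<gamma>_def)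
    then have "\<bar>\<alpha>\<bar> \<le> g" using min[OF N'' k(1)] pg g0 by simp
    moreover have "g \<le> \<bar>\<alpha>\<bar>" using \<alpha>(2) by (intro zdvd_imp_le) (auto simp: g_def)
    ultimately have "\<bar>\<alpha>\<bar> = g" by simp
    then have "\<bar>\<alpha>\<bar> dvd \<gamma>" by (simp add: g_def)
    then show ?thesis by (simp add: \<gamma>_def)
  qed
  have iii: "\<alpha> dvd N $ Inr l $ Inl r" if "l \<notin> F" for l
  proof (cases "l = k")
    case True
    then show ?thesis using ii[OF N] by (simp add: \<alpha>_def)
  next
    case False
    \<comment> \<open>This move subtracts the lower row l from the lower row k and keeps the upper
      row k, so \<open>ii\<close> applies to the difference.\<close>
    have "levi_mat l k 1 ** N \<in> reach p F M" by (intro reach.levi N k False)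
    from ii[OF this] have "\<alpha> dvd N $ Inr k $ Inl r - N $ Inr l $ Inl r" using False by (simp add: levi_row \<alpha>_def)
    then show ?thesis using ii[OF N] by (simp add: \<alpha>_def dvd_diff_right_iff)
  qed
  have "\<alpha> dvd 1"
  proof (rule col_primitive[OF _ _ r])
    show "N \<in> Sp_int" "fixed_cols F N" using props[OF N] by (simp_all add: Gamma0_def)
  qed (simp add: i iii)
  then have "\<bar>\<alpha>\<bar> = 1" by simp
  then show ?thesis using N k by (auto simp: \<alpha>_def)
qed

text \<open>An upper entry 1 at r clears the other upper entries. The lower entries are multiples of
  p; outside F they are cleared by an entry equal to p, created at r for this purpose and removed
  last, and in F they vanish by \<open>fixed_col_zero\<close>.\<close>

lemma reach_fix_col:
  fixes M :: "int^('n + 'n)^('n + 'n)"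
  assumes M: "M \<in> Gamma0 p" and F: "fixed_cols F M" and r: "r \<notin> F"
  shows "\<exists>N\<in>reach p F M. fixed_cols (insert r F) N"
proof -
  note props = reach_props[OF _ M F]
  obtain N k where N: "N \<in> reach p F M" and k: "k \<notin> F" "\<bar>N $ Inl k $ Inl r\<bar> = 1"
    using reach_unit_entry[OF assms] by blast
  have "\<exists>N\<in>reach p F M. N $ Inl r $ Inl r = 1"
  proof (cases "k = r")
    case True
    show ?thesis
    proof (cases "N $ Inl r $ Inl r = 1")
      case False
      then have "N $ Inl r $ Inl r = - 1" using k True by auto
      then show ?thesis
        by (intro bexI[of _ "emb_mat r (- 1) 0 0 (- 1) ** N"]) (auto simp: emb_row intro!: reach.emb N r)
    qed (use N in blast)
  next
    case False
    define \<alpha> where "\<alpha> = N $ Inl k $ Inl r"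
    have "\<alpha> = 1 \<or> \<alpha> = - 1" using k by (auto simp: \<alpha>_def)
    then have "\<alpha> * \<alpha> = 1" by auto
    then have "(levi_mat r k ((1 - N $ Inl r $ Inl r) * \<alpha>) ** N) $ Inl r $ Inl r = 1"
      by (simp add: levi_row \<alpha>_def[symmetric] mult.assoc)
    moreover have "levi_mat r k ((1 - N $ Inl r $ Inl r) * \<alpha>) ** N \<in> reach p F M"
      using False by (intro reach.levi N k) auto
    ultimately show ?thesis by blast
  qed
  then obtain N1 where N1: "N1 \<in> reach p F M" "N1 $ Inl r $ Inl r = 1" by blast
  have "\<exists>N\<in>reach p F M. N $ Inl r $ Inl r = 1 \<and> (\<forall>l\<in>G. N $ Inl l $ Inl r = 0)" if "finite G" "r \<notin> G" for G
    using that
  proof (induction G rule: finite_induct)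
    case empty
    then show ?case using N1 by auto
  next
    case (insert l G)
    then obtain N where N: "N \<in> reach p F M" "N $ Inl r $ Inl r = 1" "\<forall>l\<in>G. N $ Inl l $ Inl r = 0" by auto
    have "levi_mat l r (- N $ Inl l $ Inl r) ** N \<in> reach p F M" using insert.prems by (intro reach.levi N r) auto
    moreover have "(levi_mat l r (- N $ Inl l $ Inl r) ** N) $ Inl r $ Inl r = 1"
      using insert.prems by (auto simp: levi_row N)
    moreover have "\<forall>l'\<in>insert l G. (levi_mat l r (- N $ Inl l $ Inl r) ** N) $ Inl l' $ Inl r = 0"
      using N insert.hyps by (auto simp: levi_row)
    ultimately show ?case by blast
  qed
  from this[of "UNIV - {r}"] obtain N2 where N2: "N2 \<in> reach p F M" "N2 $ Inl r $ Inl r = 1" "\<And>l. l \<noteq> r \<Longrightarrow> N2 $ Inl l $ Inl r = 0"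
    by auto
  define N3 where "N3 = emb_mat r 1 0 (int p - N2 $ Inr r $ Inl r) 1 ** N2"
  have N3: "N3 \<in> reach p F M"
    unfolding N3_def using props[OF N2(1)] by (intro reach.emb N2 r) (auto simp: Gamma0_alt)
  have N3': "N3 $ Inl r $ Inl r = 1" "\<And>l. l \<noteq> r \<Longrightarrow> N3 $ Inl l $ Inl r = 0" "N3 $ Inr r $ Inl r = int p"
    by (auto simp: N3_def emb_row N2)
  have "\<exists>N\<in>reach p F M. N $ Inl r $ Inl r = 1 \<and> (\<forall>l. l \<noteq> r \<longrightarrow> N $ Inl l $ Inl r = 0) \<and> N $ Inr r $ Inl r = int p \<and> (\<forall>l\<in>G. N $ Inr l $ Inl r = 0)"
    if "finite G" "r \<notin> G" "G \<inter> F = {}" for G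
    using that
  proof (induction G rule: finite_induct)
    case empty
    then show ?case using N3 N3' by auto
  next
    case (insert l G)
    then obtain N where N: "N \<in> reach p F M" "N $ Inl r $ Inl r = 1" "\<And>l. l \<noteq> r \<Longrightarrow> N $ Inl l $ Inl r = 0"
      "N $ Inr r $ Inl r = int p" "\<forall>l\<in>G. N $ Inr l $ Inl r = 0" by auto
    have "int p dvd N $ Inr l $ Inl r" using props[OF N(1)] by (simp add: Gamma0_alt)
    then obtain m where m: "N $ Inr l $ Inl r = int p * m" by (elim dvdE)
    have "levi_mat r l m ** N \<in> reach p F M" using insert.prems by (intro reach.levi N) auto
    moreover have "(levi_mat r l m ** N) $ Inl r $ Inl r = 1" "(levi_mat r l m ** N) $ Inr r $ Inl r = int p"
      "\<And>l'. l' \<noteq> r \<Longrightarrow> (levi_mat r l m ** N) $ Inl l' $ Inl r = 0"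
      using insert.prems N by (auto simp: levi_row)
    moreover have "\<forall>l'\<in>insert l G. (levi_mat r l m ** N) $ Inr l' $ Inl r = 0"
      using N insert.hyps insert.prems m by (auto simp: levi_row)
    ultimately show ?case by blast
  qed
  from this[of "UNIV - insert r F"] obtain N4 where N4: "N4 \<in> reach p F M" "N4 $ Inl r $ Inl r = 1"
    "\<And>l. l \<noteq> r \<Longrightarrow> N4 $ Inl l $ Inl r = 0" "N4 $ Inr r $ Inl r = int p" "\<And>l. l \<notin> F \<Longrightarrow> l \<noteq> r \<Longrightarrow> N4 $ Inr l $ Inl r = 0"
    using finite by blast
  define N5 where "N5 = emb_mat r 1 0 (- int p) 1 ** N4"
  have N5: "N5 \<in> reach p F M" unfolding N5_def by (intro reach.emb N4 r) auto
  have "N5 $ Inr l $ Inl r = 0" for l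
  proof (cases "l \<in> F")
    case True
    then show ?thesis using props[OF N5] fixed_col_zero(1)[of N5 F l r] by (auto simp: Gamma0_alt)
  next
    case False
    then show ?thesis using N4 by (auto simp: N5_def emb_row)
  qed
  moreover have "N5 $ Inl l $ Inl r = (if l = r then 1 else 0)" for l using N4 by (auto simp: N5_def emb_row)
  ultimately have "fixed_cols (insert r F) N5"
    using props[OF N5] by (auto simp: fixed_cols_def)
  then show ?thesis using N5 by blast
qed

lemma fixed_all_in_S:
  assumes M: "M \<in> Gamma0 p" and F: "fixed_cols UNIV M"
  shows "M \<in> S"
proof -
  have A: "block_A M = mat 1" and C: "block_C M = 0"
    using F by (auto simp: fixed_cols_def block_A_def block_C_def mat_def vec_eq_iff)
  have Sp: "M \<in> Sp_int" using M by (simp add: Gamma0_def)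
  have D: "block_D M = mat 1" using Sp unfolding Sp_int_iff A C by (simp add: transpose_mat transpose_zero zero_mat_mult)
  have B: "transpose (block_B M) = block_B M" using Sp unfolding Sp_int_iff D by (simp add: transpose_mat)
  have "M = trans_mat (block_B M)" by (rule block_mat_eqI) (simp_all add: trans_mat_def A C D)
  then show ?thesis using trans[OF B] by simp
qed

theorem Gamma0_subset: "M \<in> Gamma0 p \<Longrightarrow> M \<in> S"
proof -
  have "M \<in> S" if "finite G" "M \<in> Gamma0 p" "fixed_cols (UNIV - G) M" for G M
    using that
  proof (induction G arbitrary: M rule: finite_induct)
    case empty
    then show ?case by (simp add: fixed_all_in_S)
  next
    case (insert r G)
    obtain N where N: "N \<in> reach p (UNIV - insert r G) M" "fixed_cols (insert r (UNIV - insert r G)) N"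
      using reach_fix_col[OF insert.prems, of r] by auto
    have "insert r (UNIV - insert r G) = UNIV - G" using insert.hyps by auto
    then have "N \<in> S" using insert.IH[of N] N reach_props[OF N(1) insert.prems] by simp
    then show ?case using reach_props[OF N(1) insert.prems] by simp
  qed
  from this[of UNIV M] show "M \<in> Gamma0 p \<Longrightarrow> M \<in> S" by (simp add: fixed_cols_def)
qed

end

section \<open>Uniqueness of Fourier expansions\<close>

lemma sum_ee_roots:
  fixes n :: int
  assumes "K > 0"
  shows "(\<Sum>t<K. ee (of_int n * of_nat t / of_nat K)) = (if int K dvd n then of_nat K else 0)"
proof -
  define w where "w = ee (of_int n / of_nat K)"
  have "ee (of_int n * of_nat t / of_nat K) = w ^ t" for t
    using ee_of_nat_mult[of t "of_int n / of_nat K"] by (simp add: w_def mult.commute)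
  then have S: "(\<Sum>t<K. ee (of_int n * of_nat t / of_nat K)) = (\<Sum>t<K. w ^ t)" by simp
  have wK: "w ^ K = 1" using assms ee_of_nat_mult[of K "of_int n / of_nat K"] by (simp add: w_def)
  show ?thesis
  proof (cases "int K dvd n")
    case True
    then obtain m where "n = int K * m" by blast
    then have "w = ee (of_int m)" using assms by (simp add: w_def)
    then show ?thesis using True S by simp
  next
    case False
    have "w \<noteq> 1"
    proof
      assume "w = 1"
      then have "of_int n / of_nat K \<in> (\<int> :: complex set)" by (simp add: w_def ee_eq_1_iff)
      then obtain m where "of_int n / of_nat K = (of_int m :: complex)" by (auto elim: Ints_cases)
      then have "(of_int n :: complex) = of_int (int K * m)" using assms by (simp add: field_simps)
      then have "n = int K * m" by (simp only: of_int_eq_iff)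
      then show False using False by simp
    qed
    then have "(\<Sum>t<K. w ^ t) = 0" using geometric_sum[of w K] wK by simp
    then show ?thesis using False S by simp
  qed
qed

lemma has_sum_finite_sum:
  fixes f :: "'a \<Rightarrow> 'b \<Rightarrow> 'c::{topological_comm_monoid_add, comm_monoid_add}"
  assumes "finite A" "\<And>a. a \<in> A \<Longrightarrow> (f a has_sum S a) X"
  shows "((\<lambda>x. \<Sum>a\<in>A. f a x) has_sum (\<Sum>a\<in>A. S a)) X"
  using assms by (induction A rule: finite_induct) (auto intro: has_sum_add)

text \<open>Averaging over the K-torsion points of the torus isolates the frequencies in one class modulo K; as K
  grows, absolute convergence leaves a single one.\<close>

lemma exp_sum_zero_imp_zero:
  fixes c :: "'x \<Rightarrow> complex" and u :: "'x \<Rightarrow> 'j::finite \<Rightarrow> int"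
  assumes summ: "c summable_on UNIV"
    and inj: "\<And>x y. c x \<noteq> 0 \<Longrightarrow> c y \<noteq> 0 \<Longrightarrow> u x = u y \<Longrightarrow> x = y"
    and zero: "\<And>K (m :: 'j \<Rightarrow> nat). K > 0 \<Longrightarrow> (\<Sum>\<^sub>\<infinity>x. c x * ee (\<Sum>j\<in>UNIV. of_int (u x j) * of_nat (m j) / of_nat K)) = 0"
  shows "c x0 = 0"
proof (rule ccontr)
  assume c0: "c x0 \<noteq> 0"
  have abs: "(\<lambda>x. norm (c x)) summable_on UNIV" using summ by (simp add: summable_on_iff_abs_summable_on_complex)
  define A where "A K = {x. \<forall>j. int K dvd u x j - u x0 j}" for K
  have sumA: "infsum c (A K) = 0" if K: "K > 0" for K
  proof -
    let ?e = "\<lambda>x (m :: 'j \<Rightarrow> nat). ee (\<Sum>j\<in>UNIV. of_int (u x j) * of_nat (m j) / of_nat K)"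
    let ?M = "PiE (UNIV :: 'j set) (\<lambda>_. {..<K})"
    have ne: "norm (?e x m) = 1" for x m
      by (simp add: norm_ee Im_divide_of_nat)
    have sm: "(\<lambda>x. c x * ?e x m) summable_on UNIV" for m
      by (rule abs_summable_summable) (use abs ne in \<open>simp add: norm_mult\<close>)
    have prod: "(\<Sum>m\<in>?M. ?e x m * inverse (?e x0 m)) = (if x \<in> A K then of_nat K ^ CARD('j) else 0)" for x
    proof -
      have "(\<Sum>m\<in>?M. ?e x m * inverse (?e x0 m)) = (\<Sum>m\<in>?M. \<Prod>j\<in>UNIV. ee (of_int (u x j - u x0 j) * of_nat (m j) / of_nat K))"
      proof (intro sum.cong refl)
        fix m
        have ee_sum: "ee (\<Sum>j\<in>J. g j) = (\<Prod>j\<in>J. ee (g j))" if "finite J" for J and g :: "'j \<Rightarrow> complex"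
          using that by (induction J rule: finite_induct) (auto simp: ee_add)
        have "?e x m * inverse (?e x0 m) = ee (\<Sum>j\<in>UNIV. of_int (u x j - u x0 j) * of_nat (m j) / of_nat K)"
          by (simp add: sum_subtractf ee_diff left_diff_distrib diff_divide_distrib divide_inverse)
        then show "?e x m * inverse (?e x0 m) = (\<Prod>j\<in>UNIV. ee (of_int (u x j - u x0 j) * of_nat (m j) / of_nat K))"
          by (simp add: ee_sum)
      qed
      also have "\<dots> = (\<Prod>j\<in>UNIV. \<Sum>t<K. ee (of_int (u x j - u x0 j) * of_nat t / of_nat K))"
        by (subst prod_sum_PiE) auto
      also have "\<dots> = (\<Prod>j\<in>(UNIV :: 'j set). if int K dvd u x j - u x0 j then of_nat K else 0)"
        by (intro prod.cong refl sum_ee_roots K)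
      also have "\<dots> = (if x \<in> A K then of_nat K ^ CARD('j) else 0)"
        by (auto simp: A_def)
      finally show ?thesis .
    qed
    have "0 = (\<Sum>m\<in>?M. inverse (?e x0 m) * (\<Sum>\<^sub>\<infinity>x. c x * ?e x m))"
      using zero[OF K] by simp
    also have "\<dots> = (\<Sum>m\<in>?M. \<Sum>\<^sub>\<infinity>x. inverse (?e x0 m) * (c x * ?e x m))"
      by (simp add: infsum_cmult_right')
    also have "\<dots> = (\<Sum>\<^sub>\<infinity>x. \<Sum>m\<in>?M. inverse (?e x0 m) * (c x * ?e x m))"
      by (rule infsumI[symmetric, OF has_sum_finite_sum])
         (auto intro!: has_sum_infsum summable_on_cmult_right sm finite_PiE)
    also have "\<dots> = (\<Sum>\<^sub>\<infinity>x. c x * (\<Sum>m\<in>?M. ?e x m * inverse (?e x0 m)))"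
      by (intro infsum_cong) (simp add: sum_distrib_left mult_ac)
    also have "\<dots> = (\<Sum>\<^sub>\<infinity>x. (if x \<in> A K then c x else 0) * of_nat K ^ CARD('j))"
      unfolding prod by (intro infsum_cong) auto
    also have "\<dots> = (\<Sum>\<^sub>\<infinity>x. if x \<in> A K then c x else 0) * of_nat K ^ CARD('j)"
      by (rule infsum_cmult_left')
    also have "(\<Sum>\<^sub>\<infinity>x. if x \<in> A K then c x else 0) = infsum c (A K)"
      by (rule infsum_cong_neutral) auto
    finally show ?thesis using K by simp
  qed
  define \<epsilon> where "\<epsilon> = norm (c x0)"
  have \<epsilon>: "\<epsilon> > 0" using c0 by (simp add: \<epsilon>_def)
  obtain F where F: "finite F" "dist (\<Sum>x\<in>F. norm (c x)) (\<Sum>\<^sub>\<infinity>x. norm (c x)) \<le> \<epsilon> / 2"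
    using infsum_finite_approximation[OF abs, of "\<epsilon> / 2"] \<epsilon> by auto
  have tail: "(\<Sum>\<^sub>\<infinity>x\<in>- F. norm (c x)) \<le> \<epsilon> / 2"
  proof -
    have "(\<Sum>\<^sub>\<infinity>x. norm (c x)) = (\<Sum>\<^sub>\<infinity>x\<in>F \<union> - F. norm (c x))" by simp
    also have "\<dots> = (\<Sum>\<^sub>\<infinity>x\<in>F. norm (c x)) + (\<Sum>\<^sub>\<infinity>x\<in>- F. norm (c x))"
      by (rule infsum_Un_disjoint) (auto intro: summable_on_subset[OF abs])
    finally show ?thesis using F by (simp add: dist_real_def)
  qed
  \<comment> \<open>K exceeds every difference of frequencies occurring in the finite set
    \<open>F\<close>, so the class modulo K meets \<open>F\<close> with nonzero coefficient in
    \<open>x0\<close> at most.\<close>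
  define K where "K = Suc (\<Sum>x\<in>F. \<Sum>j\<in>UNIV. nat \<bar>u x j - u x0 j\<bar>)"
  have small: "\<bar>u x j - u x0 j\<bar> < int K" if "x \<in> F" for x j
  proof -
    have "nat \<bar>u x j - u x0 j\<bar> \<le> (\<Sum>j\<in>UNIV. nat \<bar>u x j - u x0 j\<bar>)" by (rule member_le_sum) auto
    also have "\<dots> \<le> (\<Sum>x\<in>F. \<Sum>j\<in>UNIV. nat \<bar>u x j - u x0 j\<bar>)" using that F(1)
      by (intro member_le_sum[of x F "\<lambda>x. \<Sum>j\<in>UNIV. nat \<bar>u x j - u x0 j\<bar>"]) auto
    finally show ?thesis unfolding K_def by linarith
  qed
  have only: "c x = 0" if "x \<in> A K" "x \<in> F" "x \<noteq> x0" for x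
  proof (rule ccontr)
    assume "c x \<noteq> 0"
    then have "u x \<noteq> u x0" using inj c0 that(3) by blast
    then obtain j where j: "u x j \<noteq> u x0 j" by auto
    have "int K dvd u x j - u x0 j" using that(1) by (simp add: A_def)
    then have "int K dvd \<bar>u x j - u x0 j\<bar>" by simp
    then have "int K \<le> \<bar>u x j - u x0 j\<bar>" using j by (intro zdvd_imp_le) auto
    then show False using small[OF that(2), of j] by simp
  qed
  have x0A: "x0 \<in> A K" by (simp add: A_def)
  have "infsum c (A K) = c x0 + infsum c (A K - {x0})"
  proof -
    have "infsum c (insert x0 (A K - {x0})) = c x0 + infsum c (A K - {x0})"
      by (rule infsum_insert) (auto intro: summable_on_subset[OF summ])
    then show ?thesis using x0A by (simp add: insert_absorb)
  qed
  then have "c x0 = - infsum c (A K - {x0})" using sumA[of K] by (simp add: K_def eq_neg_iff_add_eq_0)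
  then have "\<epsilon> = norm (infsum c (A K - {x0}))" by (simp add: \<epsilon>_def)
  also have "\<dots> \<le> (\<Sum>\<^sub>\<infinity>x\<in>A K - {x0}. norm (c x))"
    by (rule norm_infsum_bound) (auto intro: summable_on_subset[OF abs])
  also have "\<dots> \<le> (\<Sum>\<^sub>\<infinity>x\<in>- F. norm (c x))"
    by (rule infsum_mono_neutral) (use only in \<open>auto intro: summable_on_subset[OF abs]\<close>)
  finally show False using tail \<epsilon> by simp
qed

text \<open>The one-variable theta function is divided out in \<open>poisson_root_lattice\<close>;
  for this some point where it does not vanish is needed.\<close>

lemma theta1_nonvanishing:
  assumes "Im \<tau> > 0"
  shows "\<exists>s. theta1 \<tau> s \<noteq> 0"
proof (rule ccontr)
  assume "\<nexists>s. theta1 \<tau> s \<noteq> 0"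
  then have th: "theta1 \<tau> s = 0" for s by blast
  define c where "c n = ee (\<tau> * (of_int n)\<^sup>2 / 2)" for n :: int
  have "c 0 = 0"
  proof (rule exp_sum_zero_imp_zero[where u = "\<lambda>n (_ :: unit). n" and c = c])
    show "c summable_on UNIV"
      by (rule abs_summable_summable) (use theta1_summable[OF assms, of 0] in \<open>simp add: c_def\<close>)
    fix K :: nat and m :: "unit \<Rightarrow> nat"
    have "theta1 \<tau> (of_nat (m ()) / of_nat K) = (\<Sum>\<^sub>\<infinity>x. c x * ee (\<Sum>j\<in>UNIV. of_int x * of_nat (m j) / of_nat K))"
      unfolding theta1_def c_def by (intro infsum_cong) (simp add: ee_add UNIV_unit)
    then show "(\<Sum>\<^sub>\<infinity>x. c x * ee (\<Sum>j\<in>UNIV. of_int x * of_nat (m j) / of_nat K)) = 0" using th by simp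
  qed (auto dest: fun_cong)
  then show False by (simp add: c_def)
qed

definition tr_pair :: "real^'n^'n::finite \<Rightarrow> complex^'n^'n \<Rightarrow> complex" where
  "tr_pair T Z = (\<Sum>i\<in>UNIV. \<Sum>k\<in>UNIV. of_real (T $ i $ k) * Z $ k $ i)"

lemma trace_eq_tr_pair: "trace ((\<chi> i k. of_real (T $ i $ k)) ** Z) = tr_pair T Z"
  by (simp add: trace_def matrix_matrix_mult_def tr_pair_def)

lemma has_fourier_expansion_alt:
  "has_fourier_expansion f a \<longleftrightarrow>
     (\<exists>N::nat. N > 0 \<and> (\<forall>T. a T \<noteq> 0 \<longrightarrow> real N *\<^sub>R T \<in> half_integral)) \<and>
     (\<forall>Z\<in>siegel_upper. ((\<lambda>T. a T * ee (tr_pair T Z)) has_sum f Z) UNIV)"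
  unfolding has_fourier_expansion_def trace_eq_tr_pair ee_def ..

lemma half_integral_mult:
  assumes "T \<in> half_integral"
  shows "real N *\<^sub>R T \<in> half_integral"
proof -
  have "real N * T $ i $ i \<in> \<int>" "2 * (real N * T $ i $ k) \<in> \<int>" for i k
    using assms Ints_mult[of "real N" "T $ i $ i"] Ints_mult[of "real N" "2 * T $ i $ k"]
    by (simp_all add: half_integral_def mult.left_commute)
  then show ?thesis using assms by (simp add: half_integral_def transpose_def vec_eq_iff)
qed

lemma half_integralD:
  assumes "T \<in> half_integral"
  shows "T $ i $ k = T $ k $ i" "2 * T $ i $ k \<in> \<int>"
  using assms by (auto simp: half_integral_def transpose_def vec_eq_iff)

text \<open>At X + i with rational symmetric X the difference of two expansions becomes a
  trigonometric sum with integral frequencies that vanishes at all torsion points.\<close>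

lemma has_fourier_expansion_unique:
  fixes f :: "complex^'n^'n::finite \<Rightarrow> complex"
  assumes a: "has_fourier_expansion f a" and b: "has_fourier_expansion f b"
  shows "a = b"
proof -
  obtain N1 where N1: "N1 > 0" "\<And>T. a T \<noteq> 0 \<Longrightarrow> real N1 *\<^sub>R T \<in> half_integral"
    using a by (auto simp: has_fourier_expansion_alt)
  obtain N2 where N2: "N2 > 0" "\<And>T. b T \<noteq> 0 \<Longrightarrow> real N2 *\<^sub>R T \<in> half_integral"
    using b by (auto simp: has_fourier_expansion_alt)
  define N where "N = N1 * N2"
  have N0: "N > 0" using N1 N2 by (simp add: N_def)
  have N: "real N *\<^sub>R T \<in> half_integral" if "a T \<noteq> b T" for T
  proof (cases "a T = 0")
    case True
    then show ?thesis using half_integral_mult[OF N2(2)[of T], of N1] that by (simp add: N_def)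
  next
    case False
    then show ?thesis using half_integral_mult[OF N1(2)[of T], of N2] by (simp add: N_def mult.commute)
  qed
  define Y :: "complex^'n^'n" where "Y = (\<chi> i k. if i = k then \<i> else 0)"
  have Zin: "(\<chi> i k. of_real (X i k)) + Y \<in> siegel_upper" if X: "\<And>i k. X i k = X k i" for X :: "'n \<Rightarrow> 'n \<Rightarrow> real"
  proof (rule siegel_upperI)
    show "transpose ((\<chi> i k. of_real (X i k)) + Y) = (\<chi> i k. of_real (X i k)) + Y"
      using X by (auto simp: transpose_def vec_eq_iff Y_def)
    have "im_mat ((\<chi> i k. of_real (X i k)) + Y) = mat 1" by (auto simp: im_mat_def Y_def mat_def vec_eq_iff)
    then show "x \<noteq> 0 \<Longrightarrow> x \<bullet> (im_mat ((\<chi> i k. of_real (X i k)) + Y) *v x) > 0" for x by simp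
  qed
  define c where "c T = (a T - b T) * ee (tr_pair T Y)" for T
  define u where "u T ik = \<lfloor>2 * (real N * T $ fst ik $ snd ik)\<rfloor>" for T :: "real^'n^'n" and ik
  have u: "2 * (real N * T $ i $ k) = of_int (u T (i, k))" if "a T \<noteq> b T" for T i k
    using half_integralD(2)[OF N[OF that], of i k] by (auto simp: u_def elim!: Ints_cases)
  have sym: "T $ i $ k = T $ k $ i" if "a T \<noteq> b T" for T i k
    using half_integralD(1)[OF N[OF that], of i k] N0 by simp
  have hs: "((\<lambda>T. (a T - b T) * ee (tr_pair T Z)) has_sum 0) UNIV" if Z: "Z \<in> siegel_upper" for Z
  proof -
    have "((\<lambda>T. a T * ee (tr_pair T Z)) has_sum f Z) UNIV" "((\<lambda>T. b T * ee (tr_pair T Z)) has_sum f Z) UNIV"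
      using a b Z by (auto simp: has_fourier_expansion_alt)
    from has_sum_add[OF this(1) has_sum_uminusI[OF this(2)]] show ?thesis by (simp add: left_diff_distrib)
  qed
  have tr_add: "tr_pair T (Z + Z') = tr_pair T Z + tr_pair T Z'" for T :: "real^'n^'n" and Z Z'
    by (simp add: tr_pair_def distrib_left sum.distrib)
  have "c T = 0" for T
  proof (rule exp_sum_zero_imp_zero[where u = u and c = c])
    show "c summable_on UNIV"
      using hs[OF Zin[of "\<lambda>i k. 0"]] unfolding c_def
      by (auto simp: summable_on_def tr_add zero_vec_def[symmetric] tr_pair_def)
    show "x = y" if "c x \<noteq> 0" "c y \<noteq> 0" "u x = u y" for x y
    proof -
      have "a x \<noteq> b x" "a y \<noteq> b y" using that by (auto simp: c_def)
      then have "2 * (real N * x $ i $ k) = 2 * (real N * y $ i $ k)" for i k using u that(3) by metis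
      then show ?thesis using N0 by (simp add: vec_eq_iff)
    qed
    fix K :: nat and m :: "'n \<times> 'n \<Rightarrow> nat" assume K: "K > 0"
    \<comment> \<open>The frequencies are the entries of 2 N T. As T is symmetric, the two summands
      contribute equally, and the trace of T X becomes the sum of frequency times m / K.\<close>
    define X where "X i k = real N * (real (m (i, k)) + real (m (k, i))) / real K" for i k
    have Xs: "X i k = X k i" for i k by (simp add: X_def add.commute)
    have "c T * ee (\<Sum>j\<in>UNIV. of_int (u T j) * of_nat (m j) / of_nat K) = (a T - b T) * ee (tr_pair T ((\<chi> i k. of_real (X i k)) + Y))" for T
    proof (cases "a T = b T")
      case False
      have "tr_pair T (\<chi> i k. of_real (X i k)) = of_real (\<Sum>i\<in>UNIV. \<Sum>k\<in>UNIV. T $ i $ k * X k i)"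
        by (simp add: tr_pair_def)
      also have "(\<Sum>i\<in>UNIV. \<Sum>k\<in>UNIV. T $ i $ k * X k i) =
          (\<Sum>i\<in>UNIV. \<Sum>k\<in>UNIV. T $ i $ k * real N * real (m (i, k)) / real K) + (\<Sum>i\<in>UNIV. \<Sum>k\<in>UNIV. T $ i $ k * real N * real (m (k, i)) / real K)"
        by (simp add: X_def algebra_simps add_divide_distrib sum.distrib)
      also have "(\<Sum>i\<in>UNIV. \<Sum>k\<in>UNIV. T $ i $ k * real N * real (m (k, i)) / real K) = (\<Sum>i\<in>UNIV. \<Sum>k\<in>UNIV. T $ i $ k * real N * real (m (i, k)) / real K)"
        by (subst sum.swap) (simp add: sym[OF False])
      also have "(\<Sum>i\<in>UNIV. \<Sum>k\<in>UNIV. T $ i $ k * real N * real (m (i, k)) / real K) + (\<Sum>i\<in>UNIV. \<Sum>k\<in>UNIV. T $ i $ k * real N * real (m (i, k)) / real K)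
          = (\<Sum>i\<in>UNIV. \<Sum>k\<in>UNIV. (2 * (real N * T $ i $ k)) * real (m (i, k)) / real K)"
        by (simp add: sum.distrib[symmetric] algebra_simps add_divide_distrib[symmetric])
      also have "\<dots> = (\<Sum>i\<in>UNIV. \<Sum>k\<in>UNIV. of_int (u T (i, k)) * real (m (i, k)) / real K)"
        by (simp only: u[OF False])
      also have "\<dots> = (\<Sum>j\<in>UNIV. of_int (u T j) * real (m j) / real K)"
        by (simp add: sum.cartesian_product case_prod_unfold)
      finally have "tr_pair T (\<chi> i k. of_real (X i k)) = (\<Sum>j\<in>UNIV. of_int (u T j) * of_nat (m j) / of_nat K)" by simp
      then show ?thesis by (simp add: c_def tr_add ee_add mult_ac)
    qed (simp add: c_def)
    then show "(\<Sum>\<^sub>\<infinity>T. c T * ee (\<Sum>j\<in>UNIV. of_int (u T j) * of_nat (m j) / of_nat K)) = 0"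
      using hs[OF Zin[OF Xs]] by (simp add: has_sum_iff)
  qed
  then show ?thesis by (auto simp: c_def fun_eq_iff)
qed

lemma fourier_coeff_eqI: "has_fourier_expansion f a \<Longrightarrow> fourier_coeff f = a"
  unfolding fourier_coeff_def by (rule the_equality) (auto intro: has_fourier_expansion_unique)

section \<open>Theta functions of lattices\<close>

lemma summable_on_prod_PiE:
  fixes f :: "'a \<Rightarrow> 'b \<Rightarrow> real"
  assumes "finite A" "\<And>x. x \<in> A \<Longrightarrow> f x summable_on B x" "\<And>x y. x \<in> A \<Longrightarrow> y \<in> B x \<Longrightarrow> f x y \<ge> 0"
  shows "(\<lambda>g. \<Prod>x\<in>A. f x (g x)) summable_on PiE A B"
  using assms
proof (induction A rule: finite_induct)
  case (insert x F)
  have IH: "(\<lambda>g. \<Prod>x\<in>F. f x (g x)) summable_on PiE F B" using insert by auto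
  have nn: "(\<Prod>x\<in>F. f x (g x)) \<ge> 0" if "g \<in> PiE F B" for g
    using that insert.prems by (intro prod_nonneg) (auto simp: PiE_def Pi_def)
  have prod: "(\<Prod>z\<in>insert x F. f z ((g(x := y)) z)) = f x y * (\<Prod>x\<in>F. f x (g x))" for y g
    using insert.hyps by (auto intro!: prod.cong)
  have "(\<lambda>z. norm (case z of (y, g) \<Rightarrow> f x y * (\<Prod>x\<in>F. f x (g x)))) summable_on (B x \<times> PiE F B)"
    unfolding Infinite_Sum.abs_summable_on_Sigma_iff
  proof (intro conjI ballI)
    fix y assume "y \<in> B x"
    show "(\<lambda>g. norm (case (y, g) of (y, g) \<Rightarrow> f x y * (\<Prod>x\<in>F. f x (g x)))) summable_on PiE F B"
    proof (rule summable_on_cong[THEN iffD1])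
      show "(\<lambda>g. f x y * (\<Prod>x\<in>F. f x (g x))) summable_on PiE F B" by (rule summable_on_cmult_right[OF IH])
      show "f x y * (\<Prod>x\<in>F. f x (g x)) = norm (case (y, g) of (y, g) \<Rightarrow> f x y * (\<Prod>x\<in>F. f x (g x)))" if "g \<in> PiE F B" for g
        using nn[OF that] insert.prems \<open>y \<in> B x\<close> by simp
    qed
  next
    have "(\<lambda>y. f x y * (\<Sum>\<^sub>\<infinity>g\<in>PiE F B. (\<Prod>x\<in>F. f x (g x)))) summable_on B x"
      using insert.prems by (intro summable_on_cmult_left) auto
    moreover have "(\<Sum>\<^sub>\<infinity>g\<in>PiE F B. norm (case (y, g) of (y, g) \<Rightarrow> f x y * (\<Prod>x\<in>F. f x (g x)))) = f x y * (\<Sum>\<^sub>\<infinity>g\<in>PiE F B. (\<Prod>x\<in>F. f x (g x)))"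
      if "y \<in> B x" for y
    proof -
      have "norm (case (y, g) of (y, g) \<Rightarrow> f x y * (\<Prod>x\<in>F. f x (g x))) = f x y * (\<Prod>x\<in>F. f x (g x))" if "g \<in> PiE F B" for g
        using nn[OF that] insert.prems \<open>y \<in> B x\<close> by simp
      then have "(\<Sum>\<^sub>\<infinity>g\<in>PiE F B. norm (case (y, g) of (y, g) \<Rightarrow> f x y * (\<Prod>x\<in>F. f x (g x)))) = (\<Sum>\<^sub>\<infinity>g\<in>PiE F B. f x y * (\<Prod>x\<in>F. f x (g x)))"
        by (rule infsum_cong)
      then show ?thesis by (simp only: infsum_cmult_right')
    qed
    ultimately show "(\<lambda>y. norm (\<Sum>\<^sub>\<infinity>g\<in>PiE F B. norm (case (y, g) of (y, g) \<Rightarrow> f x y * (\<Prod>x\<in>F. f x (g x))))) summable_on B x"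
      by (subst summable_on_iff_abs_summable_on_real[symmetric]) (rule summable_on_cong[THEN iffD1], auto)
  qed
  then have "(\<lambda>(y, g). f x y * (\<Prod>x\<in>F. f x (g x))) summable_on (B x \<times> PiE F B)"
    by (rule abs_summable_summable)
  then have "((\<lambda>g. \<Prod>z\<in>insert x F. f z (g z)) \<circ> (\<lambda>(y, g). g(x := y))) summable_on (B x \<times> PiE F B)"
    by (simp only: o_def case_prod_unfold prod)
  then show ?case
    unfolding PiE_insert_eq using inj_combinator[OF insert.hyps(2), of B] by (subst summable_on_reindex)
qed simp

text \<open>A common home for the lattices and their duals, so that convergence has to be settled
  only once.\<close>

definition frac_vecs :: "nat \<Rightarrow> cvec set" where
  "frac_vecs p = {f. periodic p f \<and> (\<forall>i. of_nat p * f i \<in> \<int>)}"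

definition of_coords :: "nat \<Rightarrow> (nat \<Rightarrow> int) \<Rightarrow> cvec" where
  "of_coords p n = (\<lambda>i. of_int (n (i mod p)))"

lemma of_coords_bij:
  assumes "p > 0"
  shows "bij_betw (of_coords p) (PiE {..<p} (\<lambda>_. UNIV)) (int_vecs p)"
  unfolding bij_betw_def
proof
  show "inj_on (of_coords p) (PiE {..<p} (\<lambda>_. UNIV))"
  proof (rule inj_onI)
    fix m n :: "nat \<Rightarrow> int"
    assume mn: "m \<in> PiE {..<p} (\<lambda>_. UNIV)" "n \<in> PiE {..<p} (\<lambda>_. UNIV)" "of_coords p m = of_coords p n"
    show "m = n"
    proof (rule PiE_ext[OF mn(1,2)])
      fix i assume "i \<in> {..<p}"
      then show "m i = n i" using fun_cong[OF mn(3), of i] by (simp add: of_coords_def)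
    qed
  qed
  show "of_coords p ` PiE {..<p} (\<lambda>_. UNIV) = int_vecs p"
  proof (intro equalityI subsetI)
    fix f assume "f \<in> of_coords p ` PiE {..<p} (\<lambda>_. UNIV)"
    then obtain n where "f = of_coords p n" by blast
    then show "f \<in> int_vecs p" by (simp add: of_coords_def int_vecs_def periodic_def)
  next
    fix f assume f: "f \<in> int_vecs p"
    have "f = of_coords p (restrict (\<lambda>i. \<lfloor>Re (f i)\<rfloor>) {..<p})"
    proof
      fix i
      have "f i = f (i mod p)" using periodic_mod[of p f i] f by (simp add: int_vecs_def)
      moreover have "f (i mod p) \<in> \<int>" using f by (simp add: int_vecs_def)
      ultimately show "f i = of_coords p (restrict (\<lambda>i. \<lfloor>Re (f i)\<rfloor>) {..<p}) i"
        using assms by (auto simp: of_coords_def elim: Ints_cases)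
    qed
    then show "f \<in> of_coords p ` PiE {..<p} (\<lambda>_. UNIV)"
      by (intro image_eqI[where x = "restrict (\<lambda>i. \<lfloor>Re (f i)\<rfloor>) {..<p}"]) auto
  qed
qed

lemma frac_vecs_eq: "p > 0 \<Longrightarrow> frac_vecs p = scale (1 / of_nat p) ` int_vecs p"
proof (intro equalityI subsetI)
  assume p: "p > 0"
  fix f assume f: "f \<in> frac_vecs p"
  then have "scale (of_nat p) f \<in> int_vecs p" by (simp add: frac_vecs_def int_vecs_def periodic_scale) (simp add: scale_def)
  moreover have "f = scale (1 / of_nat p) (scale (of_nat p) f)" using p by (simp add: scale_def fun_eq_iff)
  ultimately show "f \<in> scale (1 / of_nat p) ` int_vecs p" by blast
qed (auto simp: frac_vecs_def int_vecs_def periodic_def scale_def)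

lemma summable_gauss_weight:
  assumes p: "p > 0" and c: "c > 0"
  shows "(\<lambda>g. exp (\<Sum>l<p. b * \<bar>Re (g l)\<bar> - c * (Re (g l))\<^sup>2)) summable_on frac_vecs p"
proof -
  define h where "h n = exp ((b / real p) * \<bar>of_int n\<bar> - (c / (real p)\<^sup>2) * (of_int n)\<^sup>2 :: real)" for n :: int
  have "h summable_on UNIV" unfolding h_def using c p by (intro summable_on_gauss_int) simp
  moreover have "h n \<ge> 0" for n by (simp add: h_def)
  ultimately have S: "(\<lambda>n. \<Prod>l<p. h (n l)) summable_on PiE {..<p} (\<lambda>_. UNIV)"
    by (intro summable_on_prod_PiE[where f = "\<lambda>_. h"]) auto
  have "bij_betw (scale (1 / of_nat p)) (int_vecs p) (frac_vecs p)"
    unfolding frac_vecs_eq[OF p] using p by (intro inj_on_imp_bij_betw inj_onI) (simp add: scale_def fun_eq_iff)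
  from bij_betw_trans[OF of_coords_bij[OF p] this]
  have bij: "bij_betw (\<lambda>n. scale (1 / of_nat p) (of_coords p n)) (PiE {..<p} (\<lambda>_. UNIV)) (frac_vecs p)"
    by (simp add: o_def)
  have "(\<Prod>l<p. h (n l)) = exp (\<Sum>l<p. b * \<bar>Re (scale (1 / of_nat p) (of_coords p n) l)\<bar> - c * (Re (scale (1 / of_nat p) (of_coords p n) l))\<^sup>2)" for n
    unfolding exp_sum[OF finite_lessThan] using p
    by (intro prod.cong refl) (simp add: h_def scale_def of_coords_def power_divide)
  then show ?thesis 
    using S summable_on_reindex_bij_betw[OF bij, of "\<lambda>g. exp (\<Sum>l<p. b * \<bar>Re (g l)\<bar> - c * (Re (g l))\<^sup>2)"] by simp
qed

lemma frac_vecs_real: "g \<in> frac_vecs p \<Longrightarrow> p > 0 \<Longrightarrow> g l = of_real (Re (g l))"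
proof -
  assume g: "g \<in> frac_vecs p" and p: "p > 0"
  then have "of_nat p * g l \<in> \<int>" by (simp add: frac_vecs_def)
  then obtain n where "of_nat p * g l = of_int n" by (auto elim: Ints_cases)
  then have "Im (of_nat p * g l) = 0" by simp
  then have "Im (g l) = 0" using p by simp
  then show ?thesis by (simp add: complex_eq_iff)
qed

lemma th_term_bound:
  assumes g: "g \<in> frac_vecs p" and p: "p > 0"
  shows "norm (ee (\<tau> * ip p g g / 2 + ip p g z))
    \<le> exp (\<Sum>l<p. (2 * pi * (\<Sum>l<p. \<bar>Im (z l)\<bar>)) * \<bar>Re (g l)\<bar> - (pi * Im \<tau>) * (Re (g l))\<^sup>2)"
proof -
  have gl: "g l = of_real (Re (g l))" for l by (rule frac_vecs_real[OF g p])
  have 1: "ip p g g = of_real (\<Sum>l<p. (Re (g l))\<^sup>2)"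
    unfolding ip_def of_real_sum by (intro sum.cong refl) (subst (1 2) gl, simp add: power2_eq_square)
  have 2: "Im (ip p g z) = (\<Sum>l<p. Re (g l) * Im (z l))"
    unfolding ip_def Im_sum by (intro sum.cong refl) (subst gl, simp)
  have "- Im (ip p g z) \<le> (\<Sum>l<p. (\<Sum>l<p. \<bar>Im (z l)\<bar>) * \<bar>Re (g l)\<bar>)"
    unfolding 2 sum_negf[symmetric]
  proof (rule sum_mono)
    fix l assume l: "l \<in> {..<p}"
    have "- (Re (g l) * Im (z l)) \<le> \<bar>Im (z l)\<bar> * \<bar>Re (g l)\<bar>"
      using abs_ge_minus_self[of "Re (g l) * Im (z l)"] by (simp add: abs_mult mult.commute)
    also have "\<dots> \<le> (\<Sum>l<p. \<bar>Im (z l)\<bar>) * \<bar>Re (g l)\<bar>" using l by (intro mult_right_mono member_le_sum) auto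
    finally show "- (Re (g l) * Im (z l)) \<le> (\<Sum>l<p. \<bar>Im (z l)\<bar>) * \<bar>Re (g l)\<bar>" .
  qed
  then have "2 * pi * (- Im (ip p g z)) \<le> 2 * pi * (\<Sum>l<p. (\<Sum>l<p. \<bar>Im (z l)\<bar>) * \<bar>Re (g l)\<bar>)"
    by (rule mult_left_mono) simp
  moreover have "Im (\<tau> * ip p g g / 2) = Im \<tau> * (\<Sum>l<p. (Re (g l))\<^sup>2) / 2" unfolding 1 by simp
  moreover have "- 2 * pi * (x / 2 + y) = 2 * pi * (- y) - pi * x" for x y :: real by (simp add: algebra_simps)
  ultimately have "- 2 * pi * Im (\<tau> * ip p g g / 2 + ip p g z) \<le> 2 * pi * (\<Sum>l<p. (\<Sum>l<p. \<bar>Im (z l)\<bar>) * \<bar>Re (g l)\<bar>) - pi * (Im \<tau> * (\<Sum>l<p. (Re (g l))\<^sup>2))"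
    by (simp only: plus_complex.sel)
  also have "\<dots> = (\<Sum>l<p. (2 * pi * (\<Sum>l<p. \<bar>Im (z l)\<bar>)) * \<bar>Re (g l)\<bar> - (pi * Im \<tau>) * (Re (g l))\<^sup>2)"
  proof -
    have "(\<Sum>l<p. 2 * pi * A * x l - pi * t * y l) = 2 * pi * (\<Sum>l<p. A * x l) - pi * (t * (\<Sum>l<p. y l))" for A t and x y :: "nat \<Rightarrow> real"
      by (simp add: sum_subtractf sum_distrib_left mult.assoc)
    then show ?thesis by simp
  qed
  finally show ?thesis unfolding norm_ee by simp
qed

lemma th_summable:
  assumes "Im \<tau> > 0" "p > 0" "L \<subseteq> frac_vecs p"
  shows "(\<lambda>g. norm (ee (\<tau> * ip p g g / 2 + ip p g z))) summable_on L"
proof (rule summable_on_comparison_test)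
  show "(\<lambda>g. exp (\<Sum>l<p. (2 * pi * (\<Sum>l<p. \<bar>Im (z l)\<bar>)) * \<bar>Re (g l)\<bar> - (pi * Im \<tau>) * (Re (g l))\<^sup>2)) summable_on L"
    by (rule summable_on_subset[OF summable_gauss_weight]) (use assms in auto)
qed (use assms th_term_bound in auto)

definition th :: "nat \<Rightarrow> cvec set \<Rightarrow> complex \<Rightarrow> cvec \<Rightarrow> complex" where
  "th p L \<tau> z = (\<Sum>\<^sub>\<infinity>g\<in>L. ee (\<tau> * ip p g g / 2 + ip p g z))"

text \<open>The dual side of Poisson summation, kept as a sum of Gaussians at y + z: a shift of z by
  a dual vector then moves only the summation index.\<close>

definition dth :: "nat \<Rightarrow> cvec set \<Rightarrow> complex \<Rightarrow> cvec \<Rightarrow> complex" where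
  "dth p L \<tau> z = (\<Sum>\<^sub>\<infinity>y\<in>L. ee (- (ip p (vadd y z) (vadd y z) / (2 * \<tau>))))"

lemma im_neg_inverse_pos: "Im \<tau> > 0 \<Longrightarrow> Im (- 1 / \<tau>) > 0"
  by (simp add: Im_divide add_nonneg_pos)

lemma dth_term:
  "ee (- (ip p (vadd y z) (vadd y z) / (2 * \<tau>)))
   = ee (- (ip p z z / (2 * \<tau>))) * ee ((- 1 / \<tau>) * ip p y y / 2 + ip p y (scale (- 1 / \<tau>) z))"
proof -
  have "ip p (vadd y z) (vadd y z) = ip p y y + 2 * ip p y z + ip p z z" by (simp add: ip_commute[of p z y])
  then have "- (ip p (vadd y z) (vadd y z) / (2 * \<tau>)) = - (ip p z z / (2 * \<tau>)) + ((- 1 / \<tau>) * ip p y y / 2 + ip p y (scale (- 1 / \<tau>) z))"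
    by (simp add: add_divide_distrib)
  then show ?thesis by (simp only: ee_add)
qed

lemma dth_eq_th: "dth p L \<tau> z = ee (- (ip p z z / (2 * \<tau>))) * th p L (- 1 / \<tau>) (scale (- 1 / \<tau>) z)"
  unfolding dth_def th_def dth_term by (rule infsum_cmult_right')

lemma dth_summable:
  assumes "Im \<tau> > 0" "p > 0" "L \<subseteq> frac_vecs p"
  shows "(\<lambda>y. ee (- (ip p (vadd y z) (vadd y z) / (2 * \<tau>)))) summable_on L"
  unfolding dth_term
  by (intro summable_on_cmult_right, rule abs_summable_summable) (intro th_summable im_neg_inverse_pos assms)

lemma int_vecs_subset_frac: "p > 0 \<Longrightarrow> int_vecs p \<subseteq> frac_vecs p"
  by (auto simp: int_vecs_def frac_vecs_def)

lemma prod_ee: "finite A \<Longrightarrow> (\<Prod>x\<in>A. ee (f x)) = ee (\<Sum>x\<in>A. f x)"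
  by (induction A rule: finite_induct) (auto simp: ee_add)

lemma poisson_int_vecs:
  assumes \<tau>: "Im \<tau> > 0" and p: "p > 0"
  shows "th p (int_vecs p) \<tau> z = csqrt (\<i> / \<tau>) ^ p * dth p (int_vecs p) \<tau> z"
proof -
  let ?P = "PiE {..<p} (\<lambda>_. UNIV :: int set)"
  have "th p (int_vecs p) \<tau> z = (\<Sum>\<^sub>\<infinity>n\<in>?P. \<Prod>l<p. ee (\<tau> * (of_int (n l))\<^sup>2 / 2 + of_int (n l) * z l))"
    unfolding th_def infsum_reindex_bij_betw[OF of_coords_bij[OF p], symmetric]
    by (intro infsum_cong) (simp add: prod_ee ip_def of_coords_def sum.distrib sum_distrib_left sum_divide_distrib power2_eq_square)
  also have "\<dots> = (\<Prod>l<p. \<Sum>\<^sub>\<infinity>n. ee (\<tau> * (of_int n)\<^sup>2 / 2 + of_int n * z l))"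
    by (rule infsum_prod_PiE_abs) (auto intro: theta1_summable[OF \<tau>])
  also have "\<dots> = (\<Prod>l<p. csqrt (\<i> / \<tau>) * (\<Sum>\<^sub>\<infinity>m::int. ee (- ((of_int m + z l)\<^sup>2 / (2 * \<tau>)))))"
    using poisson_theta1[OF \<tau>] by (simp add: theta1_def)
  also have "\<dots> = csqrt (\<i> / \<tau>) ^ p * (\<Prod>l<p. \<Sum>\<^sub>\<infinity>m::int. ee (- ((of_int m + z l)\<^sup>2 / (2 * \<tau>))))"
    by (simp add: prod.distrib)
  also have "(\<Prod>l<p. \<Sum>\<^sub>\<infinity>m::int. ee (- ((of_int m + z l)\<^sup>2 / (2 * \<tau>)))) = (\<Sum>\<^sub>\<infinity>n\<in>?P. \<Prod>l<p. ee (- ((of_int (n l) + z l)\<^sup>2 / (2 * \<tau>))))"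
  proof (rule infsum_prod_PiE_abs[symmetric])
    fix l
    have "ee (- ((of_int m + z l)\<^sup>2 / (2 * \<tau>))) = ee (- ((z l)\<^sup>2 / (2 * \<tau>))) * ee ((- 1 / \<tau>) * (of_int m)\<^sup>2 / 2 + of_int m * (- z l / \<tau>))" for m :: int
      by (simp add: ee_add[symmetric], intro arg_cong[of _ _ ee], simp add: power2_sum add_divide_distrib algebra_simps)
    then show "(\<lambda>m::int. norm (ee (- ((of_int m + z l)\<^sup>2 / (2 * \<tau>))))) summable_on UNIV"
      using theta1_summable[OF im_neg_inverse_pos[OF \<tau>], of "- z l / \<tau>"] by (simp add: norm_mult summable_on_cmult_right)
  qed auto
  also have "(\<Sum>\<^sub>\<infinity>n\<in>?P. \<Prod>l<p. ee (- ((of_int (n l) + z l)\<^sup>2 / (2 * \<tau>)))) = dth p (int_vecs p) \<tau> z"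
    unfolding dth_def infsum_reindex_bij_betw[OF of_coords_bij[OF p], symmetric]
    by (intro infsum_cong) (simp add: prod_ee ip_def vadd_def of_coords_def sum_negf sum_divide_distrib power2_eq_square)
  finally show ?thesis .
qed

text \<open>Averaging over the characters of a quotient of order p passes from a lattice to a sublattice.\<close>

lemma poisson_sublattice:
  assumes \<tau>: "Im \<tau> > 0" and p: "p > 0" and sub: "L \<subseteq> frac_vecs p" "M' \<subseteq> frac_vecs p"
    and y0: "\<And>g. g \<in> L \<Longrightarrow> of_nat p * ip p g y0 \<in> \<int>"
    and bij: "bij_betw (\<lambda>(t, y). vadd y (scale (of_nat t) y0)) ({..<p} \<times> L') M'"
    and P: "\<And>t. th p L \<tau> (vadd z (scale (of_nat t) y0)) = C * dth p L' \<tau> (vadd z (scale (of_nat t) y0))"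
  shows "th p {g \<in> L. ip p g y0 \<in> \<int>} \<tau> z = C / of_nat p * dth p M' \<tau> z"
proof -
  let ?E = "\<lambda>g. ee (\<tau> * ip p g g / 2 + ip p g z)"
  let ?D = "\<lambda>y. ee (- (ip p (vadd y z) (vadd y z) / (2 * \<tau>)))"
  have sE: "(\<lambda>g. ?E g * ee (of_nat t * ip p g y0)) summable_on L" for t
  proof -
    have "(\<lambda>g. ee (\<tau> * ip p g g / 2 + ip p g (vadd z (scale (of_nat t) y0)))) summable_on L"
      by (rule abs_summable_summable) (rule th_summable[OF \<tau> p sub(1)])
    then show ?thesis by (simp add: ee_add mult.assoc)
  qed
  have "(\<Sum>t<p. th p L \<tau> (vadd z (scale (of_nat t) y0))) = (\<Sum>t<p. \<Sum>\<^sub>\<infinity>g\<in>L. ?E g * ee (of_nat t * ip p g y0))"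
    unfolding th_def by (simp add: ee_add mult.assoc)
  also have "\<dots> = (\<Sum>\<^sub>\<infinity>g\<in>L. \<Sum>t<p. ?E g * ee (of_nat t * ip p g y0))"
    by (rule infsumI[symmetric, OF has_sum_finite_sum]) (auto intro!: has_sum_infsum sE)
  also have "\<dots> = (\<Sum>\<^sub>\<infinity>g\<in>L. ?E g * (if ip p g y0 \<in> \<int> then of_nat p else 0))"
  proof (rule infsum_cong)
    fix g assume "g \<in> L"
    then obtain n :: int where n: "of_nat p * ip p g y0 = of_int n" using y0 by (auto elim: Ints_cases)
    then have n': "ip p g y0 = of_int n / of_nat p" using p by (simp add: field_simps)
    have "(\<Sum>t<p. ?E g * ee (of_nat t * ip p g y0)) = ?E g * (\<Sum>t<p. ee (of_int n * of_nat t / of_nat p))"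
      unfolding n' sum_distrib_left by (intro sum.cong refl) (simp add: mult.commute)
    also have "(\<Sum>t<p. ee (of_int n * of_nat t / of_nat p)) = (if int p dvd n then of_nat p else 0)"
      by (rule sum_ee_roots[OF p])
    also have "int p dvd n \<longleftrightarrow> ip p g y0 \<in> \<int>"
    proof
      assume "int p dvd n"
      then show "ip p g y0 \<in> \<int>" using p by (auto simp: n')
    next
      assume "ip p g y0 \<in> \<int>"
      then obtain m where "ip p g y0 = of_int m" by (auto elim: Ints_cases)
      then have "(of_int (int p * m) :: complex) = of_int n" using n by simp
      then have "int p * m = n" by (simp only: of_int_eq_iff)
      then show "int p dvd n" by auto
    qed
    finally show "(\<Sum>t<p. ?E g * ee (of_nat t * ip p g y0)) = ?E g * (if ip p g y0 \<in> \<int> then of_nat p else 0)" .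
  qed
  also have "\<dots> = (\<Sum>\<^sub>\<infinity>g\<in>{g \<in> L. ip p g y0 \<in> \<int>}. ?E g * of_nat p)"
    by (rule infsum_cong_neutral) auto
  also have "\<dots> = th p {g \<in> L. ip p g y0 \<in> \<int>} \<tau> z * of_nat p"
    unfolding th_def by (rule infsum_cmult_left')
  finally have 1: "(\<Sum>t<p. th p L \<tau> (vadd z (scale (of_nat t) y0))) = th p {g \<in> L. ip p g y0 \<in> \<int>} \<tau> z * of_nat p" .
  have sD: "?D summable_on M'" by (rule dth_summable[OF \<tau> p sub(2)])
  have "(\<lambda>(t, y). ?D (vadd y (scale (of_nat t) y0))) summable_on ({..<p} \<times> L')"
    using sD summable_on_reindex_bij_betw[OF bij, of ?D] by (simp add: case_prod_unfold)
  then have "(\<Sum>\<^sub>\<infinity>t\<in>{..<p}. \<Sum>\<^sub>\<infinity>y\<in>L'. ?D (vadd y (scale (of_nat t) y0))) = (\<Sum>\<^sub>\<infinity>(t, y)\<in>{..<p} \<times> L'. ?D (vadd y (scale (of_nat t) y0)))"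
    by (rule infsum_Sigma'_banach)
  also have "\<dots> = infsum ?D M'"
    using infsum_reindex_bij_betw[OF bij, of ?D] by (simp add: case_prod_unfold)
  finally have "(\<Sum>t<p. \<Sum>\<^sub>\<infinity>y\<in>L'. ?D (vadd y (scale (of_nat t) y0))) = dth p M' \<tau> z" by (simp add: dth_def)
  moreover have "(\<Sum>\<^sub>\<infinity>y\<in>L'. ?D (vadd y (scale (of_nat t) y0))) = dth p L' \<tau> (vadd z (scale (of_nat t) y0))" for t
  proof -
    have "vadd (vadd y (scale (of_nat t) y0)) z = vadd y (vadd z (scale (of_nat t) y0))" for y
      by (simp add: vadd_def fun_eq_iff)
    then show ?thesis by (simp add: dth_def)
  qed
  ultimately have "(\<Sum>t<p. dth p L' \<tau> (vadd z (scale (of_nat t) y0))) = dth p M' \<tau> z" by simp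
  then have "C * dth p M' \<tau> z = th p {g \<in> L. ip p g y0 \<in> \<int>} \<tau> z * of_nat p"
    unfolding 1[symmetric] by (simp add: P flip: sum_distrib_left)
  then show ?thesis using p by (simp add: field_simps)
qed

lemma csqrt_divide_of_nat: "p > 0 \<Longrightarrow> csqrt (z / of_nat p) = csqrt z / of_real (sqrt (real p))"
proof (rule csqrt_unique)
  assume p: "p > 0"
  have "(of_real (sqrt (real p)))\<^sup>2 = (of_nat p :: complex)" by (simp flip: of_real_power)
  then show "(csqrt z / of_real (sqrt (real p)))\<^sup>2 = z / of_nat p" by (simp add: power_divide)
  have "Re (csqrt z / of_real (sqrt (real p))) = Re (csqrt z) / sqrt (real p)" "Im (csqrt z / of_real (sqrt (real p))) = Im (csqrt z) / sqrt (real p)"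
    by simp_all
  then show "0 < Re (csqrt z / of_real (sqrt (real p))) \<or> Re (csqrt z / of_real (sqrt (real p))) = 0 \<and> 0 \<le> Im (csqrt z / of_real (sqrt (real p)))"
    using csqrt_principal[of z] p by auto
qed

section \<open>Poisson summation for the lattices\<close>

lemma delta_pow_const:
  assumes "a \<ge> 1"
  shows "(delta ^^ a) (\<lambda>_. c) = (\<lambda>_. 0)"
proof -
  have "(delta ^^ a) (\<lambda>_. 0) = (\<lambda>_. 0)" for a
    by (induction a) (simp_all add: delta_def fun_eq_iff)
  moreover obtain b where "a = Suc b" using assms by (cases a) auto
  moreover have "delta (\<lambda>_. c) = (\<lambda>_. 0)" by (simp add: delta_def fun_eq_iff)
  ultimately show ?thesis by (simp only: funpow_Suc_right o_apply)
qed

lemma delta_integral_offset: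
  assumes x: "periodic p x" "(\<Sum>l<p. x l) = 0" and d: "\<And>i. delta x i \<in> \<int>" and p: "p > 0"
  obtains m :: int where "\<And>i. x i - of_int m / of_nat p \<in> \<int>"
proof -
  have n: "x i - x 0 \<in> \<int>" for i
  proof (induction i)
    case (Suc i)
    have eq: "x (Suc i) - x 0 = (x i - x 0) - delta x i" by (simp add: delta_def)
    show ?case unfolding eq by (rule Ints_diff[OF Suc d])
  qed simp
  have "(\<Sum>l<p. x l - x 0) \<in> \<int>" by (intro Ints_sum n)
  then have "- (of_nat p * x 0) \<in> \<int>" using x(2) by (simp add: sum_subtractf)
  then have "of_nat p * x 0 \<in> \<int>" by (simp only: minus_in_Ints_iff)
  then obtain m where m: "of_nat p * x 0 = of_int m" by (auto elim: Ints_cases)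
  then have "x 0 = of_int m / of_nat p" using p by (simp add: field_simps)
  then show ?thesis using that n by auto
qed

text \<open>Negated partial sums invert \<open>delta\<close>, and they are periodic because the
  total over a period vanishes. So \<open>lat p 1\<close> is the root lattice of type A.\<close>

lemma lat_1_eq:
  assumes p: "p > 0"
  shows "lat p 1 = int_vecs p \<inter> hyperplane p"
proof
  show "lat p 1 \<subseteq> int_vecs p \<inter> hyperplane p"
    using lat_subset_int_vecs[of p 1] lat_subset_hyperplane[OF p, of 1] by auto
  show "int_vecs p \<inter> hyperplane p \<subseteq> lat p 1"
  proof
    fix g assume g: "g \<in> int_vecs p \<inter> hyperplane p"
    define f where "f i = - (\<Sum>j<i. g j)" for i
    have "f (i + p) = f i" for i
    proof -
      have "(\<Sum>j<i + p. g j) = (\<Sum>j<i. g j) + (\<Sum>j<p. g (j + i))"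
      proof (induction p)
        case (Suc q)
        then show ?case by (simp add: add.commute add.left_commute)
      qed simp
      then show ?thesis using g sum_shift_periodic[of p g i] p by (simp add: f_def hyperplane_def)
    qed
    moreover have "f i \<in> \<int>" for i using g unfolding f_def minus_in_Ints_iff by (intro Ints_sum) (auto simp: int_vecs_def)
    ultimately have "f \<in> int_vecs p" by (simp add: int_vecs_def periodic_def)
    moreover have "g = (delta ^^ 1) f" by (simp add: fun_eq_iff delta_def f_def)
    ultimately show "g \<in> lat p 1" unfolding lat_def by blast
  qed
qed

lemma ip_const: "ip p g (\<lambda>_. c) = c * (\<Sum>l<p. g l)" "ip p (\<lambda>_. c) g = c * (\<Sum>l<p. g l)"
  by (simp_all add: ip_def sum_distrib_left mult.commute)

lemma infsum_prod_split:
  fixes f :: "'a \<Rightarrow> complex" and g :: "'b \<Rightarrow> complex"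
  assumes bij: "bij_betw h (A \<times> B) C" and eq: "\<And>x y. x \<in> A \<Longrightarrow> y \<in> B \<Longrightarrow> F (h (x, y)) = f x * g y"
    and summ: "F summable_on C"
  shows "infsum F C = infsum f A * infsum g B"
proof -
  have "(\<lambda>z. F (h z)) summable_on (A \<times> B)" using summ summable_on_reindex_bij_betw[OF bij] by blast
  then have s: "(\<lambda>(x, y). f x * g y) summable_on (A \<times> B)"
    by (rule summable_on_cong[THEN iffD1, rotated]) (auto simp: eq)
  have "infsum F C = infsum (\<lambda>z. F (h z)) (A \<times> B)" by (rule infsum_reindex_bij_betw[OF bij, symmetric])
  also have "\<dots> = infsum (\<lambda>(x, y). f x * g y) (A \<times> B)" by (rule infsum_cong) (auto simp: eq)
  also have "\<dots> = (\<Sum>\<^sub>\<infinity>x\<in>A. \<Sum>\<^sub>\<infinity>y\<in>B. f x * g y)" by (rule infsum_Sigma'_banach[OF s, symmetric])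
  also have "\<dots> = infsum f A * infsum g B" by (simp add: infsum_cmult_right' infsum_cmult_left')
  finally show ?thesis .
qed

context odd_prime
begin

lemma dual_lat_subset_frac: "2 * a \<le> p - 1 \<Longrightarrow> dual_lat p a \<subseteq> frac_vecs p"
proof
  fix y assume a: "2 * a \<le> p - 1" and y: "y \<in> dual_lat p a"
  from dual_lat_scale_prime[OF y a] have "scale (of_nat p) y \<in> int_vecs p" using lat_subset_int_vecs by blast
  then show "y \<in> frac_vecs p" using y by (simp add: frac_vecs_def int_vecs_def scale_def dual_lat_def hyperplane_def)
qed

lemma lat_subset_frac: "lat p a \<subseteq> frac_vecs p"
  using lat_subset_int_vecs int_vecs_subset_frac[OF p_pos] by blast

lemma p_ge_3: "p \<ge> 3"
  using prime_ge_2_nat[OF prime] odd by (cases "p = 2") auto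

text \<open>The lattice generated by the integer vectors and the constant vector 1/p, that is the
  dual of the integer vectors with coordinate sum divisible by p.\<close>

definition base_dual :: "cvec set" where
  "base_dual = {v. periodic p v \<and> (\<forall>i. of_nat p * v i \<in> \<int>) \<and> (\<forall>i. v i - v (i + 1) \<in> \<int>)}"

lemma base_dual_diff: "v \<in> base_dual \<Longrightarrow> v i - v 0 \<in> \<int>"
proof (induction i)
  case (Suc i)
  have "v (Suc i) - v 0 = (v i - v 0) - (v i - v (i + 1))" by simp
  moreover have "v i - v (i + 1) \<in> \<int>" using Suc.prems by (simp add: base_dual_def)
  ultimately show ?case using Suc by (metis Ints_diff)
qed simp

lemma base_dual_bij1:
  "bij_betw (\<lambda>(t, y). vadd y (scale (of_nat t) (\<lambda>_. 1 / of_nat p))) ({..<p} \<times> int_vecs p) base_dual"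
  unfolding bij_betw_def
proof
  show "inj_on (\<lambda>(t, y). vadd y (scale (of_nat t) (\<lambda>_. 1 / of_nat p))) ({..<p} \<times> int_vecs p)"
  proof (rule inj_onI, clarify)
    fix s t y w assume st: "s < p" "t < p" and yw: "y \<in> int_vecs p" "w \<in> int_vecs p"
      and eq: "vadd y (scale (of_nat s) (\<lambda>_. 1 / of_nat p)) = vadd w (scale (of_nat t) (\<lambda>_. 1 / of_nat p))"
    have e: "y i + of_nat s / of_nat p = w i + of_nat t / of_nat p" for i
      using fun_cong[OF eq, of i] by (simp add: vadd_def scale_def)
    have "y 0 - w 0 \<in> \<int>" using yw by (simp add: int_vecs_def)
    then obtain m where m: "y 0 - w 0 = of_int m" by (auto elim: Ints_cases)
    have "(of_int (int t - int s) :: complex) = of_int (int p * m)"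
      using e[of 0] m p_pos by (simp add: field_simps)
    then have "int t - int s = int p * m" by (simp only: of_int_eq_iff)
    then have "int p dvd int t - int s" by simp
    moreover have "\<bar>int t - int s\<bar> < int p" using st by auto
    ultimately have "s = t" using zdvd_not_zless[of "\<bar>int t - int s\<bar>" "int p"] by fastforce
    then show "s = t \<and> y = w" using e by (simp add: fun_eq_iff)
  qed
  show "(\<lambda>(t, y). vadd y (scale (of_nat t) (\<lambda>_. 1 / of_nat p))) ` ({..<p} \<times> int_vecs p) = base_dual"
  proof (intro equalityI subsetI)
    fix v assume "v \<in> (\<lambda>(t, y). vadd y (scale (of_nat t) (\<lambda>_. 1 / of_nat p))) ` ({..<p} \<times> int_vecs p)"
    then show "v \<in> base_dual" using p_pos
      by (auto simp: base_dual_def int_vecs_def vadd_def scale_def periodic_def distrib_left)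
  next
    fix v assume v: "v \<in> base_dual"
    then have "of_nat p * v 0 \<in> \<int>" by (simp add: base_dual_def)
    then obtain m where m: "of_nat p * v 0 = of_int m" by (auto elim: Ints_cases)
    define t where "t = nat (m mod int p)"
    have t: "t < p" "int t = m mod int p" using p_pos by (simp_all add: t_def nat_less_iff)
    define y where "y = vadd v (\<lambda>_. - (of_nat t / of_nat p))"
    have v0: "v 0 - of_nat t / of_nat p = of_int (m div int p)"
    proof -
      have "(of_int m :: complex) = of_int (int p * (m div int p) + int t)" unfolding t(2) by simp
      then show ?thesis using m p_pos by (simp add: field_simps)
    qed
    have "y i \<in> \<int>" for i
    proof -
      have "y i = (v i - v 0) + (v 0 - of_nat t / of_nat p)" by (simp add: y_def vadd_def)
      then show ?thesis using base_dual_diff[OF v, of i] unfolding v0 by simp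
    qed
    then have "y \<in> int_vecs p" using v by (simp add: int_vecs_def y_def vadd_def periodic_def base_dual_def)
    moreover have "v = vadd y (scale (of_nat t) (\<lambda>_. 1 / of_nat p))" by (simp add: y_def vadd_def scale_def fun_eq_iff)
    ultimately show "v \<in> (\<lambda>(t, y). vadd y (scale (of_nat t) (\<lambda>_. 1 / of_nat p))) ` ({..<p} \<times> int_vecs p)"
      using t by (intro image_eqI[of _ _ "(t, y)"]) auto
  qed
qed

lemma hyperplane_const_inj:
  assumes "x \<in> hyperplane p" "y \<in> hyperplane p" "vadd x (\<lambda>_. c) = vadd y (\<lambda>_. d)"
  shows "x = y \<and> c = d"
proof -
  have e: "x i + c = y i + d" for i using fun_cong[OF assms(3), of i] by (simp add: vadd_def)
  have "(\<Sum>i<p. x i + c) = (\<Sum>i<p. y i + d)" by (simp only: e)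
  then have "c = d" using assms p_pos by (simp add: hyperplane_def sum.distrib)
  then show ?thesis using e by (simp add: fun_eq_iff)
qed

text \<open>The coordinate sum m is an integer; removing the mean m / p leaves a vector of the dual
  root lattice.\<close>

lemma base_dual_bij2:
  "bij_betw (\<lambda>(w, m). vadd w (\<lambda>_. of_int m / of_nat p)) (dual_lat p 1 \<times> UNIV) base_dual"
  unfolding bij_betw_def
proof
  show "inj_on (\<lambda>(w, m). vadd w (\<lambda>_. of_int m / of_nat p)) (dual_lat p 1 \<times> (UNIV :: int set))"
    using hyperplane_const_inj p_pos by (intro inj_onI) (fastforce simp: dual_lat_def)
  show "(\<lambda>(w, m). vadd w (\<lambda>_. of_int m / of_nat p)) ` (dual_lat p 1 \<times> (UNIV :: int set)) = base_dual"
  proof (intro equalityI subsetI)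
    fix v assume "v \<in> (\<lambda>(w, m). vadd w (\<lambda>_. of_int m / of_nat p)) ` (dual_lat p 1 \<times> (UNIV :: int set))"
    then obtain w and m :: int where w: "w \<in> dual_lat p 1" "v = vadd w (\<lambda>_. of_int m / of_nat p)" by auto
    have "2 * 1 \<le> p - 1" using p_ge_3 by simp
    then have "w \<in> frac_vecs p" using dual_lat_subset_frac w(1) by blast
    then show "v \<in> base_dual" using w p_pos
      by (auto simp: base_dual_def vadd_def periodic_def distrib_left dual_lat_def int_vecs_def delta_def frac_vecs_def)
  next
    fix v assume v: "v \<in> base_dual"
    define S where "S = (\<Sum>l<p. v l)"
    have "S = (\<Sum>l<p. v l - v 0) + of_nat p * v 0" by (simp add: S_def sum_subtractf)
    moreover have "(\<Sum>l<p. v l - v 0) \<in> \<int>" by (intro Ints_sum base_dual_diff v)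
    moreover have "of_nat p * v 0 \<in> \<int>" using v by (simp add: base_dual_def)
    ultimately have "S \<in> \<int>" by simp
    then obtain m where m: "S = of_int m" by (auto elim: Ints_cases)
    define w where "w = vadd v (\<lambda>_. - (of_int m / of_nat p))"
    have "(\<Sum>l<p. w l) = 0" using m p_pos by (simp add: S_def w_def vadd_def sum_subtractf)
    then have wh: "w \<in> hyperplane p" using v by (simp add: hyperplane_def w_def vadd_def periodic_def base_dual_def)
    have "delta w i \<in> \<int>" for i using v by (simp add: delta_def w_def vadd_def base_dual_def)
    then have "w \<in> dual_lat p 1"
      using wh periodic_delta_pow[of p w 1] by (simp add: dual_lat_def hyperplane_def int_vecs_def)
    moreover have "v = vadd w (\<lambda>_. of_int m / of_nat p)" by (simp add: w_def vadd_def fun_eq_iff)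
    ultimately show "v \<in> (\<lambda>(w, m). vadd w (\<lambda>_. of_int m / of_nat p)) ` (dual_lat p 1 \<times> (UNIV :: int set))" by force
  qed
qed

lemma base_lat_bij:
  "bij_betw (\<lambda>(h, m). vadd h (\<lambda>_. of_int m)) (lat p 1 \<times> UNIV) {g \<in> int_vecs p. ip p g (\<lambda>_. 1 / of_nat p) \<in> \<int>}"
  unfolding bij_betw_def
proof
  show "inj_on (\<lambda>(h, m). vadd h (\<lambda>_. of_int m)) (lat p 1 \<times> (UNIV :: int set))"
  proof (rule inj_onI, clarify)
    fix h h' and m m' :: int
    assume "h \<in> lat p 1" "h' \<in> lat p 1" "vadd h (\<lambda>_. complex_of_int m) = vadd h' (\<lambda>_. of_int m')"
    then show "h = h' \<and> m = m'" using hyperplane_const_inj[of h h' "of_int m" "of_int m'"] unfolding lat_1_eq[OF p_pos] by auto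
  qed
  show "(\<lambda>(h, m). vadd h (\<lambda>_. of_int m)) ` (lat p 1 \<times> (UNIV :: int set)) = {g \<in> int_vecs p. ip p g (\<lambda>_. 1 / of_nat p) \<in> \<int>}"
  proof (intro equalityI subsetI)
    fix v assume "v \<in> (\<lambda>(h, m). vadd h (\<lambda>_. of_int m)) ` (lat p 1 \<times> (UNIV :: int set))"
    then obtain h and m :: int where h: "h \<in> lat p 1" "v = vadd h (\<lambda>_. of_int m)" by auto
    have "(\<Sum>l<p. v l) = of_nat p * of_int m"
      using h unfolding lat_1_eq[OF p_pos] by (simp add: vadd_def sum.distrib hyperplane_def)
    then show "v \<in> {g \<in> int_vecs p. ip p g (\<lambda>_. 1 / of_nat p) \<in> \<int>}"
      using h p_pos unfolding lat_1_eq[OF p_pos] by (simp add: ip_const int_vecs_def vadd_def periodic_def)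
  next
    fix v assume v: "v \<in> {g \<in> int_vecs p. ip p g (\<lambda>_. 1 / of_nat p) \<in> \<int>}"
    then obtain m where m: "ip p v (\<lambda>_. 1 / of_nat p) = of_int m" by (auto elim: Ints_cases)
    then have S: "(\<Sum>l<p. v l) = of_nat p * of_int m" using p_pos by (simp add: ip_const field_simps)
    define h where "h = vadd v (\<lambda>_. - of_int m)"
    have "h \<in> lat p 1" using v S unfolding lat_1_eq[OF p_pos]
      by (simp add: h_def int_vecs_def vadd_def periodic_def hyperplane_def sum_subtractf)
    moreover have "v = vadd h (\<lambda>_. of_int m)" by (simp add: h_def vadd_def fun_eq_iff)
    ultimately show "v \<in> (\<lambda>(h, m). vadd h (\<lambda>_. of_int m)) ` (lat p 1 \<times> (UNIV :: int set))" by force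
  qed
qed

text \<open>The sublattice of integer vectors whose coordinate sum is divisible by p splits orthogonally into the
  root lattice and the multiples of the all-one vector; the theta series of the latter is divided out.\<close>

lemma poisson_root_lattice:
  assumes \<tau>: "Im \<tau> > 0" and z: "z \<in> hyperplane p"
  shows "th p (lat p 1) \<tau> z = csqrt (\<i> / \<tau>) ^ (p - 1) / of_real (sqrt (real p)) * dth p (dual_lat p 1) \<tau> z"
proof -
  define c where "c = csqrt (\<i> / \<tau>)"
  have c0: "c \<noteq> 0" using \<tau> by (auto simp: c_def)
  have p0: "of_nat p \<noteq> (0 :: complex)" using p_pos by simp
  have p\<tau>: "Im (of_nat p * \<tau>) > 0" using \<tau> p_pos by simp
  \<comment> \<open>The shift along the all-one vector is free. It is chosen such that the theta
    value to be cancelled is nonzero.\<close>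
  obtain s' where s': "theta1 (of_nat p * \<tau>) s' \<noteq> 0" using theta1_nonvanishing[OF p\<tau>] by blast
  define s where "s = s' / of_nat p"
  have s: "s' = of_nat p * s" using p0 by (simp add: s_def)
  define zs where "zs = vadd z (\<lambda>_. s)"
  let ?M = "{g \<in> int_vecs p. ip p g (\<lambda>_. 1 / of_nat p) \<in> \<int>}"
  have "th p ?M \<tau> zs = c ^ p / of_nat p * dth p base_dual \<tau> zs"
  proof (rule poisson_sublattice[OF \<tau> p_pos int_vecs_subset_frac[OF p_pos] _ _ base_dual_bij1])
    show "base_dual \<subseteq> frac_vecs p" by (auto simp: base_dual_def frac_vecs_def)
    show "of_nat p * ip p g (\<lambda>_. 1 / of_nat p) \<in> \<int>" if "g \<in> int_vecs p" for g
      using that p_pos by (simp add: ip_const int_vecs_def Ints_sum)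
  qed (simp add: poisson_int_vecs[OF \<tau> p_pos] c_def)
  also have "th p ?M \<tau> zs = th p (lat p 1) \<tau> z * theta1 (of_nat p * \<tau>) s'"
    unfolding th_def theta1_def
  proof (rule infsum_prod_split[OF base_lat_bij])
    fix h and m :: int assume "h \<in> lat p 1"
    then have h: "(\<Sum>l<p. h l) = 0" unfolding lat_1_eq[OF p_pos] by (simp add: hyperplane_def)
    then have hs: "sum (vadd h (\<lambda>_. of_int m)) {..<p} = of_nat p * of_int m" by (simp add: vadd_def sum.distrib)
    have zz: "(\<Sum>l<p. z l) = 0" using z by (simp add: hyperplane_def)
    show "ee (\<tau> * ip p (case (h, m) of (h, m) \<Rightarrow> vadd h (\<lambda>_. of_int m)) (case (h, m) of (h, m) \<Rightarrow> vadd h (\<lambda>_. of_int m)) / 2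
        + ip p (case (h, m) of (h, m) \<Rightarrow> vadd h (\<lambda>_. of_int m)) zs)
      = ee (\<tau> * ip p h h / 2 + ip p h z) * ee (of_nat p * \<tau> * (of_int m)\<^sup>2 / 2 + of_int m * s')"
      unfolding ee_add[symmetric] s zs_def
      by (simp add: ip_const h zz hs power2_eq_square) (simp add: algebra_simps add_divide_distrib)
  next
    show "(\<lambda>g. ee (\<tau> * ip p g g / 2 + ip p g zs)) summable_on ?M"
      by (rule abs_summable_summable, rule th_summable[OF \<tau> p_pos]) (use int_vecs_subset_frac[OF p_pos] in auto)
  qed
  also have "dth p base_dual \<tau> zs = dth p (dual_lat p 1) \<tau> z * (\<Sum>\<^sub>\<infinity>m::int. ee (- ((of_int m + s')\<^sup>2 / (2 * (of_nat p * \<tau>)))))"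
    unfolding dth_def
  proof (rule infsum_prod_split[OF base_dual_bij2])
    fix w and m :: int assume "w \<in> dual_lat p 1"
    then have w: "(\<Sum>l<p. w l) = 0" by (simp add: dual_lat_def hyperplane_def)
    have zz: "(\<Sum>l<p. z l) = 0" using z by (simp add: hyperplane_def)
    define c' where "c' = of_int m / of_nat p + s"
    have v: "vadd (vadd w (\<lambda>_. of_int m / of_nat p)) zs = vadd (vadd w z) (\<lambda>_. c')"
      by (simp add: vadd_def zs_def c'_def fun_eq_iff)
    have c': "of_int m + s' = of_nat p * c'" using p0 by (simp add: c'_def s distrib_left)
    have s1: "(\<Sum>l<p. vadd w z l) = 0" by (simp add: vadd_def sum.distrib w zz)
    have s2: "sum (vadd (vadd w z) (\<lambda>_. c')) {..<p} = of_nat p * c'" by (simp add: vadd_def sum.distrib w zz)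
    have iq: "ip p (vadd (vadd w z) (\<lambda>_. c')) (vadd (vadd w z) (\<lambda>_. c')) = ip p (vadd w z) (vadd w z) + of_nat p * c'\<^sup>2"
      by (simp only: ip_vadd_left[of p "vadd w z"] ip_vadd_right[of p _ "vadd w z"] ip_const s1 s2) (simp add: power2_eq_square)
    have dv: "(of_nat p * c')\<^sup>2 / (2 * (of_nat p * \<tau>)) = of_nat p * c'\<^sup>2 / (2 * \<tau>)"
      using p0 by (simp add: power2_eq_square)
    show "ee (- (ip p (vadd (case (w, m) of (w, m) \<Rightarrow> vadd w (\<lambda>_. of_int m / of_nat p)) zs)
          (vadd (case (w, m) of (w, m) \<Rightarrow> vadd w (\<lambda>_. of_int m / of_nat p)) zs) / (2 * \<tau>)))
      = ee (- (ip p (vadd w z) (vadd w z) / (2 * \<tau>))) * ee (- ((of_int m + s')\<^sup>2 / (2 * (of_nat p * \<tau>))))"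
      unfolding ee_add[symmetric] c' prod.case v iq dv by (simp only: add_divide_distrib minus_add_distrib)
  next
    show "(\<lambda>v. ee (- (ip p (vadd v zs) (vadd v zs) / (2 * \<tau>)))) summable_on base_dual"
      by (rule dth_summable[OF \<tau> p_pos]) (auto simp: base_dual_def frac_vecs_def)
  qed
  finally have 1: "th p (lat p 1) \<tau> z * theta1 (of_nat p * \<tau>) s' =
     c ^ p / of_nat p * (dth p (dual_lat p 1) \<tau> z * (\<Sum>\<^sub>\<infinity>m::int. ee (- ((of_int m + s')\<^sup>2 / (2 * (of_nat p * \<tau>))))))" .
  have "csqrt (\<i> / (of_nat p * \<tau>)) = c / of_real (sqrt (real p))"
    using csqrt_divide_of_nat[OF p_pos, of "\<i> / \<tau>"] by (simp add: c_def mult.commute)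
  then have 2: "theta1 (of_nat p * \<tau>) s' = c / of_real (sqrt (real p)) * (\<Sum>\<^sub>\<infinity>m::int. ee (- ((of_int m + s')\<^sup>2 / (2 * (of_nat p * \<tau>)))))"
    using poisson_theta1[OF p\<tau>, of s'] by simp
  define S where "S = (\<Sum>\<^sub>\<infinity>m::int. ee (- ((of_int m + s')\<^sup>2 / (2 * (of_nat p * \<tau>)))))"
  have S0: "S \<noteq> 0" using s' 2 by (auto simp: S_def)
  define r where "r = complex_of_real (sqrt (real p))"
  have r: "r * r = of_nat p" "r \<noteq> 0" using p_pos by (simp_all add: r_def flip: of_real_mult)
  have "c ^ p = c ^ (p - 1) * c" using p_pos by (metis power_minus_mult)
  then have "th p (lat p 1) \<tau> z * (c / r * S) = c ^ (p - 1) * c / (r * r) * (dth p (dual_lat p 1) \<tau> z * S)"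
    using 1 unfolding 2 S_def[symmetric] r_def[symmetric] r(1) by simp
  then have "th p (lat p 1) \<tau> z = c ^ (p - 1) / r * dth p (dual_lat p 1) \<tau> z"
    using S0 r(2) c0 by (simp add: field_simps)
  then show ?thesis by (simp add: c_def r_def)
qed

text \<open>Minus the projection of the unit vector at 0 to the hyperplane. It is not integral but
  its differences are, so a vector y with a-th difference equal to it lies in the next dual lattice
  and not in the present one.\<close>

definition chain_target :: "cvec" where
  "chain_target = vadd (\<lambda>_. 1 / of_nat p) (scale (- 1) (unit_vec p 0))"

lemma chain_target_hyperplane: "chain_target \<in> hyperplane p"
proof -
  have "(\<Sum>l<p. unit_vec p 0 l) = 1"
    using ip_unit_vec[OF p_pos, of "\<lambda>_. 1"] by (simp add: ip_const)
  then have "(\<Sum>l<p. chain_target l) = 0"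
    using p_pos by (simp add: chain_target_def vadd_def scale_def sum_subtractf)
  then show ?thesis
    using unit_vec_int[of p 0] by (simp add: hyperplane_def chain_target_def int_vecs_def periodic_def vadd_def scale_def)
qed

text \<open>On the hyperplane p is a multiple of (1 - X)^a; applying the complementary factor to the
  target and dividing by p inverts the a-th difference.\<close>

lemma chain_vector:
  assumes "a \<le> p - 1"
  obtains y where "y \<in> hyperplane p" "(delta ^^ a) y = chain_target"
proof -
  obtain H where H: "\<And>f i. f \<in> hyperplane p \<Longrightarrow> of_nat p * f i = poly_act ([:1, - 1:] ^ (p - 1) * H) f i"
    using ramified by blast
  define y where "y = scale (1 / of_nat p) (poly_act ([:1, - 1:] ^ (p - 1 - a) * H) chain_target)"
  have "p - 1 = a + (p - 1 - a)" using assms by simp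
  then have u: "([:1, - 1:] :: int poly) ^ (p - 1) * H = [:1, - 1:] ^ a * ([:1, - 1:] ^ (p - 1 - a) * H)"
    by (metis power_add mult.assoc)
  have "y \<in> hyperplane p"
    unfolding y_def by (intro hyperplane_scale delta_pow_hyperplane' chain_target_hyperplane p_pos)
  moreover have "(delta ^^ a) y = chain_target"
  proof
    fix i
    have "(delta ^^ a) y i = 1 / of_nat p * poly_act ([:1, - 1:] ^ (p - 1) * H) chain_target i"
      unfolding y_def delta_pow_scale u poly_act_mult'[of "[:1, - 1:] ^ a"] poly_act_delta_pow by (simp add: scale_def)
    then show "(delta ^^ a) y i = chain_target i"
      using H[OF chain_target_hyperplane, of i] p_pos by (metis nonzero_mult_div_cancel_left of_nat_eq_0_iff less_irrefl times_divide_eq_left mult_1)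
  qed
  ultimately show ?thesis by (rule that)
qed

text \<open>Moving the differences to y leaves the pairing of f with the target: modulo integers and
  up to sign this is the sum of f divided by p.\<close>

lemma chain_pairing:
  assumes f: "f \<in> int_vecs p" and y: "y \<in> hyperplane p" "(delta ^^ a) y = chain_target"
  obtains m :: int where "ip p ((delta ^^ a) f) y = (- 1) ^ a * ((\<Sum>l<p. f l) / of_nat p - of_int m)"
proof -
  let ?w = "\<lambda>l. unit_vec p 0 (l + a * (p - 1))"
  have "ip p f ?w \<in> \<int>" using f unit_vec_int[of p 0] by (intro ip_Ints) (auto simp: int_vecs_def)
  then obtain m where m: "ip p f ?w = of_int m" by (auto elim: Ints_cases)
  have "(\<lambda>l. (delta ^^ a) y (l + a * (p - 1))) = vadd (\<lambda>_. 1 / of_nat p) (scale (- 1) ?w)"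
    unfolding y by (simp add: chain_target_def vadd_def scale_def)
  then have "ip p ((delta ^^ a) f) y = (- 1) ^ a * ((\<Sum>l<p. f l) / of_nat p - of_int m)"
    using ip_delta_pow_left[of p f y a] f y p_pos m by (simp add: int_vecs_def hyperplane_def ip_const)
  then show ?thesis by (rule that)
qed

text \<open>By \<open>chain_pairing\<close> the condition says that p divides the sum of f.
  Subtracting a constant, which \<open>delta\<close> kills, makes the sum zero, and then f is itself
  a difference.\<close>

lemma sublattice_chain:
  assumes a: "a \<ge> 1" and y: "y \<in> hyperplane p" "(delta ^^ a) y = chain_target"
  shows "{g \<in> lat p a. ip p g y \<in> \<int>} = lat p (Suc a)"
proof (intro equalityI subsetI)
  fix g assume "g \<in> {g \<in> lat p a. ip p g y \<in> \<int>}"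
  then obtain f where f: "f \<in> int_vecs p" "g = (delta ^^ a) f" "ip p g y \<in> \<int>" by (auto simp: lat_def)
  obtain m where m: "ip p g y = (- 1) ^ a * ((\<Sum>l<p. f l) / of_nat p - of_int m)"
    using chain_pairing[OF f(1) y] f(2) by metis
  then have "(\<Sum>l<p. f l) / of_nat p - of_int m \<in> \<int>" using f(3) by (cases "even a") (auto simp: minus_in_Ints_iff)
  then have "((\<Sum>l<p. f l) / of_nat p - of_int m) + of_int m \<in> \<int>" by (intro Ints_add) auto
  then have "(\<Sum>l<p. f l) / of_nat p \<in> \<int>" by simp
  then obtain k where "(\<Sum>l<p. f l) / of_nat p = of_int k" by (auto elim: Ints_cases)
  then have k: "(\<Sum>l<p. f l) = of_nat p * of_int k" using p_pos by (simp add: field_simps)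
  define f1 where "f1 = vadd f (\<lambda>_. - of_int k)"
  have "f1 \<in> lat p 1" unfolding lat_1_eq[OF p_pos]
    using f(1) k by (simp add: f1_def int_vecs_def hyperplane_def vadd_def periodic_def sum_subtractf)
  then obtain f2 where f2: "f2 \<in> int_vecs p" "f1 = delta f2" by (auto simp: lat_def)
  have "(delta ^^ a) f1 = g"
    unfolding f1_def delta_pow_vadd delta_pow_const[OF a] f(2) by (simp add: vadd_def)
  then have "g = (delta ^^ Suc a) f2" unfolding f2(2) by (simp only: funpow_Suc_right o_apply)
  then show "g \<in> lat p (Suc a)" using f2 unfolding lat_def by blast
next
  fix g assume "g \<in> lat p (Suc a)"
  then obtain f where f: "f \<in> int_vecs p" "g = (delta ^^ a) (delta f)" unfolding lat_def funpow_Suc_right by auto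
  have df: "delta f \<in> int_vecs p" using int_vecs_delta_pow[OF f(1), of 1] by simp
  have "(\<Sum>l<p. delta f l) = 0" using delta_pow_hyperplane[of p f 1] f(1) p_pos by (simp add: int_vecs_def hyperplane_def)
  then obtain m :: int where "ip p g y = (- 1) ^ a * (0 / of_nat p - of_int m)"
    using chain_pairing[OF df y] f(2) by metis
  then have "ip p g y \<in> \<int>" by simp
  moreover have "g \<in> lat p a" using df f(2) by (simp add: lat_def)
  ultimately show "g \<in> {g \<in> lat p a. ip p g y \<in> \<int>}" by simp
qed

text \<open>The multiples of y by t < p represent the cosets of the smaller dual lattice in the
  larger one: the a-th difference of a vector in the latter is integral up to a constant in (1/p)
  Z.\<close>

lemma dual_chain:
  assumes a: "a \<ge> 1" and y: "y \<in> hyperplane p" "(delta ^^ a) y = chain_target"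
  shows "bij_betw (\<lambda>(t, x). vadd x (scale (of_nat t) y)) ({..<p} \<times> dual_lat p a) (dual_lat p (Suc a))"
  unfolding bij_betw_def
proof
  \<comment> \<open>Any index other than 0 modulo p detects t: the target equals 1 / p there, while
    x contributes an integer.\<close>
  have target1: "chain_target 1 = 1 / of_nat p" using p_ge_3 by (simp add: chain_target_def vadd_def scale_def unit_vec_def)
  show "inj_on (\<lambda>(t, x). vadd x (scale (of_nat t) y)) ({..<p} \<times> dual_lat p a)"
  proof (rule inj_onI, clarify)
    fix s t x w assume st: "s < p" "t < p" and xw: "x \<in> dual_lat p a" "w \<in> dual_lat p a"
      and eq: "vadd x (scale (of_nat s) y) = vadd w (scale (of_nat t) y)"
    have "(delta ^^ a) (vadd x (scale (of_nat s) y)) 1 = (delta ^^ a) (vadd w (scale (of_nat t) y)) 1" by (simp only: eq)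
    then have e: "(delta ^^ a) x 1 + of_nat s * (1 / of_nat p) = (delta ^^ a) w 1 + of_nat t * (1 / of_nat p)"
      unfolding delta_pow_vadd delta_pow_scale y unfolding vadd_def scale_def target1 .
    have "(delta ^^ a) x 1 - (delta ^^ a) w 1 \<in> \<int>" using xw by (simp add: dual_lat_def int_vecs_def)
    then obtain m where m: "(delta ^^ a) x 1 - (delta ^^ a) w 1 = of_int m" by (auto elim: Ints_cases)
    have "of_nat t / of_nat p - of_nat s / of_nat p = (of_int m :: complex)"
      using e unfolding m[symmetric] by (simp add: algebra_simps)
    then have "(of_int (int t - int s) :: complex) = of_int (int p * m)"
      using p_pos by (simp add: field_simps)
    then have "int t - int s = int p * m" by (simp only: of_int_eq_iff)
    then have "int p dvd int t - int s" by simp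
    moreover have "\<bar>int t - int s\<bar> < int p" using st by auto
    ultimately have "s = t" using zdvd_not_zless[of "\<bar>int t - int s\<bar>" "int p"] by fastforce
    then show "s = t \<and> x = w" using eq by (simp add: vadd_def fun_eq_iff)
  qed
  show "(\<lambda>(t, x). vadd x (scale (of_nat t) y)) ` ({..<p} \<times> dual_lat p a) = dual_lat p (Suc a)"
  proof (intro equalityI subsetI)
    fix v assume "v \<in> (\<lambda>(t, x). vadd x (scale (of_nat t) y)) ` ({..<p} \<times> dual_lat p a)"
    then obtain t x where x: "x \<in> dual_lat p a" "v = vadd x (scale (of_nat t) y)" by auto
    have dt: "delta chain_target i \<in> \<int>" for i
      by (simp add: delta_def chain_target_def vadd_def scale_def unit_vec_def)
    have "(delta ^^ Suc a) v = delta (vadd ((delta ^^ a) x) (scale (of_nat t) chain_target))"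
      by (simp add: x(2) delta_pow_vadd delta_pow_scale y)
    then have "(delta ^^ Suc a) v i = delta ((delta ^^ a) x) i + of_nat t * delta chain_target i" for i
      by (simp add: delta_def vadd_def scale_def algebra_simps)
    moreover have "delta ((delta ^^ a) x) i \<in> \<int>" for i using x(1) by (simp add: dual_lat_def int_vecs_def delta_def)
    ultimately have i: "(delta ^^ Suc a) v i \<in> \<int>" for i using dt by simp
    have "v \<in> hyperplane p" unfolding x(2) using x(1) y by (intro hyperplane_vadd hyperplane_scale) (auto simp: dual_lat_def)
    then show "v \<in> dual_lat p (Suc a)"
      using i periodic_delta_pow[of p v "Suc a"] unfolding dual_lat_def int_vecs_def hyperplane_def by blast
  next
    fix v assume v: "v \<in> dual_lat p (Suc a)"
    define x where "x = (delta ^^ a) v"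
    have per: "periodic p v" using v by (simp add: dual_lat_def hyperplane_def)
    have "x \<in> hyperplane p" unfolding x_def by (rule delta_pow_hyperplane[OF per p_pos a])
    moreover have "delta x i \<in> \<int>" for i using v by (simp add: dual_lat_def int_vecs_def x_def)
    ultimately obtain m :: int where m: "\<And>i. x i - of_int m / of_nat p \<in> \<int>"
      using delta_integral_offset[of p x] p_pos by (auto simp: hyperplane_def)
    define t where "t = nat (m mod int p)"
    have t: "t < p" "int t = m mod int p" using p_pos by (simp_all add: t_def nat_less_iff)
    define u where "u = vadd v (scale (- of_nat t) y)"
    have mt: "of_int m / of_nat p - of_nat t / of_nat p = (of_int (m div int p) :: complex)"
    proof -
      have "(of_int m :: complex) = of_int (int p * (m div int p) + int t)" unfolding t(2) by simp
      then show ?thesis using p_pos by (simp add: field_simps)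
    qed
    have "(delta ^^ a) u i \<in> \<int>" for i
    proof -
      have "(delta ^^ a) u i = x i - of_nat t * chain_target i"
        by (simp add: u_def delta_pow_vadd delta_pow_scale y x_def[symmetric]) (simp add: vadd_def scale_def)
      also have "\<dots> = (x i - of_int m / of_nat p) + (of_int m / of_nat p - of_nat t / of_nat p) + of_nat t * unit_vec p 0 i"
        by (simp add: chain_target_def vadd_def scale_def algebra_simps)
      also have "\<dots> \<in> \<int>" unfolding mt using m[of i] unit_vec_int[of p 0] by (simp add: int_vecs_def)
      finally show ?thesis .
    qed
    moreover have uh: "u \<in> hyperplane p"
      unfolding u_def using v y by (intro hyperplane_vadd hyperplane_scale) (auto simp: dual_lat_def)
    ultimately have "u \<in> dual_lat p a"
      using periodic_delta_pow[of p u a] by (simp add: dual_lat_def int_vecs_def hyperplane_def)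
    moreover have "v = vadd u (scale (of_nat t) y)" by (simp add: u_def vadd_def scale_def fun_eq_iff)
    ultimately show "v \<in> (\<lambda>(t, x). vadd x (scale (of_nat t) y)) ` ({..<p} \<times> dual_lat p a)" using t by force
  qed
qed

text \<open>Induction along the chain of sublattices of index p, each of which divides the constant
  by p. The elliptic variable is kept general because a step uses the preceding formula at all
  shifts z + t y.\<close>

theorem poisson_lat:
  assumes a: "1 \<le> a" "2 * a \<le> p - 1" and \<tau>: "Im \<tau> > 0" and z: "z \<in> hyperplane p"
  shows "th p (lat p a) \<tau> z = (\<i> / \<tau>) ^ ((p - 1) div 2) / (of_real (sqrt (real p)) * of_nat p ^ (a - 1)) * dth p (dual_lat p a) \<tau> z"
proof -
  \<comment> \<open>The rank is even, so the square root occurs to an even power and its branch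
    disappears.\<close>
  have "p - 1 = 2 * ((p - 1) div 2)" using odd by simp
  then have "(csqrt (\<i> / \<tau>)) ^ (p - 1) = ((csqrt (\<i> / \<tau>))\<^sup>2) ^ ((p - 1) div 2)"
    by (metis power_mult)
  then have pow: "(csqrt (\<i> / \<tau>)) ^ (p - 1) = (\<i> / \<tau>) ^ ((p - 1) div 2)" by simp
  show ?thesis
    using a z
  proof (induction a arbitrary: z rule: nat_induct_at_least)
    case base
    then show ?case using poisson_root_lattice[OF \<tau>, of z] pow by simp
  next
    case (Suc a)
    obtain y where y: "y \<in> hyperplane p" "(delta ^^ a) y = chain_target"
      using chain_vector[of a] Suc.prems by auto
    let ?C = "(\<i> / \<tau>) ^ ((p - 1) div 2) / (of_real (sqrt (real p)) * of_nat p ^ (a - 1))"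
    have "th p {g \<in> lat p a. ip p g y \<in> \<int>} \<tau> z = ?C / of_nat p * dth p (dual_lat p (Suc a)) \<tau> z"
    proof (rule poisson_sublattice[OF \<tau> p_pos lat_subset_frac dual_lat_subset_frac[OF Suc.prems(1)] _ dual_chain[OF Suc.hyps y]])
      show "of_nat p * ip p g y \<in> \<int>" if "g \<in> lat p a" for g
      proof -
        obtain f where f: "f \<in> int_vecs p" "g = (delta ^^ a) f" using \<open>g \<in> lat p a\<close> by (auto simp: lat_def)
        obtain m :: int where "ip p g y = (- 1) ^ a * ((\<Sum>l<p. f l) / of_nat p - of_int m)"
          using chain_pairing[OF f(1) y] f(2) by metis
        then have "of_nat p * ip p g y = (- 1) ^ a * (of_nat p * ((\<Sum>l<p. f l) / of_nat p) - of_nat p * of_int m)"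
          by (simp only: right_diff_distrib mult.left_commute)
        also have "of_nat p * ((\<Sum>l<p. f l) / of_nat p) = (\<Sum>l<p. f l)" using p_pos by simp
        also have "(- 1) ^ a * ((\<Sum>l<p. f l) - of_nat p * of_int m) \<in> \<int>" using f(1) by (intro Ints_mult Ints_diff Ints_power Ints_sum) (auto simp: int_vecs_def)
        finally show ?thesis .
      qed
      show "th p (lat p a) \<tau> (vadd z (scale (of_nat t) y)) = ?C * dth p (dual_lat p a) \<tau> (vadd z (scale (of_nat t) y))" for t
        using Suc.prems y by (intro Suc.IH hyperplane_vadd hyperplane_scale) auto
    qed
    then have "th p (lat p (Suc a)) \<tau> z = ?C / of_nat p * dth p (dual_lat p (Suc a)) \<tau> z"
      unfolding sublattice_chain[OF Suc.hyps y] .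
    moreover have "(of_nat p :: complex) ^ (Suc a - 1) = of_nat p ^ (a - 1) * of_nat p"
      using Suc.hyps by (metis diff_Suc_1 power_minus_mult less_eq_Suc_le One_nat_def)
    ultimately show ?case by simp
  qed
qed

end

section \<open>The Jacobi transformation\<close>

text \<open>Substitution in a sum over a finite quotient given by representatives: an injective map
  of the classes is a permutation.\<close>

lemma sum_reindex_reps:
  fixes F :: "'x \<Rightarrow> complex"
  assumes "finite R" "\<And>x. x \<in> X \<Longrightarrow> rep x \<in> R" "\<And>r. r \<in> R \<Longrightarrow> \<psi> r \<in> X" "\<And>x. x \<in> X \<Longrightarrow> F x = F (rep x)"
    and "\<And>r s. r \<in> R \<Longrightarrow> s \<in> R \<Longrightarrow> rep (\<psi> r) = rep (\<psi> s) \<Longrightarrow> r = s"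
  shows "(\<Sum>r\<in>R. F (\<psi> r)) = (\<Sum>r\<in>R. F r)"
proof -
  have inj: "inj_on (\<lambda>r. rep (\<psi> r)) R" using assms by (auto intro!: inj_onI)
  moreover have "(\<lambda>r. rep (\<psi> r)) ` R \<subseteq> R" using assms by auto
  ultimately have bij: "bij_betw (\<lambda>r. rep (\<psi> r)) R R"
    using assms(1) by (simp add: bij_betw_def endo_inj_surj)
  have "(\<Sum>r\<in>R. F (\<psi> r)) = (\<Sum>r\<in>R. F (rep (\<psi> r)))" using assms by (intro sum.cong) auto
  also have "\<dots> = (\<Sum>r\<in>R. F r)" by (rule sum.reindex_bij_betw[OF bij])
  finally show ?thesis .
qed

text \<open>A periodic sequence with constant difference has difference zero, because the difference
  sums to zero over a period; this lowers the order one by one.\<close>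

lemma delta_pow_zero_const:
  assumes "p > 0" "periodic p w" "(delta ^^ a) w = (\<lambda>_. 0)"
  shows "w i = w 0"
  using assms(2,3)
proof (induction a arbitrary: w i)
  case (Suc a)
  have per: "periodic p (delta w)" using periodic_delta_pow[OF Suc.prems(1), of 1] by simp
  have c: "delta w i = delta w 0" for i
    by (rule Suc.IH[OF per]) (use Suc.prems(2) in \<open>simp only: funpow_Suc_right o_apply\<close>)
  have "(\<Sum>l<p. delta w l) = 0" using delta_pow_hyperplane[OF Suc.prems(1) assms(1), of 1] by (simp add: hyperplane_def)
  moreover have "(\<Sum>l<p. delta w l) = (\<Sum>l<p. delta w 0)" by (intro sum.cong refl c)
  ultimately have "delta w 0 = 0" using assms(1) by simp
  then have d0: "w j = w (j + 1)" for j using c[of j] by (simp add: delta_def)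
  show ?case by (induction i) (use d0 in auto)
qed simp

lemma im_moebius_pos:
  fixes \<tau> :: complex and a b c d :: int
  assumes "Im \<tau> > 0" "a * d - b * c = 1"
  shows "of_int c * \<tau> + of_int d \<noteq> 0" "Im ((of_int a * \<tau> + of_int b) / (of_int c * \<tau> + of_int d)) > 0"
proof -
  define x y where "x = Re \<tau>" and "y = Im \<tau>"
  have y: "y > 0" using assms by (simp add: y_def)
  have ad: "real_of_int a * of_int d - of_int b * of_int c = 1" using assms(2) by (simp flip: of_int_mult of_int_diff)
  show nz: "of_int c * \<tau> + of_int d \<noteq> 0"
  proof
    assume eq: "of_int c * \<tau> + of_int d = 0"
    have "Im (of_int c * \<tau> + of_int d) = of_int c * y" "Re (of_int c * \<tau> + of_int d) = of_int c * x + of_int d"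
      by (simp_all add: x_def y_def)
    then have "of_int c * y = 0" "of_int c * x + of_int d = 0" using eq by simp_all
    then have "c = 0" "d = 0" using y by auto
    then show False using assms(2) by simp
  qed
  have "Im ((of_int a * \<tau> + of_int b) / (of_int c * \<tau> + of_int d))
     = (of_int a * y * (of_int c * x + of_int d) - (of_int a * x + of_int b) * (of_int c * y)) / ((of_int c * x + of_int d)\<^sup>2 + (of_int c * y)\<^sup>2)"
    by (simp add: Im_divide x_def y_def)
  also have "of_int a * y * (of_int c * x + of_int d) - (of_int a * x + of_int b) * (of_int c * y) = y * (of_int a * of_int d - of_int b * of_int c)"
    by (simp add: algebra_simps)
  also have "\<dots> = y" by (simp add: ad)
  finally have "Im ((of_int a * \<tau> + of_int b) / (of_int c * \<tau> + of_int d)) = y / ((of_int c * x + of_int d)\<^sup>2 + (of_int c * y)\<^sup>2)" .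
  moreover have "(of_int c * x + of_int d)\<^sup>2 + (of_int c * y)\<^sup>2 > 0"
    using nz y unfolding sum_power2_gt_zero_iff by (auto simp: complex_eq_iff x_def y_def)
  ultimately show "Im ((of_int a * \<tau> + of_int b) / (of_int c * \<tau> + of_int d)) > 0" using y by simp
qed

text \<open>\<open>e\<close> is the index of the lattice, since the letters a, b, c, d are kept for
  matrix entries.\<close>

locale theta_lattice = odd_prime +
  fixes e :: nat
  assumes e: "1 \<le> e" "2 * e \<le> p - 1"
begin

abbreviation "L \<equiv> lat p e"
abbreviation "L' \<equiv> dual_lat p e"
definition wt :: nat where "wt = (p - 1) div 2"
definition vol :: complex where "vol = of_real (sqrt (real p)) * of_nat p ^ (e - 1)"

lemma L_hyp: "g \<in> L \<Longrightarrow> g \<in> hyperplane p"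
  using lat_subset_hyperplane[OF p_pos e(1)] by blast

lemma L'_hyp: "g \<in> L' \<Longrightarrow> g \<in> hyperplane p"
  by (simp add: dual_lat_def)

lemma L'_frac: "L' \<subseteq> frac_vecs p"
  by (rule dual_lat_subset_frac[OF e(2)])

lemma ip_LL: "g \<in> L \<Longrightarrow> h \<in> L \<Longrightarrow> ip p g h \<in> \<int>"
  using ip_lat_dual[OF _ _ p_pos] lat_subset_dual[OF p_pos e(1)] by blast

lemma ip_LL': "g \<in> L \<Longrightarrow> h \<in> L' \<Longrightarrow> ip p g h \<in> \<int>"
  using ip_lat_dual[OF _ _ p_pos] by blast

lemma even_L: "g \<in> L \<Longrightarrow> ip p g g / 2 \<in> \<int>"
  using lat_even[OF _ p_pos e(1)] by blast

lemma poisson_L: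
  "Im \<tau> > 0 \<Longrightarrow> z \<in> hyperplane p \<Longrightarrow> th p L \<tau> z = (\<i> / \<tau>) ^ wt / vol * dth p L' \<tau> z"
  using poisson_lat[OF e] by (simp add: wt_def vol_def)

text \<open>Coordinates on the lattice: constants are in the kernel of \<open>delta\<close>, so the
  preimage is normalised to vanish at p - 1 and p - 1 free coordinates remain.\<close>

definition basis_map :: "(nat \<Rightarrow> int) \<Rightarrow> cvec" where
  "basis_map n = (delta ^^ e) (\<lambda>i. if i mod p = p - 1 then 0 else of_int (n (i mod p)))"

lemma basis_map_inj:
  assumes "basis_map n = basis_map n'" "i < p - 1"
  shows "n i = n' i"
proof -
  define f where "f n i = (if i mod p = p - 1 then 0 else complex_of_int (n (i mod p)))" for n :: "nat \<Rightarrow> int" and i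
  define w where "w = vadd (f n) (scale (- 1) (f n'))"
  have "(delta ^^ e) w = (\<lambda>_. 0)"
    using assms(1) unfolding w_def delta_pow_vadd delta_pow_scale basis_map_def f_def[abs_def] by (simp add: vadd_def scale_def)
  moreover have "periodic p w" by (simp add: periodic_def w_def f_def vadd_def scale_def)
  ultimately have "w i = w 0" "w (p - 1) = w 0" using delta_pow_zero_const[OF p_pos] by blast+
  then have "w i = w (p - 1)" by simp
  then show ?thesis using assms(2) by (simp add: w_def f_def vadd_def scale_def)
qed

lemma basis_map_surj:
  assumes "g \<in> L"
  obtains n where "g = basis_map n"
proof -
  obtain f where f: "f \<in> int_vecs p" "g = (delta ^^ e) f" using assms by (auto simp: lat_def)
  define n where "n i = \<lfloor>Re (f i - f (p - 1))\<rfloor>" for i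
  have n: "of_int (n i) = f i - f (p - 1)" for i
  proof -
    have "f i - f (p - 1) \<in> \<int>" using f by (simp add: int_vecs_def)
    then obtain m where m: "f i - f (p - 1) = of_int m" by (auto elim: Ints_cases)
    show ?thesis unfolding n_def m by simp
  qed
  have "(\<lambda>i. if i mod p = p - 1 then 0 else of_int (n (i mod p))) = vadd f (\<lambda>_. - f (p - 1))"
  proof
    fix i
    have "f (i mod p) = f i" using periodic_mod f by (simp add: int_vecs_def)
    then show "(if i mod p = p - 1 then 0 else of_int (n (i mod p))) = vadd f (\<lambda>_. - f (p - 1)) i"
      using n[of "i mod p"] by (auto simp: vadd_def)
  qed
  then have "basis_map n = vadd g (\<lambda>_. 0)"
    unfolding basis_map_def f(2) by (simp only: delta_pow_vadd delta_pow_const[OF e(1)])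
  then show ?thesis using that[of n] by (simp add: vadd_def)
qed

lemma basis_map_in: "basis_map n \<in> L"
  unfolding basis_map_def lat_def by (rule imageI) (simp add: int_vecs_def periodic_def)

lemma basis_map_add: "vadd (basis_map n) (scale (of_int d) (basis_map n')) = basis_map (\<lambda>i. n i + d * n' i)"
  unfolding basis_map_def delta_pow_scale[symmetric] delta_pow_vadd[symmetric]
  by (intro arg_cong[of _ _ "delta ^^ e"]) (auto simp: vadd_def scale_def fun_eq_iff)

lemma basis_map_cong: "(\<And>i. i < p - 1 \<Longrightarrow> n i = n' i) \<Longrightarrow> basis_map n = basis_map n'"
proof -
  assume eq: "\<And>i. i < p - 1 \<Longrightarrow> n i = n' i"
  have "i mod p = p - 1 \<or> i mod p < p - 1" for i using mod_less_divisor[OF p_pos, of i] by linarith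
  then show ?thesis unfolding basis_map_def
    by (intro arg_cong[of _ _ "delta ^^ e"] ext) (use eq in fastforce)
qed

definition congr :: "int \<Rightarrow> cvec \<Rightarrow> cvec \<Rightarrow> bool" where
  "congr d x y \<longleftrightarrow> (\<exists>l\<in>L. x = vadd y (scale (of_int d) l))"

lemma congrI: "l \<in> L \<Longrightarrow> x = vadd y (scale (of_int d) l) \<Longrightarrow> congr d x y"
  by (auto simp: congr_def)

lemma congr_sym: "congr d x y \<Longrightarrow> congr d y x"
proof -
  assume "congr d x y"
  then obtain l where l: "l \<in> L" "x = vadd y (scale (of_int d) l)" by (auto simp: congr_def)
  have "scale (- 1) l \<in> L" by (rule lat_scale[OF l(1)]) simp
  then show ?thesis by (rule congrI) (simp add: l(2) vadd_def scale_def)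
qed

lemma congr_trans: "congr d x y \<Longrightarrow> congr d y z \<Longrightarrow> congr d x z"
proof -
  assume "congr d x y" "congr d y z"
  then obtain l l' where l: "l \<in> L" "x = vadd y (scale (of_int d) l)" "l' \<in> L" "y = vadd z (scale (of_int d) l')"
    by (auto simp: congr_def)
  have "vadd l' l \<in> L" by (rule lat_vadd[OF l(3,1)])
  then show ?thesis by (rule congrI) (simp add: l(2,4) vadd_def scale_def fun_eq_iff algebra_simps)
qed

lemma congr_lin:
  assumes "congr d x x'" "congr d y y'"
  shows "congr d (vadd (scale (of_int s) x) (scale (of_int t) y)) (vadd (scale (of_int s) x') (scale (of_int t) y'))"
proof -
  obtain l l' where l: "l \<in> L" "x = vadd x' (scale (of_int d) l)" "l' \<in> L" "y = vadd y' (scale (of_int d) l')"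
    using assms by (auto simp: congr_def)
  have "vadd (scale (of_int s) l) (scale (of_int t) l') \<in> L" by (intro lat_vadd lat_scale l) auto
  then show ?thesis by (rule congrI) (simp add: l(2,4) vadd_def scale_def fun_eq_iff algebra_simps)
qed

lemma transversal:
  assumes d: "d \<noteq> 0"
  obtains R rep where "finite R" "R \<subseteq> L" "card R = nat \<bar>d\<bar> ^ (p - 1)"
    "bij_betw (\<lambda>(r, l). vadd r (scale (of_int d) l)) (R \<times> L) L"
    "\<And>x. x \<in> L \<Longrightarrow> rep x \<in> R" "\<And>x. x \<in> L \<Longrightarrow> congr d x (rep x)"
    "\<And>r s. r \<in> R \<Longrightarrow> s \<in> R \<Longrightarrow> congr d r s \<Longrightarrow> r = s"
proof -
  define P where "P = PiE {..<p - 1} (\<lambda>_. {0..<\<bar>d\<bar>})"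
  define R where "R = basis_map ` P"
  have PR: "n i = n' i" if "n \<in> P" "n' \<in> P" "n i + d * q = n' i + d * q'" "i < p - 1" for n n' i q q'
  proof -
    have "n i - n' i = d * (q' - q)" using that by (simp add: algebra_simps)
    then have "\<bar>d\<bar> dvd n i - n' i" by simp
    then have "n i mod \<bar>d\<bar> = n' i mod \<bar>d\<bar>" by (simp add: mod_eq_dvd_iff)
    then show ?thesis using that by (auto simp: P_def PiE_def Pi_def)
  qed
  have injR: "inj_on basis_map P"
  proof (rule inj_onI)
    fix n n' assume n: "n \<in> P" "n' \<in> P" "basis_map n = basis_map n'"
    show "n = n'" using n(1,2) basis_map_inj[OF n(3)] unfolding P_def by (intro PiE_ext) auto
  qed
  have finR: "finite R" by (simp add: R_def P_def finite_PiE)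
  have cardR: "card R = nat \<bar>d\<bar> ^ (p - 1)"
    by (simp add: R_def card_image[OF injR]) (simp add: P_def card_PiE)
  have RL: "R \<subseteq> L" by (auto simp: R_def basis_map_in)
  have uniq: "r = s \<and> l = l'"
    if rs: "r \<in> R" "s \<in> R" "l \<in> L" "l' \<in> L" "vadd r (scale (of_int d) l) = vadd s (scale (of_int d) l')" for r s l l'
  proof -
    obtain n n' where n: "n \<in> P" "r = basis_map n" "n' \<in> P" "s = basis_map n'" using rs(1,2) by (auto simp: R_def)
    obtain q where q: "l = basis_map q" using basis_map_surj[OF rs(3)] .
    obtain q' where q': "l' = basis_map q'" using basis_map_surj[OF rs(4)] .
    have "basis_map (\<lambda>i. n i + d * q i) = basis_map (\<lambda>i. n' i + d * q' i)"
      using rs(5) unfolding n(2,4) q q' basis_map_add .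
    then have *: "n i + d * q i = n' i + d * q' i" if "i < p - 1" for i using basis_map_inj that by blast
    then have "n i = n' i" if "i < p - 1" for i using PR[OF n(1,3)] that by blast
    then have "r = s" unfolding n(2,4) by (intro basis_map_cong) auto
    moreover have "scale (of_int d) l = scale (of_int d) l'"
      using rs(5) calculation by (simp add: vadd_def fun_eq_iff)
    then have "l = l'" using d by (simp add: scale_def fun_eq_iff)
    ultimately show ?thesis by simp
  qed
  have ex: "\<exists>r\<in>R. congr d x r" if x: "x \<in> L" for x
  proof -
    obtain n where n: "x = basis_map n" using basis_map_surj[OF x] .
    define r where "r = restrict (\<lambda>i. n i mod \<bar>d\<bar>) {..<p - 1}"
    have "r \<in> P" using d by (auto simp: r_def P_def)
    moreover have "x = vadd (basis_map r) (scale (of_int d) (basis_map (\<lambda>i. sgn d * (n i div \<bar>d\<bar>))))"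
      unfolding n basis_map_add
    proof (rule basis_map_cong)
      fix i assume i: "i < p - 1"
      have A: "d * (sgn d * (n i div \<bar>d\<bar>)) = \<bar>d\<bar> * (n i div \<bar>d\<bar>)" by (simp only: mult.assoc[symmetric] mult_sgn_abs mult.commute[of d "sgn d"] abs_sgn)
      have B: "r i = n i mod \<bar>d\<bar>" using i by (simp add: r_def)
      show "n i = r i + d * (sgn d * (n i div \<bar>d\<bar>))" unfolding A B by (rule mod_mult_div_eq[symmetric])
    qed
    ultimately show ?thesis unfolding R_def using congrI[OF basis_map_in] by blast
  qed
  define rep where "rep x = (SOME r. r \<in> R \<and> congr d x r)" for x
  have rep: "rep x \<in> R \<and> congr d x (rep x)" if "x \<in> L" for x
    unfolding rep_def using someI_ex[of "\<lambda>r. r \<in> R \<and> congr d x r"] ex[OF that] by blast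
  have bij: "bij_betw (\<lambda>(r, l). vadd r (scale (of_int d) l)) (R \<times> L) L"
    unfolding bij_betw_def
  proof
    show "inj_on (\<lambda>(r, l). vadd r (scale (of_int d) l)) (R \<times> L)"
      by (rule inj_onI) (use uniq in auto)
    show "(\<lambda>(r, l). vadd r (scale (of_int d) l)) ` (R \<times> L) = L"
    proof (intro equalityI subsetI)
      fix x assume "x \<in> (\<lambda>(r, l). vadd r (scale (of_int d) l)) ` (R \<times> L)"
      then show "x \<in> L" using RL by (auto intro!: lat_vadd lat_scale)
    next
      fix x assume "x \<in> L"
      then obtain l where "rep x \<in> R" "l \<in> L" "x = vadd (rep x) (scale (of_int d) l)" using rep by (auto simp: congr_def)
      then show "x \<in> (\<lambda>(r, l). vadd r (scale (of_int d) l)) ` (R \<times> L)" by force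
    qed
  qed
  have uniqR: "r = s" if rs: "r \<in> R" "s \<in> R" "congr d r s" for r s
  proof -
    obtain l where l: "l \<in> L" "r = vadd s (scale (of_int d) l)" using rs(3) by (auto simp: congr_def)
    have "vadd r (scale (of_int d) (\<lambda>l. 0)) = vadd s (scale (of_int d) l)" using l by (simp add: vadd_def scale_def)
    then show ?thesis using uniq[OF rs(1,2) lat_zero l(1)] by blast
  qed
  show ?thesis
  proof (rule that[of R rep])
    show "r = s" if "r \<in> R" "s \<in> R" "congr d r s" for r s using that by (rule uniqR)
    show "rep x \<in> R" "congr d x (rep x)" if "x \<in> L" for x using rep[OF that] by simp_all
  qed (fact finR RL cardR bij)+
qed

text \<open>The finite sum over classes modulo c that splits off when Poisson summation is applied
  on every class separately; y is the dual variable.\<close>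

definition gauss_weight :: "cvec set \<Rightarrow> int \<Rightarrow> int \<Rightarrow> cvec \<Rightarrow> complex" where
  "gauss_weight R a c y = (\<Sum>r\<in>R. ee ((of_int a * ip p r r / 2 - ip p r y) / of_int c))"

text \<open>L is split into classes modulo c. On each class the rational part a / c of the modulus
  contributes only a constant phase, and Poisson summation at the modulus - c / u does the
  rest.\<close>

lemma jacobi_general:
  fixes a b c d :: int
  assumes \<tau>: "Im \<tau> > 0" and z: "z \<in> hyperplane p" and det: "a * d - b * c = 1" and c: "c \<noteq> 0"
    and R: "finite R" "R \<subseteq> L" "bij_betw (\<lambda>(r, l). vadd r (scale (of_int c) l)) (R \<times> L) L"
  defines "u \<equiv> of_int c * \<tau> + of_int d"
  shows "th p L ((of_int a * \<tau> + of_int b) / u) (scale (1 / u) z) * ee (- (of_int c * ip p z z / (2 * u)))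
    = (- \<i> * u / of_int c) ^ wt / vol *
      (\<Sum>\<^sub>\<infinity>y\<in>L'. gauss_weight R a c y * ee (of_int d * ip p y y / (2 * of_int c)) * ee (\<tau> * ip p y y / 2 + ip p y z))"
proof -
  have u: "u \<noteq> 0" and im: "Im ((of_int a * \<tau> + of_int b) / u) > 0"
    using im_moebius_pos[OF \<tau> det] by (simp_all add: u_def)
  define C A D :: complex where "C = of_int c" and "A = of_int a" and "D = of_int d"
  have C: "C \<noteq> 0" using c by (simp add: C_def)
  define t where "t = (A * \<tau> + of_int b) / u"
  have detC: "A * D - of_int b * C = 1" using det by (simp add: A_def D_def C_def flip: of_int_mult of_int_diff)
  \<comment> \<open>The classical decomposition of a Moebius transformation into a rational
    translation and an inversion.\<close>
  have t_eq: "t = A / C - 1 / (C * u)"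
  proof -
    have "C * (A * \<tau> + of_int b) = A * u - 1"
      using detC by (simp add: u_def C_def[symmetric] D_def[symmetric] algebra_simps)
    then have "A * \<tau> + of_int b = (A * u - 1) / C" using C by (simp add: field_simps)
    then show ?thesis using u C by (simp add: t_def diff_divide_distrib)
  qed
  have imC: "Im (- C / u) > 0"
  proof -
    have "Im (- C / u) = (of_int c)\<^sup>2 * Im \<tau> / ((Re u)\<^sup>2 + (Im u)\<^sup>2)"
      by (simp add: Im_divide C_def u_def power2_eq_square)
    moreover have "(Re u)\<^sup>2 + (Im u)\<^sup>2 > 0" using u by (simp add: sum_power2_gt_zero_iff complex_eq_iff) 
    ultimately show ?thesis using \<tau> c by simp
  qed
  define z' where "z' r = scale (1 / u) (vadd (scale C z) (scale (- 1) r))" for r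
  have z': "z' r \<in> hyperplane p" if "r \<in> R" for r
    unfolding z'_def using that R(2) by (intro hyperplane_scale hyperplane_vadd z L_hyp) auto
  have term1: "ee (t * ip p (vadd r (scale C l)) (vadd r (scale C l)) / 2 + ip p (vadd r (scale C l)) (scale (1 / u) z))
     = ee (A * ip p r r / (2 * C) - ip p r r / (2 * C * u) + ip p r z / u) * ee ((- C / u) * ip p l l / 2 + ip p l (z' r))"
    if r: "r \<in> L" and l: "l \<in> L" for r l
  proof -
    \<comment> \<open>The part of the exponent that would couple r and l through a / c is an
      integer, as L is integral and even.\<close>
    have i: "A * ip p r l + A * C * (ip p l l / 2) \<in> \<int>"
      unfolding A_def C_def by (intro Ints_add Ints_mult Ints_of_int ip_LL[OF r l] even_L[OF l])
    have "t * ip p (vadd r (scale C l)) (vadd r (scale C l)) / 2 + ip p (vadd r (scale C l)) (scale (1 / u) z)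
      = (A * ip p r r / (2 * C) - ip p r r / (2 * C * u) + ip p r z / u) + ((- C / u) * ip p l l / 2 + ip p l (z' r))
        + (A * ip p r l + A * C * (ip p l l / 2))"
      unfolding t_eq z'_def using C u by (simp add: ip_commute[of p l r]) (simp add: field_simps)
    then have "ee (t * ip p (vadd r (scale C l)) (vadd r (scale C l)) / 2 + ip p (vadd r (scale C l)) (scale (1 / u) z))
      = ee (A * ip p r r / (2 * C) - ip p r r / (2 * C * u) + ip p r z / u) * ee ((- C / u) * ip p l l / 2 + ip p l (z' r))
        * ee (A * ip p r l + A * C * (ip p l l / 2))" by (simp only: ee_add[symmetric])
    then show ?thesis by (simp only: ee_Ints[OF i] mult_1_right)
  qed
  have term2: "ee (A * ip p r r / (2 * C) - ip p r r / (2 * C * u) + ip p r z / u) * ee (- (ip p (vadd y (z' r)) (vadd y (z' r)) / (2 * (- C / u))))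
     = ee (C * ip p z z / (2 * u)) * (ee ((A * ip p r r / 2 - ip p r y) / C) * ee (D * ip p y y / (2 * C)) * ee (\<tau> * ip p y y / 2 + ip p y z))" for r y
  proof -
    have "u / C = \<tau> + D / C" using C by (simp add: u_def C_def[symmetric] D_def[symmetric] add_divide_distrib)
    then have uC: "u * ip p y y / (2 * C) = D * ip p y y / (2 * C) + \<tau> * ip p y y / 2"
      using C by (simp add: field_simps)
    have "- (ip p (vadd y (z' r)) (vadd y (z' r)) / (2 * (- C / u))) = u * ip p y y / (2 * C) + ip p y z - ip p r y / C
        + C * ip p z z / (2 * u) - ip p r z / u + ip p r r / (2 * C * u)"
      unfolding z'_def using C u
      by (simp add: ip_commute[of p z y] ip_commute[of p y r] ip_commute[of p z r]) (simp add: field_simps)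
    then have "(A * ip p r r / (2 * C) - ip p r r / (2 * C * u) + ip p r z / u) + - (ip p (vadd y (z' r)) (vadd y (z' r)) / (2 * (- C / u)))
      = C * ip p z z / (2 * u) + ((A * ip p r r / 2 - ip p r y) / C + D * ip p y y / (2 * C) + (\<tau> * ip p y y / 2 + ip p y z))"
      unfolding uC using C by (simp add: diff_divide_distrib)
    then show ?thesis by (simp only: ee_add[symmetric])
  qed
  let ?E = "\<lambda>g. ee (t * ip p g g / 2 + ip p g (scale (1 / u) z))"
  have sE: "?E summable_on L"
    by (rule abs_summable_summable, rule th_summable) (use im p_pos lat_subset_frac in \<open>auto simp: t_def A_def\<close>)
  have "(\<lambda>rl. ?E (case rl of (r, l) \<Rightarrow> vadd r (scale C l))) summable_on (R \<times> L)"
    using sE summable_on_reindex_bij_betw[OF R(3), of ?E] by (simp add: C_def)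
  then have sRL: "(\<lambda>(r, l). ?E (vadd r (scale C l))) summable_on (R \<times> L)"
    by (simp add: case_prod_unfold)
  have "th p L t (scale (1 / u) z) = infsum (\<lambda>(r, l). ?E (vadd r (scale C l))) (R \<times> L)"
    unfolding th_def using infsum_reindex_bij_betw[OF R(3), of ?E] by (simp add: C_def case_prod_unfold)
  also have "\<dots> = (\<Sum>\<^sub>\<infinity>r\<in>R. \<Sum>\<^sub>\<infinity>l\<in>L. ?E (vadd r (scale C l)))"
    by (rule infsum_Sigma'_banach[OF sRL, symmetric])
  also have "\<dots> = (\<Sum>r\<in>R. \<Sum>\<^sub>\<infinity>l\<in>L. ?E (vadd r (scale C l)))" using R(1) by simp
  also have "\<dots> = (\<Sum>r\<in>R. (- \<i> * u / C) ^ wt / vol * (ee (C * ip p z z / (2 * u)) *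
      (\<Sum>\<^sub>\<infinity>y\<in>L'. ee ((A * ip p r r / 2 - ip p r y) / C) * ee (D * ip p y y / (2 * C)) * ee (\<tau> * ip p y y / 2 + ip p y z))))"
  proof (rule sum.cong[OF refl])
    fix r assume r: "r \<in> R"
    then have rL: "r \<in> L" using R by blast
    let ?K = "ee (A * ip p r r / (2 * C) - ip p r r / (2 * C * u) + ip p r z / u)"
    have "(\<Sum>\<^sub>\<infinity>l\<in>L. ?E (vadd r (scale C l))) = (\<Sum>\<^sub>\<infinity>l\<in>L. ?K * ee ((- C / u) * ip p l l / 2 + ip p l (z' r)))"
      by (intro infsum_cong term1 rL)
    also have "\<dots> = ?K * th p L (- C / u) (z' r)" unfolding th_def by (rule infsum_cmult_right')
    also have "th p L (- C / u) (z' r) = (\<i> / (- C / u)) ^ wt / vol * dth p L' (- C / u) (z' r)"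
      by (rule poisson_L[OF imC z'[OF r]])
    also have "\<i> / (- C / u) = - \<i> * u / C" by simp
    also have "?K * ((- \<i> * u / C) ^ wt / vol * dth p L' (- C / u) (z' r)) = (- \<i> * u / C) ^ wt / vol * (?K * dth p L' (- C / u) (z' r))" by simp
    also have "?K * dth p L' (- C / u) (z' r) = ee (C * ip p z z / (2 * u)) *
      (\<Sum>\<^sub>\<infinity>y\<in>L'. ee ((A * ip p r r / 2 - ip p r y) / C) * ee (D * ip p y y / (2 * C)) * ee (\<tau> * ip p y y / 2 + ip p y z))"
      unfolding dth_def infsum_cmult_right'[symmetric] term2 ..
    finally show "(\<Sum>\<^sub>\<infinity>l\<in>L. ?E (vadd r (scale C l))) = (- \<i> * u / C) ^ wt / vol * (ee (C * ip p z z / (2 * u)) *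
      (\<Sum>\<^sub>\<infinity>y\<in>L'. ee ((A * ip p r r / 2 - ip p r y) / C) * ee (D * ip p y y / (2 * C)) * ee (\<tau> * ip p y y / 2 + ip p y z)))" .
  qed
  also have "\<dots> = ee (C * ip p z z / (2 * u)) * ((- \<i> * u / C) ^ wt / vol *
      (\<Sum>r\<in>R. \<Sum>\<^sub>\<infinity>y\<in>L'. ee ((A * ip p r r / 2 - ip p r y) / C) * ee (D * ip p y y / (2 * C)) * ee (\<tau> * ip p y y / 2 + ip p y z)))"
    by (simp add: sum_distrib_left mult_ac)
  also have "(\<Sum>r\<in>R. \<Sum>\<^sub>\<infinity>y\<in>L'. ee ((A * ip p r r / 2 - ip p r y) / C) * ee (D * ip p y y / (2 * C)) * ee (\<tau> * ip p y y / 2 + ip p y z))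
    = (\<Sum>\<^sub>\<infinity>y\<in>L'. \<Sum>r\<in>R. ee ((A * ip p r r / 2 - ip p r y) / C) * ee (D * ip p y y / (2 * C)) * ee (\<tau> * ip p y y / 2 + ip p y z))"
  proof (rule infsumI[symmetric, OF has_sum_finite_sum[OF R(1)]], rule has_sum_infsum)
    fix r assume "r \<in> R"
    then have rL: "r \<in> L" using R by blast
    have real: "ip p y y \<in> \<real>" "ip p r y \<in> \<real>" "ip p r r \<in> \<real>" if "y \<in> L'" for y
    proof -
      have "y l \<in> \<real>" for l using frac_vecs_real[OF _ p_pos, of y l] that L'_frac by (metis Reals_of_real subsetD)
      moreover have "r l \<in> \<real>" for l using frac_vecs_real[OF _ p_pos, of r l] rL lat_subset_frac by (metis Reals_of_real subsetD)
      ultimately show "ip p y y \<in> \<real>" "ip p r y \<in> \<real>" "ip p r r \<in> \<real>" by (auto simp: ip_def intro!: sum_in_Reals)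
    qed
    have "norm (ee ((A * ip p r r / 2 - ip p r y) / C) * ee (D * ip p y y / (2 * C)) * ee (\<tau> * ip p y y / 2 + ip p y z)) = norm (ee (\<tau> * ip p y y / 2 + ip p y z))"
      if "y \<in> L'" for y
    proof -
      have "(A * ip p r r / 2 - ip p r y) / C \<in> \<real>" "D * ip p y y / (2 * C) \<in> \<real>"
        using real[OF that] by (simp_all add: A_def C_def D_def)
      then show ?thesis by (simp add: norm_mult norm_ee complex_is_Real_iff)
    qed
    then show "(\<lambda>y. ee ((A * ip p r r / 2 - ip p r y) / C) * ee (D * ip p y y / (2 * C)) * ee (\<tau> * ip p y y / 2 + ip p y z)) summable_on L'"
      by (intro abs_summable_summable[OF summable_on_cong[THEN iffD2, OF _ th_summable[OF \<tau> p_pos L'_frac, of z]]])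
  qed
  finally have "th p L t (scale (1 / u) z) = ee (C * ip p z z / (2 * u)) * ((- \<i> * u / C) ^ wt / vol *
     (\<Sum>\<^sub>\<infinity>y\<in>L'. gauss_weight R a c y * ee (D * ip p y y / (2 * C)) * ee (\<tau> * ip p y y / 2 + ip p y z)))"
    by (simp add: gauss_weight_def A_def C_def sum_distrib_right)
  moreover have "ee (C * ip p z z / (2 * u)) * ee (- (C * ip p z z / (2 * u))) = 1" by (simp flip: ee_add)
  ultimately show ?thesis by (simp add: t_def A_def C_def D_def mult_ac)
qed

end

section \<open>Gauss sums\<close>

locale gauss_sum = theta_lattice +
  fixes b d :: int and R :: "cvec set" and rep :: "cvec \<Rightarrow> cvec"
  assumes d: "d > 0" "odd d" "coprime b d" "coprime d (int p)"
    and R: "finite R" "R \<subseteq> L" "card R = nat d ^ (p - 1)"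
    and rep: "\<And>x. x \<in> L \<Longrightarrow> rep x \<in> R" "\<And>x. x \<in> L \<Longrightarrow> congr d x (rep x)"
    and uniq: "\<And>r s. r \<in> R \<Longrightarrow> s \<in> R \<Longrightarrow> congr d r s \<Longrightarrow> r = s"
begin

definition F :: "cvec \<Rightarrow> complex" where "F x = ee (of_int b * ip p x x / (2 * of_int d))"
definition G :: complex where "G = (\<Sum>r\<in>R. F r)"

lemma ip_L_int:
  assumes "x \<in> L" "y \<in> L"
  obtains m where "ip p x y = of_int m"
  using ip_LL[OF assms] by (auto elim: Ints_cases)

lemma F_congr:
  assumes "y \<in> L" "congr d x y"
  shows "F x = F y"
proof -
  obtain l where l: "l \<in> L" "x = vadd y (scale (of_int d) l)" using assms by (auto simp: congr_def)
  have "of_int b * ip p x x / (2 * of_int d) = of_int b * ip p y y / (2 * of_int d) + (of_int b * ip p y l + of_int b * of_int d * (ip p l l / 2))"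
    using d unfolding l(2) by (simp add: ip_commute[of p l y] field_simps)
  moreover have "of_int b * ip p y l + of_int b * of_int d * (ip p l l / 2) \<in> \<int>"
    by (intro Ints_add Ints_mult Ints_of_int ip_LL assms even_L l)
  ultimately show ?thesis unfolding F_def by (metis ee_add ee_Ints mult_1_right)
qed

lemma congr_rep_eq:
  assumes "x \<in> L" "y \<in> L" "rep x = rep y"
  shows "congr d x y"
  using rep(2)[OF assms(1)] rep(2)[OF assms(2)] congr_sym congr_trans unfolding assms(3) by blast

lemma sum_shift_reps:
  assumes s: "s \<in> L" and f: "\<And>x y. y \<in> L \<Longrightarrow> x \<in> L \<Longrightarrow> congr d x y \<Longrightarrow> f x = (f y :: complex)"
  shows "(\<Sum>r\<in>R. f (vadd r s)) = (\<Sum>r\<in>R. f r)"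
proof (rule sum_reindex_reps[of R L rep])
  fix r r' assume r: "r \<in> R" "r' \<in> R" "rep (vadd r s) = rep (vadd r' s)"
  have "congr d (vadd r s) (vadd r' s)" by (rule congr_rep_eq) (use r s R in \<open>auto intro: lat_vadd\<close>)
  then have "congr d r r'" by (auto simp: congr_def vadd_def fun_eq_iff algebra_simps)
  then show "r = r'" by (rule uniq[OF r(1,2)])
qed (use s R rep in \<open>auto intro: lat_vadd f\<close>)

lemma cnj_F: "x \<in> L \<Longrightarrow> cnj (F x) = ee (- (of_int b * ip p x x / (2 * of_int d)))"
proof -
  assume x: "x \<in> L"
  obtain m where "ip p x x = of_int m" using ip_L_int[OF x x] .
  then show ?thesis by (simp add: F_def cnj_ee)
qed

lemma zero_L: "(\<lambda>l. 0) \<in> L"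
  by (rule lat_zero)

text \<open>A nontrivial character has sum zero. Off the zero class the character is nontrivial by
  \<open>pairing_nondegenerate_mod\<close>, as d is prime to p and to b.\<close>

lemma character_sum:
  assumes r: "r \<in> L"
  shows "(\<Sum>s\<in>R. ee (of_int b * ip p r s / of_int d)) = (if congr d r (\<lambda>l. 0) then of_nat (card R) else 0)"
proof (cases "congr d r (\<lambda>l. 0)")
  case True
  then obtain l where l: "l \<in> L" "r = scale (of_int d) l" by (auto simp: congr_def vadd_def)
  have "ee (of_int b * ip p r s / of_int d) = 1" if "s \<in> R" for s
  proof -
    have "of_int b * ip p r s / of_int d = of_int b * ip p l s" using d by (simp add: l(2))
    also have "\<dots> \<in> \<int>" using that R by (intro Ints_mult Ints_of_int ip_LL l) auto
    finally show ?thesis by simp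
  qed
  then show ?thesis using True by simp
next
  case False
  have "\<exists>s0\<in>L. of_int b * ip p r s0 / of_int d \<notin> \<int>"
  proof (rule ccontr)
    assume "\<not> ?thesis"
    then have int: "of_int b * ip p r s / of_int d \<in> \<int>" if "s \<in> L" for s using that by blast
    have "ip p s r / of_int d \<in> \<int>" if s: "s \<in> L" for s
    proof -
      obtain m where m: "ip p r s = of_int m" using ip_L_int[OF r s] .
      obtain k where "of_int b * of_int m / of_int d = (of_int k :: complex)" using int[OF s] m by (auto elim: Ints_cases)
      then have "(of_int (b * m) :: complex) = of_int (d * k)" using d by (simp add: field_simps)
      then have "b * m = d * k" by (simp only: of_int_eq_iff)
      then have "d dvd b * m" by simp
      then have "d dvd m" using d(3) by (simp add: coprime_commute coprime_dvd_mult_right_iff)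
      then show ?thesis using d m by (auto simp: ip_commute[of p s r])
    qed
    then obtain t' where "t' \<in> L" "r = scale (of_int d) t'"
      using pairing_nondegenerate_mod[OF r _ d(4) e] d(1) by (metis less_irrefl)
    then have "congr d r (\<lambda>l. 0)" by (intro congrI[of t']) (auto simp: vadd_def)
    then show False using False by simp
  qed
  then obtain s0 where s0: "s0 \<in> L" "of_int b * ip p r s0 / of_int d \<notin> \<int>" by blast
  let ?X = "\<lambda>s. ee (of_int b * ip p r s / of_int d)"
  have "(\<Sum>s\<in>R. ?X (vadd s s0)) = (\<Sum>s\<in>R. ?X s)"
  proof (rule sum_shift_reps[OF s0(1)])
    fix x y assume "y \<in> L" "congr d x y"
    then obtain l where l: "l \<in> L" "x = vadd y (scale (of_int d) l)" by (auto simp: congr_def)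
    have "of_int b * ip p r x / of_int d = of_int b * ip p r y / of_int d + of_int b * ip p r l"
      using d unfolding l(2) by (simp add: field_simps)
    moreover have "of_int b * ip p r l \<in> \<int>" by (intro Ints_mult Ints_of_int ip_LL l r)
    ultimately show "?X x = ?X y" by (metis ee_add ee_Ints mult_1_right)
  qed
  moreover have "(\<Sum>s\<in>R. ?X (vadd s s0)) = ?X s0 * (\<Sum>s\<in>R. ?X s)"
    by (simp add: sum_distrib_left distrib_left add_divide_distrib ee_add mult.commute)
  ultimately have "(?X s0 - 1) * (\<Sum>s\<in>R. ?X s) = 0" by (simp add: left_diff_distrib)
  then have "?X s0 = 1 \<or> (\<Sum>s\<in>R. ?X s) = 0" by simp
  then show ?thesis using False s0(2) by (simp add: ee_eq_1_iff)
qed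

text \<open>Replacing r by r + s in the double sum leaves the characters s -> ee (b ip(r, s) / d),
  whose sums vanish unless r is in the zero class.\<close>

lemma G_mult_cnj: "G * cnj G = of_int d ^ (p - 1)"
proof -
  let ?r0 = "rep (\<lambda>l. 0)"
  have r0: "?r0 \<in> R" by (rule rep(1)[OF zero_L])
  have "cnj G = (\<Sum>s\<in>R. ee (- (of_int b * ip p s s / (2 * of_int d))))"
    unfolding G_def cnj_sum by (intro sum.cong refl cnj_F) (use R in auto)
  then have "G * cnj G = (\<Sum>s\<in>R. G * ee (- (of_int b * ip p s s / (2 * of_int d))))"
    by (simp only: sum_distrib_left)
  also have "\<dots> = (\<Sum>s\<in>R. \<Sum>r\<in>R. F r * ee (of_int b * ip p r s / of_int d))"
  proof (rule sum.cong[OF refl])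
    fix s assume "s \<in> R"
    then have s: "s \<in> L" using R by blast
    have "F (vadd r s) * ee (- (of_int b * ip p s s / (2 * of_int d))) = F r * ee (of_int b * ip p r s / of_int d)" for r
    proof -
      have "of_int b * ip p (vadd r s) (vadd r s) / (2 * of_int d) + - (of_int b * ip p s s / (2 * of_int d))
         = of_int b * ip p r r / (2 * of_int d) + of_int b * ip p r s / of_int d"
        using d by (simp add: ip_commute[of p s r] field_simps)
      then show ?thesis unfolding F_def by (metis ee_add)
    qed
    moreover have "G = (\<Sum>r\<in>R. F (vadd r s))" unfolding G_def by (rule sum_shift_reps[OF s F_congr, symmetric])
    ultimately show "G * ee (- (of_int b * ip p s s / (2 * of_int d))) = (\<Sum>r\<in>R. F r * ee (of_int b * ip p r s / of_int d))"
      by (simp add: sum_distrib_right)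
  qed
  also have "\<dots> = (\<Sum>r\<in>R. F r * (\<Sum>s\<in>R. ee (of_int b * ip p r s / of_int d)))"
    by (subst sum.swap) (simp add: sum_distrib_left)
  also have "\<dots> = (\<Sum>r\<in>R. if r = ?r0 then F r * of_nat (card R) else 0)"
  proof (rule sum.cong[OF refl])
    fix r assume r: "r \<in> R"
    then have rL: "r \<in> L" using R by blast
    have "congr d r (\<lambda>l. 0) \<longleftrightarrow> r = ?r0"
      using rep(2)[OF zero_L] uniq[OF r r0] congr_trans congr_sym by blast
    then show "F r * (\<Sum>s\<in>R. ee (of_int b * ip p r s / of_int d)) = (if r = ?r0 then F r * of_nat (card R) else 0)"
      by (simp add: character_sum[OF rL])
  qed
  also have "\<dots> = F ?r0 * of_nat (card R)" using R(1) r0 by simp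
  also have "F ?r0 = F (\<lambda>l. 0)" by (rule F_congr[OF zero_L congr_sym[OF rep(2)[OF zero_L]]])
  also have "F (\<lambda>l. 0) = 1" by (simp add: F_def)
  also have "of_nat (card R) = (of_int d :: complex) ^ (p - 1)" using d(1) by (simp add: R(3))
  finally show ?thesis by simp
qed

text \<open>The multiplier is - 1 modulo d.\<close>

lemma congr_cancel:
  assumes "congr d (scale (of_int (d * m - 1)) r) (scale (of_int (d * m - 1)) r')" "r \<in> L" "r' \<in> L"
  shows "congr d r r'"
proof -
  obtain l where l: "l \<in> L" "scale (of_int (d * m - 1)) r = vadd (scale (of_int (d * m - 1)) r') (scale (of_int d) l)"
    using assms by (auto simp: congr_def)
  have "vadd (vadd (scale (of_int m) r) (scale (of_int (- m)) r')) (scale (of_int (- 1)) l) \<in> L"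
    by (intro lat_vadd lat_scale assms l) auto
  then show ?thesis
    by (rule congrI) (use l(2) in \<open>auto simp: vadd_def scale_def fun_eq_iff algebra_simps\<close>)
qed

text \<open>The substitution (r, s) -> (u r + v s, - v r + u s) multiplies ip(r, r) + ip(s, s) by
  u^2 + v^2, which is - 1 modulo d, and so conjugates each term of G^2.\<close>

lemma G_square: "G * G = cnj G * cnj G"
proof -
  obtain u v where "int (nat d) dvd u\<^sup>2 + v\<^sup>2 + 1" using two_squares_mod_odd[of "nat d"] d by (auto simp: even_nat_iff)
  then obtain m where "u\<^sup>2 + v\<^sup>2 + 1 = d * m" using d(1) by (auto elim!: dvdE)
  then have m: "u * u + v * v = d * m - 1" by (simp add: power2_eq_square)
  then have mC: "(of_int u * of_int u + of_int v * of_int v :: complex) = of_int (d * m - 1)"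
    by (simp only: flip: of_int_mult of_int_add)
  define \<psi> where "\<psi> = (\<lambda>(r, s). (vadd (scale (of_int u) r) (scale (of_int v) s), vadd (scale (of_int (- v)) r) (scale (of_int u) s)))"
  let ?F = "\<lambda>(x, y). F x * F y"
  have \<psi>L: "\<psi> x \<in> L \<times> L" if "x \<in> L \<times> L" for x
    using that by (auto simp: \<psi>_def intro!: lat_vadd lat_scale)
  have "(\<Sum>x\<in>R \<times> R. ?F (\<psi> x)) = (\<Sum>x\<in>R \<times> R. ?F x)"
  proof (rule sum_reindex_reps[of _ "L \<times> L" "map_prod rep rep"])
    show "finite (R \<times> R)" using R by simp
    show "map_prod rep rep x \<in> R \<times> R" if "x \<in> L \<times> L" for x using that rep by auto
    show "\<psi> r \<in> L \<times> L" if "r \<in> R \<times> R" for r using \<psi>L that R(2) by blast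
    show "?F x = ?F (map_prod rep rep x)" if "x \<in> L \<times> L" for x
    proof -
      have "F y = F (rep y)" if "y \<in> L" for y using F_congr[OF _ rep(2)[OF that]] rep(1)[OF that] R(2) by blast
      then show ?thesis using that by auto
    qed
    fix x y assume xy: "x \<in> R \<times> R" "y \<in> R \<times> R" "map_prod rep rep (\<psi> x) = map_prod rep rep (\<psi> y)"
    obtain r s where rs: "x = (r, s)" "r \<in> R" "s \<in> R" using xy by auto
    obtain r' s' where rs': "y = (r', s')" "r' \<in> R" "s' \<in> R" using xy by auto
    have L: "r \<in> L" "s \<in> L" "r' \<in> L" "s' \<in> L" using rs rs' R by auto
    have c1: "congr d (fst (\<psi> x)) (fst (\<psi> y))"
      by (rule congr_rep_eq) (use xy(3) \<psi>L[of x] \<psi>L[of y] L rs rs' in \<open>auto simp: prod_eq_iff mem_Times_iff\<close>)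
    have c2: "congr d (snd (\<psi> x)) (snd (\<psi> y))"
      by (rule congr_rep_eq) (use xy(3) \<psi>L[of x] \<psi>L[of y] L rs rs' in \<open>auto simp: prod_eq_iff mem_Times_iff\<close>)
    \<comment> \<open>The adjugate of \<open>\<psi>\<close> recovers r and s up to the factor u^2 +
      v^2, a unit modulo d; this gives injectivity on classes.\<close>
    have e1: "vadd (scale (of_int u) (fst (\<psi> (r, s)))) (scale (of_int (- v)) (snd (\<psi> (r, s)))) = scale (of_int (d * m - 1)) r" for r s
      unfolding mC[symmetric] by (auto simp: \<psi>_def vadd_def scale_def fun_eq_iff algebra_simps)
    have e2: "vadd (scale (of_int v) (fst (\<psi> (r, s)))) (scale (of_int u) (snd (\<psi> (r, s)))) = scale (of_int (d * m - 1)) s" for r s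
      unfolding mC[symmetric] by (auto simp: \<psi>_def vadd_def scale_def fun_eq_iff algebra_simps)
    have "congr d r r'" using congr_cancel[OF congr_lin[OF c1 c2, of u "- v", unfolded rs(1) rs'(1) e1] L(1,3)] .
    moreover have "congr d s s'" using congr_cancel[OF congr_lin[OF c1 c2, of v u, unfolded rs(1) rs'(1) e2] L(2,4)] .
    ultimately show "x = y" using uniq rs rs' by blast
  qed
  moreover have "?F (\<psi> x) = cnj (?F x)" if xR: "x \<in> R \<times> R" for x
  proof -
    obtain r s where x: "x = (r, s)" "r \<in> L" "s \<in> L" using xR R(2) by (cases x) auto
    let ?q = "ip p r r + ip p s s"
    have "ip p (fst (\<psi> x)) (fst (\<psi> x)) + ip p (snd (\<psi> x)) (snd (\<psi> x)) = (of_int u * of_int u + of_int v * of_int v) * ?q"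
      by (simp add: \<psi>_def x(1) ip_commute[of p s r] algebra_simps)
    also have "\<dots> = (of_int d * of_int m - 1) * ?q" unfolding mC by simp
    finally have "of_int b * ip p (fst (\<psi> x)) (fst (\<psi> x)) / (2 * of_int d) + of_int b * ip p (snd (\<psi> x)) (snd (\<psi> x)) / (2 * of_int d)
      = of_int b * ((of_int d * of_int m - 1) * ?q) / (2 * of_int d)" by (simp only: add_divide_distrib[symmetric] distrib_left[symmetric])
    also have "\<dots> = - (of_int b * ip p r r / (2 * of_int d)) + - (of_int b * ip p s s / (2 * of_int d)) + of_int b * of_int m * (ip p r r / 2 + ip p s s / 2)"
      using d by (simp add: field_simps)
    finally have eq: "of_int b * ip p (fst (\<psi> x)) (fst (\<psi> x)) / (2 * of_int d) + of_int b * ip p (snd (\<psi> x)) (snd (\<psi> x)) / (2 * of_int d)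
      = - (of_int b * ip p r r / (2 * of_int d)) + - (of_int b * ip p s s / (2 * of_int d)) + of_int b * of_int m * (ip p r r / 2 + ip p s s / 2)" .
    have i: "of_int b * of_int m * (ip p r r / 2 + ip p s s / 2) \<in> \<int>"
      by (intro Ints_mult Ints_add Ints_of_int even_L x)
    have "?F (\<psi> x) = ee (of_int b * ip p (fst (\<psi> x)) (fst (\<psi> x)) / (2 * of_int d) + of_int b * ip p (snd (\<psi> x)) (snd (\<psi> x)) / (2 * of_int d))"
      by (simp add: case_prod_unfold F_def ee_add)
    also have "\<dots> = ee (- (of_int b * ip p r r / (2 * of_int d))) * ee (- (of_int b * ip p s s / (2 * of_int d)))"
      unfolding eq by (simp only: ee_add ee_Ints[OF i] mult_1_right)
    also have "\<dots> = cnj (?F x)" using x by (simp add: cnj_F)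
    finally show ?thesis .
  qed
  ultimately have "(\<Sum>x\<in>R \<times> R. cnj (?F x)) = (\<Sum>x\<in>R \<times> R. ?F x)" by simp
  moreover have "(\<Sum>x\<in>R \<times> R. ?F x) = G * G" unfolding G_def sum_product sum.cartesian_product by simp
  moreover have "(\<Sum>x\<in>R \<times> R. cnj (?F x)) = cnj (G * G)" using calculation(2) by (metis cnj_sum)
  ultimately show ?thesis by simp
qed

lemma F_power: "x \<in> L \<Longrightarrow> \<exists>k. F x = ee (1 / of_int d) ^ k"
proof -
  assume x: "x \<in> L"
  obtain q where q: "ip p x x / 2 = of_int q" using even_L[OF x] by (auto elim: Ints_cases)
  define k where "k = nat ((b * q) mod d)"
  have bq: "b * q = d * (b * q div d) + int k" using d(1) by (simp add: k_def)
  have "of_int b * ip p x x / (2 * of_int d) = of_int b * (ip p x x / 2) / of_int d" by simp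
  also have "\<dots> = of_int (b * q) / of_int d" by (simp add: q)
  also have "\<dots> = of_int (b * q div d) + of_nat k * (1 / of_int d)" using d(1) by (subst bq) (simp add: field_simps)
  finally have "F x = ee (of_int (b * q div d) + of_nat k * (1 / of_int d))" by (simp only: F_def)
  then show ?thesis by (simp only: ee_add ee_of_nat_mult) auto
qed

lemma F_shift: "x \<in> L \<Longrightarrow> F (\<lambda>i. x (i + 1)) = F x"
  using ip_shift[of p x x 1] L_hyp[of x] p_pos by (simp add: F_def hyperplane_def)

lemma congr_shift: "congr d x y \<Longrightarrow> congr d (\<lambda>i. x (i + k)) (\<lambda>i. y (i + k))"
  unfolding congr_def using lat_shift[of _ p e k] by (fastforce simp: vadd_def scale_def)

text \<open>The shift permutes the classes modulo d, preserves \<open>F\<close> and by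
  \<open>shift_fixed_mod\<close> fixes only the zero class. Off that class each value of
  \<open>F\<close> is therefore taken a multiple of p times.\<close>

lemma G_mod_p: "\<exists>y\<in>int_span (ee (1 / of_int d)). G = 1 + of_nat p * y"
proof -
  define s where "s x = rep (\<lambda>i. x (i + 1))" for x
  define r0 where "r0 = rep (\<lambda>l. 0)"
  have r0: "r0 \<in> R" unfolding r0_def by (rule rep(1)[OF zero_L])
  have s: "s x \<in> R" "congr d (\<lambda>i. x (i + 1)) (s x)" if "x \<in> R" for x
    unfolding s_def using rep[OF lat_shift, of x 1] that R by auto
  have per: "congr d (\<lambda>i. x (i + k)) ((s ^^ k) x) \<and> (s ^^ k) x \<in> R" if x: "x \<in> R" for x k
  proof (induction k)
    case 0
    show ?case using x congrI[OF zero_L] by (simp add: vadd_def scale_def)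
  next
    case (Suc k)
    have "congr d (\<lambda>i. x (i + Suc k)) (\<lambda>i. (s ^^ k) x (i + 1))" using congr_shift[OF conjunct1[OF Suc], of 1] by (simp add: add_ac)
    then show ?case using s[OF conjunct2[OF Suc]] congr_trans unfolding funpow.simps o_apply by blast
  qed
  have fixed: "x = r0" if x: "x \<in> R" and sx: "congr d (\<lambda>i. x (i + 1)) x" for x
  proof -
    obtain l where l: "l \<in> L" "(\<lambda>i. x (i + 1)) = vadd x (scale (of_int d) l)" using sx by (auto simp: congr_def)
    have "\<exists>t\<in>L. x = scale (of_int d) t"
    proof (rule shift_fixed_mod[OF _ l(1) _ d(4) e(1)])
      show "x \<in> L" using x R by blast
      show "x (i + 1) - x i = of_int d * l i" for i using fun_cong[OF l(2), of i] by (simp add: vadd_def scale_def)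
    qed
    then obtain t where "t \<in> L" "x = scale (of_int d) t" by blast
    then have "congr d x (\<lambda>l. 0)" by (intro congrI[of t]) (auto simp: vadd_def)
    then show ?thesis unfolding r0_def using rep(2)[OF zero_L] congr_trans uniq[OF x rep(1)[OF zero_L]] by blast
  qed
  have sr0: "s x \<noteq> r0" if x: "x \<in> R" "x \<noteq> r0" for x
  proof
    assume "s x = r0"
    then have "congr d (\<lambda>i. x (i + 1)) (\<lambda>l. 0)"
      using s(2)[OF x(1)] rep(2)[OF zero_L] congr_sym congr_trans unfolding r0_def by metis
    then obtain l where l: "l \<in> L" "(\<lambda>i. x (i + 1)) = scale (of_int d) l" by (auto simp: congr_def vadd_def)
    have px: "x (i + p) = x i" for i using x R L_hyp by (auto simp: hyperplane_def periodic_def)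
    \<comment> \<open>Shifting p - 1 times more undoes the shift.\<close>
    have "x = scale (of_int d) (\<lambda>i. l (i + (p - 1)))"
    proof
      fix i
      have "x i = x (i + (p - 1) + 1)" using px[of i] p_pos by simp
      then show "x i = scale (of_int d) (\<lambda>i. l (i + (p - 1))) i" using fun_cong[OF l(2), of "i + (p - 1)"] by (simp add: scale_def)
    qed
    then have "congr d x (\<lambda>l. 0)" by (intro congrI[OF lat_shift[OF l(1), of "p - 1"]]) (simp add: vadd_def)
    then have "x = r0" unfolding r0_def using rep(2)[OF zero_L] congr_trans uniq[OF x(1) rep(1)[OF zero_L]] by blast
    then show False using x by simp
  qed
  have dvd: "p dvd card {x \<in> R - {r0}. F x = t}" for t
  proof (rule prime_dvd_card_free_action[of _ p s])
    show "finite {x \<in> R - {r0}. F x = t}" using R by simp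
    show "prime p" by (rule prime)
    fix x assume "x \<in> {x \<in> R - {r0}. F x = t}"
    then have x: "x \<in> R" "x \<noteq> r0" "F x = t" by auto
    have xL: "x \<in> L" "(\<lambda>i. x (i + 1)) \<in> L" using x R lat_shift[of x p e 1] by auto
    have "F (s x) = F x" using F_congr[OF _ s(2)[OF x(1)]] F_shift[OF xL(1)] s(1)[OF x(1)] R by auto
    then show "s x \<in> {x \<in> R - {r0}. F x = t}" using s x sr0 by auto
    have "congr d x ((s ^^ p) x)"
    proof -
      have "(\<lambda>i. x (i + p)) = x" using L_hyp[OF xL(1)] by (simp add: hyperplane_def periodic_def)
      then show ?thesis using per[OF x(1), of p] by simp
    qed
    then show "(s ^^ p) x = x" using uniq[OF x(1)] per[OF x(1)] by metis
    show "s x \<noteq> x" using fixed[OF x(1)] s(2)[OF x(1)] x(2) by metis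
  qed
  have "G = F r0 + (\<Sum>r\<in>R - {r0}. F r)" unfolding G_def by (rule sum.remove[OF R(1) r0])
  also have "F r0 = F (\<lambda>l. 0)" unfolding r0_def by (rule F_congr[OF zero_L congr_sym[OF rep(2)[OF zero_L]]])
  also have "F (\<lambda>l. 0) = 1" by (simp add: F_def)
  also have "(\<Sum>r\<in>R - {r0}. F r) = (\<Sum>t\<in>F ` (R - {r0}). \<Sum>x\<in>{x \<in> R - {r0}. F x = t}. F x)"
    using R by (intro sum.image_gen) auto
  also have "\<dots> = (\<Sum>t\<in>F ` (R - {r0}). of_nat p * (of_nat (card {x \<in> R - {r0}. F x = t} div p) * t))"
  proof (rule sum.cong[OF refl])
    fix t
    have "(\<Sum>x\<in>{x \<in> R - {r0}. F x = t}. F x) = of_nat (card {x \<in> R - {r0}. F x = t}) * t" by simp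
    also have "card {x \<in> R - {r0}. F x = t} = p * (card {x \<in> R - {r0}. F x = t} div p)" using dvd[of t] by simp
    finally show "(\<Sum>x\<in>{x \<in> R - {r0}. F x = t}. F x) = of_nat p * (of_nat (card {x \<in> R - {r0}. F x = t} div p) * t)"
      by (simp only: of_nat_mult mult.assoc)
  qed
  also have "\<dots> = of_nat p * (\<Sum>t\<in>F ` (R - {r0}). of_nat (card {x \<in> R - {r0}. F x = t} div p) * t)"
    by (rule sum_distrib_left[symmetric])
  finally have "G = 1 + of_nat p * (\<Sum>t\<in>F ` (R - {r0}). of_nat (card {x \<in> R - {r0}. F x = t} div p) * t)" .
  moreover have "(\<Sum>t\<in>F ` (R - {r0}). of_nat (card {x \<in> R - {r0}. F x = t} div p) * t) \<in> int_span (ee (1 / of_int d))"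
  proof (rule int_span_sum)
    fix t assume "t \<in> F ` (R - {r0})"
    then obtain k where k: "t = ee (1 / of_int d) ^ k" using F_power R by blast
    show "of_nat (card {x \<in> R - {r0}. F x = t} div p) * t \<in> int_span (ee (1 / of_int d))"
      unfolding k using int_span.power[of "int (card {x \<in> R - {r0}. F x = ee (1 / of_int d) ^ k} div p)" "ee (1 / of_int d)" k] by simp
  qed
  ultimately show ?thesis by blast
qed

text \<open>Put D = d^((p-1)/2). Absolute value and reality of the square leave G^2 = D^2 or - D^2.
  The minus sign would give - 1 = 1 modulo p, by Fermat and G = 1 modulo p. So G = s D with a sign
  s, and s D = 1 modulo p identifies s by Euler's criterion.\<close>

lemma G_eq: "G = of_int (Legendre d (int p)) * of_int d ^ wt"
proof -
  obtain y where y: "y \<in> int_span (ee (1 / of_int d))" "G = 1 + of_nat p * y" using G_mod_p by blast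
  define D where "D = d ^ wt"
  have p1: "p - 1 = wt + wt" using odd p_pos by (auto simp: wt_def elim!: oddE)
  have DD: "D * D = d ^ (p - 1)" unfolding D_def p1 power_add ..
  have root: "ee (1 / of_int d) ^ nat d = 1" using d(1) by (simp flip: ee_of_nat_mult)
  have dv: "int p dvd n" if "of_int n = of_nat p * w" "w \<in> int_span (ee (1 / of_int d))" for n w
    by (rule int_span_divisible[OF prime that(2) root _ that(1)]) (use d in simp)
  have p3: "p > 2" using prime odd prime_ge_2_nat[of p] by (cases "p = 2") auto
  have nd: "\<not> int p dvd d"
  proof
    assume "int p dvd d"
    then have "int p dvd 1" by (rule coprime_common_divisor[OF d(4) _ dvd_refl])
    then show False using p3 by simp
  qed
  have fermat: "[d ^ (p - 1) = 1] (mod int p)"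
  proof -
    have "int (nat d) = d" using d(1) by simp
    then have "\<not> p dvd nat d" using nd by (simp flip: int_dvd_int_iff)
    then have "[(nat d) ^ (p - 1) = 1] (mod p)" by (rule fermat_theorem[OF prime])
    then have "[int ((nat d) ^ (p - 1)) = int 1] (mod int p)" by (simp only: cong_int_iff)
    then show ?thesis using d(1) by simp
  qed
  have "(G * G) * (G * G) = (G * cnj G) * (G * cnj G)" using G_square by (metis mult.assoc mult.commute)
  also have "\<dots> = (of_int (D * D)) * (of_int (D * D))" by (simp add: G_mult_cnj DD)
  finally have "(G * G - of_int (D * D)) * (G * G + of_int (D * D)) = 0" by (simp only: mult.commute[of "G * G - _"] square_diff_square_factored[symmetric] right_minus_eq)
  then consider "G * G = of_int (D * D)" | "G * G = - of_int (D * D)" by (auto simp: eq_neg_iff_add_eq_0)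
  then have GG: "G * G = of_int (D * D)"
  proof cases
    case 2
    have "of_int (- (D * D) - 1) = of_nat p * (of_int 2 * y + of_int (int p) * (y * y))"
    proof -
      have "of_int (- (D * D) - 1) = G * G - 1" using 2 by simp
      also have "\<dots> = of_nat p * (of_int 2 * y + of_int (int p) * (y * y))" unfolding y(2) by (simp add: algebra_simps)
      finally show ?thesis .
    qed
    then have "int p dvd - (D * D) - 1"
      by (rule dv) (intro int_span.add int_span_mult int_span_int y)
    moreover have "int p dvd D * D - 1" using fermat unfolding DD by (simp add: cong_iff_dvd_diff)
    ultimately have "int p dvd (- (D * D) - 1) + (D * D - 1)" by (rule dvd_add)
    then have "int p dvd 2" by simp
    then have "p \<le> 2" by (metis int_dvd_int_iff of_nat_numeral dvd_imp_le zero_less_numeral)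
    then show ?thesis using p3 by simp
  qed
  then have "(G - of_int D) * (G + of_int D) = 0" by (simp add: algebra_simps)
  then have "G - of_int D = 0 \<or> G + of_int D = 0" by (simp only: mult_eq_0_iff)
  then have "G = of_int (1 * D) \<or> G = of_int (- 1 * D)" by (simp add: eq_neg_iff_add_eq_0)
  then obtain s :: int where s: "s = 1 \<or> s = - 1" "G = of_int (s * D)" by blast
  have "of_int (s * D - 1) = of_nat p * y" using s(2) y(2) by (simp add: diff_eq_eq add.commute)
  then have "int p dvd s * D - 1" by (rule dv[OF _ y(1)])
  then have "int p dvd s * (s * D - 1)" by simp
  moreover have "s * (s * D - 1) = D - s" using s(1) by auto
  ultimately have "[D = s] (mod int p)" by (simp add: cong_iff_dvd_diff)
  then have "[s = D] (mod int p)" by (rule cong_sym)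
  then have "Legendre d (int p) = s" by (intro Legendre_eqI prime p3) (use s in \<open>auto simp: D_def wt_def\<close>)
  then show ?thesis using s(2) by (simp add: D_def)
qed

end

context theta_lattice
begin

text \<open>Splitting modulo c would lead to degenerate Gauss sums, as p divides c. With \<tau> = -
  1 / \<tau>1 the same transformation has the rows (b, - a) and (d, - c), so the modulus becomes d,
  which is prime to p; a final Poisson summation returns to \<tau>.\<close>

theorem jacobi_Gamma0:
  assumes \<tau>: "Im \<tau> > 0" and z: "z \<in> hyperplane p" and det: "a * d - b * c = 1" and pc: "int p dvd c"
    and d: "d > 0" "odd d"
  defines "u \<equiv> of_int c * \<tau> + of_int d"
  shows "th p L ((of_int a * \<tau> + of_int b) / u) (scale (1 / u) z) * ee (- (of_int c * ip p z z / (2 * u)))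
    = of_int (Legendre d (int p)) * u ^ wt * th p L \<tau> z"
proof -
  have u: "u \<noteq> 0" using im_moebius_pos[OF \<tau> det] by (simp add: u_def)
  have t0: "\<tau> \<noteq> 0" using \<tau> by auto
  have d0: "d \<noteq> 0" using d by simp
  obtain R rep where RR: "finite R" "R \<subseteq> L" "card R = nat \<bar>d\<bar> ^ (p - 1)"
    "bij_betw (\<lambda>(r, l). vadd r (scale (of_int d) l)) (R \<times> L) L"
    "\<And>x. x \<in> L \<Longrightarrow> rep x \<in> R" "\<And>x. x \<in> L \<Longrightarrow> congr d x (rep x)"
    "\<And>r s. r \<in> R \<Longrightarrow> s \<in> R \<Longrightarrow> congr d r s \<Longrightarrow> r = s"
    using that by (rule transversal[OF d0])
  have "coprime b d" by (rule coprimeI) (metis det dvd_diff dvd_mult dvd_mult2 mult.commute)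
  moreover have "coprime d (int p)"
    by (rule coprimeI) (metis det pc dvd_diff dvd_mult dvd_trans)
  ultimately interpret gauss_sum p e b d R rep
    by unfold_locales (use RR d in auto)
  have weight: "gauss_weight R b d y = G * ee (of_int c * ip p y y / (2 * of_int d))" if y: "y \<in> L'" for y
  proof -
    obtain c' where c': "c = int p * c'" using pc by blast
    \<comment> \<open>As p divides c and p L' lies in L, the vector c y is an admissible shift of
      the summation variable r.\<close>
    have cy: "scale (of_int c) y \<in> L"
    proof -
      have "scale (of_int c') (scale (of_nat p) y) \<in> L" by (intro lat_scale dual_lat_scale_prime[OF y e(2)]) simp
      then show ?thesis by (simp add: scale_def c' mult_ac)
    qed
    have eq: "(of_int b * ip p r r / 2 - ip p r y) / of_int d = of_int b * ip p (vadd r (scale (of_int c) y)) (vadd r (scale (of_int c) y)) / (2 * of_int d)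
       + of_int c * ip p y y / (2 * of_int d) + (- (of_int a * ip p r y) + - (of_int (a * c') * (of_nat p * ip p y y / 2)))" if r: "r \<in> R" for r
    proof -
      \<comment> \<open>Since b c is - 1 modulo d, the term linear in y comes from the square of r +
        c y: the weight is G times a phase.\<close>
      have D: "of_int b * of_int c = of_int a * (of_int d :: complex) - 1" using det by (simp flip: of_int_mult of_int_diff add: algebra_simps)
      have "of_int b * ip p (vadd r (scale (of_int c) y)) (vadd r (scale (of_int c) y))
         = of_int b * ip p r r + 2 * (of_int b * of_int c) * ip p r y + (of_int b * of_int c) * (of_int c * ip p y y)"
        by (simp add: ip_commute[of p y r] algebra_simps)
      also have "\<dots> = of_int b * ip p r r + 2 * (of_int a * of_int d - 1) * ip p r y + (of_int a * of_int d - 1) * (of_int c * ip p y y)"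
        unfolding D ..
      finally have E: "of_int b * ip p (vadd r (scale (of_int c) y)) (vadd r (scale (of_int c) y)) / (2 * of_int d)
        = (of_int b * ip p r r + 2 * (of_int a * of_int d - 1) * ip p r y + (of_int a * of_int d - 1) * (of_int c * ip p y y)) / (2 * of_int d)" by (rule arg_cong)
      have P: "of_nat p * of_int c' = (of_int c :: complex)" by (simp add: c')
      have "of_int (a * c') * (of_nat p * ip p y y / 2) = of_int a * of_int c * ip p y y / 2" by (simp add: P[symmetric])
      then show ?thesis unfolding E using d0 by (simp add: field_simps)
    qed
    have int: "- (of_int a * ip p r y) + - (of_int (a * c') * (of_nat p * ip p y y / 2)) \<in> \<int>" if r: "r \<in> R" for r
      using r R by (intro Ints_add Ints_minus Ints_mult Ints_of_int ip_LL' y dual_lat_level[OF y e]) auto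
    have "ee ((of_int b * ip p r r / 2 - ip p r y) / of_int d) = F (vadd r (scale (of_int c) y)) * ee (of_int c * ip p y y / (2 * of_int d))"
      if r: "r \<in> R" for r
      unfolding eq[OF r] F_def ee_add[of "_ + _" "- (of_int a * ip p r y) + _"] ee_Ints[OF int[OF r]] by (simp add: ee_add)
    then have "gauss_weight R b d y = (\<Sum>r\<in>R. F (vadd r (scale (of_int c) y)) * ee (of_int c * ip p y y / (2 * of_int d)))"
      unfolding gauss_weight_def by (intro sum.cong refl)
    also have "\<dots> = (\<Sum>r\<in>R. F (vadd r (scale (of_int c) y))) * ee (of_int c * ip p y y / (2 * of_int d))"
      by (rule sum_distrib_right[symmetric])
    also have "(\<Sum>r\<in>R. F (vadd r (scale (of_int c) y))) = G" unfolding G_def by (rule sum_shift_reps[OF cy F_congr])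
    finally show ?thesis .
  qed
  define \<tau>1 z1 where "\<tau>1 = - 1 / \<tau>" and "z1 = scale (- 1 / \<tau>) z"
  define u1 where "u1 = of_int d * \<tau>1 + of_int (- c)"
  have u1: "u1 = - (u / \<tau>)" using t0 by (simp add: u1_def u_def \<tau>1_def field_simps)
  have \<tau>1: "Im \<tau>1 > 0" unfolding \<tau>1_def by (rule im_neg_inverse_pos[OF \<tau>])
  have z1: "z1 \<in> hyperplane p" unfolding z1_def by (rule hyperplane_scale[OF z])
  have det1: "b * (- c) - (- a) * d = 1" using det by (simp add: algebra_simps)
  have "th p L ((of_int b * \<tau>1 + of_int (- a)) / u1) (scale (1 / u1) z1) * ee (- (of_int d * ip p z1 z1 / (2 * u1)))
    = (- \<i> * u1 / of_int d) ^ wt / vol *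
      (\<Sum>\<^sub>\<infinity>y\<in>L'. gauss_weight R b d y * ee (of_int (- c) * ip p y y / (2 * of_int d)) * ee (\<tau>1 * ip p y y / 2 + ip p y z1))"
    unfolding u1_def by (rule jacobi_general[OF \<tau>1 z1 det1 d0 RR(1,2,4)])
  also have "(\<Sum>\<^sub>\<infinity>y\<in>L'. gauss_weight R b d y * ee (of_int (- c) * ip p y y / (2 * of_int d)) * ee (\<tau>1 * ip p y y / 2 + ip p y z1))
     = (\<Sum>\<^sub>\<infinity>y\<in>L'. G * ee (\<tau>1 * ip p y y / 2 + ip p y z1))"
    by (intro infsum_cong) (simp add: weight ee_minus)
  also have "\<dots> = G * th p L' \<tau>1 z1" unfolding th_def by (rule infsum_cmult_right')
  also have "- \<i> * u1 / of_int d = (\<i> / \<tau>) * (u / of_int d)" using u1 by simp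
  also have "((\<i> / \<tau>) * (u / of_int d)) ^ wt / vol * (G * th p L' \<tau>1 z1) = ((\<i> / \<tau>) ^ wt / vol * th p L' \<tau>1 z1) * (u ^ wt * (G / of_int d ^ wt))"
    by (simp only: power_mult_distrib power_divide) (simp add: field_simps)
  also have "(\<i> / \<tau>) ^ wt / vol * th p L' \<tau>1 z1 = ee (ip p z z / (2 * \<tau>)) * th p L \<tau> z"
    unfolding poisson_L[OF \<tau> z] dth_eq_th \<tau>1_def z1_def by (simp add: ee_minus)
  also have "G / of_int d ^ wt = of_int (Legendre d (int p))" using d0 by (simp add: G_eq)
  also have "(of_int b * \<tau>1 + of_int (- a)) / u1 = (of_int a * \<tau> + of_int b) / u"
    unfolding u1 \<tau>1_def using t0 u by (simp add: field_simps)
  also have "scale (1 / u1) z1 = scale (1 / u) z" unfolding u1 z1_def using t0 u by (simp add: scale_def)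
  also have "- (of_int d * ip p z1 z1 / (2 * u1)) = ip p z z / (2 * \<tau>) + - (of_int c * ip p z z / (2 * u))"
  proof -
    have "- (of_int d * ip p z1 z1 / (2 * u1)) = of_int d * ip p z z / (2 * u * \<tau>)" unfolding u1 z1_def using t0 u by (simp add: field_simps)
    also have "\<dots> = (u - of_int c * \<tau>) * ip p z z / (2 * u * \<tau>)" by (simp add: u_def)
    also have "\<dots> = ip p z z / (2 * \<tau>) + - (of_int c * ip p z z / (2 * u))"
      using t0 u by (simp add: field_simps)
    finally show ?thesis .
  qed
  finally show ?thesis by (simp add: ee_diff ee_minus field_simps)
qed

theorem jacobi_inversion:
  assumes \<tau>: "Im \<tau> > 0" and z: "z \<in> hyperplane p"
  shows "th p L (- 1 / \<tau>) (scale (1 / \<tau>) z) * ee (- (ip p z z / (2 * \<tau>))) = (- \<i> * \<tau>) ^ wt / vol * th p L' \<tau> z"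
proof -
  have t0: "\<tau> \<noteq> 0" using \<tau> by auto
  have "th p L (- 1 / \<tau>) (scale (1 / \<tau>) z) = (\<i> / (- 1 / \<tau>)) ^ wt / vol * dth p L' (- 1 / \<tau>) (scale (1 / \<tau>) z)"
    by (intro poisson_L im_neg_inverse_pos hyperplane_scale \<tau> z)
  also have "dth p L' (- 1 / \<tau>) (scale (1 / \<tau>) z) = ee (ip p z z / (2 * \<tau>)) * th p L' \<tau> z"
  proof -
    have "- (ip p (scale (1 / \<tau>) z) (scale (1 / \<tau>) z) / (2 * (- 1 / \<tau>))) = ip p z z / (2 * \<tau>)" using t0 by simp
    moreover have "- 1 / (- 1 / \<tau>) = \<tau>" "scale (- 1 / (- 1 / \<tau>)) (scale (1 / \<tau>) z) = z" using t0 by (simp_all add: scale_def)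
    ultimately show ?thesis unfolding dth_eq_th by (simp only:)
  qed
  also have "\<i> / (- 1 / \<tau>) = - \<i> * \<tau>" by simp
  finally show ?thesis by (simp add: ee_minus)
qed

end

section \<open>Fourier series over general index sets\<close>

lemma has_fourier_expansion_cong:
  "(\<And>Z. Z \<in> siegel_upper \<Longrightarrow> f Z = g Z) \<Longrightarrow> has_fourier_expansion f a \<Longrightarrow> has_fourier_expansion g a"
  unfolding has_fourier_expansion_alt by auto

text \<open>Terms with the same index matrix are collected; the sum over a fibre is the
  coefficient.\<close>

lemma has_fourier_expansion_series:
  fixes T :: "'x \<Rightarrow> real^'n^'n::finite"
  assumes N: "N > 0" "\<And>x. x \<in> X \<Longrightarrow> real N *\<^sub>R T x \<in> half_integral"
    and summ: "\<And>Z. Z \<in> siegel_upper \<Longrightarrow> (\<lambda>x. norm (w x * ee (tr_pair (T x) Z))) summable_on X"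
    and f: "\<And>Z. Z \<in> siegel_upper \<Longrightarrow> f Z = (\<Sum>\<^sub>\<infinity>x\<in>X. w x * ee (tr_pair (T x) Z))"
  shows "has_fourier_expansion f (\<lambda>t. \<Sum>\<^sub>\<infinity>x\<in>{x \<in> X. T x = t}. w x)"
  unfolding has_fourier_expansion_alt
proof (intro conjI exI[of _ N] ballI allI impI)
  show "N > 0" by fact
  fix t assume "(\<Sum>\<^sub>\<infinity>x\<in>{x \<in> X. T x = t}. w x) \<noteq> 0"
  then have "{x \<in> X. T x = t} \<noteq> {}" by (metis infsum_empty)
  then show "real N *\<^sub>R t \<in> half_integral" using N(2) by auto
next
  fix Z :: "complex^'n^'n" assume Z: "Z \<in> siegel_upper"
  let ?g = "\<lambda>x. w x * ee (tr_pair (T x) Z)"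
  let ?F = "\<lambda>t. {x \<in> X. T x = t}"
  have sX: "?g summable_on X" by (rule abs_summable_summable[OF summ[OF Z]])
  have bij: "bij_betw snd (Sigma UNIV ?F) X"
    by (rule bij_betwI[of _ _ _ "\<lambda>x. (T x, x)"]) auto
  have "((\<lambda>y. ?g (snd y)) has_sum f Z) (Sigma UNIV ?F)"
    using has_sum_infsum[OF sX] f[OF Z] has_sum_reindex_bij_betw[OF bij, of ?g "f Z"] by simp
  moreover have "((\<lambda>x. ?g (snd (t, x))) has_sum (\<Sum>\<^sub>\<infinity>x\<in>?F t. w x) * ee (tr_pair t Z)) (?F t)" for t
  proof -
    have "(?g has_sum (\<Sum>\<^sub>\<infinity>x\<in>?F t. ?g x)) (?F t)"
      by (rule has_sum_infsum[OF summable_on_subset[OF sX]]) auto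
    also have "(\<Sum>\<^sub>\<infinity>x\<in>?F t. ?g x) = (\<Sum>\<^sub>\<infinity>x\<in>?F t. w x * ee (tr_pair t Z))" by (intro infsum_cong) auto
    also have "\<dots> = (\<Sum>\<^sub>\<infinity>x\<in>?F t. w x) * ee (tr_pair t Z)" by (rule infsum_cmult_left')
    finally show ?thesis by simp
  qed
  ultimately show "((\<lambda>t. (\<Sum>\<^sub>\<infinity>x\<in>?F t. w x) * ee (tr_pair t Z)) has_sum f Z) UNIV"
    by (rule has_sum_SigmaD)
qed

lemma half_integral_0: "0 \<in> half_integral"
  by (simp add: half_integral_def transpose_zero)

lemma has_fourier_expansion_const: "has_fourier_expansion (\<lambda>_. c) (\<lambda>T. if T = 0 then c else 0)"
proof -
  have "((\<lambda>T. (if T = 0 then c else 0) * ee (tr_pair T Z)) has_sum c) UNIV" for Z :: "complex^'n^'n"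
  proof -
    have "((\<lambda>T. (if T = 0 then c else 0) * ee (tr_pair T Z)) has_sum c) {0}"
      by (rule has_sum_finiteI) (auto simp: tr_pair_def)
    then show ?thesis by (rule has_sum_cong_neutral[THEN iffD1, rotated -1]) auto
  qed
  then show ?thesis unfolding has_fourier_expansion_alt by (auto simp: half_integral_0 intro!: exI[of _ 1])
qed

lemma has_fourier_expansion_cmult:
  assumes "has_fourier_expansion f a"
  shows "has_fourier_expansion (\<lambda>Z. c * f Z) (\<lambda>T. c * a T)"
proof -
  obtain N where N: "N > 0" "\<And>T. a T \<noteq> 0 \<Longrightarrow> real N *\<^sub>R T \<in> half_integral"
    using assms unfolding has_fourier_expansion_alt by blast
  then show ?thesis using assms unfolding has_fourier_expansion_alt
    by (auto simp: mult.assoc intro!: exI[of _ N] has_sum_cmult_right)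
qed

lemma has_fourier_expansion_add:
  assumes "has_fourier_expansion f a" "has_fourier_expansion g b"
  shows "has_fourier_expansion (\<lambda>Z. f Z + g Z) (\<lambda>T. a T + b T)"
proof -
  obtain N1 where N1: "N1 > 0" "\<And>T. a T \<noteq> 0 \<Longrightarrow> real N1 *\<^sub>R T \<in> half_integral"
    using assms unfolding has_fourier_expansion_alt by blast
  obtain N2 where N2: "N2 > 0" "\<And>T. b T \<noteq> 0 \<Longrightarrow> real N2 *\<^sub>R T \<in> half_integral"
    using assms unfolding has_fourier_expansion_alt by blast
  have "real (N1 * N2) *\<^sub>R T \<in> half_integral" if "a T + b T \<noteq> 0" for T
  proof (cases "a T = 0")
    case True
    then show ?thesis using half_integral_mult[OF N2(2), of T N1] that by (simp add: mult_ac)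
  next
    case False
    then show ?thesis using half_integral_mult[OF N1(2), of T N2] by (simp add: mult_ac)
  qed
  then show ?thesis using assms N1(1) N2(1) unfolding has_fourier_expansion_alt
    by (auto simp: distrib_right intro!: exI[of _ "N1 * N2"] has_sum_add)
qed

lemma has_fourier_expansion_sum:
  fixes f :: "'r \<Rightarrow> complex^'n^'n::finite \<Rightarrow> complex"
  assumes "finite A" "\<And>r. r \<in> A \<Longrightarrow> has_fourier_expansion (f r) (a r)"
  shows "has_fourier_expansion (\<lambda>Z. \<Sum>r\<in>A. f r Z) (\<lambda>T. \<Sum>r\<in>A. a r T)"
  using assms
proof (induction A rule: finite_induct)
  case empty
  have "(\<lambda>T. if T = 0 then 0 else 0) = (\<lambda>T::real^'n^'n. 0::complex)" by auto
  then show ?case using has_fourier_expansion_const[of 0] by simp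
qed (simp add: has_fourier_expansion_add)

lemma siegel_holomorphic_sum:
  fixes f :: "'r \<Rightarrow> complex^'n^'n::finite \<Rightarrow> complex"
  assumes "finite A" "\<And>r. r \<in> A \<Longrightarrow> siegel_holomorphic (f r)"
  shows "siegel_holomorphic (\<lambda>Z. \<Sum>r\<in>A. c r * f r Z)"
  unfolding siegel_holomorphic_def
proof
  fix Z :: "complex^'n^'n" assume "Z \<in> siegel_upper"
  then have "\<forall>r\<in>A. \<exists>f'. (f r has_derivative f') (at Z within siegel_upper) \<and> (\<forall>c W. f' (mat c ** W) = c * f' W)"
    using assms unfolding siegel_holomorphic_def by blast
  then obtain f' where f': "\<And>r. r \<in> A \<Longrightarrow> (f r has_derivative f' r) (at Z within siegel_upper)"
    "\<And>r c W. r \<in> A \<Longrightarrow> f' r (mat c ** W) = c * f' r W" by metis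
  show "\<exists>f'. ((\<lambda>Z. \<Sum>r\<in>A. c r * f r Z) has_derivative f') (at Z within siegel_upper) \<and> (\<forall>c W. f' (mat c ** W) = c * f' W)"
  proof (intro exI conjI allI)
    show "((\<lambda>Z. \<Sum>r\<in>A. c r * f r Z) has_derivative (\<lambda>W. \<Sum>r\<in>A. c r * f' r W)) (at Z within siegel_upper)"
      by (intro has_derivative_sum has_derivative_mult_right f')
    fix s W
    show "(\<Sum>r\<in>A. c r * f' r (mat s ** W)) = s * (\<Sum>r\<in>A. c r * f' r W)"
      unfolding sum_distrib_left by (intro sum.cong refl) (simp add: f'(2) mult_ac)
  qed
qed

section \<open>Theta series of higher degree\<close>

definition cdot :: "complex^'n::finite \<Rightarrow> complex^'n \<Rightarrow> complex" where
  "cdot x y = (\<Sum>i\<in>UNIV. x $ i * y $ i)"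

lemma cdot_matrix: "cdot x (A *v y) = cdot (transpose A *v x) y"
  unfolding cdot_def matrix_vector_mult_def transpose_def
  by (simp add: sum_distrib_left sum_distrib_right) (subst sum.swap, simp add: mult_ac)

definition column_at :: "('n::finite \<Rightarrow> cvec) \<Rightarrow> nat \<Rightarrow> complex^'n" where
  "column_at G l = (\<chi> i. G i l)"

text \<open>Half the trace of Z times the matrix of inner products of the rows of G.\<close>

definition qf :: "nat \<Rightarrow> complex^'n^'n::finite \<Rightarrow> ('n \<Rightarrow> cvec) \<Rightarrow> complex" where
  "qf p Z G = (\<Sum>i\<in>UNIV. \<Sum>k\<in>UNIV. Z $ i $ k * ip p (G i) (G k)) / 2"

text \<open>Half the inner products, so that \<open>qf\<close> is the trace of this matrix times Z.
  The real part only changes the type, as the vectors in question are real.\<close>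

definition gram :: "nat \<Rightarrow> ('n::finite \<Rightarrow> cvec) \<Rightarrow> real^'n^'n" where
  "gram p G = (\<chi> i k. Re (ip p (G i) (G k)) / 2)"

text \<open>The lattice may vary with the row, because a partial inversion passes to the dual
  lattice in some rows only.\<close>

definition tuples :: "('n \<Rightarrow> cvec set) \<Rightarrow> ('n::finite \<Rightarrow> cvec) set" where
  "tuples \<Lambda> = {G. \<forall>i. G i \<in> \<Lambda> i}"

definition Theta :: "nat \<Rightarrow> ('n::finite \<Rightarrow> cvec set) \<Rightarrow> complex^'n^'n \<Rightarrow> complex" where
  "Theta p \<Lambda> Z = (\<Sum>\<^sub>\<infinity>G\<in>tuples \<Lambda>. ee (qf p Z G))"

definition size2 :: "nat \<Rightarrow> ('n::finite \<Rightarrow> cvec) \<Rightarrow> real" where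
  "size2 p G = (\<Sum>i\<in>UNIV. \<Sum>l<p. (Re (G i l))\<^sup>2)"

lemma qf_cdot: "qf p Z G = (\<Sum>l<p. cdot (column_at G l) (Z *v column_at G l)) / 2"
proof -
  have "(\<Sum>i\<in>UNIV. \<Sum>k\<in>UNIV. Z $ i $ k * ip p (G i) (G k)) = (\<Sum>i\<in>UNIV. \<Sum>k\<in>UNIV. \<Sum>l<p. Z $ i $ k * (G i l * G k l))"
    by (simp add: ip_def sum_distrib_left)
  also have "\<dots> = (\<Sum>i\<in>UNIV. \<Sum>l<p. \<Sum>k\<in>UNIV. Z $ i $ k * (G i l * G k l))"
    by (intro sum.cong refl sum.swap)
  also have "\<dots> = (\<Sum>l<p. \<Sum>i\<in>UNIV. \<Sum>k\<in>UNIV. Z $ i $ k * (G i l * G k l))"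
    by (rule sum.swap)
  also have "\<dots> = (\<Sum>l<p. cdot (column_at G l) (Z *v column_at G l))"
    by (simp add: cdot_def column_at_def matrix_vector_mult_def sum_distrib_left mult_ac)
  finally show ?thesis by (simp add: qf_def)
qed

lemma qf_congruence:
  "qf p (A ** Z ** transpose A) G = qf p Z (\<lambda>j l. \<Sum>i\<in>UNIV. A $ i $ j * G i l)"
proof -
  have "column_at (\<lambda>j l. \<Sum>i\<in>UNIV. A $ i $ j * G i l) l = transpose A *v column_at G l" for l
    by (simp add: column_at_def matrix_vector_mult_def transpose_def vec_eq_iff)
  moreover have "cdot x ((A ** Z ** transpose A) *v x) = cdot (transpose A *v x) (Z *v (transpose A *v x))" for x
    by (simp only: matrix_vector_mul_assoc[symmetric] cdot_matrix)
  ultimately show ?thesis unfolding qf_cdot by simp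
qed

lemma qf_add: "qf p (Z + W) G = qf p Z G + qf p W G"
  by (simp add: qf_def distrib_right sum.distrib add_divide_distrib)

lemma ip_frac:
  assumes "x \<in> frac_vecs p" "y \<in> frac_vecs p" "p > 0"
  shows "ip p x y = of_real (\<Sum>l<p. Re (x l) * Re (y l))"
proof -
  have "x l * y l = of_real (Re (x l) * Re (y l))" for l
    using frac_vecs_real[OF assms(1,3), of l] frac_vecs_real[OF assms(2,3), of l] by (metis of_real_mult)
  then show ?thesis by (simp add: ip_def)
qed

lemma ip_frac_Re: "x \<in> frac_vecs p \<Longrightarrow> y \<in> frac_vecs p \<Longrightarrow> p > 0 \<Longrightarrow> ip p x y = of_real (Re (ip p x y))"
  by (simp add: ip_frac)

lemma qf_tr_pair:
  assumes "p > 0" "\<And>i. G i \<in> frac_vecs p"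
  shows "qf p Z G = tr_pair (gram p G) Z"
proof -
  have "tr_pair (gram p G) Z = (\<Sum>i\<in>UNIV. \<Sum>k\<in>UNIV. Z $ k $ i * ip p (G k) (G i) / 2)"
    unfolding tr_pair_def gram_def
    using ip_frac_Re[OF assms(2,2,1)] by (intro sum.cong refl) (simp add: ip_commute)
  also have "\<dots> = (\<Sum>k\<in>UNIV. \<Sum>i\<in>UNIV. Z $ k $ i * ip p (G k) (G i) / 2)" by (rule sum.swap)
  finally show ?thesis by (simp add: qf_def sum_divide_distrib)
qed

text \<open>The least value of the quadratic form on the compact unit sphere.\<close>

lemma siegel_upper_bound:
  fixes Z :: "complex^'n^'n::finite"
  assumes "Z \<in> siegel_upper"
  obtains c where "c > 0" "\<And>x. c * (x \<bullet> x) \<le> x \<bullet> (im_mat Z *v x)"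
proof -
  let ?f = "\<lambda>x. x \<bullet> (im_mat Z *v x)"
  have "continuous_on (sphere 0 1) ?f"
    by (intro continuous_intros matrix_vector_mult_linear_continuous_on)
  moreover have "sphere (0 :: real^'n) 1 \<noteq> {}" by simp
  ultimately obtain x0 where x0: "x0 \<in> sphere 0 1" "\<And>y. y \<in> sphere 0 1 \<Longrightarrow> ?f x0 \<le> ?f y"
    using continuous_attains_inf[OF compact_sphere, of 0 1 ?f] by blast
  have "?f x0 > 0" by (rule siegel_upperD(3)[OF assms]) (use x0 in auto)
  moreover have "?f x0 * (x \<bullet> x) \<le> ?f x" for x
  proof (cases "x = 0")
    case False
    define y where "y = x /\<^sub>R norm x"
    have "y \<in> sphere 0 1" using False by (simp add: y_def)
    then have "?f x0 \<le> ?f y" by (rule x0)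
    also have "?f y = ?f x / (x \<bullet> x)"
      by (simp add: y_def matrix_vector_mult_scaleR divide_simps dot_square_norm power2_eq_square)
    finally show ?thesis using False by (simp add: field_simps)
  qed simp
  ultimately show ?thesis using that by blast
qed

lemma norm_qf_bound:
  fixes Z :: "complex^'n^'n::finite"
  assumes Z: "Z \<in> siegel_upper" and p: "p > 0"
  obtains c where "c > 0" "\<And>G. (\<And>i. G i \<in> frac_vecs p) \<Longrightarrow> norm (ee (qf p Z G)) \<le> exp (- c * size2 p G)"
proof -
  obtain c where c: "c > 0" "\<And>x. c * (x \<bullet> x) \<le> x \<bullet> (im_mat Z *v x)" using siegel_upper_bound[OF Z] by blast
  have "norm (ee (qf p Z G)) \<le> exp (- (pi * c) * size2 p G)" if G: "\<And>i. G i \<in> frac_vecs p" for G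
  proof -
    define x where "x l = (\<chi> i. Re (G i l))" for l
    have Gx: "column_at G l $ i = of_real (x l $ i)" for l i using frac_vecs_real[OF G p] by (simp add: column_at_def x_def)
    have "Im (cdot (column_at G l) (Z *v column_at G l)) = x l \<bullet> (im_mat Z *v x l)" for l
      by (simp add: cdot_def matrix_vector_mult_def Gx inner_vec_def im_mat_def)
    then have "2 * Im (qf p Z G) = (\<Sum>l<p. x l \<bullet> (im_mat Z *v x l))" by (simp add: qf_cdot)
    also have "\<dots> \<ge> (\<Sum>l<p. c * (x l \<bullet> x l))" by (intro sum_mono c)
    also have "(\<Sum>l<p. c * (x l \<bullet> x l)) = c * size2 p G"
      unfolding size2_def by (subst sum.swap) (simp add: x_def inner_vec_def power2_eq_square sum_distrib_left)
    finally have "pi * (c * size2 p G) \<le> pi * (2 * Im (qf p Z G))" by (intro mult_left_mono) auto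
    then show ?thesis by (simp add: norm_ee mult_ac)
  qed
  then show ?thesis using that[of "pi * c"] c by simp
qed

lemma summable_size2:
  assumes p: "p > 0" and c: "c > 0" and sub: "\<And>i. \<Lambda> i \<subseteq> frac_vecs p"
  shows "(\<lambda>G. exp (- c * size2 p G)) summable_on tuples (\<Lambda> :: 'n::finite \<Rightarrow> cvec set)"
proof -
  have "(\<lambda>G. \<Prod>i\<in>UNIV. exp (\<Sum>l<p. 0 * \<bar>Re (G i l)\<bar> - c * (Re (G i l))\<^sup>2)) summable_on PiE (UNIV :: 'n set) \<Lambda>"
    by (intro summable_on_prod_PiE summable_on_subset[OF summable_gauss_weight[OF p c]] sub) auto
  moreover have "PiE (UNIV :: 'n set) \<Lambda> = tuples \<Lambda>" by (auto simp: tuples_def PiE_UNIV_domain)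
  moreover have "(\<Prod>i\<in>UNIV. exp (\<Sum>l<p. 0 * \<bar>Re (G i l)\<bar> - c * (Re (G i l))\<^sup>2)) = exp (- c * size2 p G)" for G :: "'n \<Rightarrow> cvec"
    by (simp add: exp_sum[symmetric] size2_def sum_distrib_left sum_negf)
  ultimately show ?thesis by simp
qed

lemma Theta_summable:
  assumes Z: "Z \<in> siegel_upper" and p: "p > 0" and sub: "\<And>i. \<Lambda> i \<subseteq> frac_vecs p"
  shows "(\<lambda>G. norm (ee (qf p Z G))) summable_on tuples \<Lambda>"
proof -
  obtain c where c: "c > 0" "\<And>G. (\<And>i. G i \<in> frac_vecs p) \<Longrightarrow> norm (ee (qf p Z G)) \<le> exp (- c * size2 p G)"
    using norm_qf_bound[OF Z p] by blast
  show ?thesis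
  proof (rule summable_on_comparison_test[OF summable_size2[OF p c(1) sub]])
    fix G assume "G \<in> tuples \<Lambda>"
    then have "G i \<in> frac_vecs p" for i using sub by (auto simp: tuples_def)
    then show "norm (ee (qf p Z G)) \<le> exp (- c * size2 p G)" by (rule c(2))
  qed simp
qed

lemma qf_norm_le:
  fixes V :: "complex^'n^'n::finite"
  assumes p: "p > 0" and G: "\<And>i. G i \<in> frac_vecs p"
  shows "norm (2 * of_real pi * \<i> * qf p V G) \<le> (pi * (real (CARD('n)))\<^sup>2 * size2 p G) * norm V"
proof -
  have le: "norm (ip p (G i) (G k)) \<le> size2 p G" for i k
  proof -
    have S: "(\<Sum>l<p. (Re (G i l))\<^sup>2) \<le> size2 p G" for i
      unfolding size2_def by (rule member_le_sum[of i UNIV "\<lambda>i. \<Sum>l<p. (Re (G i l))\<^sup>2"]) (auto intro: sum_nonneg)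
    have "norm (ip p (G i) (G k)) = \<bar>\<Sum>l<p. Re (G i l) * Re (G k l)\<bar>" unfolding ip_frac[OF G G p] by (rule norm_of_real)
    also have "\<dots> \<le> (\<Sum>l<p. \<bar>Re (G i l) * Re (G k l)\<bar>)" by (rule sum_abs)
    also have "\<dots> \<le> (\<Sum>l<p. ((Re (G i l))\<^sup>2 + (Re (G k l))\<^sup>2) / 2)"
    proof (rule sum_mono)
      fix l
      have "0 \<le> (\<bar>Re (G i l)\<bar> - \<bar>Re (G k l)\<bar>)\<^sup>2" by simp
      then show "\<bar>Re (G i l) * Re (G k l)\<bar> \<le> ((Re (G i l))\<^sup>2 + (Re (G k l))\<^sup>2) / 2"
        by (simp add: power2_diff abs_mult)
    qed
    also have "\<dots> = ((\<Sum>l<p. (Re (G i l))\<^sup>2) + (\<Sum>l<p. (Re (G k l))\<^sup>2)) / 2" by (simp add: sum.distrib flip: sum_divide_distrib)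
    also have "\<dots> \<le> size2 p G" using S[of i] S[of k] by simp
    finally show ?thesis .
  qed
  have nV: "norm (V $ i $ k) \<le> norm V" for i k
    by (rule order_trans[OF Finite_Cartesian_Product.norm_nth_le Finite_Cartesian_Product.norm_nth_le])
  have "norm (\<Sum>i\<in>UNIV. \<Sum>k\<in>UNIV. V $ i $ k * ip p (G i) (G k)) \<le> (\<Sum>i\<in>(UNIV :: 'n set). \<Sum>k\<in>(UNIV :: 'n set). norm V * size2 p G)"
    by (intro sum_norm_le) (simp add: norm_mult mult_mono[OF nV le])
  also have "\<dots> = (real (CARD('n)))\<^sup>2 * (norm V * size2 p G)" by (simp add: power2_eq_square)
  finally have "pi * norm (\<Sum>i\<in>UNIV. \<Sum>k\<in>UNIV. V $ i $ k * ip p (G i) (G k)) \<le> pi * ((real (CARD('n)))\<^sup>2 * (norm V * size2 p G))"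
    by (intro mult_left_mono) auto
  then show ?thesis by (simp add: qf_def norm_mult norm_divide mult_ac)
qed

lemma qf_bounded_linear:
  fixes G :: "'n::finite \<Rightarrow> cvec"
  shows "bounded_linear (\<lambda>Z. 2 * of_real pi * \<i> * qf p Z G)"
proof -
  have "(\<lambda>Z. 2 * of_real pi * \<i> * qf p Z G) = (\<lambda>Z. \<Sum>i\<in>UNIV. \<Sum>k\<in>UNIV. Z $ i $ k * (of_real pi * \<i> * ip p (G i) (G k)))"
  proof
    fix Z :: "complex^'n^'n"
    have "2 * of_real pi * \<i> * qf p Z G = (of_real pi * \<i>) * (\<Sum>i\<in>UNIV. \<Sum>k\<in>UNIV. Z $ i $ k * ip p (G i) (G k))" by (simp add: qf_def)
    then show "2 * of_real pi * \<i> * qf p Z G = (\<Sum>i\<in>UNIV. \<Sum>k\<in>UNIV. Z $ i $ k * (of_real pi * \<i> * ip p (G i) (G k)))"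
      by (simp only: sum_distrib_left) (simp add: mult_ac)
  qed
  moreover have "bounded_linear (\<lambda>Z. Z $ i $ k * s)" for i k :: 'n and s :: complex
    by (intro bounded_linear_compose[OF bounded_linear_mult_left] bounded_linear_compose[OF bounded_linear_vec_nth bounded_linear_vec_nth])
  ultimately show ?thesis by (simp only: bounded_linear_sum)
qed

theorem Theta_holomorphic:
  fixes \<Lambda> :: "'n::finite \<Rightarrow> cvec set"
  assumes p: "p > 0" and sub: "\<And>i. \<Lambda> i \<subseteq> frac_vecs p"
  shows "siegel_holomorphic (Theta p \<Lambda>)"
  unfolding siegel_holomorphic_def
proof
  fix Z :: "complex^'n^'n" assume Z: "Z \<in> siegel_upper"
  let ?l = "\<lambda>G Z. 2 * of_real pi * \<i> * qf p Z G"
  let ?D = "\<lambda>W. \<Sum>\<^sub>\<infinity>G\<in>tuples \<Lambda>. 1 * exp (?l G Z) * ?l G W"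
  obtain c where c: "c > 0" "\<And>G. (\<And>i. G i \<in> frac_vecs p) \<Longrightarrow> norm (ee (qf p Z G)) \<le> exp (- c * size2 p G)"
    using norm_qf_bound[OF Z p] by blast
  define K where "K = pi * (real (CARD('n)))\<^sup>2"
  have K: "K > 0" by (simp add: K_def)
  have G: "G i \<in> frac_vecs p" if "G \<in> tuples \<Lambda>" for G i using that sub by (auto simp: tuples_def)
  have S0: "size2 p G \<ge> 0" for G :: "'n \<Rightarrow> cvec" by (simp add: size2_def sum_nonneg)
  have "((\<lambda>Z. \<Sum>\<^sub>\<infinity>G\<in>tuples \<Lambda>. 1 * exp (?l G Z)) has_derivative ?D) (at Z within siegel_upper)"
  \<comment> \<open>With this e the reserve factor costs half of the Gaussian decay rate c, and the
    other half keeps the series summable.\<close>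
  proof (rule has_derivative_exp_series[where w = "\<lambda>G. K * size2 p G" and e = "c / (2 * K)"])
    show "bounded_linear (?l G)" for G by (rule qf_bounded_linear)
    show "norm (?l G v) \<le> K * size2 p G * norm v" if "G \<in> tuples \<Lambda>" for G v
      unfolding K_def by (rule qf_norm_le[OF p G[OF that]])
    show "0 \<le> K * size2 p G" for G :: "'n \<Rightarrow> cvec" using K S0 by simp
    show "c / (2 * K) > 0" using c K by simp
    show "(\<lambda>G. norm (1 * exp (?l G Z)) * exp (c / (2 * K) * (K * size2 p G))) summable_on tuples \<Lambda>"
    proof (rule summable_on_comparison_test)
      show "(\<lambda>G. exp (- (c / 2) * size2 p G)) summable_on tuples \<Lambda>" by (rule summable_size2[OF p _ sub]) (use c in simp)
      fix G assume "G \<in> tuples \<Lambda>"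
      have "norm (1 * exp (?l G Z)) * exp (c / (2 * K) * (K * size2 p G)) \<le> exp (- c * size2 p G) * exp (c / (2 * K) * (K * size2 p G))"
        by (intro mult_right_mono) (use c(2)[OF G[OF \<open>G \<in> tuples \<Lambda>\<close>]] in \<open>auto simp: ee_def\<close>)
      also have "\<dots> = exp (- (c / 2) * size2 p G)" using K by (simp flip: exp_add)
      finally show "norm (1 * exp (?l G Z)) * exp (c / (2 * K) * (K * size2 p G)) \<le> exp (- (c / 2) * size2 p G)" .
    qed simp
  qed
  moreover have "(\<lambda>Z. \<Sum>\<^sub>\<infinity>G\<in>tuples \<Lambda>. 1 * exp (?l G Z)) = Theta p \<Lambda>" by (simp add: Theta_def[abs_def] ee_def)
  moreover have "?D (mat s ** W) = s * ?D W" for s W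
  proof -
    have "(mat s ** W) $ i $ k = s * W $ i $ k" for i k
      by (simp add: matrix_matrix_mult_def mat_def if_distrib[where f = "\<lambda>x. x * _"] cong: if_cong)
    then have "qf p (mat s ** W) G = s * qf p W G" for G by (simp add: qf_def sum_distrib_left mult_ac)
    then have "?D (mat s ** W) = (\<Sum>\<^sub>\<infinity>G\<in>tuples \<Lambda>. s * (1 * exp (?l G Z) * ?l G W))"
      by (intro infsum_cong) (simp add: mult_ac)
    also have "\<dots> = s * ?D W" by (rule infsum_cmult_right')
    finally show ?thesis .
  qed
  ultimately show "\<exists>f'. (Theta p \<Lambda> has_derivative f') (at Z within siegel_upper) \<and> (\<forall>c W. f' (mat c ** W) = c * f' W)"
    by (intro exI[of _ ?D]) simp
qed

lemma gram_half_integral: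
  fixes G :: "'n::finite \<Rightarrow> cvec"
  assumes p: "p > 0" and G: "\<And>i. G i \<in> frac_vecs p"
  shows "real (2 * p * p) *\<^sub>R gram p G \<in> half_integral"
proof -
  have i: "2 * (real p * real p) * (Re (ip p (G i) (G k)) / 2) \<in> \<int>" for i k
  proof -
    have "of_nat p * of_nat p * ip p (G i) (G k) = (\<Sum>l<p. (of_nat p * G i l) * (of_nat p * G k l))"
      by (simp add: ip_def sum_distrib_left mult_ac)
    also have "\<dots> \<in> \<int>"
    proof -
      have "of_nat p * G i l \<in> \<int>" for i l using G[of i] by (simp add: frac_vecs_def)
      then show ?thesis by (intro Ints_sum Ints_mult[of "of_nat p * G _ _"])
    qed
    finally obtain m where m: "of_nat p * of_nat p * ip p (G i) (G k) = of_int m" by (auto elim: Ints_cases)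
    then have "Re (of_nat p * of_nat p * ip p (G i) (G k)) = of_int m" by simp
    then have "real p * real p * Re (ip p (G i) (G k)) = of_int m" by (simp flip: of_nat_mult)
    then have "2 * (real p * real p) * (Re (ip p (G i) (G k)) / 2) = of_int m" by simp
    then show ?thesis by (simp only: Ints_of_int)
  qed
  then show ?thesis unfolding half_integral_def
    by (auto simp: gram_def transpose_def vec_eq_iff ip_commute mult.assoc intro!: Ints_mult[of 2])
qed

theorem Theta_expansion:
  fixes \<Lambda> :: "'n::finite \<Rightarrow> cvec set"
  assumes p: "p > 0" and sub: "\<And>i. \<Lambda> i \<subseteq> frac_vecs p"
  shows "has_fourier_expansion (Theta p \<Lambda>) (\<lambda>T. of_nat (card {G \<in> tuples \<Lambda>. gram p G = T}))"
proof -
  have fr: "G i \<in> frac_vecs p" if "G \<in> tuples \<Lambda>" for G i using that sub by (auto simp: tuples_def)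
  have half: "real (2 * p * p) *\<^sub>R gram p G \<in> half_integral" if "G \<in> tuples \<Lambda>" for G
    by (rule gram_half_integral[OF p fr[OF that]])
  have "has_fourier_expansion (Theta p \<Lambda>) (\<lambda>T. \<Sum>\<^sub>\<infinity>G\<in>{G \<in> tuples \<Lambda>. gram p G = T}. 1)"
  proof (rule has_fourier_expansion_series[of "2 * p * p"])
    show "2 * p * p > 0" using p by simp
    fix Z :: "complex^'n^'n" assume Z: "Z \<in> siegel_upper"
    have eq: "ee (tr_pair (gram p G) Z) = ee (qf p Z G)" if "G \<in> tuples \<Lambda>" for G
      using qf_tr_pair[where G = G and Z = Z, OF p fr[OF that]] by simp
    show "(\<lambda>x. norm (1 * ee (tr_pair (gram p x) Z))) summable_on tuples \<Lambda>"
      using Theta_summable[OF Z p sub] by (simp add: eq cong: summable_on_cong)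
    show "Theta p \<Lambda> Z = (\<Sum>\<^sub>\<infinity>x\<in>tuples \<Lambda>. 1 * ee (tr_pair (gram p x) Z))"
      unfolding Theta_def by (intro infsum_cong) (simp add: eq)
  qed (use half in simp)
  \<comment> \<open>For infinite A both sides take their default value 0.\<close>
  moreover have "(\<Sum>\<^sub>\<infinity>G\<in>A. 1 :: complex) = of_nat (card A)" for A :: "('n \<Rightarrow> cvec) set"
  proof (cases "finite A")
    case False
    then have "\<not> (\<lambda>_. 1 :: real) summable_on A" by (rule infsum_diverge_constant) simp
    then have "\<not> (\<lambda>_. 1 :: complex) summable_on A" using summable_on_Re[of "\<lambda>_. 1" A] by auto
    then show ?thesis using False by (simp add: infsum_not_exists)
  qed simp
  ultimately show ?thesis by simp
qed

section \<open>Embedded elliptic transformations of theta series\<close>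

lemma matrix_row_update_mult:
  fixes W :: "'a::comm_ring_1^'n^'n::finite"
  shows "(W ** (\<chi> j k. if j = i0 then q k else if j = k then 1 else 0)) $ i $ k = W $ i $ i0 * q k + (if k = i0 then 0 else W $ i $ k)"
proof -
  have "(W ** (\<chi> j k. if j = i0 then q k else if j = k then 1 else 0)) $ i $ k
    = (\<Sum>j\<in>UNIV. (if j = i0 then W $ i $ i0 * q k else 0) + (if j = k then if k = i0 then 0 else W $ i $ k else 0))"
    unfolding matrix_matrix_mult_def vec_lambda_beta by (intro sum.cong refl) auto
  then show ?thesis by (simp add: sum.distrib)
qed

lemma det_row_update:
  fixes q :: "'n::finite \<Rightarrow> 'a::field"
  shows "det ((\<chi> j k. if j = i0 then q k else if j = k then 1 else 0) :: 'a^'n^'n) = q i0"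
proof -
  have s1: "(\<Sum>i\<in>UNIV. (\<chi> k. q k) $ i *s row i (mat 1 :: 'a^'n^'n)) = (\<chi> k. q k)"
    by (simp add: vec_eq_iff row_def mat_def sum_component if_distrib cong: if_cong)
  have s2: "(\<chi> j k. if j = i0 then q k else if j = k then 1 else 0) = (\<chi> i. if i = i0 then (\<chi> k. q k) else row i (mat 1 :: 'a^'n^'n))"
    by (simp add: vec_eq_iff row_def mat_def)
  show ?thesis using cramer_lemma_transpose[of i0 "\<chi> k. q k" "mat 1 :: 'a^'n^'n"] unfolding s1 s2 by simp
qed

lemma emb_den_num:
  fixes Z :: "complex^'n^'n::finite"
  shows "den_mat (emb_mat i0 a b c d) Z = (\<chi> j k. if j = i0 then of_int c * Z $ i0 $ k + (if k = i0 then of_int d else 0) else if j = k then 1 else 0)"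
    and "num_mat (emb_mat i0 a b c d) Z $ i $ k = (if i = i0 then of_int a * Z $ i0 $ k + (if k = i0 then of_int b else 0) else Z $ i $ k)"
  by (simp_all add: den_mat_def num_mat_def emb_mat_def int_to_cmat_def diag_mat_def matrix_matrix_mult_def vec_eq_iff
      if_distrib[where f = "\<lambda>x. x * _"] if_distrib[where f = "of_int :: int \<Rightarrow> complex"] cong: if_cong)

text \<open>With z the rest of row \<open>i0\<close> and Z' the complementary block this sends
  (\<tau>, z, Z') to (t, z / u, Z' - c z z^T / u): the action of SL_2 in Fourier-Jacobi
  coordinates.\<close>

definition emb_act :: "'n::finite \<Rightarrow> complex \<Rightarrow> complex \<Rightarrow> complex \<Rightarrow> complex^'n^'n \<Rightarrow> complex^'n^'n" where
  "emb_act i0 t u c Z = (\<chi> i k. if i = i0 then if k = i0 then t else Z $ i0 $ k / u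
     else if k = i0 then Z $ i $ i0 / u else Z $ i $ k - c * Z $ i $ i0 * Z $ i0 $ k / u)"

lemma siegel_upper_diag: "Z \<in> siegel_upper \<Longrightarrow> Im (Z $ i $ i) > 0"
proof -
  assume Z: "Z \<in> siegel_upper"
  have "axis i 1 \<bullet> (im_mat Z *v axis i 1) > 0" by (rule siegel_upperD(3)[OF Z]) (simp add: axis_eq_0_iff)
  moreover have "axis i 1 \<bullet> (im_mat Z *v axis i 1) = Im (Z $ i $ i)"
    by (simp add: inner_axis' matrix_vector_mult_basis column_def im_mat_def)
  ultimately show ?thesis by simp
qed

lemma act_emb:
  fixes Z :: "complex^'n^'n::finite" and i0 :: 'n
  assumes Z: "Z \<in> siegel_upper" and det: "a * d - b * c = 1"
  defines "u \<equiv> of_int c * Z $ i0 $ i0 + of_int d"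
  shows "det (den_mat (emb_mat i0 a b c d) Z) = u"
    and "act_mat (emb_mat i0 a b c d) Z = emb_act i0 ((of_int a * Z $ i0 $ i0 + of_int b) / u) u (of_int c) Z"
proof -
  show D: "det (den_mat (emb_mat i0 a b c d) Z) = u"
    unfolding emb_den_num(1) det_row_update by (simp add: u_def)
  have u: "u \<noteq> 0" unfolding u_def by (rule im_moebius_pos(1)[OF siegel_upper_diag[OF Z] det])
  have detC: "of_int a * of_int d = of_int b * of_int c + (1 :: complex)" using det by (simp flip: of_int_mult of_int_diff add: algebra_simps)
  let ?t = "(of_int a * Z $ i0 $ i0 + of_int b) / u"
  let ?W = "emb_act i0 ?t u (of_int c) Z"
  have 1: "?t * of_int c = of_int a - 1 / u"
  proof -
    have "(of_int a * Z $ i0 $ i0 + of_int b) * of_int c = of_int a * u - 1"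
      using detC by (simp add: u_def algebra_simps)
    then have "?t * of_int c = (of_int a * u - 1) / u" by simp
    then show ?thesis using u by (simp add: diff_divide_distrib)
  qed
  have "?W ** den_mat (emb_mat i0 a b c d) Z = num_mat (emb_mat i0 a b c d) Z"
  proof -
    have "(?W ** den_mat (emb_mat i0 a b c d) Z) $ i $ k = num_mat (emb_mat i0 a b c d) Z $ i $ k" for i k
    proof -
      consider "i = i0" "k = i0" | "i = i0" "k \<noteq> i0" | "i \<noteq> i0" "k = i0" | "i \<noteq> i0" "k \<noteq> i0" by blast
      then show ?thesis
      proof cases
        case 1
        then show ?thesis unfolding emb_den_num(1) matrix_row_update_mult emb_den_num(2)
          using u by (simp add: emb_act_def flip: u_def)
      next
        case 2
        have "?t * (of_int c * Z $ i0 $ k) = (of_int a - 1 / u) * Z $ i0 $ k" by (simp only: 1 flip: mult.assoc)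
        then show ?thesis using 2 unfolding emb_den_num(1) matrix_row_update_mult emb_den_num(2)
          by (simp add: emb_act_def left_diff_distrib)
      next
        case 3
        then show ?thesis unfolding emb_den_num(1) matrix_row_update_mult emb_den_num(2)
          using u by (simp add: emb_act_def flip: u_def)
      next
        case 4
        then show ?thesis unfolding emb_den_num(1) matrix_row_update_mult emb_den_num(2)
          by (simp add: emb_act_def)
      qed
    qed
    then show ?thesis by (simp add: vec_eq_iff)
  qed
  then show "act_mat (emb_mat i0 a b c d) Z = ?W"
    unfolding act_mat_def using D u by (intro matrix_inv_eqI) auto
qed

definition row_vec :: "complex^'n^'n::finite \<Rightarrow> 'n \<Rightarrow> ('n \<Rightarrow> cvec) \<Rightarrow> cvec" where
  "row_vec Z i0 H = (\<lambda>l. \<Sum>k\<in>UNIV. Z $ i0 $ k * H k l)"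

lemma ip_row_vec: "ip p g (row_vec Z i0 H) = (\<Sum>k\<in>UNIV. Z $ i0 $ k * ip p g (H k))"
  unfolding ip_def row_vec_def sum_distrib_left by (subst sum.swap) (simp add: mult_ac)

lemma row_vec_hyperplane: "(\<And>k. H k \<in> hyperplane p) \<Longrightarrow> row_vec Z i0 H \<in> hyperplane p"
  unfolding hyperplane_def row_vec_def periodic_def
  by (auto simp: sum.swap[of _ UNIV] simp flip: sum_distrib_left)

lemma qf_update:
  assumes sym: "\<And>i k. Z $ i $ k = Z $ k $ i" and H: "H i0 = (\<lambda>l. 0)"
  shows "qf p Z (H(i0 := g)) = qf p Z H + (Z $ i0 $ i0 * ip p g g / 2 + ip p g (row_vec Z i0 H))"
proof -
  let ?d = "\<lambda>i x. if i = i0 then x else (0::complex)"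
  have e: "ip p ((H(i0 := g)) i) ((H(i0 := g)) k) = ip p (H i) (H k) + ?d i (ip p g (H k)) + ?d k (ip p g (H i)) + ?d i (?d k (ip p g g))" for i k
    using H by (simp add: ip_commute[of p "H i" g])
  have s1: "(\<Sum>i\<in>UNIV. \<Sum>k\<in>UNIV. Z $ i $ k * ?d i (ip p g (H k))) = ip p g (row_vec Z i0 H)"
    unfolding ip_row_vec by (subst sum.swap) (simp add: if_distrib[where f = "\<lambda>x. _ * x"] cong: if_cong)
  have s2: "(\<Sum>i\<in>UNIV. \<Sum>k\<in>UNIV. Z $ i $ k * ?d k (ip p g (H i))) = ip p g (row_vec Z i0 H)"
    unfolding ip_row_vec by (simp add: if_distrib[where f = "\<lambda>x. _ * x"] sym[of i0] cong: if_cong)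
  have s3: "(\<Sum>i\<in>UNIV. \<Sum>k\<in>UNIV. Z $ i $ k * ?d i (?d k (ip p g g))) = Z $ i0 $ i0 * ip p g g"
    by (subst sum.swap) (simp add: if_distrib[where f = "\<lambda>x. _ * x"] cong: if_cong)
  have "(\<Sum>i\<in>UNIV. \<Sum>k\<in>UNIV. Z $ i $ k * ip p ((H(i0 := g)) i) ((H(i0 := g)) k))
    = (\<Sum>i\<in>UNIV. \<Sum>k\<in>UNIV. Z $ i $ k * ip p (H i) (H k)) + ip p g (row_vec Z i0 H) + ip p g (row_vec Z i0 H) + Z $ i0 $ i0 * ip p g g"
    unfolding e distrib_left sum.distrib s1 s2 s3 ..
  then show ?thesis unfolding qf_def by (simp only: add_divide_distrib) simp
qed

text \<open>With the other rows fixed in H, the sum over row \<open>i0\<close> is a one-variable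
  theta function whose elliptic variable is the combination of the rows of H with coefficients from
  row \<open>i0\<close> of Z. Row \<open>i0\<close> of H is a placeholder zero.\<close>

lemma Theta_split:
  fixes \<Lambda> :: "'n::finite \<Rightarrow> cvec set"
  assumes Z: "Z \<in> siegel_upper" and p: "p > 0" and sub: "\<And>i. \<Lambda> i \<subseteq> frac_vecs p"
  shows "Theta p \<Lambda> Z = (\<Sum>\<^sub>\<infinity>H\<in>tuples (\<Lambda>(i0 := {\<lambda>l. 0})). ee (qf p Z H) * th p (\<Lambda> i0) (Z $ i0 $ i0) (row_vec Z i0 H))"
proof -
  let ?T = "tuples (\<Lambda>(i0 := {\<lambda>l. 0}))"
  let ?b = "\<lambda>(H, g). H(i0 := g)"
  let ?f = "\<lambda>G. ee (qf p Z G)"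
  have bij: "bij_betw ?b (?T \<times> \<Lambda> i0) (tuples \<Lambda>)"
  proof (rule bij_betwI[of _ _ _ "\<lambda>G. (G(i0 := (\<lambda>l. 0)), G i0)"])
    show "?b \<in> ?T \<times> \<Lambda> i0 \<rightarrow> tuples \<Lambda>" by (auto simp: tuples_def)
    show "(\<lambda>G. (G(i0 := (\<lambda>l. 0)), G i0)) \<in> tuples \<Lambda> \<rightarrow> ?T \<times> \<Lambda> i0" by (auto simp: tuples_def)
    show "(\<lambda>G. (G(i0 := (\<lambda>l. 0)), G i0)) (?b x) = x" if "x \<in> ?T \<times> \<Lambda> i0" for x
    proof -
      have "(fst x) i0 \<in> (\<Lambda>(i0 := {\<lambda>l. 0})) i0" using that unfolding tuples_def mem_Times_iff mem_Collect_eq by blast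
      then have "(fst x) i0 = (\<lambda>l. 0)" by simp
      then show ?thesis by (cases x) (simp add: fun_upd_idem)
    qed
  qed auto
  have H0: "H i0 = (\<lambda>l. 0)" if "H \<in> ?T" for H using that by (auto simp: tuples_def dest: spec[of _ i0])
  have s: "?f summable_on tuples \<Lambda>" by (rule abs_summable_summable[OF Theta_summable[OF Z p sub]])
  then have s2: "(\<lambda>(H, g). ?f (H(i0 := g))) summable_on ?T \<times> \<Lambda> i0"
    using summable_on_reindex_bij_betw[OF bij, of ?f] by (simp add: case_prod_unfold)
  have "Theta p \<Lambda> Z = (\<Sum>\<^sub>\<infinity>(H, g)\<in>?T \<times> \<Lambda> i0. ?f (H(i0 := g)))"
    unfolding Theta_def using infsum_reindex_bij_betw[OF bij, of ?f] by (simp add: case_prod_unfold)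
  also have "\<dots> = (\<Sum>\<^sub>\<infinity>H\<in>?T. \<Sum>\<^sub>\<infinity>g\<in>\<Lambda> i0. ?f (H(i0 := g)))" by (rule infsum_Sigma'_banach[OF s2, symmetric])
  also have "\<dots> = (\<Sum>\<^sub>\<infinity>H\<in>?T. ee (qf p Z H) * th p (\<Lambda> i0) (Z $ i0 $ i0) (row_vec Z i0 H))"
  proof (rule infsum_cong)
    fix H assume "H \<in> ?T"
    then have q: "qf p Z (H(i0 := g)) = qf p Z H + (Z $ i0 $ i0 * ip p g g / 2 + ip p g (row_vec Z i0 H))" for g
      by (intro qf_update siegel_upperD(2)[OF Z] H0)
    show "(\<Sum>\<^sub>\<infinity>g\<in>\<Lambda> i0. ?f (H(i0 := g))) = ee (qf p Z H) * th p (\<Lambda> i0) (Z $ i0 $ i0) (row_vec Z i0 H)"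
      unfolding th_def infsum_cmult_right'[symmetric] q ee_add[symmetric] ..
  qed
  finally show ?thesis .
qed

text \<open>The rank-one correction of the complementary block under \<open>emb_act\<close> is
  exactly the exponential factor of the one-variable formula \<open>J\<close>. The lattice in row
  \<open>i0\<close> may change, as it does under inversion.\<close>

theorem Theta_emb:
  fixes \<Lambda> :: "'n::finite \<Rightarrow> cvec set"
  assumes Z: "Z \<in> siegel_upper" and p: "p > 0" and sub: "\<And>i. \<Lambda> i \<subseteq> frac_vecs p \<inter> hyperplane p" and sub': "\<Lambda>' \<subseteq> frac_vecs p"
    and det: "a * d - b * c = 1"
    and J: "\<And>z. z \<in> hyperplane p \<Longrightarrow> th p (\<Lambda> i0) ((of_int a * Z $ i0 $ i0 + of_int b) / (of_int c * Z $ i0 $ i0 + of_int d))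
        (scale (1 / (of_int c * Z $ i0 $ i0 + of_int d)) z) * ee (- (of_int c * ip p z z / (2 * (of_int c * Z $ i0 $ i0 + of_int d))))
      = K * th p \<Lambda>' (Z $ i0 $ i0) z"
  shows "Theta p \<Lambda> (act_mat (emb_mat i0 a b c d) Z) = K * Theta p (\<Lambda>(i0 := \<Lambda>')) Z"
proof -
  define u where "u = of_int c * Z $ i0 $ i0 + of_int d"
  define t where "t = (of_int a * Z $ i0 $ i0 + of_int b) / u"
  define W where "W = act_mat (emb_mat i0 a b c d) Z"
  have W: "W = emb_act i0 t u (of_int c) Z" unfolding W_def t_def u_def by (rule act_emb(2)[OF Z det])
  have WS: "W \<in> siegel_upper" unfolding W_def by (rule act_mat_siegel_upper[OF emb_Sp[OF det] Z])
  let ?T = "tuples (\<Lambda>(i0 := {\<lambda>l. 0}))"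
  have fr: "\<Lambda> i \<subseteq> frac_vecs p" for i using sub by blast
  have "Theta p \<Lambda> W = (\<Sum>\<^sub>\<infinity>H\<in>?T. ee (qf p W H) * th p (\<Lambda> i0) (W $ i0 $ i0) (row_vec W i0 H))"
    by (rule Theta_split[OF WS p fr])
  also have "\<dots> = (\<Sum>\<^sub>\<infinity>H\<in>?T. K * (ee (qf p Z H) * th p \<Lambda>' (Z $ i0 $ i0) (row_vec Z i0 H)))"
  proof (rule infsum_cong)
    fix H assume H: "H \<in> ?T"
    then have H0: "H i0 = (\<lambda>l. 0)" by (auto simp: tuples_def dest: spec[of _ i0])
    have zero: "(\<lambda>l. 0) \<in> hyperplane p" by (simp add: hyperplane_def periodic_def)
    have "H k \<in> hyperplane p" for k
    proof -
      have "H k \<in> (\<Lambda>(i0 := {\<lambda>l. 0})) k" using H by (simp add: tuples_def)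
      then show ?thesis using sub[of k] zero by (cases "k = i0") auto
    qed
    then have z: "row_vec Z i0 H \<in> hyperplane p" by (rule row_vec_hyperplane)
    have r: "row_vec W i0 H = scale (1 / u) (row_vec Z i0 H)"
      unfolding row_vec_def scale_def sum_distrib_left by (intro ext sum.cong refl) (auto simp: W emb_act_def H0)
    have "ip p (row_vec Z i0 H) (row_vec Z i0 H) = (\<Sum>k\<in>UNIV. Z $ i0 $ k * ip p (row_vec Z i0 H) (H k))"
      by (rule ip_row_vec)
    also have "\<dots> = (\<Sum>k\<in>UNIV. \<Sum>j\<in>UNIV. Z $ i0 $ k * (Z $ i0 $ j * ip p (H k) (H j)))"
      by (simp only: ip_commute[of p "row_vec Z i0 H"] ip_row_vec sum_distrib_left)
    finally have zz: "ip p (row_vec Z i0 H) (row_vec Z i0 H) = (\<Sum>k\<in>UNIV. \<Sum>j\<in>UNIV. Z $ i0 $ k * (Z $ i0 $ j * ip p (H k) (H j)))" .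
    have "W $ k $ j * ip p (H k) (H j) = Z $ k $ j * ip p (H k) (H j) - (of_int c / u) * (Z $ i0 $ k * (Z $ i0 $ j * ip p (H k) (H j)))" for k j
      by (auto simp: W emb_act_def H0 siegel_upperD(2)[OF Z, of k i0] left_diff_distrib)
    then have "(\<Sum>k\<in>UNIV. \<Sum>j\<in>UNIV. W $ k $ j * ip p (H k) (H j))
       = (\<Sum>k\<in>UNIV. \<Sum>j\<in>UNIV. Z $ k $ j * ip p (H k) (H j)) - (of_int c / u) * ip p (row_vec Z i0 H) (row_vec Z i0 H)"
      unfolding zz sum_distrib_left by (simp only: sum_subtractf)
    then have q: "qf p W H = qf p Z H + - (of_int c * ip p (row_vec Z i0 H) (row_vec Z i0 H) / (2 * u))"
      unfolding qf_def by (simp add: diff_divide_distrib)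
    have W00: "W $ i0 $ i0 = t" by (simp add: W emb_act_def)
    show "ee (qf p W H) * th p (\<Lambda> i0) (W $ i0 $ i0) (row_vec W i0 H) = K * (ee (qf p Z H) * th p \<Lambda>' (Z $ i0 $ i0) (row_vec Z i0 H))"
      using J[OF z, folded u_def, folded t_def] unfolding q r W00 ee_add by (simp only: mult_ac)
  qed
  also have "\<dots> = K * (\<Sum>\<^sub>\<infinity>H\<in>?T. ee (qf p Z H) * th p \<Lambda>' (Z $ i0 $ i0) (row_vec Z i0 H))" by (rule infsum_cmult_right')
  also have "(\<Sum>\<^sub>\<infinity>H\<in>?T. ee (qf p Z H) * th p \<Lambda>' (Z $ i0 $ i0) (row_vec Z i0 H)) = Theta p (\<Lambda>(i0 := \<Lambda>')) Z"
    using Theta_split[OF Z p, of "\<Lambda>(i0 := \<Lambda>')" i0] fr sub' by simp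
  finally show ?thesis unfolding W_def .
qed

lemma even_sum_symmetric:
  fixes m :: "'x \<Rightarrow> 'x \<Rightarrow> int"
  assumes "finite A" "\<And>i k. m i k = m k i" "\<And>i. even (m i i)"
  shows "even (\<Sum>i\<in>A. \<Sum>k\<in>A. m i k)"
  using assms(1)
proof (induction A rule: finite_induct)
  case (insert x A)
  have "(\<Sum>i\<in>insert x A. \<Sum>k\<in>insert x A. m i k) = m x x + (\<Sum>k\<in>A. m x k) + ((\<Sum>i\<in>A. m i x) + (\<Sum>i\<in>A. \<Sum>k\<in>A. m i k))"
    using insert(1,2) by (simp add: sum.distrib)
  also have "(\<Sum>i\<in>A. m i x) = (\<Sum>k\<in>A. m x k)" by (intro sum.cong refl assms(2))
  finally show ?case using insert.IH assms(3)[of x] by simp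
qed simp

text \<open>The exponent grows by half of a symmetric sum of integers with even diagonal, which is
  an integer.\<close>

lemma Theta_trans:
  fixes B :: "int^'n^'n::finite"
  assumes B: "transpose B = B" and ev: "\<And>i x. x \<in> \<Lambda> i \<Longrightarrow> ip p x x / 2 \<in> \<int>"
    and int': "\<And>i k x y. x \<in> \<Lambda> i \<Longrightarrow> y \<in> \<Lambda> k \<Longrightarrow> ip p x y \<in> \<int>"
  shows "Theta p \<Lambda> (Z + int_to_cmat B) = Theta p \<Lambda> Z"
  unfolding Theta_def
proof (rule infsum_cong)
  fix G assume "G \<in> tuples \<Lambda>"
  then have G: "G i \<in> \<Lambda> i" for i by (simp add: tuples_def)
  have sB: "B $ i $ k = B $ k $ i" for i k using B by (metis transpose_def vec_lambda_beta)
  define m where "m i k = B $ i $ k * \<lfloor>Re (ip p (G i) (G k))\<rfloor>" for i k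
  have ip: "ip p (G i) (G k) = of_int \<lfloor>Re (ip p (G i) (G k))\<rfloor>" for i k
  proof -
    obtain n where "ip p (G i) (G k) = of_int n" by (rule Ints_cases[OF int'[OF G[of i] G[of k]]])
    then show ?thesis by simp
  qed
  have m: "of_int (m i k) = of_int (B $ i $ k) * ip p (G i) (G k)" for i k
    unfolding m_def of_int_mult ip[symmetric] ..
  have "even (m i i)" for i
  proof -
    obtain n where "ip p (G i) (G i) / 2 = of_int n" by (rule Ints_cases[OF ev[OF G[of i]]])
    then have "ip p (G i) (G i) = of_int (2 * n)" by simp
    then have "Re (ip p (G i) (G i)) = of_int (2 * n)" by simp
    then have "m i i = B $ i $ i * (2 * n)" unfolding m_def by (simp only: floor_of_int)
    then show ?thesis by simp
  qed
  moreover have "m i k = m k i" for i k by (simp add: m_def sB[of i k] ip_commute)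
  ultimately have "even (\<Sum>i\<in>UNIV. \<Sum>k\<in>UNIV. m i k)" by (intro even_sum_symmetric) auto
  then obtain n where n: "(\<Sum>i\<in>UNIV. \<Sum>k\<in>UNIV. m i k) = 2 * n" by (auto elim: evenE)
  have "qf p (int_to_cmat B) G = of_int (\<Sum>i\<in>UNIV. \<Sum>k\<in>UNIV. m i k) / 2"
    by (simp add: qf_def int_to_cmat_def m)
  then have "qf p (int_to_cmat B) G = of_int n" unfolding n by simp
  then show "ee (qf p (Z + int_to_cmat B) G) = ee (qf p Z G)" by (simp add: qf_add ee_add)
qed

lemma act_trans: "act_mat (trans_mat B) Z = Z + int_to_cmat B" "det (den_mat (trans_mat B) Z) = 1"
proof -
  have d: "den_mat (trans_mat B) Z = mat 1"
    by (simp add: den_mat_def trans_mat_def int_to_cmat_mat) (simp add: int_to_cmat_def matrix_matrix_mult_def vec_eq_iff)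
  then show "det (den_mat (trans_mat B) Z) = 1" by simp
  show "act_mat (trans_mat B) Z = Z + int_to_cmat B" unfolding act_mat_def
    by (rule matrix_inv_eqI) (simp_all add: d, simp add: num_mat_def trans_mat_def int_to_cmat_mat)
qed

lemma act_levi:
  assumes kl: "k \<noteq> (l :: 'n::finite)"
  shows "det (den_mat (levi_mat k l m) Z) = 1"
    and "act_mat (levi_mat k l m) Z = int_to_cmat (block_A (levi_mat k l m)) ** Z ** transpose (int_to_cmat (block_A (levi_mat k l m)))"
proof -
  define M where "M = levi_mat k l m"
  have C: "block_C M = 0" "block_B M = 0" by (simp_all add: M_def levi_mat_def)
  have z: "int_to_cmat 0 = (0 :: complex^'n^'n)" by (simp add: int_to_cmat_def vec_eq_iff)
  have den: "den_mat M Z = int_to_cmat (block_D M)" by (simp add: den_mat_def C z zero_mat_mult)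
  have "int_to_cmat (block_D M) = (\<chi> j i. if j = l then (if i = l then 1 else 0) - (if i = k then of_int m else 0) else if j = i then 1 else 0)"
    by (auto simp: M_def levi_mat_def int_to_cmat_def vec_eq_iff)
  then have det: "det (int_to_cmat (block_D M)) = 1" using kl by (simp add: det_row_update)
  then show "det (den_mat (levi_mat k l m) Z) = 1" using den by (simp add: M_def)
  have "transpose (block_A M) ** block_D M = mat 1"
    using levi_Sp[OF kl, of m] unfolding Sp_int_iff M_def[symmetric] C transpose_zero zero_mat_mult by simp
  then have AD: "transpose (int_to_cmat (block_A M)) ** int_to_cmat (block_D M) = mat 1"
    unfolding int_to_cmat_transpose[symmetric] int_to_cmat_mult[symmetric] by (simp add: int_to_cmat_mat)
  show "act_mat (levi_mat k l m) Z = int_to_cmat (block_A (levi_mat k l m)) ** Z ** transpose (int_to_cmat (block_A (levi_mat k l m)))"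
    unfolding act_mat_def M_def[symmetric] den
    by (rule matrix_inv_eqI) (simp_all add: det matrix_mul_assoc[symmetric] AD num_mat_def C z)
qed

text \<open>The elementary matrix adds m times row k to row l of the tuple, which permutes the
  tuples of lattice vectors.\<close>

lemma Theta_levi:
  assumes kl: "k \<noteq> (l :: 'n::finite)" and add: "\<And>x y. x \<in> L \<Longrightarrow> y \<in> L \<Longrightarrow> vadd x y \<in> L" and sc: "\<And>x (n::int). x \<in> L \<Longrightarrow> scale (of_int n) x \<in> L"
  shows "Theta p (\<lambda>_. L) (act_mat (levi_mat k l m) Z) = Theta p (\<lambda>_. L) Z"
proof -
  let ?T = "tuples (\<lambda>_ :: 'n. L)"
  define \<phi> where "\<phi> m G = G(l := vadd (G l) (scale (of_int m) (G k)))" for m :: int and G :: "'n \<Rightarrow> cvec"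
  have \<phi>T: "\<phi> m G \<in> ?T" if "G \<in> ?T" for m G using that add sc by (auto simp: tuples_def \<phi>_def)
  have inv: "\<phi> (- m) (\<phi> m G) = G" for m G using kl by (simp add: \<phi>_def fun_eq_iff vadd_def scale_def)
  have bij: "bij_betw (\<phi> m) ?T ?T"
    by (rule bij_betwI[of _ _ _ "\<phi> (- m)"]) (use \<phi>T inv inv[of "- m"] in auto)
  have "(\<lambda>j x. \<Sum>i\<in>UNIV. int_to_cmat (block_A (levi_mat k l m)) $ i $ j * G i x) = \<phi> m G" for G
  proof (intro ext)
    fix j x
    have "int_to_cmat (block_A (levi_mat k l m)) $ i $ j * G i x = (if i = j then G j x else 0) + (if i = k then if j = l then of_int m * G k x else 0 else 0)" for i
      by (simp add: levi_mat_def int_to_cmat_def algebra_simps)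
    then show "(\<Sum>i\<in>UNIV. int_to_cmat (block_A (levi_mat k l m)) $ i $ j * G i x) = \<phi> m G j x"
      by (simp add: sum.distrib \<phi>_def vadd_def scale_def)
  qed
  then have "Theta p (\<lambda>_. L) (act_mat (levi_mat k l m) Z) = (\<Sum>\<^sub>\<infinity>G\<in>?T. ee (qf p Z (\<phi> m G)))"
    unfolding Theta_def act_levi(2)[OF kl] qf_congruence by simp
  also have "\<dots> = Theta p (\<lambda>_. L) Z" unfolding Theta_def by (rule infsum_reindex_bij_betw[OF bij])
  finally show ?thesis .
qed

section \<open>Arithmetic of the coefficients\<close>

fun euler_coeff :: "nat \<Rightarrow> nat \<Rightarrow> nat \<Rightarrow> int" where
  "euler_coeff p 0 r = (if r = 0 then 1 else 0)"
| "euler_coeff p (Suc n) r = euler_coeff p n r - (if r = 0 then 0 else int p ^ Suc n * euler_coeff p n (r - 1))"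

lemma euler_coeff_zero: "r > n \<Longrightarrow> euler_coeff p n r = 0"
  by (induction n arbitrary: r) auto

lemma euler_coeff_prod:
  "(\<Sum>r\<le>n. of_int (euler_coeff p n r) * x ^ r) = (\<Prod>j\<in>{1..n}. 1 - of_nat p ^ j * (x :: 'a::comm_ring_1))"
proof (induction n)
  case (Suc n)
  have "(\<Sum>r\<le>Suc n. of_int (euler_coeff p (Suc n) r) * x ^ r)
    = (\<Sum>r\<le>Suc n. of_int (euler_coeff p n r) * x ^ r) - (\<Sum>r\<le>Suc n. of_int (if r = 0 then 0 else int p ^ Suc n * euler_coeff p n (r - 1)) * x ^ r)"
    by (simp only: euler_coeff.simps of_int_diff left_diff_distrib sum_subtractf)
  also have "(\<Sum>r\<le>Suc n. of_int (euler_coeff p n r) * x ^ r) = (\<Sum>r\<le>n. of_int (euler_coeff p n r) * x ^ r)"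
    by (simp add: euler_coeff_zero)
  also have "(\<Sum>r\<le>Suc n. of_int (if r = 0 then 0 else int p ^ Suc n * euler_coeff p n (r - 1)) * x ^ r)
    = of_nat p ^ Suc n * x * (\<Sum>r\<le>n. of_int (euler_coeff p n r) * x ^ r)"
    by (subst sum.atMost_Suc_shift) (simp add: sum_distrib_left mult_ac)
  finally show ?case by (simp only: Suc) (simp add: algebra_simps)
qed simp

text \<open>A product of r distinct factors among p, p^2, ..., p^n has exponent at least 1 + ... +
  r.\<close>

lemma euler_coeff_dvd: "int p ^ (r * (r + 1) div 2) dvd euler_coeff p n r"
proof (induction n arbitrary: r)
  case (Suc n)
  show ?case
  proof (cases "r = 0 \<or> r > Suc n")
    case True
    then show ?thesis using euler_coeff_zero[of "Suc n" r p] Suc[of r] by auto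
  next
    case False
    then obtain s where s: "r = Suc s" "s \<le> n" by (cases r) auto
    have "r * (r + 1) div 2 = s * (s + 1) div 2 + (s + 1)" by (simp add: s)
    also have "\<dots> \<le> s * (s + 1) div 2 + Suc n" using s by simp
    finally have "int p ^ (r * (r + 1) div 2) dvd int p ^ (s * (s + 1) div 2 + Suc n)" by (rule le_imp_power_dvd)
    also have "\<dots> dvd int p ^ Suc n * euler_coeff p n s"
      unfolding power_add mult.commute[of "int p ^ (s * (s + 1) div 2)"] by (intro mult_dvd_mono dvd_refl Suc)
    finally show ?thesis unfolding euler_coeff.simps using Suc[of r] s by simp
  qed
qed simp

lemma algebraic_int_square:
  assumes "x * x = of_int (m :: int)"
  shows "algebraic_int (x :: complex)"
  by (rule algebraic_int_root[of "of_int m" "Polynomial.monom 1 2"])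
     (use assms in \<open>auto simp: poly_monom degree_monom_eq power2_eq_square int_imp_algebraic_int\<close>)

lemma of_int_in_subfield: "is_subfield K \<Longrightarrow> of_int m \<in> K"
proof -
  assume K: "is_subfield K"
  then have z: "0 \<in> K" "1 \<in> K" and d: "\<And>x y. x \<in> K \<Longrightarrow> y \<in> K \<Longrightarrow> x - y \<in> K"
    unfolding is_subfield_def by blast+
  have neg: "- x \<in> K" if "x \<in> K" for x using d[OF z(1) that] by simp
  have n: "of_nat k \<in> K" for k
  proof (induction k)
    case (Suc k)
    have "of_nat k - (- 1) \<in> K" using d[OF Suc neg[OF z(2)]] .
    then show ?case by (simp add: add.commute)
  qed (simp add: z)
  show ?thesis using n neg[OF n] by (cases m) (auto simp del: of_nat_Suc)
qed

lemma is_subfield_coeff_field: "is_subfield (coeff_field f)"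
  unfolding coeff_field_def is_subfield_def by blast

lemma coeff_in_coeff_field: "fourier_coeff f T \<in> coeff_field f"
  unfolding coeff_field_def by blast

text \<open>The valuation is known only on K, which need not contain a square root of p, so the
  bound goes through x^2: twice the valuation of x plus A is the valuation of the integer m.\<close>

lemma padic_bound:
  assumes v: "extends_padic p K v" and p: "prime p" and K: "is_subfield K" "x \<in> K"
    and eq: "x * x * of_int (int p ^ A) = of_int m" and dvd: "int p ^ B dvd m"
  shows "v x \<ge> ereal ((real B - real A) / 2)"
proof (cases "x = 0")
  case True
  then show ?thesis using v by (simp add: extends_padic_def)
next
  case False
  have pi: "prime (int p)" using p by simp
  have mulv: "v (a * b) = v a + v b" if "a \<in> K" "b \<in> K" for a b using v that by (simp add: extends_padic_def)
  have int: "v (of_int k) = ereal (real (multiplicity (int p) k))" if "k \<noteq> 0" for k using v that by (simp add: extends_padic_def)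
  have xx: "x * x \<in> K" using K by (simp add: is_subfield_def)
  have "\<bar>v x\<bar> \<noteq> \<infinity>" using v False K(2) by (simp add: extends_padic_def)
  then obtain t where t: "v x = ereal t" by (cases "v x") auto
  have m0: "m \<noteq> 0" using eq False p by (auto simp: prime_gt_0_nat dest: prime_gt_0_nat)
  have pA: "int p ^ A \<noteq> 0" using p by (simp add: prime_gt_0_nat)
  have "v (of_int m) = v x + v x + v (of_int (int p ^ A))"
    unfolding eq[symmetric] mulv[OF xx of_int_in_subfield[OF K(1)]] mulv[OF K(2) K(2)] ..
  then have "ereal (real (multiplicity (int p) m)) = ereal (2 * t + real (multiplicity (int p) (int p ^ A)))"
    unfolding int[OF m0] int[OF pA] t by simp
  moreover have "multiplicity (int p) (int p ^ A) = A" using pi by (simp add: multiplicity_same_power prime_elem_multiplicity_power_distrib)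
  moreover have "B \<le> multiplicity (int p) m" using dvd m0 pi by (intro multiplicity_geI) (auto simp: prime_gt_1_int)
  ultimately have "real B \<le> 2 * t + real A" by simp
  then show ?thesis unfolding t by simp
qed

lemma number_field_quadratic:
  assumes "\<theta> * \<theta> = of_rat q"
  shows "number_field {x. \<exists>a b. x = of_rat a + of_rat b * \<theta>}" (is "number_field ?K")
proof -
  have inv: "inverse x \<in> ?K" if xK: "x \<in> ?K" for x
  proof -
    obtain a b where x: "x = of_rat a + of_rat b * \<theta>" using xK by blast
    show ?thesis
    \<comment> \<open>The conjugate may vanish although x does not, when \<open>\<theta>\<close> is
      rational; then x equals 2 a.\<close>
    proof (cases "of_rat a - of_rat b * \<theta> = 0")
      case True
      then have "x = of_rat (2 * a)" by (simp add: x of_rat_mult)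
      then have "inverse x = of_rat (inverse (2 * a)) + of_rat 0 * \<theta>" by (simp only: of_rat_inverse of_rat_0 mult_zero_left add_0_right)
      then show ?thesis by blast
    next
      case False
      have n: "x * (of_rat a - of_rat b * \<theta>) = of_rat (a * a - b * b * q)"
        unfolding x of_rat_diff of_rat_mult assms[symmetric] by (simp add: algebra_simps)
      show ?thesis
      proof (cases "x = 0")
        case True
        then have "inverse x = of_rat 0 + of_rat 0 * \<theta>" by simp
        then show ?thesis by blast
      next
        case x0: False
        define s where "s = a * a - b * b * q"
        have ns: "x * (of_rat a - of_rat b * \<theta>) = of_rat s" unfolding s_def by (rule n)
        then have s0: "of_rat s \<noteq> (0 :: complex)" using False x0 by (metis mult_eq_0_iff)
        have "x * ((of_rat a - of_rat b * \<theta>) / of_rat s) = 1" unfolding times_divide_eq_right ns by (rule divide_self[OF s0])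
        then have "inverse x = (of_rat a - of_rat b * \<theta>) / of_rat s" by (rule inverse_unique)
        also have "\<dots> = of_rat (a / s) + of_rat (- b / s) * \<theta>" by (simp add: of_rat_divide of_rat_minus diff_divide_distrib)
        finally show ?thesis by blast
      qed
    qed
  qed
  have "x - y \<in> ?K \<and> x * y \<in> ?K" if xy: "x \<in> ?K" "y \<in> ?K" for x y
  proof -
    obtain a b where x: "x = of_rat a + of_rat b * \<theta>" using xy(1) by blast
    obtain c d where y: "y = of_rat c + of_rat d * \<theta>" using xy(2) by blast
    have "x - y = of_rat (a - c) + of_rat (b - d) * \<theta>" by (simp add: x y of_rat_diff algebra_simps)
    moreover have "x * y = of_rat (a * c + b * d * q) + of_rat (a * d + b * c) * \<theta>"
      unfolding x y of_rat_add of_rat_mult assms[symmetric] by (simp add: algebra_simps)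
    ultimately show ?thesis by blast
  qed
  moreover have "0 = of_rat 0 + of_rat 0 * \<theta>" "1 = of_rat 1 + of_rat 0 * \<theta>" by simp_all
  ultimately have "is_subfield ?K" unfolding is_subfield_def using inv by blast
  moreover have "\<exists>q :: complex \<Rightarrow> rat. x = (\<Sum>b\<in>{1, \<theta>}. of_rat (q b) * b)" if xK: "x \<in> ?K" for x
  proof -
    obtain a b where x: "x = of_rat a + of_rat b * \<theta>" using xK by blast
    show ?thesis
    \<comment> \<open>The spanning set {1, \<open>\<theta>\<close>} collapses for
      \<open>\<theta>\<close> = 1, and the two coefficients have to be added.\<close>
    proof (cases "\<theta> = 1")
      case True
      then show ?thesis by (intro exI[of _ "\<lambda>_. a + b"]) (simp add: x of_rat_add)
    next
      case False
      then show ?thesis by (intro exI[of _ "\<lambda>t. if t = 1 then a else b"]) (simp add: x)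
    qed
  qed
  then have "\<exists>B. finite B \<and> (\<forall>x\<in>?K. \<exists>q :: complex \<Rightarrow> rat. x = (\<Sum>b\<in>B. of_rat (q b) * b))"
    by (intro exI[of _ "{1, \<theta>}"]) blast
  ultimately show ?thesis unfolding number_field_def by blast
qed

lemma bounded_denominatorsI:
  assumes exp: "has_fourier_expansion f a" and a: "fourier_coeff f = a" "\<And>T. a T = of_rat (m T) * \<theta>"
    and \<theta>: "\<theta> * \<theta> = of_rat q" and N: "N \<noteq> 0" "\<And>T. algebraic_int (of_int N * a T)"
  shows "bounded_denominators f"
proof -
  have "a T = of_rat 0 + of_rat (m T) * \<theta>" for T by (simp add: a(2))
  then have "range a \<subseteq> {x. \<exists>a b. x = of_rat a + of_rat b * \<theta>}" by blast
  then show ?thesis unfolding bounded_denominators_def a(1) using exp number_field_quadratic[OF \<theta>] N by blast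
qed

section \<open>Transformation of the theta series\<close>

lemma det_int_to_cmat: "det (int_to_cmat A) = of_int (det A)"
  by (simp add: det_def int_to_cmat_def of_int_sum of_int_prod)

lemma det_cong:
  fixes A B :: "int^'n^'n::finite"
  assumes "\<And>i k. [A $ i $ k = B $ i $ k] (mod q)"
  shows "[det A = det B] (mod q)"
  unfolding det_def by (intro cong_sum cong_mult cong_refl cong_prod assms)

lemma dvd_matrix_mult:
  fixes A B :: "int^'n^'n::finite"
  shows "(\<And>i k. q dvd A $ i $ k) \<Longrightarrow> q dvd (A ** B) $ i $ k" "(\<And>i k. q dvd B $ i $ k) \<Longrightarrow> q dvd (A ** B) $ i $ k"
  by (auto simp: matrix_matrix_mult_def intro!: dvd_sum)

lemma Gamma0_mult: "M \<in> Gamma0 p \<Longrightarrow> N \<in> Gamma0 p \<Longrightarrow> M ** N \<in> Gamma0 p"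
  unfolding Gamma0_def by (auto simp: Sp_int_mult block_mult intro!: dvd_add[OF dvd_matrix_mult(1) dvd_matrix_mult(2)])

text \<open>Modulo p the lower left block vanishes, so the transpose of A is inverse to D.\<close>

lemma Gamma0_det_coprime:
  fixes M :: "int^('n + 'n)^('n::finite + 'n)"
  assumes M: "M \<in> Gamma0 p" and p: "prime p"
  shows "\<not> int p dvd det (block_D M)"
proof
  assume dvd: "int p dvd det (block_D M)"
  have "transpose (block_A M) ** block_D M = mat 1 + transpose (block_C M) ** block_B M"
    using M by (simp add: Gamma0_def Sp_int_iff)
  then have "det (transpose (block_A M)) * det (block_D M) = det (mat 1 + transpose (block_C M) ** block_B M)"
    by (metis det_mul)
  also have "[det (mat 1 + transpose (block_C M) ** block_B M) = det (mat 1 :: int^'n^'n)] (mod int p)"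
  proof (rule det_cong)
    fix i k
    have "int p dvd (transpose (block_C M) ** block_B M) $ i $ k"
      using M by (auto simp: Gamma0_def transpose_def intro!: dvd_matrix_mult(1))
    then show "[(mat 1 + transpose (block_C M) ** block_B M) $ i $ k = mat 1 $ i $ k] (mod int p)"
      by (simp add: cong_iff_dvd_diff)
  qed
  finally have "[det (transpose (block_A M)) * det (block_D M) = 1] (mod int p)" by simp
  moreover have "[det (transpose (block_A M)) * det (block_D M) = 0] (mod int p)" using dvd by (simp add: cong_0_iff)
  ultimately have "[1 = 0] (mod int p)" by (meson cong_sym cong_trans)
  then have "int p dvd 1" by (simp add: cong_0_iff)
  then show False using p by (auto simp: prime_nat_iff)
qed

lemma Gamma0_det_mult:
  assumes M: "M \<in> Gamma0 p" and N: "N \<in> Gamma0 p"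
  shows "[det (block_D (M ** N)) = det (block_D M) * det (block_D N)] (mod int p)"
  unfolding det_mul[symmetric] block_mult
proof (rule det_cong)
  fix i k
  have "int p dvd (block_C M ** block_B N) $ i $ k"
    using M by (auto simp: Gamma0_def intro!: dvd_matrix_mult(1))
  then show "[(block_C M ** block_B N + block_D M ** block_D N) $ i $ k = (block_D M ** block_D N) $ i $ k] (mod int p)"
    by (simp add: cong_iff_dvd_diff)
qed

lemma emb_mult:
  "emb_mat i a b c d ** emb_mat i a' b' c' d' = emb_mat i (a * a' + b * c') (a * b' + b * d') (c * a' + d * c') (c * b' + d * d')"
proof -
  have "emb_mat i a b c d ** (emb_mat i a' b' c' d' ** mat 1) = emb_mat i (a * a' + b * c') (a * b' + b * d') (c * a' + d * c') (c * b' + d * d') ** mat 1"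
    by (rule mat_rows_eqI) (simp_all only: emb_row, simp_all add: algebra_simps)
  then show ?thesis by (simp only: matrix_mul_rid)
qed

lemma emb_det_D: "det (block_D (emb_mat i a b c d)) = d"
proof -
  have "det (diag_mat (\<lambda>j. if j = i then d else 1)) = (\<Prod>j\<in>UNIV. if j = i then d else 1)"
    by (subst det_diagonal) (auto simp: diag_mat_def)
  then show ?thesis by (simp add: emb_mat_def prod.delta)
qed

lemma emb_Gamma0: "a * d - b * c = 1 \<Longrightarrow> int p dvd c \<Longrightarrow> emb_mat i a b c d \<in> Gamma0 p"
  by (simp add: Gamma0_def emb_Sp) (simp add: emb_mat_def diag_mat_def)

lemma emb_trans:
  fixes i :: "'n::finite"
  shows "emb_mat i 1 m 0 1 = trans_mat (diag_mat (\<lambda>j. if j = i then m else 0))"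
proof -
  have "diag_mat (\<lambda>_ :: 'n. 1) = (mat 1 :: int^'n^'n)" "diag_mat (\<lambda>_ :: 'n. 0) = (0 :: int^'n^'n)"
    by (simp_all add: diag_mat_def mat_def vec_eq_iff)
  then show ?thesis by (simp add: emb_mat_def trans_mat_def)
qed

context theta_lattice
begin

lemma p_prime: "prime p" by (rule prime)

lemma L_frac: "L \<subseteq> frac_vecs p \<inter> hyperplane p"
  using lat_subset_frac L_hyp by blast

lemma L'_frac_hyp: "L' \<subseteq> frac_vecs p \<inter> hyperplane p"
  using L'_frac L'_hyp by blast

definition automorphy :: "(int^('n + 'n)^('n::finite + 'n)) set" where
  "automorphy = {M \<in> Gamma0 p. \<forall>Z\<in>siegel_upper. slash (int wt) M (Theta p (\<lambda>_. L)) Z = of_int (chi p (det (block_D M))) * Theta p (\<lambda>_. L) Z}"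

text \<open>The Legendre symbol replaces the character because it is multiplicative and depends only
  on the residue modulo p, as closure under products requires.\<close>

lemma automorphyI:
  assumes "M \<in> Gamma0 p"
    and "\<And>Z. Z \<in> siegel_upper \<Longrightarrow> slash (int wt) M (Theta p (\<lambda>_. L)) Z = of_int (Legendre (det (block_D M)) (int p)) * Theta p (\<lambda>_. L) Z"
  shows "M \<in> automorphy"
  using assms chi_eq_Legendre[OF p_prime odd Gamma0_det_coprime[OF assms(1) p_prime]] by (simp add: automorphy_def)

lemma automorphyD:
  assumes "M \<in> automorphy"
  shows "M \<in> Gamma0 p" "Z \<in> siegel_upper \<Longrightarrow> slash (int wt) M (Theta p (\<lambda>_. L)) Z = of_int (Legendre (det (block_D M)) (int p)) * Theta p (\<lambda>_. L) Z"
proof -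
  show M: "M \<in> Gamma0 p" using assms by (simp add: automorphy_def)
  show "slash (int wt) M (Theta p (\<lambda>_. L)) Z = of_int (Legendre (det (block_D M)) (int p)) * Theta p (\<lambda>_. L) Z" if "Z \<in> siegel_upper"
    using assms that chi_eq_Legendre[OF p_prime odd Gamma0_det_coprime[OF M p_prime]] by (simp add: automorphy_def)
qed

lemma p_gt_2: "p > 2"
  using p_ge_3 by simp

lemma automorphy_mult:
  assumes M: "M \<in> automorphy" and N: "N \<in> automorphy"
  shows "M ** N \<in> automorphy"
proof (rule automorphyI)
  have S: "M \<in> Sp_int" "N \<in> Sp_int" using automorphyD(1)[OF M] automorphyD(1)[OF N] by (simp_all add: Gamma0_def)
  show "M ** N \<in> Gamma0 p" by (intro Gamma0_mult automorphyD(1) assms)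
  fix Z :: "complex^'a^'a" assume Z: "Z \<in> siegel_upper"
  have "slash (int wt) (M ** N) (Theta p (\<lambda>_. L)) Z = of_int (Legendre (det (block_D M)) (int p)) * slash (int wt) N (Theta p (\<lambda>_. L)) Z"
    unfolding slash_mult[OF S Z] automorphyD(2)[OF M act_mat_siegel_upper[OF S(2) Z]] slash_alt[of _ N] by simp
  also have "\<dots> = of_int (Legendre (det (block_D M) * det (block_D N)) (int p)) * Theta p (\<lambda>_. L) Z"
    unfolding automorphyD(2)[OF N Z] Legendre_mult[OF p_prime p_gt_2] by simp
  also have "Legendre (det (block_D M) * det (block_D N)) (int p) = Legendre (det (block_D (M ** N))) (int p)"
    by (rule Legendre_cong[OF cong_sym[OF Gamma0_det_mult[OF automorphyD(1)[OF M] automorphyD(1)[OF N]]]])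
  finally show "slash (int wt) (M ** N) (Theta p (\<lambda>_. L)) Z = of_int (Legendre (det (block_D (M ** N))) (int p)) * Theta p (\<lambda>_. L) Z" .
qed

lemma trans_in_automorphy:
  assumes B: "transpose B = B"
  shows "trans_mat B \<in> automorphy"
proof (rule automorphyI)
  show "trans_mat B \<in> Gamma0 p" by (simp add: Gamma0_def trans_Sp[OF B]) (simp add: trans_mat_def)
  fix Z :: "complex^'a^'a"
  have "block_D (trans_mat B) = mat 1" by (simp add: trans_mat_def)
  moreover have "Theta p (\<lambda>_. L) (Z + int_to_cmat B) = Theta p (\<lambda>_. L) Z"
    by (rule Theta_trans[OF B]) (auto intro: even_L ip_LL)
  ultimately show "slash (int wt) (trans_mat B) (Theta p (\<lambda>_. L)) Z = of_int (Legendre (det (block_D (trans_mat B))) (int p)) * Theta p (\<lambda>_. L) Z"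
    by (simp add: slash_alt act_trans Legendre_1[OF p_prime p_gt_2])
qed

lemma levi_in_automorphy:
  assumes kl: "k \<noteq> (l :: 'n::finite)"
  shows "levi_mat k l m \<in> automorphy"
proof (rule automorphyI)
  have C: "block_C (levi_mat k l m) = 0" by (simp add: levi_mat_def)
  show "levi_mat k l m \<in> Gamma0 p" by (simp add: Gamma0_def levi_Sp[OF kl] C)
  fix Z :: "complex^'n^'n"
  have "den_mat (levi_mat k l m) Z = int_to_cmat (block_D (levi_mat k l m))"
    unfolding den_mat_def C by (simp add: int_to_cmat_def matrix_matrix_mult_def vec_eq_iff)
  then have "of_int (det (block_D (levi_mat k l m))) = (1 :: complex)"
    using act_levi(1)[OF kl, of m Z] by (simp add: det_int_to_cmat)
  then have D: "det (block_D (levi_mat k l m)) = 1" by simp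
  have "Theta p (\<lambda>_. L) (act_mat (levi_mat k l m) Z) = Theta p (\<lambda>_. L) Z"
    by (rule Theta_levi[OF kl]) (auto intro: lat_vadd lat_scale)
  then show "slash (int wt) (levi_mat k l m) (Theta p (\<lambda>_. L)) Z = of_int (Legendre (det (block_D (levi_mat k l m))) (int p)) * Theta p (\<lambda>_. L) Z"
    by (simp add: slash_alt act_levi(1)[OF kl] D Legendre_1[OF p_prime p_gt_2])
qed

lemma emb_pos_in_automorphy:
  fixes i :: "'n::finite"
  assumes det: "a * d - b * c = 1" and pc: "int p dvd c" and d: "d > 0" "odd d"
  shows "emb_mat i a b c d \<in> automorphy"
proof (rule automorphyI)
  show "emb_mat i a b c d \<in> Gamma0 p" by (rule emb_Gamma0[OF det pc])
  fix Z :: "complex^'n^'n" assume Z: "Z \<in> siegel_upper"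
  let ?u = "of_int c * Z $ i $ i + of_int d"
  have u: "?u \<noteq> 0" by (rule im_moebius_pos(1)[OF siegel_upper_diag[OF Z] det])
  have "Theta p (\<lambda>_. L) (act_mat (emb_mat i a b c d) Z) = (of_int (Legendre d (int p)) * ?u ^ wt) * Theta p ((\<lambda>_. L)(i := L)) Z"
    by (rule Theta_emb[OF Z p_pos L_frac _ det])
       (use L_frac jacobi_Gamma0[OF siegel_upper_diag[OF Z] _ det pc d] in auto)
  then show "slash (int wt) (emb_mat i a b c d) (Theta p (\<lambda>_. L)) Z = of_int (Legendre (det (block_D (emb_mat i a b c d))) (int p)) * Theta p (\<lambda>_. L) Z"
    unfolding slash_alt act_emb(1)[OF Z det] emb_det_D using u
    by (simp add: power_int_minus fun_upd_idem)
qed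

text \<open>The Gauss sum was evaluated for positive odd d. For nonzero c a translation on the right
  replaces d by d + c m, which can be made so; the case c = 0, d = - 1 is a product of elements
  already covered.\<close>

lemma emb_in_automorphy:
  fixes i :: "'n::finite"
  assumes det: "a * d - b * c = 1" and pc: "int p dvd c"
  shows "emb_mat i a b c d \<in> automorphy"
proof -
  have tr: "emb_mat i 1 m 0 1 \<in> automorphy" for m
    unfolding emb_trans by (rule trans_in_automorphy[OF transpose_diag_mat])
  have nz: "emb_mat i a b c d \<in> automorphy" if det: "a * d - b * c = 1" and pc: "int p dvd c" and c: "c \<noteq> 0" for a b c d
  proof -
    obtain m where m: "d + c * m > 0" "odd (d + c * m)"
    proof -
      \<comment> \<open>c m0 is even and at least 2 |d| + 2: d + c m0 is positive and has the parity
        of d.\<close>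
      define m0 where "m0 = sgn c * (2 * \<bar>d\<bar> + 2)"
      have cs: "c * m0 = \<bar>c\<bar> * (2 * \<bar>d\<bar> + 2)" by (simp add: m0_def abs_sgn)
      have "\<bar>c\<bar> * (2 * \<bar>d\<bar> + 2) \<ge> 1 * (2 * \<bar>d\<bar> + 2)" using c by (intro mult_right_mono) auto
      then have "c * m0 \<ge> 2 * \<bar>d\<bar> + 2" unfolding cs by simp
      then have pos: "d + c * m0 > 0" by linarith
      have ev: "even (c * m0)" unfolding cs by simp
      show ?thesis
      proof (cases "odd d")
        case True
        then show ?thesis using that[of m0] pos ev by simp
      next
        case False
        have "b * c = a * d - 1" using det by simp
        moreover have "even (a * d)" using False by simp
        ultimately have "odd (b * c)" by simp
        then have oc: "odd c" by simp
        \<comment> \<open>For even d the determinant forces c to be odd, so a further |c| changes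
          the parity.\<close>
        have "c * (m0 + sgn c) = c * m0 + \<bar>c\<bar>" by (simp add: distrib_left abs_sgn)
        then show ?thesis using that[of "m0 + sgn c"] pos ev False oc by auto
      qed
    qed
    have "emb_mat i a (b + a * m) c (d + c * m) \<in> automorphy"
      by (rule emb_pos_in_automorphy[OF _ pc m]) (use det in \<open>simp add: algebra_simps\<close>)
    from automorphy_mult[OF this tr[of "- m"]] show ?thesis by (simp add: emb_mult)
  qed
  show ?thesis
  proof (cases "c = 0")
    case False
    then show ?thesis by (rule nz[OF det pc])
  next
    case True
    then have "a * d = 1" using det by simp
    then consider "a = 1" "d = 1" | "a = - 1" "d = - 1" using zmult_eq_1_iff by blast
    then show ?thesis
    proof cases
      case 1
      then show ?thesis by (intro emb_pos_in_automorphy det pc) auto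
    next
      case 2
      \<comment> \<open>A lower left entry - p is inserted and cancelled again by the second
        factor.\<close>
      have "emb_mat i (- 1 + b * int p) b (- int p) (- 1) \<in> automorphy" by (rule nz) (use p_pos in auto)
      moreover have "emb_mat i 1 0 (- int p) 1 \<in> automorphy" by (rule emb_pos_in_automorphy) auto
      ultimately have "emb_mat i (- 1 + b * int p) b (- int p) (- 1) ** emb_mat i 1 0 (- int p) 1 \<in> automorphy" by (rule automorphy_mult)
      then show ?thesis using 2 True by (simp add: emb_mult)
    qed
  qed
qed

theorem Theta_Gamma0:
  assumes "M \<in> Gamma0 p" "Z \<in> siegel_upper"
  shows "slash (int wt) M (Theta p (\<lambda>_. L)) Z = of_int (chi p (det (block_D M))) * Theta p (\<lambda>_. L) Z"
proof -
  interpret generators p "automorphy"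
    by unfold_locales (use p_prime trans_in_automorphy levi_in_automorphy emb_in_automorphy automorphy_mult in auto)
  show ?thesis using Gamma0_subset[OF assms(1)] assms(2) by (simp add: automorphy_def)
qed

end

text \<open>The set of inverted coordinates is arbitrary here to permit induction;
  \<open>omega_eq\<close> specialises it to the first j.\<close>

definition partial_inversion :: "'n::finite set \<Rightarrow> int^('n + 'n)^('n + 'n)" where
  "partial_inversion F = block_mat (diag_mat (\<lambda>i. if i \<in> F then 0 else 1)) (diag_mat (\<lambda>i. if i \<in> F then - 1 else 0))
               (diag_mat (\<lambda>i. if i \<in> F then 1 else 0)) (diag_mat (\<lambda>i. if i \<in> F then 0 else 1))"

lemma diag_mat_add: "diag_mat f + diag_mat g = diag_mat (\<lambda>i. f i + (g i :: int))"
  by (simp add: diag_mat_def vec_eq_iff)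

lemma partial_inversion_insert: "i \<notin> F \<Longrightarrow> partial_inversion (insert i F) = partial_inversion F ** emb_mat i 0 (- 1) 1 0"
  unfolding partial_inversion_def emb_mat_def
  by (rule block_mat_eqI) (auto simp: block_mult diag_mat_mult diag_mat_add intro!: arg_cong[of _ _ diag_mat])

lemma partial_inversion_empty: "partial_inversion ({} :: 'n::finite set) = trans_mat 0"
proof -
  have "diag_mat (\<lambda>_ :: 'n. 1) = (mat 1 :: int^'n^'n)" "diag_mat (\<lambda>_ :: 'n. 0) = (0 :: int^'n^'n)" by (simp_all add: diag_mat_def mat_def vec_eq_iff)
  then show ?thesis by (simp add: partial_inversion_def trans_mat_def)
qed

lemma partial_inversion_Sp: "finite F \<Longrightarrow> partial_inversion F \<in> Sp_int"
  by (induction F rule: finite_induct)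
     (auto simp: partial_inversion_empty partial_inversion_insert transpose_zero intro!: trans_Sp Sp_int_mult emb_Sp)

lemma omega_eq: "omega j = partial_inversion {i. card {k. k < i} < j}"
  by (simp add: omega_def partial_inversion_def Let_def)

lemma card_first:
  assumes "j \<le> CARD('n::{finite,linorder})"
  shows "card {i::'n. card {k. k < i} < j} = j"
proof -
  let ?r = "\<lambda>i::'n. card {k. k < i}"
  have mono: "?r i < ?r k" if "i < k" for i k using that by (intro psubset_card_mono) auto
  have inj: "inj ?r"
  proof (rule injI)
    fix x y assume "?r x = ?r y"
    then show "x = y" using mono[of x y] mono[of y x] by (cases x y rule: linorder_cases) auto
  qed
  have "?r i < CARD('n)" for i by (rule psubset_card_mono) auto
  then have "range ?r \<subseteq> {..<CARD('n)}" by auto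
  moreover have "card (range ?r) = CARD('n)" using inj by (simp add: card_image)
  ultimately have range: "range ?r = {..<CARD('n)}" by (simp add: card_subset_eq)
  have "?r ` {i. ?r i < j} = {..<j}"
  proof
    show "{..<j} \<subseteq> ?r ` {i. ?r i < j}"
    proof
      fix m assume m: "m \<in> {..<j}"
      then have "m \<in> range ?r" using range assms by auto
      then show "m \<in> ?r ` {i. ?r i < j}" using m by auto
    qed
  qed auto
  then have "card (?r ` {i. ?r i < j}) = j" by simp
  then show ?thesis using inj by (simp add: card_image inj_on_subset)
qed

context theta_lattice
begin

text \<open>The coordinates are inverted one at a time. Each inversion replaces L by its dual in
  that row, and the power of the entry Z_ii cancels against the automorphy factor.\<close>

theorem Theta_partial_inversion:
  fixes Z :: "complex^'n^'n::finite"
  assumes Z: "Z \<in> siegel_upper"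
  shows "slash (int wt) (partial_inversion F) (Theta p (\<lambda>_. L)) Z = ((- \<i>) ^ wt / vol) ^ card F * Theta p (\<lambda>i. if i \<in> F then L' else L) Z"
proof -
  have "finite F" by simp
  then show ?thesis using Z
  proof (induction F arbitrary: Z rule: finite_induct)
    case empty
    have "int_to_cmat 0 = (0 :: complex^'n^'n)" by (simp add: int_to_cmat_def vec_eq_iff)
    then show ?case by (simp add: partial_inversion_empty slash_alt act_trans)
  next
    case (insert i F)
    let ?E = "emb_mat i 0 (- 1) 1 0"
    let ?\<Lambda> = "\<lambda>k. if k \<in> F then L' else L"
    have E: "?E \<in> Sp_int" by (rule emb_Sp) simp
    have \<tau>: "Im (Z $ i $ i) > 0" by (rule siegel_upper_diag[OF insert.prems])
    then have u: "Z $ i $ i \<noteq> 0" by auto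
    have sub: "?\<Lambda> k \<subseteq> frac_vecs p \<inter> hyperplane p" for k using L_frac L'_frac_hyp by simp
    have T: "Theta p ?\<Lambda> (act_mat ?E Z) = ((- \<i> * Z $ i $ i) ^ wt / vol) * Theta p (?\<Lambda>(i := L')) Z"
      by (rule Theta_emb[OF insert.prems p_pos sub L'_frac]) (use jacobi_inversion[OF \<tau>] insert.hyps in auto)
    have d: "det (den_mat ?E Z) = Z $ i $ i" using act_emb(1)[OF insert.prems, of 0 0 "- 1" 1 i] by simp
    have \<Lambda>: "?\<Lambda>(i := L') = (\<lambda>k. if k \<in> insert i F then L' else L)" by (auto simp: fun_eq_iff)
    have "slash (int wt) (partial_inversion (insert i F)) (Theta p (\<lambda>_. L)) Z
      = Z $ i $ i powi (- int wt) * (((- \<i>) ^ wt / vol) ^ card F * (((- \<i> * Z $ i $ i) ^ wt / vol) * Theta p (?\<Lambda>(i := L')) Z))"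
      unfolding partial_inversion_insert[OF insert.hyps(2)] slash_mult[OF partial_inversion_Sp[OF insert.hyps(1)] E insert.prems]
        insert.IH[OF act_mat_siegel_upper[OF E insert.prems]] T d ..
    also have "\<dots> = ((- \<i>) ^ wt / vol) ^ card (insert i F) * Theta p (?\<Lambda>(i := L')) Z"
      unfolding power_mult_distrib using insert.hyps u by (simp add: power_int_minus field_simps)
    finally show ?case unfolding \<Lambda> .
  qed
qed

end

section \<open>Representation numbers\<close>

lemma gram_nonneg:
  assumes "p > 0" "\<And>i. G i \<in> frac_vecs p"
  shows "x \<bullet> (gram p G *v x) \<ge> 0"
proof -
  have "x \<bullet> (gram p G *v x) = (\<Sum>i\<in>UNIV. \<Sum>k\<in>UNIV. \<Sum>l<p. x $ i * x $ k * (Re (G i l) * Re (G k l)) / 2)"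
    unfolding inner_vec_def matrix_vector_mult_def gram_def ip_frac[OF assms(2,2,1)]
    by (simp add: sum_distrib_left sum_distrib_right sum_divide_distrib mult_ac)
  also have "\<dots> = (\<Sum>l<p. \<Sum>i\<in>UNIV. \<Sum>k\<in>UNIV. x $ i * x $ k * (Re (G i l) * Re (G k l)) / 2)"
    by (subst sum.swap[of _ UNIV "{..<p}"], subst (2) sum.swap) (rule refl)
  also have "\<dots> = (\<Sum>l<p. (\<Sum>i\<in>UNIV. x $ i * Re (G i l))\<^sup>2 / 2)"
    by (simp add: power2_eq_square sum_product sum_divide_distrib mult_ac)
  also have "\<dots> \<ge> 0" by (intro sum_nonneg) simp
  finally show ?thesis .
qed

lemma gram_zero_iff:
  assumes p: "p > 0" and G: "\<And>i. G i \<in> frac_vecs p"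
  shows "gram p G = 0 \<longleftrightarrow> G = (\<lambda>_ _. 0)"
proof
  assume g: "gram p G = 0"
  have "G i l = 0" for i l
  proof -
    have "(\<Sum>l<p. Re (G i l) * Re (G i l)) = 2 * gram p G $ i $ i" by (simp add: gram_def ip_frac[OF G G p])
    then have "(\<Sum>l<p. (Re (G i l))\<^sup>2) = 0" by (simp add: g power2_eq_square)
    then have z: "Re (G i l) = 0" if "l < p" for l using that by (subst (asm) sum_nonneg_eq_0_iff) auto
    have per: "periodic p (G i)" using G by (simp add: frac_vecs_def)
    have "G i l = G i (l mod p)" by (rule periodic_mod[OF per, symmetric])
    also have "\<dots> = of_real (Re (G i (l mod p)))" by (rule frac_vecs_real[OF G p])
    also have "\<dots> = 0" using z[of "l mod p"] p by simp
    finally show ?thesis .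
  qed
  then show "G = (\<lambda>_ _. 0)" by blast
next
  assume "G = (\<lambda>_ _. 0)"
  then show "gram p G = 0" by (simp add: gram_def ip_def vec_eq_iff)
qed

text \<open>The shift applied to all rows at once preserves the Gram matrix, and a fixed tuple is
  zero. So every nonempty fibre over T other than 0 consists of free orbits.\<close>

lemma representation_number:
  fixes \<Lambda> :: "'n::finite \<Rightarrow> cvec set"
  assumes p: "prime p" and sub: "\<And>i. \<Lambda> i \<subseteq> frac_vecs p \<inter> hyperplane p"
    and shift: "\<And>i x. x \<in> \<Lambda> i \<Longrightarrow> (\<lambda>l. x (l + 1)) \<in> \<Lambda> i" and zero: "\<And>i. (\<lambda>_. 0) \<in> \<Lambda> i"
  shows "card {G \<in> tuples \<Lambda>. gram p G = 0} = 1" and "T \<noteq> 0 \<Longrightarrow> p dvd card {G \<in> tuples \<Lambda>. gram p G = T}"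
proof -
  have p0: "p > 0" using p prime_gt_0_nat by blast
  have fr: "G i \<in> frac_vecs p" "G i \<in> hyperplane p" if "G \<in> tuples \<Lambda>" for G i using that sub by (auto simp: tuples_def)
  have gz: "gram p G = 0 \<longleftrightarrow> G = (\<lambda>_ _. 0)" if "G \<in> tuples \<Lambda>" for G by (rule gram_zero_iff[OF p0 fr(1)[OF that]])
  have "(\<lambda>_ _. 0) \<in> tuples \<Lambda>" using zero by (simp add: tuples_def)
  then have "{G \<in> tuples \<Lambda>. gram p G = 0} = {\<lambda>_ _. 0}" using gz by blast
  then show "card {G \<in> tuples \<Lambda>. gram p G = 0} = 1" by simp
  assume T: "T \<noteq> 0"
  let ?X = "{G \<in> tuples \<Lambda>. gram p G = T}"
  define s where "s G = (\<lambda>i l. G i (l + 1))" for G :: "'n \<Rightarrow> cvec"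
  have sk: "(s ^^ k) G = (\<lambda>i l. G i (l + k))" for k G by (induction k) (auto simp: s_def)
  show "p dvd card ?X"
  \<comment> \<open>An infinite set has cardinality 0 by convention, which p divides.\<close>
  proof (cases "finite ?X")
    case True
    then show ?thesis
    proof (rule prime_dvd_card_free_action[OF _ p, of _ s])
      fix G assume G: "G \<in> ?X"
      then have per: "periodic p (G i)" for i using fr(1)[of G i] by (simp add: frac_vecs_def)
      have "gram p (s G) = gram p G" unfolding gram_def s_def using ip_shift[OF per per p0, of _ 1] by simp
      then show "s G \<in> ?X" using G shift by (auto simp: tuples_def s_def)
      show "(s ^^ p) G = G" unfolding sk using per by (simp add: periodic_def)
      show "s G \<noteq> G"
      proof
        assume "s G = G"
        then have "(\<lambda>l. G i (l + 1)) = G i" for i unfolding s_def by (rule fun_cong)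
        then have "G i = (\<lambda>_. 0)" for i using hyperplane_fixed[OF fr(2)] G p0 by blast
        then have "G = (\<lambda>_ _. 0)" by blast
        then show False using gz[of G] G T by auto
      qed
    qed
  qed simp
qed

section \<open>Behaviour at the cusps in degree one\<close>

lemma norm_ee_real: "x \<in> \<real> \<Longrightarrow> norm (ee x) = 1"
  by (simp add: norm_ee complex_is_Real_iff)

lemma Theta_single:
  fixes i0 :: "'n::finite"
  assumes n: "UNIV = {i0}" and Z: "Z \<in> siegel_upper" and p: "p > 0" and L: "L \<subseteq> frac_vecs p"
  shows "Theta p (\<lambda>_. L) Z = th p L (Z $ i0 $ i0) (\<lambda>l. 0)"
proof -
  have all: "i = i0" for i using n by blast
  have "tuples ((\<lambda>_. L)(i0 := {\<lambda>l. 0})) = {\<lambda>i l. 0}"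
    using all by (auto simp: tuples_def fun_eq_iff)
  moreover have "row_vec Z i0 (\<lambda>i l. 0) = (\<lambda>l. 0)" "qf p Z (\<lambda>i l. 0) = 0" by (simp_all add: row_vec_def qf_def)
  ultimately show ?thesis using Theta_split[OF Z p, of "\<lambda>_. L" i0] L by simp
qed

context theta_lattice
begin

text \<open>In degree one every symplectic matrix is an embedded elliptic one. If c = 0 it lies in
  the congruence subgroup; otherwise \<open>jacobi_general\<close> expands the function over the
  dual lattice. Indices are exhibited as Gram matrices so that \<open>gram_nonneg\<close> yields
  semidefiniteness.\<close>

lemma cusp_expansion:
  fixes M :: "int^('n + 'n)^('n::finite + 'n)"
  assumes n1: "CARD('n) = 1" and M: "M \<in> Sp_int"
  shows "\<exists>a. has_fourier_expansion (slash (int wt) M (Theta p (\<lambda>_. L))) a \<and>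
    (\<forall>T. a T \<noteq> 0 \<longrightarrow> (\<exists>G. (\<forall>i. G i \<in> frac_vecs p) \<and> gram p G = T))"
proof -
  obtain i0 where n: "(UNIV :: 'n set) = {i0}" using n1 by (rule card_1_singletonE)
  have all: "i = i0" for i :: 'n using n by blast
  define a b c d where "a = block_A M $ i0 $ i0" and "b = block_B M $ i0 $ i0"
    and "c = block_C M $ i0 $ i0" and "d = block_D M $ i0 $ i0"
  have ent: "X $ i $ k = X $ i0 $ i0" for X :: "int^'n^'n" and i k using all[of i] all[of k] by simp
  have M_emb: "M = emb_mat i0 a b c d"
    by (rule block_mat_eqI; simp add: emb_mat_def diag_mat_def vec_eq_iff a_def b_def c_def d_def)
       (use all ent in metis)+
  have "(transpose (block_A M) ** block_D M) $ i0 $ i0 = (mat 1 + transpose (block_C M) ** block_B M) $ i0 $ i0"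
    using M by (simp add: Sp_int_iff)
  then have det: "a * d - b * c = 1"
    unfolding matrix_matrix_mult_def n by (simp add: transpose_def mat_def a_def b_def c_def d_def)
  show ?thesis
  proof (cases "c = 0")
    case True
    then have MG: "M \<in> Gamma0 p" unfolding M_emb using emb_Gamma0[OF det] by simp
    have fr: "L \<subseteq> frac_vecs p" using L_frac by blast
    have "has_fourier_expansion (slash (int wt) M (Theta p (\<lambda>_. L)))
       (\<lambda>T. of_int (chi p (det (block_D M))) * of_nat (card {G \<in> tuples (\<lambda>_. L). gram p G = T}))"
      by (rule has_fourier_expansion_cong[OF _ has_fourier_expansion_cmult[OF Theta_expansion[OF p_pos fr]]])
         (simp add: Theta_Gamma0[OF MG])
    moreover have "\<exists>G. (\<forall>i. G i \<in> frac_vecs p) \<and> gram p G = T"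
      if "of_int (chi p (det (block_D M))) * of_nat (card {G \<in> tuples (\<lambda>_::'n. L). gram p G = T}) \<noteq> (0 :: complex)" for T
    proof -
      have "{G \<in> tuples (\<lambda>_::'n. L). gram p G = T} \<noteq> {}" using that by (metis card.empty mult_zero_right of_nat_0)
      then obtain G where "G \<in> tuples (\<lambda>_::'n. L)" "gram p G = T" by blast
      then show ?thesis using fr by (intro exI[of _ G]) (auto simp: tuples_def)
    qed
    ultimately show ?thesis by blast
  next
    case False
    obtain R rep where R: "finite R" "R \<subseteq> L" "card R = nat \<bar>c\<bar> ^ (p - 1)"
      "bij_betw (\<lambda>(r, l). vadd r (scale (of_int c) l)) (R \<times> L) L"
      "\<And>x. x \<in> L \<Longrightarrow> rep x \<in> R" "\<And>x. x \<in> L \<Longrightarrow> congr c x (rep x)"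
      "\<And>r s. r \<in> R \<Longrightarrow> s \<in> R \<Longrightarrow> congr c r s \<Longrightarrow> r = s"
      using that by (rule transversal[OF False])
    \<comment> \<open>The power of u in the transformation formula cancels against the automorphy
      factor, so the weights do not depend on Z.\<close>
    define C where "C = (- \<i> / of_int c) ^ wt / vol"
    define w where "w y = C * (gauss_weight R a c y * ee (of_int d * ip p y y / (2 * of_int c)))" for y
    let ?G = "\<lambda>y. (\<lambda>_ :: 'n. y)"
    have tp: "tr_pair (gram p (?G y)) Z = Z $ i0 $ i0 * ip p y y / 2" if "y \<in> L'" for y Z
      using qf_tr_pair[of p "?G y" Z] p_pos L'_frac that by (auto simp: qf_def n)
    have real: "ip p y y \<in> \<real>" "ip p r r \<in> \<real>" "ip p r y \<in> \<real>" if "y \<in> L'" "r \<in> R" for y r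
      using ip_frac_Re[OF _ _ p_pos] that R(2) L'_frac L_frac by (metis Reals_of_real le_inf_iff subsetD)+
    have w_bound: "norm (w y) \<le> norm C * card R" if y: "y \<in> L'" for y
    proof -
      have "norm (gauss_weight R a c y) \<le> (\<Sum>r\<in>R. norm (ee ((of_int a * ip p r r / 2 - ip p r y) / of_int c)))"
        unfolding gauss_weight_def by (rule norm_sum)
      also have "\<dots> = (\<Sum>r\<in>R. 1)" by (intro sum.cong refl norm_ee_real) (use real[OF y] in auto)
      finally have "norm (gauss_weight R a c y) \<le> card R" by simp
      moreover have "norm (ee (of_int d * ip p y y / (2 * of_int c))) = 1"
        using ip_frac_Re[OF _ _ p_pos, of y y] y L'_frac by (intro norm_ee_real) (metis Reals_divide Reals_mult Reals_of_int Reals_of_real Reals_numeral subsetD)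
      ultimately show ?thesis by (simp add: w_def norm_mult mult_left_mono)
    qed
    have "has_fourier_expansion (slash (int wt) M (Theta p (\<lambda>_. L))) (\<lambda>t. \<Sum>\<^sub>\<infinity>y\<in>{y \<in> L'. gram p (?G y) = t}. w y)"
    proof (rule has_fourier_expansion_series)
      show "2 * p * p > 0" using p_pos by simp
      show "real (2 * p * p) *\<^sub>R gram p (?G y) \<in> half_integral" if "y \<in> L'" for y
        by (rule gram_half_integral[OF p_pos]) (use that L'_frac in blast)
      fix Z :: "complex^'n^'n" assume Z: "Z \<in> siegel_upper"
      let ?\<tau> = "Z $ i0 $ i0"
      have \<tau>: "Im ?\<tau> > 0" by (rule siegel_upper_diag[OF Z])
      show "(\<lambda>y. norm (w y * ee (tr_pair (gram p (?G y)) Z))) summable_on L'"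
      proof (rule summable_on_comparison_test)
        show "(\<lambda>y. (norm C * card R) * norm (ee (?\<tau> * ip p y y / 2 + ip p y (\<lambda>l. 0)))) summable_on L'"
          by (intro summable_on_cmult_right th_summable \<tau> p_pos L'_frac)
        fix y assume "y \<in> L'"
        then show "norm (w y * ee (tr_pair (gram p (?G y)) Z)) \<le> (norm C * card R) * norm (ee (?\<tau> * ip p y y / 2 + ip p y (\<lambda>l. 0)))"
          using w_bound by (simp add: norm_mult tp mult_right_mono)
      qed simp
      define u where "u = of_int c * ?\<tau> + of_int d"
      have u: "u \<noteq> 0" unfolding u_def by (rule im_moebius_pos(1)[OF \<tau> det])
      have zero: "(\<lambda>l. 0) \<in> hyperplane p" using L_hyp lat_zero by blast
      have AS: "act_mat M Z \<in> siegel_upper" by (rule act_mat_siegel_upper[OF M Z])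
      have A00: "act_mat M Z $ i0 $ i0 = (of_int a * ?\<tau> + of_int b) / u"
        unfolding M_emb act_emb(2)[OF Z det] by (simp add: emb_act_def u_def)
      have fr: "L \<subseteq> frac_vecs p" using L_frac by blast
      have "slash (int wt) M (Theta p (\<lambda>_. L)) Z = u powi (- int wt) * th p L ((of_int a * ?\<tau> + of_int b) / u) (\<lambda>l. 0)"
        unfolding slash_alt Theta_single[OF n AS p_pos fr] A00 by (simp add: M_emb act_emb(1)[OF Z det] u_def)
      also have "th p L ((of_int a * ?\<tau> + of_int b) / u) (\<lambda>l. 0) = (- \<i> * u / of_int c) ^ wt / vol *
         (\<Sum>\<^sub>\<infinity>y\<in>L'. gauss_weight R a c y * ee (of_int d * ip p y y / (2 * of_int c)) * ee (?\<tau> * ip p y y / 2 + ip p y (\<lambda>l. 0)))"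
        using jacobi_general[OF \<tau> zero det False R(1,2,4)] by (simp add: scale_def u_def)
      also have "u powi (- int wt) * ((- \<i> * u / of_int c) ^ wt / vol *
         (\<Sum>\<^sub>\<infinity>y\<in>L'. gauss_weight R a c y * ee (of_int d * ip p y y / (2 * of_int c)) * ee (?\<tau> * ip p y y / 2 + ip p y (\<lambda>l. 0))))
        = C * (\<Sum>\<^sub>\<infinity>y\<in>L'. gauss_weight R a c y * ee (of_int d * ip p y y / (2 * of_int c)) * ee (?\<tau> * ip p y y / 2 + ip p y (\<lambda>l. 0)))"
      proof -
        have "- \<i> * u / of_int c = u * (- \<i> / of_int c)" by simp
        then have "(- \<i> * u / of_int c) ^ wt = u ^ wt * (- \<i> / of_int c) ^ wt" by (simp only: power_mult_distrib)
        moreover have "u powi (- int wt) * u ^ wt = 1" using u by (simp add: power_int_minus)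
        ultimately show ?thesis by (simp only: C_def mult.assoc[symmetric] times_divide_eq_right mult_1_left)
      qed
      also have "\<dots> = (\<Sum>\<^sub>\<infinity>y\<in>L'. C * (gauss_weight R a c y * ee (of_int d * ip p y y / (2 * of_int c)) * ee (?\<tau> * ip p y y / 2 + ip p y (\<lambda>l. 0))))"
        by (rule infsum_cmult_right'[symmetric])
      also have "\<dots> = (\<Sum>\<^sub>\<infinity>y\<in>L'. w y * ee (tr_pair (gram p (?G y)) Z))"
        by (rule infsum_cong) (simp add: w_def tp mult.assoc)
      finally show "slash (int wt) M (Theta p (\<lambda>_. L)) Z = (\<Sum>\<^sub>\<infinity>y\<in>L'. w y * ee (tr_pair (gram p (?G y)) Z))" .
    qed
    moreover have "\<exists>G. (\<forall>i. G i \<in> frac_vecs p) \<and> gram p G = t" if "(\<Sum>\<^sub>\<infinity>y\<in>{y \<in> L'. gram p (?G y) = t}. w y) \<noteq> 0" for t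
    proof -
      have "{y \<in> L'. gram p (?G y) = t} \<noteq> {}" using that by (metis infsum_empty)
      then obtain y where "y \<in> L'" "gram p (?G y) = t" by blast
      then show ?thesis using L'_frac by (intro exI[of _ "?G y"]) auto
    qed
    ultimately show ?thesis by blast
  qed
qed

end

section \<open>The linear combination and its valuation at the cusps\<close>

lemma triangular_exponent: "r * j \<le> r * (r + 1) div 2 + j * (j - 1) div 2" for r j :: nat
proof -
  \<comment> \<open>A product of consecutive integers is nonnegative. This is the count that makes
    p^(rj) divide c_r p^(j(j-1)/2).\<close>
  have "0 \<le> (int r - int j) * (int r - int j + 1)"
    by (cases "r \<ge> j") (auto intro: mult_nonneg_nonneg mult_nonpos_nonpos)
  then have "2 * (int r * int j) \<le> int r * (int r + 1) + int j * (int j - 1)" by (simp add: algebra_simps)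
  moreover have "int j * (int j - 1) = int (j * (j - 1))" by (cases j) (auto simp: algebra_simps)
  ultimately have "int (2 * (r * j)) \<le> int (r * (r + 1) + j * (j - 1))"
    by (simp only: of_nat_add of_nat_mult of_nat_1 of_nat_numeral)
  then have le: "2 * (r * j) \<le> r * (r + 1) + j * (j - 1)" by linarith
  have "even (r * (r + 1))" "even (j * (j - 1))" by (simp, cases j, simp_all)
  then obtain a b where ab: "r * (r + 1) = 2 * a" "j * (j - 1) = 2 * b" by (metis evenE)
  show ?thesis using le unfolding ab by simp
qed

theorem theorem2:
  fixes p :: nat
  assumes "prime p" and "p \<ge> 2 * CARD('n::{finite,linorder}) + 3"
  shows "\<exists>h :: complex^('n::{finite,linorder})^('n::{finite,linorder}) \<Rightarrow> complex.
    h \<in> siegel_forms (int ((p - 1) div 2)) (Gamma0 p) (chi p) \<and>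
    bounded_denominators h \<and>
    (\<forall>v. extends_padic p (coeff_field h) v \<longrightarrow> nu v h \<ge> 0 \<and> nu v (\<lambda>Z. h Z - 1) \<ge> 1) \<and>
    (\<forall>j\<in>{1..CARD('n)}.
       bounded_denominators (slash (int ((p - 1) div 2)) (omega j) h) \<and>
       (\<forall>v. extends_padic p (coeff_field (slash (int ((p - 1) div 2)) (omega j) h)) v \<longrightarrow>
          nu v (slash (int ((p - 1) div 2)) (omega j) h) \<ge> ereal (- (real j)\<^sup>2 / 2 + 1)))"
proof -
  define n where "n = CARD('n)"
  define wt where "wt = (p - 1) div 2"
  have n: "n > 0" "p \<ge> 2 * n + 3" using assms(2) by (simp_all add: n_def)
  have p0: "p > 0" and p3: "p \<ge> 3" using n by simp_all
  have oddp: "odd p" using prime_odd_nat[OF assms(1)] n by simp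
  \<comment> \<open>The summand r uses the lattice of index r + 1, so the condition 2 (r + 1) <= p -
    1 for all r <= n is the bound on p.\<close>
  have loc: "theta_lattice p (r + 1)" if "r \<le> n" for r
    by unfold_locales (use assms(1) oddp that n in auto)
  define c where "c r = euler_coeff p n r" for r
  define \<Theta> :: "nat \<Rightarrow> complex^('n::{finite,linorder})^('n::{finite,linorder}) \<Rightarrow> complex" where "\<Theta> r = Theta p (\<lambda>_. lat p (r + 1))" for r
  define h where "h Z = (\<Sum>r\<le>n. of_int (c r) * \<Theta> r Z)" for Z
  have wt: "theta_lattice.wt p = wt" using theta_lattice.wt_def[OF loc[of 0]] by (simp add: wt_def)
  have fr: "lat p (r + 1) \<subseteq> frac_vecs p" if "r \<le> n" for r
    using theta_lattice.L_frac[OF loc[OF that]] by simp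
  have slash_h: "slash k M h Z = (\<Sum>r\<le>n. of_int (c r) * slash k M (\<Theta> r) Z)" for k M Z
    by (simp add: slash_alt h_def sum_distrib_left mult_ac)
  have "h \<in> siegel_forms (int wt) (Gamma0 p) (chi p)"
    unfolding siegel_forms_def
  proof (intro CollectI conjI ballI impI)
    show "siegel_holomorphic h" unfolding h_def[abs_def]
    proof (rule siegel_holomorphic_sum)
      fix r assume "r \<in> {..n}"
      then show "siegel_holomorphic (\<Theta> r)" unfolding \<Theta>_def by (intro Theta_holomorphic[OF p0] fr) simp
    qed simp
    show "slash (int wt) M h Z = of_int (chi p (det (block_D M))) * h Z" if "M \<in> Gamma0 p" "Z \<in> siegel_upper" for M Z
      unfolding slash_h h_def sum_distrib_left
    proof (rule sum.cong[OF refl])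
      fix r assume "r \<in> {..n}"
      then have "r \<le> n" by simp
      from theta_lattice.Theta_Gamma0[OF loc[OF this] that]
      show "of_int (c r) * slash (int wt) M (\<Theta> r) Z = of_int (chi p (det (block_D M))) * (of_int (c r) * \<Theta> r Z)"
        unfolding wt \<Theta>_def by simp
    qed
    fix M :: "int^('n + 'n)^('n + 'n)"
    assume n1: "CARD('n) = 1" and M: "M \<in> Sp_int"
    have "\<forall>r\<in>{..n}. \<exists>a. has_fourier_expansion (slash (int wt) M (\<Theta> r)) a \<and> (\<forall>T. a T \<noteq> 0 \<longrightarrow> (\<exists>G. (\<forall>i. G i \<in> frac_vecs p) \<and> gram p G = T))"
      using theta_lattice.cusp_expansion[OF loc n1 M] unfolding wt \<Theta>_def by blast
    then obtain a where a: "\<And>r. r \<in> {..n} \<Longrightarrow> has_fourier_expansion (slash (int wt) M (\<Theta> r)) (a r)"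
      "\<And>r T. r \<in> {..n} \<Longrightarrow> a r T \<noteq> 0 \<Longrightarrow> \<exists>G. (\<forall>i. G i \<in> frac_vecs p) \<and> gram p G = T" by metis
    have "has_fourier_expansion (slash (int wt) M h) (\<lambda>T. \<Sum>r\<le>n. of_int (c r) * a r T)"
      unfolding slash_h[abs_def] by (intro has_fourier_expansion_sum has_fourier_expansion_cmult a) auto
    moreover have "x \<bullet> (T *v x) \<ge> 0" if T: "(\<Sum>r\<le>n. of_int (c r) * a r T) \<noteq> 0" for T :: "real^('n::{finite,linorder})^('n::{finite,linorder})" and x
    proof -
      obtain r where "r \<in> {..n}" "a r T \<noteq> 0" using T by (metis (mono_tags, lifting) mult_zero_right sum.neutral)
      then obtain G where "\<And>i. G i \<in> frac_vecs p" "gram p G = T" using a(2) by blast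
      then show ?thesis using gram_nonneg[OF p0] by blast
    qed
    ultimately show "\<exists>a. has_fourier_expansion (slash (int wt) M h) a \<and> (\<forall>T. a T \<noteq> 0 \<longrightarrow> (\<forall>x. 0 \<le> x \<bullet> (T *v x)))"
      by blast
  qed
  moreover
  define N where "N \<Lambda> T = int (card {G \<in> tuples (\<Lambda> :: 'n \<Rightarrow> cvec set). gram p G = T})" for \<Lambda> T
  define m where "m T = (\<Sum>r\<le>n. c r * N (\<lambda>_. lat p (r + 1)) T)" for T
  have zero_lat: "(\<lambda>_. 0) \<in> lat p (r + 1)" for r by (rule lat_zero)
  have N0: "N (\<lambda>_. lat p (r + 1)) 0 = 1" and Np: "T \<noteq> 0 \<Longrightarrow> int p dvd N (\<lambda>_. lat p (r + 1)) T" if r: "r \<le> n" for r T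
  proof -
    have sh: "(\<lambda>l. x (l + 1)) \<in> lat p (r + 1)" if "x \<in> lat p (r + 1)" for x using that by (rule lat_shift)
    note R = representation_number[of p "\<lambda>_ :: 'n. lat p (r + 1)", OF assms(1) theta_lattice.L_frac[OF loc[OF r]] sh zero_lat]
    show "N (\<lambda>_. lat p (r + 1)) 0 = 1" unfolding N_def using R(1) by simp
    show "int p dvd N (\<lambda>_. lat p (r + 1)) T" if "T \<noteq> 0" unfolding N_def using R(2)[OF _ that] by simp
  qed
  have h_exp: "has_fourier_expansion h (\<lambda>T. of_int (m T))"
  proof -
    have "has_fourier_expansion h (\<lambda>T. \<Sum>r\<le>n. of_int (c r) * of_nat (card {G \<in> tuples (\<lambda>_. lat p (r + 1)). gram p G = T}))"
      unfolding h_def[abs_def] \<Theta>_def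
      by (intro has_fourier_expansion_sum has_fourier_expansion_cmult Theta_expansion p0) (use fr in auto)
    then show ?thesis by (simp add: m_def N_def)
  qed
  then have h_coeff: "fourier_coeff h = (\<lambda>T. of_int (m T))" by (rule fourier_coeff_eqI)
  \<comment> \<open>At T = 0 every theta series has coefficient 1, and the combination is the
    product of the 1 - p^i, which is 1 modulo p.\<close>
  have m_dvd: "int p dvd m T - (if T = 0 then 1 else 0)" for T
  proof (cases "T = 0")
    case True
    have "m T = (\<Sum>r\<le>n. of_int (euler_coeff p n r) * 1 ^ r)" unfolding m_def c_def True by (intro sum.cong refl) (use N0 in auto)
    also have "\<dots> = (\<Prod>j\<in>{1..n}. 1 - of_nat p ^ j * 1)" by (rule euler_coeff_prod)
    also have "[\<dots> = (\<Prod>j\<in>{1..n}. 1)] (mod int p)"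
      by (intro cong_prod) (auto simp: cong_iff_dvd_diff)
    finally show ?thesis using True by (simp add: cong_iff_dvd_diff)
  next
    case False
    have "int p dvd m T" unfolding m_def by (intro dvd_sum dvd_mult Np) (use False in simp_all)
    then show ?thesis using False by simp
  qed
  have "bounded_denominators h"
    by (rule bounded_denominatorsI[OF h_exp h_coeff, where m = "\<lambda>T. of_int (m T)" and \<theta> = 1 and q = 1 and N = 1])
       (auto intro: int_imp_algebraic_int)
  moreover have "nu v h \<ge> 0 \<and> nu v (\<lambda>Z. h Z - 1) \<ge> 1" if v: "extends_padic p (coeff_field h) v" for v
  proof
    \<comment> \<open>For integers the bound of \<open>padic_bound\<close> is used with A = 0 and
      the doubled exponent of the square.\<close>
    have bd: "v (of_int k) \<ge> ereal (real B)" if "int p ^ B dvd k" for k B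
    proof -
      have "int p ^ (2 * B) dvd k * k" using mult_dvd_mono[OF that that] by (simp add: mult_2 power_add)
      from padic_bound[OF v assms(1) is_subfield_coeff_field of_int_in_subfield[OF is_subfield_coeff_field] _ this, of k 0]
      show ?thesis by simp
    qed
    show "nu v h \<ge> 0" unfolding nu_def h_coeff by (intro INF_greatest) (use bd[of 0] in \<open>simp add: zero_ereal_def\<close>)
    have "has_fourier_expansion (\<lambda>Z. h Z + (- 1)) (\<lambda>T. of_int (m T) + (if T = 0 then - 1 else 0))"
      by (intro has_fourier_expansion_add h_exp has_fourier_expansion_const)
    moreover have "(\<lambda>T. of_int (m T) + (if T = 0 then - 1 else 0)) = (\<lambda>T. of_int (m T - (if T = 0 then 1 else 0)) :: complex)" by auto
    ultimately have "has_fourier_expansion (\<lambda>Z. h Z - 1) (\<lambda>T. of_int (m T - (if T = 0 then 1 else 0)))" by simp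
    then have "fourier_coeff (\<lambda>Z. h Z - 1) = (\<lambda>T. of_int (m T - (if T = 0 then 1 else 0)))" by (rule fourier_coeff_eqI)
    then show "nu v (\<lambda>Z. h Z - 1) \<ge> 1" unfolding nu_def
      by (intro INF_greatest) (use bd[of 1] m_dvd in \<open>simp add: one_ereal_def del: of_int_diff\<close>)
  qed
  moreover have "bounded_denominators (slash (int wt) (omega j) h) \<and>
       (\<forall>v. extends_padic p (coeff_field (slash (int wt) (omega j) h)) v \<longrightarrow>
          nu v (slash (int wt) (omega j) h) \<ge> ereal (- (real j)\<^sup>2 / 2 + 1))" if j: "j \<in> {1..n}" for j
  proof -
    define F where "F = {i::'n. card {k. k < i} < j}"
    have cF: "card F = j" unfolding F_def by (rule card_first) (use j in \<open>simp add: n_def\<close>)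
    define \<Lambda> where "\<Lambda> r = (\<lambda>i::'n. if i \<in> F then dual_lat p (r + 1) else lat p (r + 1))" for r
    \<comment> \<open>All c_r / p^(rj) have the common denominator p^s. With the factor p^(-j/2)
      from the covolumes this makes up p^(-j^2/2).\<close>
    define s where "s = j * (j - 1) div 2"
    have s2: "j + 2 * s = j\<^sup>2"
    proof -
      have "even (j * (j - 1))" by (cases j) simp_all
      then have "2 * s = j * (j - 1)" by (simp add: s_def)
      then show ?thesis using j by (cases j) (auto simp: power2_eq_square)
    qed
    have sub: "\<Lambda> r i \<subseteq> frac_vecs p \<inter> hyperplane p" if "r \<le> n" for r i
      using theta_lattice.L_frac[OF loc[OF that]] theta_lattice.L'_frac_hyp[OF loc[OF that]] by (simp add: \<Lambda>_def)
    define \<theta>0 where "\<theta>0 = ((- \<i>) ^ wt / of_real (sqrt (real p))) ^ j"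
    define \<theta> where "\<theta> = \<theta>0 / of_nat p ^ s"
    \<comment> \<open>The integer division is exact by \<open>triangular_exponent\<close> and
      \<open>euler_coeff_dvd\<close>.\<close>
    define d where "d r = c r * int p ^ s div int p ^ (r * j)" for r
    have d: "of_int (c r) / of_nat p ^ (r * j) = (of_int (d r) / of_nat p ^ s :: complex)" for r
    proof -
      have "int p ^ (r * j) dvd int p ^ (r * (r + 1) div 2 + s)" unfolding s_def by (intro le_imp_power_dvd triangular_exponent)
      also have "\<dots> dvd c r * int p ^ s" unfolding power_add c_def by (intro mult_dvd_mono euler_coeff_dvd dvd_refl)
      finally have "c r * int p ^ s = d r * int p ^ (r * j)" by (simp add: d_def)
      then have "(of_int (c r * int p ^ s) :: complex) = of_int (d r * int p ^ (r * j))" by (rule arg_cong)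
      then show ?thesis using p0 by (simp add: field_simps)
    qed
    define I where "I T = (\<Sum>r\<le>n. d r * N (\<Lambda> r) T)" for T
    have shift: "(\<lambda>l. x (l + 1)) \<in> \<Lambda> r i" if "x \<in> \<Lambda> r i" for x r i
      using that lat_shift[of x p "r + 1" 1] dual_lat_shift[of x p "r + 1" 1] p0 by (auto simp: \<Lambda>_def split: if_splits)
    have zero: "(\<lambda>_. 0) \<in> \<Lambda> r i" for r i
      using lat_zero[of p "r + 1"] lat_subset_dual[OF p0, of "r + 1"] by (auto simp: \<Lambda>_def)
    have N0: "N (\<Lambda> r) 0 = 1" and Np: "T \<noteq> 0 \<Longrightarrow> int p dvd N (\<Lambda> r) T" if r: "r \<le> n" for r T
    proof -
      note R = representation_number[of p "\<Lambda> r", OF assms(1) sub[OF r] shift zero]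
      show "N (\<Lambda> r) 0 = 1" unfolding N_def using R(1) by simp
      show "int p dvd N (\<Lambda> r) T" if "T \<noteq> 0" unfolding N_def using R(2)[OF _ that] by simp
    qed
    have I_dvd: "int p dvd I T" for T
    proof (cases "T = 0")
      case True
      have "of_int (I T) = (\<Sum>r\<le>n. of_int (d r) :: complex)" unfolding I_def True of_int_sum by (intro sum.cong refl) (simp add: N0)
      also have "\<dots> = of_nat p ^ s * (\<Sum>r\<le>n. of_int (c r) / of_nat p ^ (r * j))"
        unfolding d using p0 by (simp add: sum_distrib_left)
      also have "(\<Sum>r\<le>n. of_int (c r) / of_nat p ^ (r * j)) = (\<Sum>r\<le>n. of_int (euler_coeff p n r) * (1 / of_nat p ^ j :: complex) ^ r)"
        by (simp add: c_def power_divide mult.commute[of _ j] power_mult)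
      also have "\<dots> = (\<Prod>i\<in>{1..n}. 1 - of_nat p ^ i * (1 / of_nat p ^ j))" by (rule euler_coeff_prod)
      \<comment> \<open>The factor with i = j is 1 - p^j / p^j.\<close>
      also have "\<dots> = 0" by (rule prod_zero) (use j p0 in \<open>auto intro!: bexI[of _ j]\<close>)
      finally have "I T = 0" by simp
      then show ?thesis by simp
    next
      case False
      then show ?thesis unfolding I_def by (intro dvd_sum dvd_mult Np) simp_all
    qed
    let ?g = "slash (int wt) (omega j) h"
    have g_exp: "has_fourier_expansion ?g (\<lambda>T. of_rat (of_int (I T)) * \<theta>)"
    proof -
      define b where "b T = (\<Sum>r\<le>n. of_int (c r) * (((- \<i>) ^ wt / (of_real (sqrt (real p)) * of_nat p ^ r)) ^ j * of_nat (card {G \<in> tuples (\<Lambda> r). gram p G = T})))" for T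
      have "has_fourier_expansion (\<lambda>Z. \<Sum>r\<le>n. of_int (c r) * (((- \<i>) ^ wt / (of_real (sqrt (real p)) * of_nat p ^ r)) ^ j * Theta p (\<Lambda> r) Z)) b"
        unfolding b_def[abs_def]
        by (intro has_fourier_expansion_sum has_fourier_expansion_cmult Theta_expansion p0) (use sub in auto)
      then have "has_fourier_expansion ?g b"
      proof (rule has_fourier_expansion_cong[rotated])
        fix Z :: "complex^('n::{finite,linorder})^('n::{finite,linorder})" assume Z: "Z \<in> siegel_upper"
        show "(\<Sum>r\<le>n. of_int (c r) * (((- \<i>) ^ wt / (of_real (sqrt (real p)) * of_nat p ^ r)) ^ j * Theta p (\<Lambda> r) Z)) = ?g Z"
          unfolding slash_h
        proof (rule sum.cong[OF refl])
          fix r assume "r \<in> {..n}"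
          then have l: "theta_lattice p (r + 1)" by (intro loc) simp
          show "of_int (c r) * (((- \<i>) ^ wt / (of_real (sqrt (real p)) * of_nat p ^ r)) ^ j * Theta p (\<Lambda> r) Z) = of_int (c r) * slash (int wt) (omega j) (\<Theta> r) Z"
            using theta_lattice.Theta_partial_inversion[OF l Z, of F]
            unfolding \<Theta>_def omega_eq F_def[symmetric] \<Lambda>_def wt theta_lattice.vol_def[OF l] cF by simp
        qed
      qed
      moreover have "b T = of_rat (of_int (I T)) * \<theta>" for T
      proof -
        have "b T = (\<Sum>r\<le>n. \<theta>0 * (of_int (c r) / of_nat p ^ (r * j)) * of_int (N (\<Lambda> r) T))"
          unfolding b_def by (intro sum.cong refl) (simp add: \<theta>0_def N_def power_divide power_mult_distrib power_mult mult_ac)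
        also have "\<dots> = (\<Sum>r\<le>n. of_int (d r * N (\<Lambda> r) T) * \<theta>)"
          unfolding d \<theta>_def by (intro sum.cong refl) (simp add: mult_ac)
        also have "\<dots> = of_int (I T) * \<theta>" by (simp only: sum_distrib_right[symmetric] I_def of_int_sum)
        finally show ?thesis by simp
      qed
      then have "b = (\<lambda>T. of_rat (of_int (I T)) * \<theta>)" by (rule ext)
      ultimately show ?thesis by simp
    qed
    then have g_coeff: "fourier_coeff ?g = (\<lambda>T. of_rat (of_int (I T)) * \<theta>)" by (rule fourier_coeff_eqI)
    \<comment> \<open>\<open>\<theta>\<close> may involve i and the square root of p, but its square
      is rational, so the coefficients at the cusp lie in an at most quadratic field.\<close>
    have \<theta>\<theta>: "\<theta> * \<theta> = (- 1) ^ (wt * j) / of_nat p ^ (j\<^sup>2)"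
    proof -
      have "(- \<i>) ^ wt * (- \<i>) ^ wt = (- 1 :: complex) ^ wt" by (simp flip: power_mult_distrib)
      moreover have "of_real (sqrt (real p)) * of_real (sqrt (real p)) = (of_nat p :: complex)" by (simp flip: of_real_mult)
      ultimately have "\<theta>0 * \<theta>0 = ((- 1) ^ wt / of_nat p) ^ j"
        unfolding \<theta>0_def power_mult_distrib[symmetric] times_divide_times_eq by (simp only:)
      then have "\<theta> * \<theta> = (- 1) ^ (wt * j) / (of_nat p ^ j * (of_nat p ^ s * of_nat p ^ s))"
        unfolding \<theta>_def times_divide_times_eq by (simp add: power_divide power_mult)
      then show ?thesis by (simp add: s2[symmetric] power_add mult_2)
    qed
    have sq: "(of_rat (of_int (I T)) * \<theta>) * (of_rat (of_int (I T)) * \<theta>) * of_int (int p ^ j\<^sup>2) = of_int ((- 1) ^ (wt * j) * (I T * I T))" for T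
    proof -
      have "(of_rat (of_int (I T)) * \<theta>) * (of_rat (of_int (I T)) * \<theta>) * of_int (int p ^ j\<^sup>2) = (\<theta> * \<theta>) * of_nat p ^ j\<^sup>2 * (of_int (I T) * of_int (I T))"
        by (simp add: mult_ac)
      also have "(\<theta> * \<theta>) * of_nat p ^ j\<^sup>2 = (- 1) ^ (wt * j)" unfolding \<theta>\<theta> using p0 by simp
      finally show ?thesis by simp
    qed
    have "bounded_denominators ?g"
    proof (rule bounded_denominatorsI[OF g_exp g_coeff])
      show "\<theta> * \<theta> = of_rat ((- 1) ^ (wt * j) / of_nat p ^ (j\<^sup>2))"
        unfolding \<theta>\<theta> by (simp add: of_rat_divide of_rat_power of_rat_minus)
      show "int p ^ j\<^sup>2 \<noteq> 0" using p0 by simp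
      fix T
      let ?x = "of_rat (of_int (I T)) * \<theta>" and ?P = "of_int (int p ^ j\<^sup>2) :: complex"
      have "(?P * ?x) * (?P * ?x) = ?P * (?x * ?x * ?P)" by (simp only: mult_ac)
      also have "\<dots> = of_int (int p ^ j\<^sup>2 * ((- 1) ^ (wt * j) * (I T * I T)))" unfolding sq by (simp only: of_int_mult)
      finally show "algebraic_int (?P * ?x)" by (rule algebraic_int_square)
    qed rule
    moreover have "nu v ?g \<ge> ereal (- (real j)\<^sup>2 / 2 + 1)" if v: "extends_padic p (coeff_field ?g) v" for v
      unfolding nu_def
    proof (rule INF_greatest)
      fix T
      \<comment> \<open>A coefficient is \<open>\<theta>\<close> times a multiple of p; its square
        thus carries p^2 over p^(j^2), and half of 2 - j^2 is the claimed exponent.\<close>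
      have "int p ^ 2 dvd (- 1) ^ (wt * j) * (I T * I T)"
        unfolding power2_eq_square by (intro dvd_mult mult_dvd_mono I_dvd)
      moreover have "fourier_coeff ?g T * fourier_coeff ?g T * of_int (int p ^ j\<^sup>2) = of_int ((- 1) ^ (wt * j) * (I T * I T))"
        unfolding g_coeff by (rule sq)
      ultimately have "ereal ((real 2 - real (j\<^sup>2)) / 2) \<le> v (fourier_coeff ?g T)"
        by (intro padic_bound[OF v assms(1) is_subfield_coeff_field coeff_in_coeff_field])
      moreover have "(real 2 - real (j\<^sup>2)) / 2 = - (real j)\<^sup>2 / 2 + 1" by (simp add: field_simps)
      ultimately show "ereal (- (real j)\<^sup>2 / 2 + 1) \<le> v (fourier_coeff ?g T)" by (simp only:)
    qed
    ultimately show ?thesis by blast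
  qed
  ultimately show ?thesis unfolding wt_def n_def by blast
qed

end
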